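(* Let $\mu$ be a coweight, $\mathbf a$ a polynomial $\ell$-weight, and $\mathbf z=(\mathbf z_i)_{i\in I}\in(\mathbb{C}^\times)^I$ a constant $\ell$-weight such that $\prod_{j\in I}\mathbf z_j^{c_{ji}}=\mathbf a_{i,0}^{-1}\mathbf a_{i,n_i}$ for all $i\in I$, where $\mathbf a_{i,0}$ and $\mathbf a_{i,n_i}$ are the constant term and the leading coefficient of the polynomial $\mathbf a_i(z)$. Let $V$ be a T-polynomial module in category $\mathcal O_\mu$. Assume that for each $i\in I$ the image of the generating series $\mathscr A_i^+(z):=\mathbf a_i^*(z)\mathbf A_i^+(z)$ in $(\mathrm{End}\,V)[[z]]$ stabilizes $V[z]$. Then: (i) The pair $(\mu,\mathbf a)$ is truncatable and the $\mathcal U_\mu(\hat{\mathfrak g})$-module $V$ factorizes through the simply-connected truncation $\mathcal U_\mu^{\mathbf a}(\hat{\mathfrak g})$. (ii) There exists $\lambda'\in\mathfrak p_0$ such that the $\mathcal U_\mu^{\mathbf a}(\hat{\mathfrak g})$-module structure on $L_0(\lambda')\otimes V$ can be extended to the adjoint truncation $\mathcal U_\mu^{\mathbf a,\mathbf z}(\hat{\mathfrak g})$. (iii) The $\mathcal U_\mu(\hat{\mathfrak g})$-module $V$ is of finite representation length.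
   Context: **Lie-theoretic notation.** $\mathfrak g$ is a finite-dimensional simple complex Lie algebra, $I=\{1,\dots,r\}$ its Dynkin nodes, $(\alpha_i)_{i\in I}$ the simple roots, $(\,,)$ the invariant form normalized so that the $d_i=(\alpha_i,\alpha_i)/2\in\{1,2,3\}$ are coprime positive integers; $c_{ij}=2(\alpha_i,\alpha_j)/(\alpha_i,\alpha_i)$, $b_{ij}=(\alpha_i,\alpha_j)=d_ic_{ij}$. $\varpi_i^\vee$ are the fundamental coweights, $\langle\varpi_i^\vee,\alpha_j\rangle=\delta_{ij}$. A coweight is an element of $\bigoplus_i\mathbb{Z}\varpi_i^\vee$; it is dominant if its coefficients are all $\ge 0$. $\mathbf Q=\bigoplus_i\mathbb{Z}\alpha_i$, $\mathbf Q_+=\sum_i\mathbb{N}\alpha_i$, $\mathbf Q_-=-\mathbf Q_+$, $\mathbb N=\mathbb Z_{\ge0}$. Fix $q\in\mathbb{C}^\times$ not a root of unity; $q_i=q^{d_i}$, $[t]_q=\frac{q^t-q^{-t}}{q-q^{-1}}$, $\binom{t}{n}_q=\prod_{m=1}^n\frac{[t-m+1]_q}{[m]_q}$. $B(q)=([b_{ij}]_q)_{i,j\in I}$ is invertible, and for $s\neq0$, $\widetilde B(q^s)$ denotes the inverse of $B(q^s)$. **Shifted quantum affine algebra.** For a coweight $\mu=\sum_i m_i\varpi_i^\vee$, $\mathcal{U}_\mu(\hat{\mathfrak g})$ is the associative algebra generated by $x_{i,m}^\pm,\phi_{i,m}^\pm$ ($(i,m)\in I\times\mathbb{Z}$) with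 relations (for $i,j\in I$, $m,n\in\mathbb{Z}$, $\varepsilon\in\{+,-\}$): $\phi^+_{i,m}=0$ if $m<0$; $\phi^-_{i,m}=0$ if $m>m_i$; $\phi^+_{i,0}\phi^-_{i,m_i}$ is central and invertible; $[\phi_{i,m}^\pm,\phi_{j,n}^\varepsilon]=0$; $[x_{i,m}^+,x_{j,n}^-]=\delta_{ij}\frac{\phi_{i,m+n}^+-\phi_{i,m+n}^-}{q_i-q_i^{-1}}$; $\phi_{i,m+1}^\varepsilon x_{j,n}^\pm-q^{\pm b_{ij}}\phi_{i,m}^\varepsilon x_{j,n+1}^\pm=q^{\pm b_{ij}}x_{j,n}^\pm\phi_{i,m+1}^\varepsilon-x_{j,n+1}^\pm\phi_{i,m}^\varepsilon$; $x_{i,m+1}^\pm x_{j,n}^\pm-q^{\pm b_{ij}}x_{i,m}^\pm x_{j,n+1}^\pm=q^{\pm b_{ij}}x_{j,n}^\pm x_{i,m+1}^\pm-x_{j,n+1}^\pm x_{i,m}^\pm$; and $\sum_{s=0}^{1-c_{ij}}(-1)^s\binom{1-c_{ij}}{s}_{q_i}(x_{i,0}^\pm)^{1-c_{ij}-s}x_{j,0}^\pm(x_{i,0}^\pm)^s=0$ for $i\ne j$. For $y\in\{x^\pm,\phi^\pm\}$ put $y_i(z)=\sum_{m\in\mathbb Z}y_{i,m}z^m$. **Modules.** $\mathfrak t^*=(\mathbb{C}^\times)^I$ (componentwise multiplication). For a $\mathcal U_\mu(\hat{\mathfrak g})$-module $M$ and $\lambda\in\mathfrak t^*$, $M_\lambda=\{v:\phi_{i,0}^+v=\lambda(i)v\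 \forall i\in I\}$. $\mathbf Q$ embeds in $\mathfrak t^*$ by $\alpha_j\mapsto\overline{\alpha_j}=(q^{b_{ji}})_{i\in I}$, written $\beta\mapsto\overline\beta$. $M$ is weight graded if it is the direct sum of its $M_\lambda$. $M$ is top graded with top weight $\lambda$ if it is weight graded with all weights in $\lambda\overline{\mathbf Q_-}$ and $\dim M_\lambda=1$. $M$ is in $\mathcal O_\mu$ if it is weight graded, all $M_\lambda$ are finite-dimensional, and the weights lie in a finite union of cones $\lambda_k\overline{\mathbf Q_-}$. A polynomial $\ell$-weight of coweight $\nu=\sum_in_i\varpi_i^\vee$ ($\nu$ dominant) is an $I$-tuple $\mathbf a=(\mathbf a_i(z))_{i\in I}$ of polynomials with $\deg\mathbf a_i=n_i$ and $\mathbf a_i(0)\neq0$; constant $\ell$-weights form the group $\mathfrak p_0=(\mathbb{C}^\times)^I$. For $\lambda\in\mathfrak p_0$ and a $\mathcal U_\mu(\hat{\mathfrak g})$-module $V$, $L_0(\lambda)\otimes V$ is the pullback of $V$ by the automorphism $x_i^+(z)\mapsto\lambda_ix_i^+(z)$, $x_i^-(z)\mapsto x_i^-(z)$, $\phi_i^\pm(z)\mapsto\lambda_i\phi_i^\pm(z)$ of $\mathcal U_\mu(\hat{\mathfrak g})$. **A-series, T-series, T-polynomiality.** In $\mathcal U_\mu(\hat{\mathfrak g})$ put $\overline\phi_i^+(z)=(\phi_{i,0}^+)^{-1}\phi_i^+(z)$, $\overline\phi_i^-(z)=(\phi_{i,m_i}^-)^{-1}z^{-m_i}\phi_i^-(z)$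 and define $h_{i,s}$ ($s\ne0$) by $\overline\phi_i^\pm(z)=\exp(\pm(q-q^{-1})\sum_{\pm s>0}h_{i,s}z^s)$. Set $$\mathbf A_i^\pm(z)=\exp\Big(\pm(q^{-1}-q)\sum_{\pm s>0}\sum_{j\in I}\widetilde B_{ji}(q^s)\tfrac{1-q_i^{-2s}}{q^s-q^{-s}}h_{j,s}z^s\Big),\quad \mathbf T_i^\pm(z)=\exp\Big(\pm(q-q^{-1})\sum_{\pm s>0}\sum_{j\in I}\widetilde B_{ji}(q^s)\tfrac{1}{q^s-q^{-s}}h_{j,s}z^s\Big).$$ Let $V$ be a top graded $\mathcal U_\mu(\hat{\mathfrak g})$-module with top weight $\lambda$; let $f_i^V(z)\in\mathbb{C}[[z]]$ be the eigenvalue of $\mathbf T_i^+(z)$ on $V_\lambda$ and $\overline{\mathbf T}_i^V(z)=f_i^V(z)^{-1}\mathbf T_i^+(z)|_V$. $V$ is *T-polynomial* if for all $i\in I$ and $\beta\in\mathbf Q_+$, on the weight space $V_{\lambda\overline\beta^{-1}}$ the operator $\overline{\mathbf T}_i^V(z)$ is a polynomial in $z$ of degree $\langle\varpi_i^\vee,\beta\rangle$ whose dominant coefficient is invertible. **Truncations.** Let $\mathbf a$ be a polynomial $\ell$-weight of coweight $\nu=\sum_in_i\varpi_i^\vee$. Define $\lambda_{i,s}\in\mathbb C$ by $\mathbf a_i(z)\mathbf a_{i,0}^{-1}=\exp(\sum_{s>0}\lambda_{i,s}z^s)$ and $\mathbf a_i(z)z^{-n_i}\mathbf a_{i,n_i}^{-1}=\exp(\sum_{s<0}\lambda_{i,s}z^s)$.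 Set $\mathbf a_i^*(z)=\exp\Big(\sum_{j\in I}\sum_{s>0}\widetilde B_{ji}(q^s)\frac{1-q_i^{-2s}}{q^s-q^{-s}}\lambda_{j,s}z^s\Big)$, and $\mathbf a_i^\sharp(z)$ the same with $s<0$ in place of $s>0$. Put $\mathscr A_i^+(z)=\mathbf a_i^*(z)\mathbf A_i^+(z)=\sum_k\mathscr A_{i,k}^+z^k$, $\mathscr A_i^-(z)=\mathbf a_i^\sharp(z)\mathbf A_i^-(z)=\sum_k\mathscr A_{i,k}^-z^k$. The pair $(\mu,\mathbf a)$ is *truncatable* if the unique solution $(t_j)_{j\in I}$ of $\sum_{j\in I}c_{ji}t_j=n_i-m_i$ ($i\in I$) lies in $\mathbb N^I$. In that case the *simply-connected truncation* $\mathcal U_\mu^{\mathbf a}(\hat{\mathfrak g})$ is the quotient of $\mathcal U_\mu(\hat{\mathfrak g})$ by: $\mathscr A_{i,k}^+=0$ for $k>t_i$; $\mathscr A_{i,k}^-=\mathscr A_{i,-t_i}^-\mathscr A_{i,k+t_i}^+$ for $k\in\mathbb{Z}$; $\mathbf a_{i,n_i}\phi_{i,0}^+\prod_{j:c_{ji}<0}(\mathscr A_{j,t_j}^+q_j^{t_j})^{-c_{ji}}=\mathbf a_{i,0}\phi_{i,m_i}^-(\mathscr A_{i,t_i}^+q_i^{t_i})^2$. The adjoint shifted quantum affine algebra $\mathcal U_\mu^{\mathrm{ad}}(\hat{\mathfrak g})$ has generators $x_{i,m}^\pm,\phi_{i,m}^\pm,\psi_i^\pm$, the relations of $\mathcal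 U_\mu(\hat{\mathfrak g})$ and: the $\psi$'s commute with one another; $\psi_i^+\psi_i^-$ is central and invertible; $\phi_{i,0}^+=\prod_j(\psi_j^+)^{c_{ji}}$; $\phi_{i,m_i}^-=\prod_j(\psi_j^-)^{c_{ji}}$; $\psi_i^+\phi_{j,m}^\pm=\phi_{j,m}^\pm\psi_i^+$; $\psi_i^+x_{j,m}^\pm=q_i^{\pm\delta_{ij}}x_{j,m}^\pm\psi_i^+$. For $(\mu,\mathbf a)$ truncatable and $\mathbf z\in(\mathbb{C}^\times)^I$ with $\prod_j\mathbf z_j^{c_{ji}}=\mathbf a_{i,0}^{-1}\mathbf a_{i,n_i}$, the *adjoint truncation* $\mathcal U_\mu^{\mathbf a,\mathbf z}(\hat{\mathfrak g})$ is the quotient of $\mathcal U_\mu^{\mathrm{ad}}(\hat{\mathfrak g})$ by: $\mathscr A_{i,k}^+=0$ for $k>t_i$; $\mathscr A_{i,k}^-=\mathscr A_{i,-t_i}^-\mathscr A_{i,k+t_i}^+$ for $k\in\mathbb{Z}$; $\psi_i^+\psi_i^-=(-q_i)^{-t_i}\mathbf z_i$; $\mathscr A_{i,t_i}^+=(-1)^{t_i}(\psi_i^+)^2$. The natural map $\mathcal U_\mu(\hat{\mathfrak g})\to\mathcal U_\mu^{\mathrm{ad}}(\hat{\mathfrak g})$ descends to $\mathcal U_\mu^{\mathbf a}(\hat{\mathfrak g})\to\mathcal U_\mu^{\mathbf a,\mathbf z}(\hat{\mathfrak g})$; a module structure "extends" if it is the pullback along this map of a $\mathcal U_\mu^{\mathbf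 a,\mathbf z}(\hat{\mathfrak g})$-module structure. *)

theory Defs
  imports
    "HOL-Analysis.Analysis"
    "HOL-Computational_Algebra.Computational_Algebra"
    "HOL-Library.Poly_Mapping"
    "HOL-Algebra.QuotRing"
    "HOL-Algebra.Module"
begin

section \<open>Associative complex algebras\<close>

text \<open>
  An associative unital complex algebra, not necessarily commutative, is represented by the
  HOL-Algebra record of a ring together with a scalar multiplication.
\<close>

type_synonym 'b calg = "(complex, 'b) Module.module"

subsection \<open>Free algebras, quotients and presentations\<close>

datatype 'g fword = FWord "'g list"

instantiation fword :: (type) monoid_add
begin

definition zero_fword :: "'a fword" where
  "zero_fword = FWord []"

fun plus_fword :: "'a fword \<Rightarrow> 'a fword \<Rightarrow> 'a fword" where
  "plus_fword (FWord u) (FWord v) = FWord (u @ v)"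

instance
proof
  fix u v w :: "'a fword"
  show "u + v + w = u + (v + w)" by (cases u; cases v; cases w) simp
  show "0 + u = u" by (cases u) (simp add: zero_fword_def)
  show "u + 0 = u" by (cases u) (simp add: zero_fword_def)
qed

end

text \<open>
  Finitely supported functions on words, with the convolution product: the free associative
  algebra on \<^typ>\<open>'g\<close>.
\<close>

type_synonym 'g falg = "'g fword \<Rightarrow>\<^sub>0 complex"

definition fgen :: "'g \<Rightarrow> 'g falg" where
  "fgen g = Poly_Mapping.single (FWord [g]) 1"

definition fscal :: "complex \<Rightarrow> 'g falg" where
  "fscal c = Poly_Mapping.single 0 c"

definition free_alg :: "'g falg calg" where
  "free_alg = \<lparr>carrier = UNIV, mult = (*), one = 1, zero = 0, add = (+),
     smult = (\<lambda>c p. fscal c * p)\<rparr>"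

definition quot_alg :: "'b calg \<Rightarrow> 'b set \<Rightarrow> 'b set calg" where
  "quot_alg A S = (let J = Idl\<^bsub>A\<^esub> S in
     ring.extend (A Quot J)
       (module.fields (\<lambda>c X. \<Union>x\<in>X. J +>\<^bsub>A\<^esub> (c \<odot>\<^bsub>A\<^esub> x))))"

definition quot_proj :: "'b calg \<Rightarrow> 'b set \<Rightarrow> 'b \<Rightarrow> 'b set" where
  "quot_proj A S x = (Idl\<^bsub>A\<^esub> S) +>\<^bsub>A\<^esub> x"

text \<open>
  The map on cosets induced by \<open>f\<close>, for \<open>f\<close> constant on each coset.
\<close>

definition quot_map :: "('b \<Rightarrow> 'e) \<Rightarrow> 'b set \<Rightarrow> 'e" where
  "quot_map f X = the_elem (f ` X)"

definition alg_prod_list :: "'b calg \<Rightarrow> 'b list \<Rightarrow> 'b" where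
  "alg_prod_list A xs = foldr (\<lambda>x y. x \<otimes>\<^bsub>A\<^esub> y) xs \<one>\<^bsub>A\<^esub>"

text \<open>
  The product of the \<open>f j\<close> for \<open>j \<in> J\<close>, in increasing order of \<open>j\<close>. It is only used for
  factors commuting with one another.
\<close>

definition alg_prod :: "'b calg \<Rightarrow> ('i::linorder \<Rightarrow> 'b) \<Rightarrow> 'i set \<Rightarrow> 'b" where
  "alg_prod A f J = alg_prod_list A (map f (sorted_list_of_set J))"

text \<open>The unique homomorphism from the free algebra to \<open>A\<close> mapping each generator \<open>g\<close> to \<open>f g\<close>.\<close>

fun word_eval :: "'b calg \<Rightarrow> ('g \<Rightarrow> 'b) \<Rightarrow> 'g fword \<Rightarrow> 'b" where
  "word_eval A f (FWord gs) = alg_prod_list A (map f gs)"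

definition free_lift :: "'b calg \<Rightarrow> ('g \<Rightarrow> 'b) \<Rightarrow> 'g falg \<Rightarrow> 'b" where
  "free_lift A f p =
     (\<Oplus>\<^bsub>A\<^esub>w\<in>Poly_Mapping.keys p. Poly_Mapping.lookup p w \<odot>\<^bsub>A\<^esub> word_eval A f w)"

subsection \<open>Power series with coefficients in an algebra\<close>

definition ser_mult :: "'b calg \<Rightarrow> (nat \<Rightarrow> 'b) \<Rightarrow> (nat \<Rightarrow> 'b) \<Rightarrow> nat \<Rightarrow> 'b" where
  "ser_mult A f g k = (\<Oplus>\<^bsub>A\<^esub>l\<in>{..k}. f l \<otimes>\<^bsub>A\<^esub> g (k - l))"

fun ser_power :: "'b calg \<Rightarrow> (nat \<Rightarrow> 'b) \<Rightarrow> nat \<Rightarrow> nat \<Rightarrow> 'b" where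
  "ser_power A f 0 = (\<lambda>k. if k = 0 then \<one>\<^bsub>A\<^esub> else \<zero>\<^bsub>A\<^esub>)"
| "ser_power A f (Suc n) = ser_mult A f (ser_power A f n)"

text \<open>
  The exponential \<open>\<Sum>n. f\<^sup>n / n!\<close> of a series \<open>f\<close> with zero constant term; then \<open>f\<^sup>n\<close> has no
  term of degree less than \<open>n\<close>, so the sum for the \<open>k\<close>-th coefficient stops at \<open>n = k\<close>.
\<close>

definition ser_exp :: "'b calg \<Rightarrow> (nat \<Rightarrow> 'b) \<Rightarrow> nat \<Rightarrow> 'b" where
  "ser_exp A f k = (\<Oplus>\<^bsub>A\<^esub>n\<in>{..k}. (1 / fact n) \<odot>\<^bsub>A\<^esub> ser_power A f n k)"

subsection \<open>Modules\<close>

definition end_alg :: "(complex \<Rightarrow> 'v \<Rightarrow> 'v) \<Rightarrow> ('v::ab_group_add \<Rightarrow> 'v) calg" where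
  "end_alg scl = \<lparr>carrier = {f. Vector_Spaces.linear scl scl f},
     mult = (\<circ>), one = id, zero = (\<lambda>v. 0), add = (\<lambda>f g v. f v + g v),
     smult = (\<lambda>c f v. scl c (f v))\<rparr>"

text \<open>\<open>\<rho>\<close> makes the complex vector space \<^typ>\<open>'v\<close> with scalar multiplication \<open>scl\<close> an \<open>A\<close>-module.\<close>

definition alg_module ::
    "'b calg \<Rightarrow> (complex \<Rightarrow> 'v \<Rightarrow> 'v) \<Rightarrow> ('b \<Rightarrow> 'v::ab_group_add \<Rightarrow> 'v) \<Rightarrow> bool" where
  "alg_module A scl \<rho> \<longleftrightarrow>
     vector_space scl \<and> \<rho> \<in> ring_hom A (end_alg scl) \<and>
     (\<forall>c. \<forall>u\<in>carrier A. \<rho> (c \<odot>\<^bsub>A\<^esub> u) = c \<odot>\<^bsub>end_alg scl\<^esub> \<rho> u)"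

definition is_pullback ::
    "'b calg \<Rightarrow> ('b \<Rightarrow> 'e) \<Rightarrow> ('e \<Rightarrow> 'v \<Rightarrow> 'v) \<Rightarrow> ('b \<Rightarrow> 'v \<Rightarrow> 'v) \<Rightarrow> bool" where
  "is_pullback A f \<rho>' \<rho> \<longleftrightarrow> (\<forall>u\<in>carrier A. \<rho> u = \<rho>' (f u))"

definition submodule ::
    "'b calg \<Rightarrow> (complex \<Rightarrow> 'v \<Rightarrow> 'v) \<Rightarrow> ('b \<Rightarrow> 'v::ab_group_add \<Rightarrow> 'v) \<Rightarrow> 'v set \<Rightarrow> bool" where
  "submodule A scl \<rho> W \<longleftrightarrow>
     Modules.module.subspace scl W \<and> (\<forall>u\<in>carrier A. \<forall>w\<in>W. \<rho> u w \<in> W)"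

text \<open>
  Existence of a composition series: the quotient of \<open>W (Suc k)\<close> by \<open>W k\<close> is simple iff \<open>W k\<close> is
  a maximal proper submodule of \<open>W (Suc k)\<close>.
\<close>

definition finite_length ::
    "'b calg \<Rightarrow> (complex \<Rightarrow> 'v \<Rightarrow> 'v) \<Rightarrow> ('b \<Rightarrow> 'v::ab_group_add \<Rightarrow> 'v) \<Rightarrow> bool" where
  "finite_length A scl \<rho> \<longleftrightarrow>
     (\<exists>n (W :: nat \<Rightarrow> 'v set). W 0 = {0} \<and> W n = UNIV \<and>
        (\<forall>k\<le>n. submodule A scl \<rho> (W k)) \<and>
        (\<forall>k<n. W k \<subset> W (Suc k) \<and>
           (\<forall>X. submodule A scl \<rho> X \<and> W k \<subseteq> X \<and> X \<subseteq> W (Suc k) \<longrightarrow>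
              X = W k \<or> X = W (Suc k))))"

text \<open>
  A series \<open>F\<close> with coefficients in \<open>End V\<close> stabilizes \<open>V[z]\<close>; elements of \<open>V[z]\<close> are finitely
  supported sequences in \<open>V\<close>.
\<close>

definition stabilizes_polynomials :: "(nat \<Rightarrow> 'v \<Rightarrow> 'v::ab_group_add) \<Rightarrow> bool" where
  "stabilizes_polynomials F \<longleftrightarrow>
     (\<forall>v :: nat \<Rightarrow> 'v. finite {k. v k \<noteq> 0} \<longrightarrow>
        finite {k. (\<Sum>l\<le>k. F l (v (k - l))) \<noteq> 0})"

section \<open>Cartan data and quantum numbers\<close>

text \<open>
  The Cartan matrix \<open>c\<close> of a finite-dimensional simple complex Lie algebra with node set \<^typ>\<open>'i\<close>
  (an indecomposable Cartan matrix of finite type), and the coprime positive integers \<open>d\<close> for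
  which \<open>d i * c i j\<close> is the matrix of the normalized invariant form on the simple roots.
\<close>

definition simple_cartan_datum :: "('i::finite \<Rightarrow> 'i \<Rightarrow> int) \<Rightarrow> ('i \<Rightarrow> int) \<Rightarrow> bool" where
  "simple_cartan_datum c d \<longleftrightarrow>
     (\<forall>i. c i i = 2) \<and> (\<forall>i j. i \<noteq> j \<longrightarrow> c i j \<le> 0) \<and>
     (\<forall>i. d i > 0) \<and> Gcd (range d) = 1 \<and>
     (\<forall>i j. d i * c i j = d j * c j i) \<and>
     (\<forall>x :: 'i \<Rightarrow> real. x \<noteq> (\<lambda>i. 0) \<longrightarrow>
        0 < (\<Sum>i\<in>UNIV. \<Sum>j\<in>UNIV. x i * of_int (d i * c i j) * x j)) \<and>
     (\<forall>J. J \<noteq> {} \<and> J \<noteq> UNIV \<longrightarrow> (\<exists>i\<in>J. \<exists>j\<in>-J. c i j \<noteq> 0))"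

definition qnum :: "complex \<Rightarrow> int \<Rightarrow> complex" where
  "qnum q t = (q powi t - q powi (- t)) / (q - inverse q)"

definition qbinom :: "complex \<Rightarrow> int \<Rightarrow> nat \<Rightarrow> complex" where
  "qbinom q t n = (\<Prod>m = 1..n. qnum q (t - int m + 1) / qnum q (int m))"

section \<open>Shifted quantum affine algebras\<close>

datatype pm = Pos | Neg

fun sgi :: "pm \<Rightarrow> int" where
  "sgi Pos = 1"
| "sgi Neg = - 1"

fun opp :: "pm \<Rightarrow> pm" where
  "opp Pos = Neg"
| "opp Neg = Pos"

text \<open>
  \<open>GX \<epsilon> i k\<close> is \<open>x\<^sup>\<epsilon>\<close> and \<open>GPhi \<epsilon> i k\<close> is \<open>\<phi>\<^sup>\<epsilon>\<close> with indices \<open>(i, k)\<close>. The generator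
  \<open>GPhiInv i\<close> is the inverse of the product of \<open>GPhi Pos i 0\<close> and \<open>GPhi Neg i (m i)\<close>, which is
  required to be central and invertible.
\<close>

datatype 'i gen = GX pm 'i int | GPhi pm 'i int | GPhiInv 'i

text \<open>
  Generators of the adjoint version; \<open>GPsiInv i\<close> is the inverse of the product of \<open>GPsi Pos i\<close>
  and \<open>GPsi Neg i\<close>.
\<close>

datatype 'i adgen = GBase "'i gen" | GPsi pm 'i | GPsiInv 'i

context
  fixes c :: "'i::{finite,linorder} \<Rightarrow> 'i \<Rightarrow> int"
    and d :: "'i \<Rightarrow> int"
    and q :: complex
    and m :: "'i \<Rightarrow> int"  \<comment> \<open>the coweight \<open>\<mu>\<close>, in the basis of fundamental coweights\<close>
begin

definition bform :: "'i \<Rightarrow> 'i \<Rightarrow> int" where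
  "bform i j = d i * c i j"

definition qi :: "'i \<Rightarrow> complex" where
  "qi i = q powi d i"

definition Bmat :: "complex \<Rightarrow> ((complex, 'i) vec, 'i) vec" where
  "Bmat t = (\<chi> i j. qnum t (bform i j))"

definition Btilde :: "int \<Rightarrow> 'i \<Rightarrow> 'i \<Rightarrow> complex" where
  "Btilde s i j = matrix_inv (Bmat (q powi s)) $ i $ j"

subsection \<open>The algebra and its adjoint version\<close>

text \<open>
  The defining relations, each as an element of the free algebra to be set to zero. They are
  written for an arbitrary set \<^typ>\<open>'g\<close> of generators containing the basic ones by \<open>\<gamma>\<close>, so as to
  serve for both algebras; central means commuting with all generators in \<^typ>\<open>'g\<close>.
\<close>

definition base_rels :: "('i gen \<Rightarrow> 'g) \<Rightarrow> 'g falg set" where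
  "base_rels \<gamma> = (let
       x = (\<lambda>\<epsilon> i k. fgen (\<gamma> (GX \<epsilon> i k)));
       \<phi> = (\<lambda>\<epsilon> i k. fgen (\<gamma> (GPhi \<epsilon> i k)));
       \<kappa> = (\<lambda>i. \<phi> Pos i 0 * \<phi> Neg i (m i));
       \<kappa>' = (\<lambda>i. fgen (\<gamma> (GPhiInv i)));
       qb = (\<lambda>\<epsilon> i j. fscal (q powi (sgi \<epsilon> * bform i j)))
     in
       {\<phi> Pos i k | i k. k < 0} \<union>
       {\<phi> Neg i k | i k. k > m i} \<union>
       {\<kappa> i * \<kappa>' i - 1 | i. True} \<union>
       {\<kappa>' i * \<kappa> i - 1 | i. True} \<union>
       {\<kappa> i * fgen g - fgen g * \<kappa> i | i g. True} \<union>
       {\<phi> \<delta> i k * \<phi> \<epsilon> j l - \<phi> \<epsilon> j l * \<phi> \<delta> i k | \<delta> \<epsilon> i j k l. True} \<union>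
       {x Pos i k * x Neg j l - x Neg j l * x Pos i k
          - (if i = j then fscal (1 / (qi i - inverse (qi i))) * (\<phi> Pos i (k + l) - \<phi> Neg i (k + l))
             else 0) | i j k l. True} \<union>
       {\<phi> \<epsilon> i (k + 1) * x \<delta> j l - qb \<delta> i j * \<phi> \<epsilon> i k * x \<delta> j (l + 1)
          - (qb \<delta> i j * x \<delta> j l * \<phi> \<epsilon> i (k + 1) - x \<delta> j (l + 1) * \<phi> \<epsilon> i k) | \<delta> \<epsilon> i j k l. True} \<union>
       {x \<delta> i (k + 1) * x \<delta> j l - qb \<delta> i j * x \<delta> i k * x \<delta> j (l + 1)
          - (qb \<delta> i j * x \<delta> j l * x \<delta> i (k + 1) - x \<delta> j (l + 1) * x \<delta> i k) | \<delta> i j k l. True} \<union>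
       {(let N = nat (1 - c i j) in
           \<Sum>s = 0..N. fscal ((- 1) ^ s * qbinom (qi i) (1 - c i j) s)
             * x \<delta> i 0 ^ (N - s) * x \<delta> j 0 * x \<delta> i 0 ^ s) | \<delta> i j. i \<noteq> j})"

definition U_alg :: "'i gen falg set calg" where
  "U_alg = quot_alg free_alg (base_rels id)"

definition U_gen :: "'i gen \<Rightarrow> 'i gen falg set" where
  "U_gen g = quot_proj free_alg (base_rels id) (fgen g)"

abbreviation phi :: "pm \<Rightarrow> 'i \<Rightarrow> int \<Rightarrow> 'i gen falg set" where
  "phi \<epsilon> i k \<equiv> U_gen (GPhi \<epsilon> i k)"

text \<open>
  Integer powers of \<open>\<psi>\<^sup>\<epsilon>\<close> in the free algebra: modulo the relations below, the inverse of
  \<open>GPsi \<epsilon> i\<close> is the product of \<open>GPsi (opp \<epsilon>) i\<close> and \<open>GPsiInv i\<close>.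
\<close>

definition psi_powi :: "pm \<Rightarrow> 'i \<Rightarrow> int \<Rightarrow> 'i adgen falg" where
  "psi_powi \<epsilon> i k = (if k \<ge> 0 then fgen (GPsi \<epsilon> i) ^ nat k
     else (fgen (GPsi (opp \<epsilon>) i) * fgen (GPsiInv i)) ^ nat (- k))"

definition ad_rels :: "'i adgen falg set" where
  "ad_rels = (let
       x = (\<lambda>\<epsilon> i k. fgen (GBase (GX \<epsilon> i k)));
       \<phi> = (\<lambda>\<epsilon> i k. fgen (GBase (GPhi \<epsilon> i k)));
       \<psi> = (\<lambda>\<epsilon> i. fgen (GPsi \<epsilon> i));
       \<kappa> = (\<lambda>i. \<psi> Pos i * \<psi> Neg i);
       \<kappa>' = (\<lambda>i. fgen (GPsiInv i))
     in
       base_rels GBase \<union>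
       {\<psi> \<delta> i * \<psi> \<epsilon> j - \<psi> \<epsilon> j * \<psi> \<delta> i | \<delta> \<epsilon> i j. True} \<union>
       {\<kappa> i * \<kappa>' i - 1 | i. True} \<union>
       {\<kappa>' i * \<kappa> i - 1 | i. True} \<union>
       {\<kappa> i * fgen g - fgen g * \<kappa> i | i g. True} \<union>
       {\<phi> Pos i 0 - alg_prod free_alg (\<lambda>j. psi_powi Pos j (c j i)) UNIV | i. True} \<union>
       {\<phi> Neg i (m i) - alg_prod free_alg (\<lambda>j. psi_powi Neg j (c j i)) UNIV | i. True} \<union>
       {\<psi> Pos i * \<phi> \<epsilon> j k - \<phi> \<epsilon> j k * \<psi> Pos i | \<epsilon> i j k. True} \<union>
       {\<psi> Pos i * x \<epsilon> j k
          - fscal (if i = j then qi i powi sgi \<epsilon> else 1) * x \<epsilon> j k * \<psi> Pos i | \<epsilon> i j k. True})"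

definition Uad_alg :: "'i adgen falg set calg" where
  "Uad_alg = quot_alg free_alg ad_rels"

definition Uad_gen :: "'i adgen \<Rightarrow> 'i adgen falg set" where
  "Uad_gen g = quot_proj free_alg ad_rels (fgen g)"

definition to_ad :: "'i gen falg set \<Rightarrow> 'i adgen falg set" where
  "to_ad = quot_map (free_lift Uad_alg (\<lambda>g. Uad_gen (GBase g)))"

text \<open>The automorphism along which \<open>V\<close> is pulled back to give \<open>L\<^sub>0(\<Lambda>) \<otimes> V\<close>.\<close>

fun L0_gen :: "('i \<Rightarrow> complex) \<Rightarrow> 'i gen \<Rightarrow> 'i gen falg set" where
  "L0_gen \<Lambda> (GX Pos i k) = \<Lambda> i \<odot>\<^bsub>U_alg\<^esub> U_gen (GX Pos i k)"
| "L0_gen \<Lambda> (GX Neg i k) = U_gen (GX Neg i k)"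
| "L0_gen \<Lambda> (GPhi \<epsilon> i k) = \<Lambda> i \<odot>\<^bsub>U_alg\<^esub> U_gen (GPhi \<epsilon> i k)"
| "L0_gen \<Lambda> (GPhiInv i) = inverse (\<Lambda> i ^ 2) \<odot>\<^bsub>U_alg\<^esub> U_gen (GPhiInv i)"

definition L0_auto :: "('i \<Rightarrow> complex) \<Rightarrow> 'i gen falg set \<Rightarrow> 'i gen falg set" where
  "L0_auto \<Lambda> = quot_map (free_lift U_alg (L0_gen \<Lambda>))"

definition L0_tensor ::
    "('i \<Rightarrow> complex) \<Rightarrow> ('i gen falg set \<Rightarrow> 'v \<Rightarrow> 'v) \<Rightarrow> 'i gen falg set \<Rightarrow> 'v \<Rightarrow> 'v" where
  "L0_tensor \<Lambda> \<rho> u = \<rho> (L0_auto \<Lambda> u)"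

subsection \<open>A-series and T-series\<close>

text \<open>
  A series in \<open>z\<^sup>\<epsilon>\<close> is given by the sequence of its coefficients: the \<open>k\<close>-th entry is the
  coefficient of \<open>z\<close> to the power \<open>sgi \<epsilon> * k\<close>.
\<close>

fun phi_bar :: "pm \<Rightarrow> 'i \<Rightarrow> nat \<Rightarrow> 'i gen falg set" where
  "phi_bar Pos i k = inv\<^bsub>U_alg\<^esub> (phi Pos i 0) \<otimes>\<^bsub>U_alg\<^esub> phi Pos i (int k)"
| "phi_bar Neg i k = inv\<^bsub>U_alg\<^esub> (phi Neg i (m i)) \<otimes>\<^bsub>U_alg\<^esub> phi Neg i (m i - int k)"

text \<open>The entry \<open>h_ser \<epsilon> i k\<close> is \<open>h\<close> with indices \<open>(i, sgi \<epsilon> * k)\<close>.\<close>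

definition h_ser :: "pm \<Rightarrow> 'i \<Rightarrow> nat \<Rightarrow> 'i gen falg set" where
  "h_ser \<epsilon> i = (THE h. range h \<subseteq> carrier U_alg \<and> h 0 = \<zero>\<^bsub>U_alg\<^esub> \<and>
     ser_exp U_alg (\<lambda>k. (of_int (sgi \<epsilon>) * (q - inverse q)) \<odot>\<^bsub>U_alg\<^esub> h k) = phi_bar \<epsilon> i)"

definition A_coeff :: "int \<Rightarrow> 'i \<Rightarrow> 'i \<Rightarrow> complex" where
  "A_coeff s i j = Btilde s j i * ((1 - qi i powi (- 2 * s)) / (q powi s - q powi (- s)))"

definition T_coeff :: "int \<Rightarrow> 'i \<Rightarrow> 'i \<Rightarrow> complex" where
  "T_coeff s i j = Btilde s j i * (1 / (q powi s - q powi (- s)))"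

definition A_ser :: "pm \<Rightarrow> 'i \<Rightarrow> nat \<Rightarrow> 'i gen falg set" where
  "A_ser \<epsilon> i = ser_exp U_alg (\<lambda>k. if k = 0 then \<zero>\<^bsub>U_alg\<^esub> else
     (of_int (sgi \<epsilon>) * (inverse q - q)) \<odot>\<^bsub>U_alg\<^esub>
       (\<Oplus>\<^bsub>U_alg\<^esub>j\<in>UNIV. A_coeff (sgi \<epsilon> * int k) i j \<odot>\<^bsub>U_alg\<^esub> h_ser \<epsilon> j k))"

definition T_ser :: "pm \<Rightarrow> 'i \<Rightarrow> nat \<Rightarrow> 'i gen falg set" where
  "T_ser \<epsilon> i = ser_exp U_alg (\<lambda>k. if k = 0 then \<zero>\<^bsub>U_alg\<^esub> else
     (of_int (sgi \<epsilon>) * (q - inverse q)) \<odot>\<^bsub>U_alg\<^esub>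
       (\<Oplus>\<^bsub>U_alg\<^esub>j\<in>UNIV. T_coeff (sgi \<epsilon> * int k) i j \<odot>\<^bsub>U_alg\<^esub> h_ser \<epsilon> j k))"

subsection \<open>Weights and T-polynomial modules\<close>

definition t_dual :: "('i \<Rightarrow> complex) set" where
  "t_dual = {\<Lambda>. \<forall>i. \<Lambda> i \<noteq> 0}"

definition root_bar :: "('i \<Rightarrow> int) \<Rightarrow> 'i \<Rightarrow> complex" where
  "root_bar \<beta> i = (\<Prod>j\<in>UNIV. (q powi bform j i) powi \<beta> j)"

text \<open>The weight \<open>\<Lambda>\<close> lowered by \<open>\<beta> \<in> Q\<^sub>+\<close>.\<close>

definition lower_wt :: "('i \<Rightarrow> complex) \<Rightarrow> ('i \<Rightarrow> nat) \<Rightarrow> 'i \<Rightarrow> complex" where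
  "lower_wt \<Lambda> \<beta> i = \<Lambda> i * root_bar (\<lambda>j. - int (\<beta> j)) i"

definition weight_cone :: "('i \<Rightarrow> complex) \<Rightarrow> ('i \<Rightarrow> complex) set" where
  "weight_cone \<Lambda> = range (lower_wt \<Lambda>)"

definition wt_space ::
    "(complex \<Rightarrow> 'v \<Rightarrow> 'v) \<Rightarrow> ('i gen falg set \<Rightarrow> 'v \<Rightarrow> 'v) \<Rightarrow> ('i \<Rightarrow> complex) \<Rightarrow> 'v set" where
  "wt_space scl \<rho> \<Lambda> = {v. \<forall>i. \<rho> (phi Pos i 0) v = scl (\<Lambda> i) v}"

definition weights ::
    "(complex \<Rightarrow> 'v \<Rightarrow> 'v) \<Rightarrow> ('i gen falg set \<Rightarrow> 'v::ab_group_add \<Rightarrow> 'v) \<Rightarrow> ('i \<Rightarrow> complex) set" where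
  "weights scl \<rho> = {\<Lambda>\<in>t_dual. wt_space scl \<rho> \<Lambda> \<noteq> {0}}"

definition weight_graded ::
    "(complex \<Rightarrow> 'v \<Rightarrow> 'v) \<Rightarrow> ('i gen falg set \<Rightarrow> 'v::ab_group_add \<Rightarrow> 'v) \<Rightarrow> bool" where
  "weight_graded scl \<rho> \<longleftrightarrow>
     (\<forall>v. \<exists>!f. finite {\<Lambda>. f \<Lambda> \<noteq> 0} \<and> (\<forall>\<Lambda>. \<Lambda> \<notin> t_dual \<longrightarrow> f \<Lambda> = 0) \<and>
        (\<forall>\<Lambda>\<in>t_dual. f \<Lambda> \<in> wt_space scl \<rho> \<Lambda>) \<and> v = (\<Sum>\<Lambda> | f \<Lambda> \<noteq> 0. f \<Lambda>))"

definition top_graded ::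
    "(complex \<Rightarrow> 'v \<Rightarrow> 'v) \<Rightarrow> ('i gen falg set \<Rightarrow> 'v::ab_group_add \<Rightarrow> 'v) \<Rightarrow> ('i \<Rightarrow> complex) \<Rightarrow> bool" where
  "top_graded scl \<rho> \<Lambda> \<longleftrightarrow> \<Lambda> \<in> t_dual \<and> weight_graded scl \<rho> \<and>
     weights scl \<rho> \<subseteq> weight_cone \<Lambda> \<and> vector_space.dim scl (wt_space scl \<rho> \<Lambda>) = 1"

definition category_O ::
    "(complex \<Rightarrow> 'v \<Rightarrow> 'v) \<Rightarrow> ('i gen falg set \<Rightarrow> 'v::ab_group_add \<Rightarrow> 'v) \<Rightarrow> bool" where
  "category_O scl \<rho> \<longleftrightarrow> alg_module U_alg scl \<rho> \<and> weight_graded scl \<rho> \<and>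
     (\<forall>\<Lambda>\<in>t_dual. \<exists>B. finite B \<and> wt_space scl \<rho> \<Lambda> \<subseteq> Modules.module.span scl B) \<and>
     (\<exists>K. finite K \<and> K \<subseteq> t_dual \<and> weights scl \<rho> \<subseteq> (\<Union>\<Lambda>\<in>K. weight_cone \<Lambda>))"

definition normalized_T ::
    "(complex \<Rightarrow> 'v \<Rightarrow> 'v) \<Rightarrow> ('i gen falg set \<Rightarrow> 'v::ab_group_add \<Rightarrow> 'v) \<Rightarrow>
     ('i \<Rightarrow> complex fps) \<Rightarrow> 'i \<Rightarrow> nat \<Rightarrow> 'v \<Rightarrow> 'v" where
  "normalized_T scl \<rho> f i k v =
     (\<Sum>l\<le>k. scl (fps_nth (inverse (f i)) l) (\<rho> (T_ser Pos i (k - l)) v))"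

text \<open>
  In the next definition \<open>f i\<close> is the eigenvalue of the T-series on the (one-dimensional) top
  weight space. Since the pairing of the \<open>i\<close>-th fundamental coweight with \<open>\<beta>\<close> is \<open>\<beta> i\<close>, the
  normalized T-series on the weight space below the top by \<open>\<beta>\<close> must be a polynomial of degree
  \<open>\<beta> i\<close> with invertible leading coefficient.
\<close>

definition T_polynomial ::
    "(complex \<Rightarrow> 'v \<Rightarrow> 'v) \<Rightarrow> ('i gen falg set \<Rightarrow> 'v::ab_group_add \<Rightarrow> 'v) \<Rightarrow> bool" where
  "T_polynomial scl \<rho> \<longleftrightarrow>
     alg_module U_alg scl \<rho> \<and>
     (\<exists>\<Lambda> f. top_graded scl \<rho> \<Lambda> \<and>
        (\<forall>i k. \<forall>v\<in>wt_space scl \<rho> \<Lambda>. \<rho> (T_ser Pos i k) v = scl (fps_nth (f i) k) v) \<and>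
        (\<forall>i \<beta>. let W = wt_space scl \<rho> (lower_wt \<Lambda> \<beta>); T = normalized_T scl \<rho> f i in
           (\<forall>k > \<beta> i. \<forall>v\<in>W. T k v = 0) \<and> bij_betw (T (\<beta> i)) W W))"

subsection \<open>Truncations\<close>

definition poly_lweight :: "('i \<Rightarrow> complex poly) \<Rightarrow> bool" where
  "poly_lweight a \<longleftrightarrow> (\<forall>i. poly (a i) 0 \<noteq> 0)"

text \<open>
  The entry \<open>k\<close> of \<open>lw_log \<epsilon> p\<close>, for \<open>p\<close> the \<open>i\<close>-th component of an \<open>\<ell>\<close>-weight, is \<open>\<lambda>\<close> with
  indices \<open>(i, sgi \<epsilon> * k)\<close>; \<^const>\<open>reflect_poly\<close> expresses \<open>p\<close>, divided by \<open>z\<close> to the power of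
  its degree, as a polynomial in the inverse of \<open>z\<close>.
\<close>

fun lw_normalized :: "pm \<Rightarrow> complex poly \<Rightarrow> complex fps" where
  "lw_normalized Pos p = fps_of_poly (Polynomial.smult (inverse (coeff p 0)) p)"
| "lw_normalized Neg p = fps_of_poly (Polynomial.smult (inverse (lead_coeff p)) (reflect_poly p))"

definition lw_log :: "pm \<Rightarrow> complex poly \<Rightarrow> complex fps" where
  "lw_log \<epsilon> p = (THE f. fps_nth f 0 = 0 \<and> fps_compose (fps_exp 1) f = lw_normalized \<epsilon> p)"

text \<open>
  The series \<open>a\<^sub>i\<^sup>*\<close> for the sign \<^const>\<open>Pos\<close> and \<open>a\<^sub>i\<^sup>\<sharp>\<close> (in the inverse of \<open>z\<close>) for
  \<^const>\<open>Neg\<close>.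
\<close>

definition lw_star :: "('i \<Rightarrow> complex poly) \<Rightarrow> pm \<Rightarrow> 'i \<Rightarrow> complex fps" where
  "lw_star a \<epsilon> i = fps_compose (fps_exp 1) (Abs_fps (\<lambda>k. if k = 0 then 0 else
     (\<Sum>j\<in>UNIV. A_coeff (sgi \<epsilon> * int k) i j * fps_nth (lw_log \<epsilon> (a j)) k)))"

definition scrA :: "('i \<Rightarrow> complex poly) \<Rightarrow> pm \<Rightarrow> 'i \<Rightarrow> nat \<Rightarrow> 'i gen falg set" where
  "scrA a \<epsilon> i k =
     (\<Oplus>\<^bsub>U_alg\<^esub>l\<in>{..k}. fps_nth (lw_star a \<epsilon> i) l \<odot>\<^bsub>U_alg\<^esub> A_ser \<epsilon> i (k - l))"

text \<open>The coefficient of \<open>z\<close> to the power \<open>k\<close> in the previous series, for any integer \<open>k\<close>.\<close>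

definition scrA_int :: "('i \<Rightarrow> complex poly) \<Rightarrow> pm \<Rightarrow> 'i \<Rightarrow> int \<Rightarrow> 'i gen falg set" where
  "scrA_int a \<epsilon> i k =
     (if sgi \<epsilon> * k \<ge> 0 then scrA a \<epsilon> i (nat (sgi \<epsilon> * k)) else \<zero>\<^bsub>U_alg\<^esub>)"

definition trunc_sol :: "('i \<Rightarrow> complex poly) \<Rightarrow> 'i \<Rightarrow> rat" where
  "trunc_sol a = (THE t. \<forall>i. (\<Sum>j\<in>UNIV. of_int (c j i) * t j) = of_int (int (degree (a i)) - m i))"

definition truncatable :: "('i \<Rightarrow> complex poly) \<Rightarrow> bool" where
  "truncatable a \<longleftrightarrow> (\<forall>j. trunc_sol a j \<in> \<nat>)"

definition trunc_t :: "('i \<Rightarrow> complex poly) \<Rightarrow> 'i \<Rightarrow> nat" where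
  "trunc_t a j = nat \<lfloor>trunc_sol a j\<rfloor>"

definition trunc_rels :: "('i \<Rightarrow> complex poly) \<Rightarrow> 'i gen falg set set" where
  "trunc_rels a = (let t = trunc_t a in
     {scrA a Pos i k | i k. k > t i} \<union>
     {scrA_int a Neg i k \<ominus>\<^bsub>U_alg\<^esub>
        scrA_int a Neg i (- int (t i)) \<otimes>\<^bsub>U_alg\<^esub> scrA_int a Pos i (k + int (t i)) | i k. True} \<union>
     {lead_coeff (a i) \<odot>\<^bsub>U_alg\<^esub> (phi Pos i 0 \<otimes>\<^bsub>U_alg\<^esub>
          alg_prod U_alg
            (\<lambda>j. (qi j ^ t j \<odot>\<^bsub>U_alg\<^esub> scrA a Pos j (t j)) [^]\<^bsub>U_alg\<^esub> nat (- c j i))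
            {j. c j i < 0})
        \<ominus>\<^bsub>U_alg\<^esub>
        coeff (a i) 0 \<odot>\<^bsub>U_alg\<^esub> (phi Neg i (m i) \<otimes>\<^bsub>U_alg\<^esub>
          (qi i ^ t i \<odot>\<^bsub>U_alg\<^esub> scrA a Pos i (t i)) [^]\<^bsub>U_alg\<^esub> (2::nat)) | i. True})"

definition trunc_alg :: "('i \<Rightarrow> complex poly) \<Rightarrow> 'i gen falg set set calg" where
  "trunc_alg a = quot_alg U_alg (trunc_rels a)"

definition to_trunc :: "('i \<Rightarrow> complex poly) \<Rightarrow> 'i gen falg set \<Rightarrow> 'i gen falg set set" where
  "to_trunc a = quot_proj U_alg (trunc_rels a)"

definition ad_trunc_rels ::
    "('i \<Rightarrow> complex poly) \<Rightarrow> ('i \<Rightarrow> complex) \<Rightarrow> 'i adgen falg set set" where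
  "ad_trunc_rels a z = (let t = trunc_t a; \<psi> = (\<lambda>\<epsilon> i. Uad_gen (GPsi \<epsilon> i)) in
     {to_ad (scrA a Pos i k) | i k. k > t i} \<union>
     {to_ad (scrA_int a Neg i k) \<ominus>\<^bsub>Uad_alg\<^esub>
        to_ad (scrA_int a Neg i (- int (t i))) \<otimes>\<^bsub>Uad_alg\<^esub> to_ad (scrA_int a Pos i (k + int (t i)))
        | i k. True} \<union>
     {\<psi> Pos i \<otimes>\<^bsub>Uad_alg\<^esub> \<psi> Neg i \<ominus>\<^bsub>Uad_alg\<^esub>
        ((- qi i) powi (- int (t i)) * z i) \<odot>\<^bsub>Uad_alg\<^esub> \<one>\<^bsub>Uad_alg\<^esub> | i. True} \<union>
     {to_ad (scrA a Pos i (t i)) \<ominus>\<^bsub>Uad_alg\<^esub>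
        (- 1) ^ t i \<odot>\<^bsub>Uad_alg\<^esub> (\<psi> Pos i [^]\<^bsub>Uad_alg\<^esub> (2::nat)) | i. True})"

definition ad_trunc_alg ::
    "('i \<Rightarrow> complex poly) \<Rightarrow> ('i \<Rightarrow> complex) \<Rightarrow> 'i adgen falg set set calg" where
  "ad_trunc_alg a z = quot_alg Uad_alg (ad_trunc_rels a z)"

definition trunc_to_ad_trunc ::
    "('i \<Rightarrow> complex poly) \<Rightarrow> ('i \<Rightarrow> complex) \<Rightarrow> 'i gen falg set set \<Rightarrow> 'i adgen falg set set" where
  "trunc_to_ad_trunc a z = quot_map (\<lambda>u. quot_proj Uad_alg (ad_trunc_rels a z) (to_ad u))"

end

end

theory Submission
  imports Defs
begin

text \<open>
  On a module, the \<open>\<phi>\<^sub>i\<^sup>\<plusminus>\<close>, the T-series and the series \<open>\<A>\<^sub>i\<^sup>\<plusminus>\<close> are power series with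
  coefficients in a commutative algebra of endomorphisms. Such series are determined by their
  logarithmic derivatives, for which the definition of the A-series is a linear system with matrix
  \<open>B(q\<^sup>s)\<close>; this gives the product formula
  \<open>\<phi>\<^sub>i(z) \<A>\<^sub>i(z) \<A>\<^sub>i(q\<^sub>i\<^sup>2 z) = \<a>\<^sub>i(z) \<Prod> \<A>\<^sub>j(z q\<^sub>j\<^sup>e)\<close> for the normalized \<open>\<phi>\<^sub>i\<^sup>+\<close>.
  The matrix \<open>B(q)\<close> is invertible since an element of its kernel unfolds to an eigenvector, of
  eigenvalue \<open>q\<close>, of an integral isometry of a positive definite lattice, and such an isometry has
  finite order.

  T-polynomiality and the stability of \<open>V[z]\<close> make \<open>\<A>\<^sub>i\<^sup>+\<close> a polynomial whose leading coefficient
  acts on the weight space below the top by \<open>\<beta>\<close> as a nonzero multiple of \<open>q\<^sub>i\<close> to the power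
  \<open>- 2 \<beta>\<^sub>i\<close>. The commutation relation of \<open>\<A>\<^sub>i\<^sup>+\<close> and \<open>x\<^sub>i\<^sup>-\<close> implies
  \<open>\<A>\<^sub>i(z) \<A>\<^sub>i(q\<^sub>i\<^sup>2 z) (\<phi>\<^sub>i\<^sup>+(z) - \<phi>\<^sub>i\<^sup>-(z)) = 0\<close>, so \<open>\<phi>\<^sub>i\<^sup>+\<close> and \<open>\<phi>\<^sub>i\<^sup>-\<close> expand the same rational
  function. Comparing degrees and leading coefficients yields truncatability and the last truncation
  relation; reversing the polynomials yields the relation between \<open>\<A>\<^sub>i\<^sup>+\<close> and \<open>\<A>\<^sub>i\<^sup>-\<close>. For the
  adjoint truncation, \<open>\<psi>\<^sub>i\<^sup>+\<close> acts on each weight space by a square root of the leading coefficient of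
  \<open>\<A>\<^sub>i\<^sup>+\<close>, up to sign.

  If \<open>Y\<^sub>1 \<subset> Y\<^sub>2\<close> are submodules, some weight space of \<open>Y\<^sub>2\<close> contains a vector which modulo \<open>Y\<^sub>1\<close> is
  annihilated by the \<open>x\<^sub>j\<^sup>+\<close> and a joint eigenvector. The eigenvalues \<open>P\<^sub>i(z)\<close> of the \<open>\<A>\<^sub>i\<^sup>+(z)\<close> are
  polynomials such that \<open>P\<^sub>i(q\<^sub>i\<^sup>2 z)\<close> divides \<open>\<a>\<^sub>i(z) \<Prod> P\<^sub>j(z q\<^sub>j\<^sup>e)\<close>, which confines their roots,
  hence their leading coefficients, hence the weight, to a finite set. Since weight spaces are
  finite-dimensional, chains of submodules have bounded length.
\<close>

section \<open>Algebras and homomorphisms\<close>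

text \<open>The leading coefficients come from one functional equation: by the shape of the defining
  coefficients, T_i(z) times the A-series is T_i(z / q_i^2). On a weight space the top terms of both
  sides contain the same invertible leading coefficient of T_i, which cancels and leaves a power of
  q_i. The invertibility of B(q) is obtained without classification. Reading q as a time shift, a
  kernel vector v becomes the plane wave q^k v_i of a discrete wave equation. One time step is a
  product of commuting reflections combined with a permutation of coordinates, so it preserves a
  quadratic form whatever the type. Unequal root lengths are accommodated by giving node i a window
  of 2 d_i times. The twist in the extension to the adjoint truncation is forced: the leading
  coefficient fixes \<psi>_i^+ up to sign, so the product of the \<psi>_j^+ to the powers c_ji is
  prescribed on the top weight space and need not be the eigenvalue of \<phi>_(i,0)^+ there.\<close>

locale calgebra = ring A for A :: "'b calg" (structure) +
  assumes smult_closed [simp, intro]: "x \<in> carrier A \<Longrightarrow> c \<odot> x \<in> carrier A"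
    and smult_add_left: "x \<in> carrier A \<Longrightarrow> (a + b) \<odot> x = a \<odot> x \<oplus> b \<odot> x"
    and smult_add_right:
      "x \<in> carrier A \<Longrightarrow> y \<in> carrier A \<Longrightarrow> c \<odot> (x \<oplus> y) = c \<odot> x \<oplus> c \<odot> y"
    and smult_smult: "x \<in> carrier A \<Longrightarrow> a \<odot> (b \<odot> x) = (a * b) \<odot> x"
    and smult_one [simp]: "x \<in> carrier A \<Longrightarrow> 1 \<odot> x = x"
    and smult_mult_left:
      "x \<in> carrier A \<Longrightarrow> y \<in> carrier A \<Longrightarrow> (c \<odot> x) \<otimes> y = c \<odot> (x \<otimes> y)"
    and smult_mult_right:
      "x \<in> carrier A \<Longrightarrow> y \<in> carrier A \<Longrightarrow> x \<otimes> (c \<odot> y) = c \<odot> (x \<otimes> y)"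
begin

lemma smult_zero_left [simp]:
  assumes "x \<in> carrier A" shows "0 \<odot> x = \<zero>"
proof -
  have "0 \<odot> x \<oplus> 0 \<odot> x = 0 \<odot> x" using smult_add_left[OF assms, of 0 0] by simp
  then show ?thesis using assms by (metis add.l_cancel_one smult_closed)
qed

lemma smult_zero_right [simp]: "c \<odot> \<zero> = \<zero>"
  using smult_smult[of \<zero> c 0] by simp

text \<open>Multiplication by c is multiplication by the ring element c 1, so a ring ideal is a
  subspace and the quotient inherits the scalars.\<close>

lemma ideal_smult:
  assumes "ideal J A" "x \<in> J" shows "c \<odot> x \<in> J"
proof -
  have "x \<in> carrier A" using assms ideal.Icarr by metis
  then have "c \<odot> x = (c \<odot> \<one>) \<otimes> x" by (simp add: smult_mult_left)
  then show ?thesis using assms ideal.I_l_closed by fastforce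
qed

end

definition alg_hom :: "'b calg \<Rightarrow> 'e calg \<Rightarrow> ('b \<Rightarrow> 'e) \<Rightarrow> bool" where
  "alg_hom A B f \<longleftrightarrow> f \<in> ring_hom A B \<and>
     (\<forall>c. \<forall>x\<in>carrier A. f (c \<odot>\<^bsub>A\<^esub> x) = c \<odot>\<^bsub>B\<^esub> f x)"

lemma alg_homD:
  assumes "alg_hom A B f"
  shows "\<And>x. x \<in> carrier A \<Longrightarrow> f x \<in> carrier B"
    and "\<And>x y. x \<in> carrier A \<Longrightarrow> y \<in> carrier A \<Longrightarrow> f (x \<oplus>\<^bsub>A\<^esub> y) = f x \<oplus>\<^bsub>B\<^esub> f y"
    and "\<And>x y. x \<in> carrier A \<Longrightarrow> y \<in> carrier A \<Longrightarrow> f (x \<otimes>\<^bsub>A\<^esub> y) = f x \<otimes>\<^bsub>B\<^esub> f y"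
    and "f \<one>\<^bsub>A\<^esub> = \<one>\<^bsub>B\<^esub>"
    and "\<And>c x. x \<in> carrier A \<Longrightarrow> f (c \<odot>\<^bsub>A\<^esub> x) = c \<odot>\<^bsub>B\<^esub> f x"
  using assms by (auto simp: alg_hom_def ring_hom_def)

lemma alg_homI:
  assumes "\<And>x. x \<in> carrier A \<Longrightarrow> f x \<in> carrier B"
    and "\<And>x y. x \<in> carrier A \<Longrightarrow> y \<in> carrier A \<Longrightarrow> f (x \<oplus>\<^bsub>A\<^esub> y) = f x \<oplus>\<^bsub>B\<^esub> f y"
    and "\<And>x y. x \<in> carrier A \<Longrightarrow> y \<in> carrier A \<Longrightarrow> f (x \<otimes>\<^bsub>A\<^esub> y) = f x \<otimes>\<^bsub>B\<^esub> f y"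
    and "f \<one>\<^bsub>A\<^esub> = \<one>\<^bsub>B\<^esub>"
    and "\<And>c x. x \<in> carrier A \<Longrightarrow> f (c \<odot>\<^bsub>A\<^esub> x) = c \<odot>\<^bsub>B\<^esub> f x"
  shows "alg_hom A B f"
  using assms by (auto simp: alg_hom_def ring_hom_def)

locale calg_hom = A: calgebra A + B: calgebra B for A :: "'b calg" and B :: "'e calg" and f +
  assumes hom: "alg_hom A B f"
begin

lemmas h_closed [simp, intro] = alg_homD(1)[OF hom]
lemmas h_add [simp] = alg_homD(2)[OF hom]
lemmas h_mult [simp] = alg_homD(3)[OF hom]
lemmas h_one [simp] = alg_homD(4)[OF hom]
lemmas h_smult [simp] = alg_homD(5)[OF hom]

sublocale R: ring_hom_ring A B f
  using hom by (intro ring_hom_ringI2) (auto simp: alg_hom_def A.ring_axioms B.ring_axioms)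

lemma h_minus [simp]:
  assumes "x \<in> carrier A" "y \<in> carrier A" shows "f (x \<ominus>\<^bsub>A\<^esub> y) = f x \<ominus>\<^bsub>B\<^esub> f y"
  using assms by (simp add: a_minus_def)

lemma h_finsum:
  assumes "finite S" "g \<in> S \<rightarrow> carrier A"
  shows "f (finsum A g S) = finsum B (\<lambda>x. f (g x)) S"
  using assms
proof (induction S)
  case (insert x S)
  then show ?case by (simp add: Pi_iff)
qed simp

lemma h_nat_pow [simp]:
  assumes "x \<in> carrier A" shows "f (x [^]\<^bsub>A\<^esub> (n::nat)) = f x [^]\<^bsub>B\<^esub> n"
  using assms by (induction n) auto

lemma h_inv:
  assumes "x \<in> Units A" shows "f (inv\<^bsub>A\<^esub> x) = inv\<^bsub>B\<^esub> (f x)"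
proof -
  have c: "x \<in> carrier A" "inv\<^bsub>A\<^esub> x \<in> carrier A" using assms by auto
  have "f (inv\<^bsub>A\<^esub> x) \<otimes>\<^bsub>B\<^esub> f x = \<one>\<^bsub>B\<^esub>" "f x \<otimes>\<^bsub>B\<^esub> f (inv\<^bsub>A\<^esub> x) = \<one>\<^bsub>B\<^esub>"
    using assms c by (simp_all flip: h_mult)
  then show ?thesis using c B.inv_unique' by (metis h_closed)
qed

lemma h_alg_prod_list:
  assumes "set xs \<subseteq> carrier A"
  shows "f (alg_prod_list A xs) = alg_prod_list B (map f xs)"
proof -
  have "foldr (\<lambda>x y. x \<otimes>\<^bsub>A\<^esub> y) xs \<one>\<^bsub>A\<^esub> \<in> carrier A \<and>
     f (foldr (\<lambda>x y. x \<otimes>\<^bsub>A\<^esub> y) xs \<one>\<^bsub>A\<^esub>) =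
     foldr (\<lambda>x y. x \<otimes>\<^bsub>B\<^esub> y) (map f xs) \<one>\<^bsub>B\<^esub>"
    using assms by (induction xs) auto
  then show ?thesis by (simp add: alg_prod_list_def)
qed

end

lemma alg_hom_comp:
  assumes "alg_hom A B f" "alg_hom B C g" shows "alg_hom A C (\<lambda>x. g (f x))"
  using alg_homD[OF assms(1)] alg_homD[OF assms(2)] by (intro alg_homI) auto

lemma (in calgebra) alg_prod_list_closed:
  assumes "set xs \<subseteq> carrier A" shows "alg_prod_list A xs \<in> carrier A"
  using assms unfolding alg_prod_list_def by (induction xs) auto

lemma alg_prod_list_simps [simp]:
  "alg_prod_list A [] = \<one>\<^bsub>A\<^esub>"
  "alg_prod_list A (x # xs) = x \<otimes>\<^bsub>A\<^esub> alg_prod_list A xs"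
  by (simp_all add: alg_prod_list_def)

lemma (in calgebra) alg_prod_list_append:
  assumes "set xs \<subseteq> carrier A" "set ys \<subseteq> carrier A"
  shows "alg_prod_list A (xs @ ys) = alg_prod_list A xs \<otimes> alg_prod_list A ys"
  using assms by (induction xs) (auto simp: alg_prod_list_closed m_assoc)

subsection \<open>Quotients\<close>

lemma quot_alg_simps:
  "carrier (quot_alg A S) = carrier (A Quot (Idl\<^bsub>A\<^esub> S))"
  "mult (quot_alg A S) = mult (A Quot (Idl\<^bsub>A\<^esub> S))"
  "one (quot_alg A S) = one (A Quot (Idl\<^bsub>A\<^esub> S))"
  "zero (quot_alg A S) = zero (A Quot (Idl\<^bsub>A\<^esub> S))"
  "add (quot_alg A S) = add (A Quot (Idl\<^bsub>A\<^esub> S))"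
  "smult (quot_alg A S) =
     (\<lambda>c X. \<Union>x\<in>X. (Idl\<^bsub>A\<^esub> S) +>\<^bsub>A\<^esub> (c \<odot>\<^bsub>A\<^esub> x))"
  by (simp_all add: quot_alg_def Let_def ring.extend_def module.fields_def)

text \<open>\<open>quot_alg\<close> puts the operations of the quotient ring into a larger record;
  the ring axioms are carried over operation by operation.\<close>

lemma ring_transfer:
  assumes "ring R" "carrier S = carrier R" "mult S = mult R" "one S = one R"
    "zero S = zero R" "add S = add R"
  shows "ring S"
proof -
  interpret ring R by fact
  show ?thesis
  proof (intro ringI abelian_groupI monoidI)
    fix x assume "x \<in> carrier S"
    then show "\<exists>y\<in>carrier S. y \<oplus>\<^bsub>S\<^esub> x = \<zero>\<^bsub>S\<^esub>"
      using assms by (auto intro!: bexI[of _ "\<ominus>\<^bsub>R\<^esub> x"] simp: l_neg)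
  qed (auto simp: assms(2-) a_ac m_assoc l_distr r_distr)
qed

context calgebra
begin

context
  fixes S assumes S: "S \<subseteq> carrier A"
begin

lemma Idl_ideal: "ideal (Idl S) A"
  using S by (rule genideal_ideal)

lemma quot_proj_eq_iff:
  assumes "x \<in> carrier A" "y \<in> carrier A"
  shows "quot_proj A S x = quot_proj A S y \<longleftrightarrow> x \<ominus> y \<in> Idl S"
  unfolding quot_proj_def using quotient_eq_iff_same_a_r_cos[OF Idl_ideal assms] by simp

lemma quot_proj_surj: "carrier (quot_alg A S) = quot_proj A S ` carrier A"
  by (auto simp: quot_alg_simps FactRing_def A_RCOSETS_def RCOSETS_def quot_proj_def a_r_coset_def)

lemma quot_proj_smult:
  assumes "x \<in> carrier A"
  shows "c \<odot>\<^bsub>quot_alg A S\<^esub> quot_proj A S x = quot_proj A S (c \<odot> x)"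
proof -
  interpret J: ideal "Idl S" A by (rule Idl_ideal)
  have *: "quot_proj A S (c \<odot> y) = quot_proj A S (c \<odot> x)" if y: "y \<in> quot_proj A S x" for y
  proof -
    obtain j where j: "j \<in> Idl S" "y = j \<oplus> x" using y by (auto simp: quot_proj_def a_r_coset_def')
    have jc: "j \<in> carrier A" using j J.Icarr by blast
    have "c \<odot> y \<ominus> c \<odot> x = c \<odot> j"
      using assms jc j(2) by (simp add: smult_add_right a_minus_def a_assoc r_neg)
    also have "\<dots> \<in> Idl S" using ideal_smult[OF Idl_ideal j(1)] .
    finally show ?thesis using quot_proj_eq_iff assms jc j(2) by simp
  qed
  have "x \<in> quot_proj A S x" unfolding quot_proj_def
    using assms J.a_rcos_self by auto
  then show ?thesis using * unfolding quot_alg_simps quot_proj_def[symmetric] by blast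
qed

lemma quot_proj_hom: "alg_hom A (quot_alg A S) (quot_proj A S)"
proof -
  interpret J: ideal "Idl S" A by (rule Idl_ideal)
  have h: "(+>) (Idl S) \<in> ring_hom A (A Quot (Idl S))" by (rule J.rcos_ring_hom)
  show ?thesis
    by (rule alg_homI)
      (use h quot_proj_smult in \<open>auto simp: ring_hom_def quot_proj_def quot_alg_simps(1-5)\<close>)
qed

lemma quot_calgebra: "calgebra (quot_alg A S)"
proof -
  interpret J: ideal "Idl S" A by (rule Idl_ideal)
  have R: "ring (quot_alg A S)"
    by (rule ring_transfer[OF J.quotient_is_ring]) (auto simp: quot_alg_simps)
  note h = alg_homD(2-5)[OF quot_proj_hom]
  show ?thesis
    by (intro calgebra.intro calgebra_axioms.intro R; unfold quot_proj_surj, elim imageE, hypsubst)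
      (simp_all flip: h,
       simp_all add: smult_add_left smult_add_right smult_smult smult_mult_left smult_mult_right)
qed

lemma quot_proj_rel:
  assumes "s \<in> S" shows "quot_proj A S s = \<zero>\<^bsub>quot_alg A S\<^esub>"
proof -
  interpret J: ideal "Idl S" A by (rule Idl_ideal)
  have "s \<in> Idl S" using assms genideal_self[OF S] by auto
  then show ?thesis using a_rcos_zero[OF Idl_ideal] by (simp add: quot_proj_def quot_alg_simps FactRing_def)
qed

text \<open>The kernel of \<open>f\<close> is an ideal containing S, hence contains the ideal
  generated by S. So the image of each coset is a singleton, as \<open>the_elem\<close> in the
  definition of \<open>quot_map\<close> presupposes.\<close>

lemma quot_map_hom:
  assumes B: "calgebra B" and f: "alg_hom A B f" and 0: "\<And>s. s \<in> S \<Longrightarrow> f s = \<zero>\<^bsub>B\<^esub>"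
  shows quot_map_proj: "\<And>x. x \<in> carrier A \<Longrightarrow> quot_map f (quot_proj A S x) = f x"
    and "alg_hom (quot_alg A S) B (quot_map f)"
proof -
  interpret J: ideal "Idl S" A by (rule Idl_ideal)
  interpret F: calg_hom A B f
    using B f by (intro calg_hom.intro calg_hom_axioms.intro calgebra_axioms)
  have "S \<subseteq> a_kernel A B f" using 0 S unfolding a_kernel_def' by blast
  then have ker: "Idl S \<subseteq> a_kernel A B f"
    using genideal_minimal[OF F.R.kernel_is_ideal] by blast
  show 1: "quot_map f (quot_proj A S x) = f x" if x: "x \<in> carrier A" for x
  proof -
    have "f y = f x" if y: "y \<in> quot_proj A S x" for y
    proof -
      obtain j where j: "j \<in> Idl S" "y = j \<oplus> x" using y by (auto simp: quot_proj_def a_r_coset_def')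
      have "f j = \<zero>\<^bsub>B\<^esub>" "j \<in> carrier A" using j(1) ker unfolding a_kernel_def' by blast+
      then show ?thesis unfolding j(2) by (simp only: F.h_add x F.h_closed F.B.l_zero)
    qed
    moreover have "x \<in> quot_proj A S x" unfolding quot_proj_def using x J.a_rcos_self by auto
    ultimately have "f ` quot_proj A S x = {f x}" by blast
    then show ?thesis by (simp add: quot_map_def)
  qed
  note h = alg_homD(2-5)[OF quot_proj_hom]
  show "alg_hom (quot_alg A S) B (quot_map f)"
  proof (rule alg_homI; (unfold quot_proj_surj, elim imageE, hypsubst)?)
    show "quot_map f \<one>\<^bsub>quot_alg A S\<^esub> = \<one>\<^bsub>B\<^esub>"
      by (simp only: h(3)[symmetric] 1 one_closed F.h_one)
  qed (simp_all only: h(1,2,4)[symmetric] 1 a_closed m_closed smult_closed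
      F.h_closed F.h_add F.h_mult F.h_smult)
qed

end

end

subsection \<open>The free algebra\<close>

lemma free_alg_simps [simp]:
  "carrier free_alg = UNIV" "mult free_alg = (*)" "one free_alg = 1" "zero free_alg = 0"
  "add free_alg = (+)" "smult free_alg = (\<lambda>c p. fscal c * p)"
  by (simp_all add: free_alg_def)

lemma fscal_simps [simp]: "fscal 0 = 0" "fscal 1 = 1"
  and fscal_add: "fscal (a + b) = fscal a + fscal b"
  and fscal_mult: "fscal (a * b) = fscal a * fscal b"
  by (simp_all add: fscal_def single_add mult_single)

lemma poly_mapping_sum_single:
  "p = (\<Sum>w\<in>Poly_Mapping.keys p. Poly_Mapping.single w (Poly_Mapping.lookup p w))"
  by (rule poly_mapping_eqI) (auto simp: lookup_sum lookup_single when_def in_keys_iff)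

lemma poly_mapping_sum_induct:
  fixes p :: "'a \<Rightarrow>\<^sub>0 'c::comm_monoid_add"
  assumes "\<And>w c. P (Poly_Mapping.single w c)" "P 0" "\<And>p q. P p \<Longrightarrow> P q \<Longrightarrow> P (p + q)"
  shows "P p"
proof -
  have "P (\<Sum>w\<in>K. Poly_Mapping.single w (f w))" if "finite K" for K f
    using that by induction (auto intro: assms)
  then show ?thesis using poly_mapping_sum_single[of p] finite_keys[of p] by metis
qed

lemma fscal_commute: "fscal c * p = p * fscal c" for p :: "'g falg"
  by (induction p rule: poly_mapping_sum_induct)
    (simp_all add: fscal_def mult_single distrib_left distrib_right mult.commute)

lemma free_calgebra: "calgebra free_alg"
proof -
  have R: "ring (free_alg :: 'g falg calg)"
  proof (intro ringI abelian_groupI monoidI)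
    fix p :: "'g falg"
    show "\<exists>y\<in>carrier free_alg. y \<oplus>\<^bsub>free_alg\<^esub> p = \<zero>\<^bsub>free_alg\<^esub>"
      by (auto intro: exI[of _ "- p"])
  qed (auto simp: algebra_simps)
  have c: "p * (fscal c * p') = fscal c * (p * p')" for p p' :: "'g falg" and c
    by (metis fscal_commute mult.assoc)
  show ?thesis
    by (intro calgebra.intro calgebra_axioms.intro R)
      (auto simp: distrib_left distrib_right mult.assoc fscal_add fscal_mult intro: c)
qed

lemma free_alg_minus [simp]: "p \<ominus>\<^bsub>free_alg\<^esub> q = p - q" for p q :: "'g falg"
proof -
  interpret calgebra "free_alg :: 'g falg calg" by (rule free_calgebra)
  have "\<ominus>\<^bsub>free_alg\<^esub> q = - q"
    using minus_equality[of "- q" q] by simp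
  then show ?thesis by (simp add: a_minus_def)
qed

lemma free_alg_pow [simp]: "p [^]\<^bsub>free_alg\<^esub> (n::nat) = p ^ n" for p :: "'g falg"
  by (induction n) (simp_all add: power_Suc2 del: power_Suc)

lemma alg_prod_list_free: "alg_prod_list free_alg ps = prod_list ps" for ps :: "'g falg list"
  by (induction ps) auto

context calgebra
begin

context
  fixes f :: "'g \<Rightarrow> 'b" assumes f: "\<And>g. f g \<in> carrier A"
begin

lemma word_eval_closed [simp, intro]: "word_eval A f w \<in> carrier A"
proof (cases w)
  fix gs assume "w = FWord gs"
  moreover have "set (map f gs) \<subseteq> carrier A" using f by auto
  ultimately show ?thesis by (simp add: alg_prod_list_closed)
qed

lemma word_eval_add: "word_eval A f (u + v) = word_eval A f u \<otimes> word_eval A f v"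
proof (cases u; cases v)
  fix xs ys assume "u = FWord xs" "v = FWord ys"
  moreover have "set (map f xs) \<subseteq> carrier A" "set (map f ys) \<subseteq> carrier A" using f by auto
  ultimately show ?thesis by (simp add: alg_prod_list_append)
qed

lemma free_lift_superset:
  assumes "finite K" "Poly_Mapping.keys p \<subseteq> K"
  shows "free_lift A f p = (\<Oplus>w\<in>K. Poly_Mapping.lookup p w \<odot> word_eval A f w)"
  unfolding free_lift_def using assms
  by (intro add.finprod_mono_neutral_cong_left) (auto simp: in_keys_iff)

lemma free_lift_closed [simp, intro]: "free_lift A f p \<in> carrier A"
  unfolding free_lift_def by (intro finsum_closed) auto

lemma free_lift_single: "free_lift A f (Poly_Mapping.single w c) = c \<odot> word_eval A f w"
proof -
  have "free_lift A f (Poly_Mapping.single w c) =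
     (\<Oplus>v\<in>{w}. Poly_Mapping.lookup (Poly_Mapping.single w c) v \<odot> word_eval A f v)"
    by (rule free_lift_superset) auto
  then show ?thesis by (simp add: finsum_insert)
qed

lemma free_lift_add: "free_lift A f (p + q) = free_lift A f p \<oplus> free_lift A f q"
proof -
  let ?K = "Poly_Mapping.keys p \<union> Poly_Mapping.keys q"
  have k: "Poly_Mapping.keys (p + q) \<subseteq> ?K" by (rule Poly_Mapping.keys_add)
  have "free_lift A f (p + q) =
     (\<Oplus>w\<in>?K. Poly_Mapping.lookup (p + q) w \<odot> word_eval A f w)"
    by (rule free_lift_superset) (use k in auto)
  also have "\<dots> = (\<Oplus>w\<in>?K. Poly_Mapping.lookup p w \<odot> word_eval A f w)
      \<oplus> (\<Oplus>w\<in>?K. Poly_Mapping.lookup q w \<odot> word_eval A f w)"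
    by (subst finsum_addf[symmetric])
      (auto simp: lookup_add smult_add_left intro!: finsum_cong')
  also have "\<dots> = free_lift A f p \<oplus> free_lift A f q"
    by (subst (1 2) free_lift_superset[of ?K]) auto
  finally show ?thesis .
qed

lemma free_lift_mult: "free_lift A f (p * q) = free_lift A f p \<otimes> free_lift A f q"
proof (induction p rule: poly_mapping_sum_induct)
  case (1 v a)
  show ?case
  proof (induction q rule: poly_mapping_sum_induct)
    case (1 w b)
    then show ?case by (simp add: mult_single free_lift_single word_eval_add smult_mult_left
          smult_mult_right smult_smult mult.commute)
  next
    case 2
    then show ?case by (simp add: free_lift_def)
  next
    case (3 q r)
    then show ?case by (simp add: distrib_left free_lift_add r_distr)
  qed
next
  case 2
  then show ?case by (simp add: free_lift_def)
next
  case (3 p r)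
  then show ?case by (simp add: distrib_right free_lift_add l_distr)
qed

lemma free_lift_fscal: "free_lift A f (fscal c) = c \<odot> \<one>"
  by (simp add: fscal_def free_lift_single zero_fword_def)

lemma free_lift_hom: "alg_hom free_alg A (free_lift A f)"
proof (rule alg_homI)
  show "free_lift A f \<one>\<^bsub>free_alg\<^esub> = \<one>"
    using free_lift_fscal[of 1] by simp
qed (simp_all add: free_lift_add free_lift_mult free_lift_fscal smult_mult_left)

lemma free_lift_fgen [simp]: "free_lift A f (fgen g) = f g"
  using f by (simp add: fgen_def free_lift_single)

end

lemma free_hom_eqI:
  assumes F: "alg_hom free_alg A F" and G: "alg_hom free_alg A G"
    and eq: "\<And>g. F (fgen g) = G (fgen g)"
  shows "F p = G (p :: 'g falg)"
proof -
  note F = alg_homD[OF F, simplified] and G = alg_homD[OF G, simplified]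
  have zero: "H 0 = \<zero>" if "\<And>x y. H (x + y) = H x \<oplus> H y" "\<And>x. H x \<in> carrier A" for H :: "'g falg \<Rightarrow> 'b"
    using that by (metis add.r_cancel_one add_0)
  have w: "F (Poly_Mapping.single (FWord gs) 1) = G (Poly_Mapping.single (FWord gs) 1)" for gs
  proof (induction gs)
    case Nil
    have "Poly_Mapping.single (FWord ([] :: 'g list)) 1 = (1 :: 'g falg)"
      by (simp flip: zero_fword_def)
    then show ?case using F(4) G(4) by simp
  next
    case (Cons g gs)
    have "Poly_Mapping.single (FWord (g # gs)) 1 = fgen g * Poly_Mapping.single (FWord gs) 1"
      by (simp add: fgen_def mult_single)
    then show ?case using Cons F(3) G(3) eq by simp
  qed
  show ?thesis
  proof (induction p rule: poly_mapping_sum_induct)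
    case (1 w c)
    have "Poly_Mapping.single w c = fscal c * Poly_Mapping.single w 1"
      by (simp add: fscal_def mult_single)
    then show ?case using F(5) G(5) w by (cases w) simp
  qed (use F(1,2) G(1,2) zero[of F] zero[of G] in auto)
qed

end

subsection \<open>Exponentials of series\<close>

context calgebra
begin

lemma ser_mult_closed [simp, intro]:
  assumes "\<And>k. F k \<in> carrier A" "\<And>k. G k \<in> carrier A" shows "ser_mult A F G k \<in> carrier A"
  unfolding ser_mult_def using assms by (intro finsum_closed) auto

lemma ser_power_closed [simp, intro]:
  assumes "\<And>k. F k \<in> carrier A" shows "ser_power A F n k \<in> carrier A"
  using assms by (induction n arbitrary: k) (auto intro: ser_mult_closed)

lemma ser_exp_closed [simp, intro]:
  assumes "\<And>k. F k \<in> carrier A" shows "ser_exp A F k \<in> carrier A"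
  unfolding ser_exp_def using assms by (intro finsum_closed) auto

lemma ser_power_low:
  assumes F: "\<And>k. F k \<in> carrier A" and 0: "F 0 = \<zero>" and "k < n"
  shows "ser_power A F n k = \<zero>"
  using \<open>k < n\<close>
proof (induction n arbitrary: k)
  case (Suc n)
  have "F l \<otimes> ser_power A F n (k - l) = \<zero>" if "l \<le> k" for l
    using Suc 0 F that by (cases "l = 0") auto
  then show ?case by (auto simp: ser_mult_def intro!: add.finprod_one_eqI)
qed simp

lemma ser_power_one:
  assumes F: "\<And>k. F k \<in> carrier A"
  shows "ser_power A F (Suc 0) k = F k"
proof -
  have "ser_power A F (Suc 0) k = (\<Oplus>l\<in>{..k}. if l = k then F l else \<zero>)"
    unfolding ser_power.simps ser_mult_def using F by (intro finsum_cong') auto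
  also have "\<dots> = F k" using F add.finprod_singleton[of k "{..k}" F] by (simp add: Pi_iff eq_commute)
  finally show ?thesis .
qed

text \<open>In a product of at least two factors with zero constant term, a factor of degree k would
  leave degree 0 for the others. So only entries below k contribute to the k-th coefficient.\<close>

lemma ser_power_cong_lower:
  assumes F: "\<And>k. F k \<in> carrier A" "\<And>k. G k \<in> carrier A" and 0: "F 0 = \<zero>" "G 0 = \<zero>"
    and eq: "\<And>l. l < k \<Longrightarrow> F l = G l" and "2 \<le> n"
  shows "ser_power A F n k = ser_power A G n k"
proof -
  have le: "ser_power A F n j = ser_power A G n j" if "j < k" for n j
    using that
  proof (induction n arbitrary: j)
    case (Suc n)
    show ?case unfolding ser_power.simps ser_mult_def
      by (intro finsum_cong') (use Suc eq F in auto)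
  qed simp
  obtain m where n: "n = Suc m" "m \<ge> 1" using \<open>2 \<le> n\<close> by (cases n) auto
  have "F l \<otimes> ser_power A F m (k - l) = G l \<otimes> ser_power A G m (k - l)" if "l \<le> k" for l
  proof -
    consider "l = 0" | "l = k" "l \<noteq> 0" | "l \<noteq> 0" "l < k" using \<open>l \<le> k\<close> by linarith
    then show ?thesis
    proof cases
      case 1 then show ?thesis using 0 F by simp
    next
      case 2 then show ?thesis using 0 F n(2) by (simp add: ser_power_low)
    next
      case 3 then show ?thesis using eq le by simp
    qed
  qed
  then show ?thesis unfolding n ser_power.simps ser_mult_def
    by (intro finsum_cong') (use F in auto)
qed

text \<open>The part of the k-th coefficient of the exponential that is at least quadratic. It
  depends on earlier entries only, so logarithms exist and are unique degree by degree.\<close>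

definition exp_tail :: "(nat \<Rightarrow> 'b) \<Rightarrow> nat \<Rightarrow> 'b" where
  "exp_tail F k = (\<Oplus>n\<in>{2..k}. (1 / fact n) \<odot> ser_power A F n k)"

lemma exp_tail_closed [simp, intro]:
  assumes "\<And>k. F k \<in> carrier A" shows "exp_tail F k \<in> carrier A"
  unfolding exp_tail_def using assms by (intro finsum_closed) auto

lemma exp_tail_cong:
  assumes "\<And>k. F k \<in> carrier A" "\<And>k. G k \<in> carrier A" "F 0 = \<zero>" "G 0 = \<zero>"
    and "\<And>l. l < k \<Longrightarrow> F l = G l"
  shows "exp_tail F k = exp_tail G k"
  unfolding exp_tail_def
  by (intro finsum_cong') (use assms in \<open>auto simp: ser_power_cong_lower[of F G k]\<close>)

lemma ser_exp_split:
  assumes F: "\<And>k. F k \<in> carrier A" and k: "k > 0"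
  shows "ser_exp A F k = F k \<oplus> exp_tail F k"
proof -
  have 1: "{..k} = insert 0 (insert 1 {2..k})" using k by auto
  show ?thesis unfolding ser_exp_def exp_tail_def 1
    using F k ser_power_one[of F k, OF F]
    by (simp add: finsum_insert Pi_iff del: ser_power.simps(2))
qed

lemma ser_exp_0: "F 0 \<in> carrier A \<Longrightarrow> ser_exp A F 0 = \<one>"
  by (simp add: ser_exp_def)

lemma ser_exp_unique:
  assumes F: "\<And>k. F k \<in> carrier A" "\<And>k. G k \<in> carrier A" "F 0 = \<zero>" "G 0 = \<zero>"
    and eq: "\<And>k. ser_exp A F k = ser_exp A G k"
  shows "F k = G k"
proof (induction k rule: less_induct)
  case (less k)
  show ?case
  proof (cases "k = 0")
    case False
    then have "F k \<oplus> exp_tail F k = G k \<oplus> exp_tail G k" using eq[of k] F by (simp add: ser_exp_split)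
    moreover have "exp_tail F k = exp_tail G k" using exp_tail_cong[of F G k] less F by simp
    ultimately show ?thesis using F by auto
  qed (use F in auto)
qed

lemma ser_exp_exists:
  assumes P: "\<And>k. P k \<in> carrier A" and P0: "P 0 = \<one>"
  shows "\<exists>F. (\<forall>k. F k \<in> carrier A) \<and> F 0 = \<zero> \<and> (\<forall>k. ser_exp A F k = P k)"
proof -
  \<comment> \<open>\<open>G n\<close> is a partial solution, final below n. Step n fills in entry n
    from the entries already fixed, and the solution is read off along the diagonal.\<close>
  define G where "G = rec_nat (\<lambda>_. \<zero>)
    (\<lambda>n g. g(n := if n = 0 then \<zero> else P n \<ominus> exp_tail g n))"
  have G0: "G 0 = (\<lambda>_. \<zero>)" and
    GS: "\<And>n. G (Suc n) = (G n)(n := if n = 0 then \<zero> else P n \<ominus> exp_tail (G n) n)"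
    by (simp_all add: G_def)
  have closed: "G n k \<in> carrier A" for n k
    by (induction n arbitrary: k) (auto simp: G0 GS P)
  define F where "F k = G (Suc k) k" for k
  have low: "G n l = F l" if "l < n" for n l
    using that by (induction n) (auto simp: GS F_def less_Suc_eq)
  have Fc: "F k \<in> carrier A" for k by (simp add: F_def closed)
  have F0: "F 0 = \<zero>" by (simp add: F_def GS)
  have "ser_exp A F k = P k" for k
  proof (cases "k = 0")
    case False
    have "G k 0 = \<zero>" using low[of 0 k] False F0 by simp
    then have "exp_tail (G k) k = exp_tail F k"
      using exp_tail_cong[of "G k" F k] closed Fc F0 low by simp
    then have "F k = P k \<ominus> exp_tail F k" using False by (simp add: F_def GS)
    then show ?thesis using False ser_exp_split[of F k, OF Fc] P Fc
      by (simp add: a_minus_def a_assoc l_neg)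
  qed (use F0 P0 ser_exp_0 in simp)
  then show ?thesis using Fc F0 by blast
qed

end

section \<open>Quantum Cartan matrices at generic parameters\<close>

lemma sum_supported_pair:
  assumes "a \<noteq> b" "\<And>i. i \<noteq> a \<Longrightarrow> i \<noteq> b \<Longrightarrow> f i = 0"
  shows "(\<Sum>i\<in>(UNIV::'i::finite set). f i) = f a + (f b :: 'a::comm_monoid_add)"
proof -
  have "(\<Sum>i\<in>UNIV. f i) = (\<Sum>i\<in>{a, b}. f i)" by (rule sum.mono_neutral_right) (use assms in auto)
  then show ?thesis using assms(1) by simp
qed

text \<open>The interval has 2 D points and consists of D / m full periods of length 2 m, each
  meeting the residue class once. The progression is made explicit because
  \<open>wave_coefficient\<close> sums powers of q along it.\<close>

lemma residues_in_interval:
  fixes D m r :: int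
  assumes "m > 0" "m dvd D" "D > 0"
  shows "{l \<in> {-D..<D}. (l - r) mod (2 * m) = 0} =
    (\<lambda>t. -D + (r + D) mod (2 * m) + 2 * m * int t) ` {..<nat (D div m)}"
    (is "?L = ?g ` _")
proof -
  obtain n where n: "D = m * n" using assms(2) by auto
  have n0: "n > 0" using assms n by (simp add: zero_less_mult_iff)
  have nd: "D div m = n" using n assms(1) by simp
  let ?e = "(r + D) mod (2 * m)"
  have e: "0 \<le> ?e" "?e < 2 * m" using assms(1) by auto
  {
    fix l assume "l \<in> ?L"
    then have l: "-D \<le> l" "l < D" and "(l - r) mod (2 * m) = 0" by auto
    then have "(l + D - (r + D)) mod (2 * m) = 0" by simp
    then have "(l + D) mod (2 * m) = ?e" by (metis mod_eq_dvd_iff dvd_eq_mod_eq_0)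
    then have le: "l + D = ?e + 2 * m * ((l + D) div (2 * m))" by (metis mod_mult_div_eq)
    let ?t = "(l + D) div (2 * m)"
    have t0: "?t \<ge> 0" using l assms(1) by (simp add: pos_imp_zdiv_nonneg_iff)
    have "2 * m * ?t < 2 * m * n" using le e(1) l n by (simp add: algebra_simps)
    then have "?t < n" using assms(1) by simp
    then have "nat ?t < nat (D div m)" using t0 nd by simp
    moreover have "l = ?g (nat ?t)" using le t0 by simp
    ultimately have "l \<in> ?g ` {..<nat (D div m)}" by blast
  }
  moreover {
    fix l assume "l \<in> ?g ` {..<nat (D div m)}"
    then obtain t where t: "t < nat n" "l = ?g t" using nd by auto
    have "int t \<le> n - 1" using t(1) by linarith
    then have "2 * m * int t \<le> 2 * m * (n - 1)" using assms(1) by simp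
    then have "l < D" using e t(2) n by (simp add: algebra_simps)
    moreover have "-D \<le> l" using e t(2) assms(1) by simp
    moreover have "(l - r) mod (2 * m) = 0"
    proof -
      have "l - r = ?e - (r + D) + 2 * m * int t" using t(2) by simp
      moreover have "2 * m dvd ?e - (r + D)" by (metis mod_eq_dvd_iff mod_mod_trivial)
      then have "2 * m dvd ?e - (r + D) + 2 * m * int t" by simp
      ultimately show ?thesis by (simp only: dvd_eq_mod_eq_0[symmetric])
    qed
    ultimately have "l \<in> ?L" by simp
  }
  ultimately show ?thesis by (intro subset_antisym subsetI)
qed

lemma card_residues_in_interval:
  fixes D m r :: int
  assumes "m > 0" "m dvd D" "D > 0"
  shows "card {l \<in> {-D..<D}. (l - r) mod (2 * m) = 0} = nat (D div m)"
  unfolding residues_in_interval[OF assms] using assms(1)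
  by (subst card_image) (auto simp: inj_on_def)

locale cartan_datum =
  fixes c :: "'i::finite \<Rightarrow> 'i \<Rightarrow> int" and d :: "'i \<Rightarrow> int"
  assumes datum: "simple_cartan_datum c d"
begin

section \<open>Entries of a Cartan matrix of finite type\<close>

lemmas datum_unfolded = datum[unfolded simple_cartan_datum_def]

lemma c_diag: "c i i = 2"
  using datum_unfolded by (elim conjE) simp

lemma c_offdiag: "i \<noteq> j \<Longrightarrow> c i j \<le> 0"
  using datum_unfolded by (elim conjE) simp

lemma d_pos: "d i > 0"
  using conjunct1[OF conjunct2[OF conjunct2[OF datum_unfolded]]] by blast

lemma sym: "d i * c i j = d j * c j i"
  using conjunct1[OF conjunct2[OF conjunct2[OF conjunct2[OF conjunct2[OF datum_unfolded]]]]] by blast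

lemma pos_def: "x \<noteq> (\<lambda>i. 0) \<Longrightarrow>
    0 < (\<Sum>i\<in>UNIV. \<Sum>j\<in>UNIV. (x i :: real) * of_int (d i * c i j) * x j)"
  using conjunct1[OF conjunct2[OF conjunct2[OF conjunct2[OF conjunct2[OF conjunct2[OF datum_unfolded]]]]]]
  by blast

lemma c_neg_sym: "c i j < 0 \<Longrightarrow> c j i < 0"
  using sym[of i j] d_pos[of i] d_pos[of j] by (metis mult_less_0_iff not_less_iff_gr_or_eq)

lemma c_neg_neq: "c i j < 0 \<Longrightarrow> i \<noteq> j"
  using c_diag[of i] by auto

lemma c_prod_less: assumes "i \<noteq> j" shows "c i j * c j i < 4"
proof -
  \<comment> \<open>The vector b_ii \<alpha>_j - b_ij \<alpha>_i is orthogonal to \<alpha>_i, and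
    its norm is b_ii times the Gram determinant of \<alpha>_i and \<alpha>_j.\<close>
  define x :: "'i \<Rightarrow> real" where
    "x = (\<lambda>k. if k = i then - of_int (d i * c i j) else if k = j then of_int (2 * d i) else 0)"
  let ?b = "of_int (d i * c i j) :: real"
  have "x j \<noteq> 0" using assms d_pos[of i] by (simp add: x_def)
  then have "0 < (\<Sum>k\<in>UNIV. \<Sum>l\<in>UNIV. x k * of_int (d k * c k l) * x l)"
    by (intro pos_def) auto
  also have "\<dots> = (\<Sum>k\<in>UNIV. x k * of_int (d k * c k i) * x i + x k * of_int (d k * c k j) * x j)"
    by (intro sum.cong refl sum_supported_pair assms) (auto simp: x_def)
  also have "\<dots> = (x i * of_int (d i * c i i) * x i + x i * ?b * x j)
     + (x j * of_int (d j * c j i) * x i + x j * of_int (d j * c j j) * x j)"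
    by (rule sum_supported_pair[OF assms]) (auto simp: x_def)
  also have "\<dots> = 2 * of_int (d i) * (4 * of_int (d i) * of_int (d j) - ?b * of_int (d j * c j i))"
    using assms sym[of i j, symmetric] by (simp add: x_def c_diag algebra_simps)
  finally have "0 < 4 * of_int (d i) * of_int (d j) - ?b * of_int (d j * c j i)"
    using d_pos[of i] by (simp add: zero_less_mult_iff)
  then have "0 < of_int (d i * d j * (4 - c i j * c j i)) * (1::real)"
    by (simp add: algebra_simps)
  then have "0 < d i * d j * (4 - c i j * c j i)" by (simp del: of_int_mult)
  moreover have "0 < d i * d j" using d_pos by simp
  ultimately have "0 < 4 - c i j * c j i" by (rule zero_less_mult_pos)
  then show ?thesis by simp
qed

lemma adjacent_cases:
  assumes "c i j < 0"
  obtains "c i j = -1" "d i = d j * (- c j i)" | "c j i = -1" "d j = d i * (- c i j)"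
proof -
  have n: "c j i < 0" using assms c_neg_sym by blast
  have p: "(- c i j) * (- c j i) < 4" using c_prod_less c_neg_neq assms by simp
  have "c i j = -1 \<or> c j i = -1"
  proof (rule ccontr)
    assume "\<not> ?thesis"
    then have "2 \<le> - c i j" "2 \<le> - c j i" using assms n by auto
    then have "2 * 2 \<le> (- c i j) * (- c j i)" by (intro mult_mono) auto
    then show False using p by simp
  qed
  then show thesis using that sym[of i j] by auto
qed

text \<open>One of c_ij and c_ji is -1, so the smaller of d_i and d_j divides the larger, and b_ij
  is minus the larger. Max and min then allow a uniform treatment of all types of edges.\<close>

lemma adjacent_b:
  assumes "c i j < 0"
  shows "d i * c i j = - max (d i) (d j)" "min (d i) (d j) dvd d i" "min (d i) (d j) dvd d j"
proof -
  have n: "c j i < 0" using assms c_neg_sym by blast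
  have "d i * c i j = - max (d i) (d j) \<and> min (d i) (d j) dvd d i \<and> min (d i) (d j) dvd d j"
    using assms
  proof (cases rule: adjacent_cases)
    case 1
    have "d j * 1 \<le> d j * (- c j i)" using d_pos[of j] n by (intro mult_left_mono) auto
    then have "d j \<le> d i" using 1 by simp
    then show ?thesis using 1 by simp
  next
    case 2
    have "d i * 1 \<le> d i * (- c i j)" using d_pos[of i] assms by (intro mult_left_mono) auto
    then have "d i \<le> d j" using 2 by simp
    then show ?thesis using 2 by simp
  qed
  then show "d i * c i j = - max (d i) (d j)" "min (d i) (d j) dvd d i" "min (d i) (d j) dvd d j"
    by auto
qed

text \<open>
  The simply laced unfolding: node \<open>i\<close> becomes \<open>2 d\<^sub>i\<close> nodes \<open>(i, k)\<close>, to be thought of as a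
  window of values at times \<open>k\<close> of a solution of the discrete wave equation
  \<open>\<Sum>\<^sub>j [b\<^sub>i\<^sub>j] u\<^sub>j = 0\<close>, in which \<open>q\<close> acts as time shift.
\<close>

definition nodes :: "('i \<times> int) set" where
  "nodes = (SIGMA i:UNIV. {- d i..<d i})"

text \<open>The residue class is chosen so that the neighbours of (i, - d i) in the window of j sit
  at the exponents of (q^M - q^(-M)) / (q^(d i) - q^(- d i)), where M = max (d i) (d j) = - b_ij;
  see \<open>wave_coefficient\<close>.\<close>

definition adj :: "'i \<times> int \<Rightarrow> 'i \<times> int \<Rightarrow> bool" where
  "adj n n' \<longleftrightarrow> c (fst n) (fst n') < 0 \<and>
     (snd n' - snd n - max (d (fst n)) (d (fst n'))) mod (2 * min (d (fst n)) (d (fst n'))) = 0"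

definition nbrs :: "'i \<times> int \<Rightarrow> ('i \<times> int) set" where
  "nbrs n = {n'\<in>nodes. adj n n'}"

text \<open>The product of the simple reflections at the earliest node of every window. These nodes
  are pairwise non-adjacent by \<open>last_not_adjacent\<close>, so the reflections commute.\<close>

definition refl_last :: "('i \<times> int \<Rightarrow> 'a::comm_ring_1) \<Rightarrow> 'i \<times> int \<Rightarrow> 'a" where
  "refl_last x n = (if snd n = - d (fst n) then - x n + (\<Sum>n'\<in>nbrs n. x n') else x n)"

definition rot :: "'i \<times> int \<Rightarrow> 'i \<times> int" where
  "rot n = (fst n, if snd n = d (fst n) - 1 then - d (fst n) else snd n + 1)"

text \<open>One time step of the wave equation: all values move back by one place, and the value
  leaving the window of i makes room for the one at time d i that the equation forces.\<close>

definition evolve :: "('i \<times> int \<Rightarrow> 'a::comm_ring_1) \<Rightarrow> 'i \<times> int \<Rightarrow> 'a" where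
  "evolve x n = refl_last x (rot n)"

text \<open>The quadratic form of the Cartan matrix of the unfolded graph: diagonal entries 2,
  entries -1 at edges.\<close>

definition energy :: "('i \<times> int \<Rightarrow> 'a::comm_ring_1) \<Rightarrow> 'a" where
  "energy x = 2 * (\<Sum>n\<in>nodes. x n ^ 2) - (\<Sum>n\<in>nodes. \<Sum>n'\<in>nbrs n. x n * x n')"

lemma finite_nodes [simp, intro]: "finite nodes" "finite (nbrs n)"
  by (auto simp: nodes_def nbrs_def)

text \<open>Exchanging the nodes negates the time difference but not the subtracted maximum. The
  resulting defect of twice the maximum is a multiple of twice the minimum.\<close>

lemma adj_sym: "adj n n' \<longleftrightarrow> adj n' n"
proof -
  have "adj n' n" if "adj n n'" for n n'
  proof -
    let ?M = "max (d (fst n)) (d (fst n'))" and ?m = "min (d (fst n)) (d (fst n'))"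
    have cn: "c (fst n) (fst n') < 0" and "2 * ?m dvd snd n' - snd n - ?M"
      using that by (auto simp: adj_def)
    moreover have "2 * ?m dvd 2 * ?M" using adjacent_b(2,3)[OF cn] by (intro mult_dvd_mono) (auto simp: max_def)
    ultimately have "2 * ?m dvd - (snd n' - snd n - ?M) - 2 * ?M"
      by (meson dvd_diff dvd_minus_iff)
    then show ?thesis using c_neg_sym[OF cn] by (simp add: adj_def max.commute min.commute algebra_simps)
  qed
  then show ?thesis by blast
qed

text \<open>\<open>rot\<close> adds 1 to every time up to a jump by 2 d, which is a multiple of the
  modulus of every edge at that node.\<close>

lemma adj_rot: assumes "n \<in> nodes" "n' \<in> nodes" shows "adj (rot n) (rot n') \<longleftrightarrow> adj n n'"
proof -
  let ?M = "max (d (fst n)) (d (fst n'))" and ?m = "min (d (fst n)) (d (fst n'))"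
  have "2 * ?m dvd snd (rot n') - snd (rot n) - ?M \<longleftrightarrow> 2 * ?m dvd snd n' - snd n - ?M"
    if cn: "c (fst n) (fst n') < 0"
  proof -
    have k: "2 * ?m dvd snd (rot k) - (snd k + 1)" if "k = n \<or> k = n'" for k
    proof -
      have "2 * ?m dvd 2 * d (fst k)" using adjacent_b(2,3)[OF cn] that by (intro mult_dvd_mono) auto
      then have "2 * ?m dvd - (2 * d (fst k))" by (simp only: dvd_minus_iff)
      then show ?thesis by (simp add: rot_def)
    qed
    have "2 * ?m dvd (snd (rot n') - (snd n' + 1)) - (snd (rot n) - (snd n + 1))"
      by (rule dvd_diff[OF k k]) auto
    then have "2 * ?m dvd (snd (rot n') - snd (rot n) - ?M) - (snd n' - snd n - ?M)"
      by (simp add: algebra_simps)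
    then show ?thesis
      using dvd_add_right_iff[of "2 * ?m" "(snd (rot n') - snd (rot n) - ?M) - (snd n' - snd n - ?M)"
          "snd n' - snd n - ?M"] by (simp only: diff_add_cancel)
  qed
  moreover have "fst (rot k) = fst k" for k by (simp add: rot_def)
  ultimately show ?thesis unfolding adj_def dvd_eq_mod_eq_0[symmetric] by auto
qed

lemma rot_bij: "bij_betw rot nodes nodes"
proof -
  have "rot ` nodes \<subseteq> nodes" using d_pos by (force simp: nodes_def rot_def)
  moreover have "inj_on rot nodes"
  proof (rule inj_onI)
    fix n n' assume *: "n \<in> nodes" "n' \<in> nodes" "rot n = rot n'"
    obtain i k i' k' where n: "n = (i, k)" "n' = (i', k')" by (cases n; cases n') auto
    have i: "i' = i" using *(3) by (simp add: n rot_def)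
    have "(if k = d i - 1 then - d i else k + 1) = (if k' = d i - 1 then - d i else k' + 1)"
      using *(3) unfolding n i rot_def fst_conv snd_conv by (rule Pair_inject)
    moreover have "- d i \<le> k" "- d i \<le> k'" using *(1,2) by (simp_all add: n i nodes_def)
    ultimately have "k = k'" by (cases "k = d i - 1"; cases "k' = d i - 1") simp_all
    then show "n = n'" by (simp add: n i)
  qed
  ultimately show ?thesis by (simp add: bij_betw_def endo_inj_surj)
qed

lemma energy_rot: "energy (\<lambda>n. y (rot n)) = energy y"
proof -
  have nb: "rot ` nbrs n = nbrs (rot n)" if "n \<in> nodes" for n
  proof (intro subset_antisym subsetI)
    fix k assume "k \<in> rot ` nbrs n"
    then obtain k' where k': "k = rot k'" "k' \<in> nodes" "adj n k'" by (auto simp: nbrs_def)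
    then show "k \<in> nbrs (rot n)"
      using adj_rot[OF that k'(2)] bij_betwE[OF rot_bij] by (simp add: nbrs_def)
  next
    fix k assume k: "k \<in> nbrs (rot n)"
    then have "k \<in> rot ` nodes" using bij_betw_imp_surj_on[OF rot_bij] by (simp add: nbrs_def)
    then obtain k' where "k = rot k'" "k' \<in> nodes" by blast
    then show "k \<in> rot ` nbrs n" using k adj_rot[OF that, of k'] by (simp add: nbrs_def)
  qed
  have "(\<Sum>n\<in>nodes. \<Sum>n'\<in>nbrs n. y (rot n) * y (rot n')) =
        (\<Sum>n\<in>nodes. \<Sum>n'\<in>nbrs (rot n). y (rot n) * y n')"
  proof (rule sum.cong[OF refl])
    fix n assume n: "n \<in> nodes"
    have "inj_on rot (nbrs n)" using rot_bij by (auto simp: bij_betw_def nbrs_def inj_on_def)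
    then show "(\<Sum>n'\<in>nbrs n. y (rot n) * y (rot n')) = (\<Sum>n'\<in>nbrs (rot n). y (rot n) * y n')"
      unfolding nb[OF n, symmetric] by (simp add: sum.reindex)
  qed
  also have "\<dots> = (\<Sum>n\<in>nodes. \<Sum>n'\<in>nbrs n. y n * y n')"
    by (rule sum.reindex_bij_betw[OF rot_bij])
  finally show ?thesis unfolding energy_def
    using sum.reindex_bij_betw[OF rot_bij, of "\<lambda>n. y n ^ 2"] by simp
qed

text \<open>For two earliest times the quantity tested by \<open>adj\<close> is congruent to the
  minimum modulo twice the minimum, hence not to 0.\<close>

lemma last_not_adjacent:
  assumes "snd n = - d (fst n)" "snd n' = - d (fst n')" shows "\<not> adj n n'"
proof
  assume a: "adj n n'"
  let ?M = "max (d (fst n)) (d (fst n'))" and ?m = "min (d (fst n)) (d (fst n'))"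
  have cn: "c (fst n) (fst n') < 0" and 1: "2 * ?m dvd d (fst n) - d (fst n') - ?M"
    using a assms by (auto simp: adj_def)
  have "2 * ?m dvd ?m"
  proof (cases "d (fst n) \<le> d (fst n')")
    case True
    then obtain k where k: "d (fst n') = d (fst n) * k" using adjacent_b(3)[OF cn] by auto
    have "d (fst n) - d (fst n') - ?M = ?m - 2 * ?m * k" using True k by (simp add: algebra_simps)
    then show ?thesis using 1 by (metis dvd_diff_left_iff dvd_triv_left)
  next
    case False
    then have "d (fst n) - d (fst n') - ?M = - ?m" by simp
    then show ?thesis using 1 by simp
  qed
  moreover have "?m > 0" using d_pos by simp
  ultimately show False using zdvd_imp_le[of "2 * ?m" ?m] by linarith
qed

text \<open>The form is quadratic in each coordinate with leading coefficient 2, and \<delta> is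
  minus half of its partial derivative, so the linear and the quadratic change cancel. No mixed
  terms arise since the changed coordinates are pairwise non-adjacent.\<close>

lemma energy_refl: "energy (refl_last x) = energy x"
proof -
  define R where "R = {n\<in>nodes. snd n = - d (fst n)}"
  define \<delta> where "\<delta> n = (if snd n = - d (fst n) then - 2 * x n + (\<Sum>n'\<in>nbrs n. x n') else 0)" for n
  have r: "refl_last x n = x n + \<delta> n" for n by (simp add: refl_last_def \<delta>_def)
  have swap: "(\<Sum>n\<in>nodes. \<Sum>n'\<in>nbrs n. f n n') = (\<Sum>n\<in>nodes. \<Sum>n'\<in>nbrs n. f n' n)"
    for f :: "'i \<times> int \<Rightarrow> 'i \<times> int \<Rightarrow> 'a"
  proof -
    have "(\<Sum>n\<in>nodes. \<Sum>n'\<in>nbrs n. f n n') = (\<Sum>n\<in>nodes. \<Sum>n'\<in>nodes. if adj n n' then f n n' else 0)"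
      by (rule sum.cong[OF refl]) (simp add: nbrs_def sum.inter_filter)
    also have "\<dots> = (\<Sum>n'\<in>nodes. \<Sum>n\<in>nodes. if adj n' n then f n n' else 0)"
      by (subst sum.swap) (simp add: adj_sym)
    also have "\<dots> = (\<Sum>n\<in>nodes. \<Sum>n'\<in>nbrs n. f n' n)"
      by (rule sum.cong[OF refl]) (simp add: nbrs_def sum.inter_filter)
    finally show ?thesis .
  qed
  have dd: "(\<Sum>n\<in>nodes. \<Sum>n'\<in>nbrs n. \<delta> n * \<delta> n') = 0"
    using last_not_adjacent by (intro sum.neutral ballI) (auto simp: \<delta>_def nbrs_def)
  have cross: "4 * (\<Sum>n\<in>nodes. \<delta> n * x n) - 2 * (\<Sum>n\<in>nodes. \<Sum>n'\<in>nbrs n. \<delta> n * x n') =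
      - 2 * (\<Sum>n\<in>nodes. \<delta> n ^ 2)"
  proof -
    have "\<delta> n ^ 2 = - 2 * (\<delta> n * x n) + (\<Sum>n'\<in>nbrs n. \<delta> n * x n')" for n
    proof -
      have "\<delta> n ^ 2 = \<delta> n * (- 2 * x n + (\<Sum>n'\<in>nbrs n. x n'))"
        by (simp add: \<delta>_def power2_eq_square)
      then show ?thesis by (simp add: algebra_simps sum_distrib_left)
    qed
    then have "(\<Sum>n\<in>nodes. \<delta> n ^ 2) = (\<Sum>n\<in>nodes. - 2 * (\<delta> n * x n) + (\<Sum>n'\<in>nbrs n. \<delta> n * x n'))"
      by (rule sum.cong[OF refl])
    then have "(\<Sum>n\<in>nodes. \<delta> n ^ 2) =
        - 2 * (\<Sum>n\<in>nodes. \<delta> n * x n) + (\<Sum>n\<in>nodes. \<Sum>n'\<in>nbrs n. \<delta> n * x n')"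
      by (simp only: sum.distrib sum_distrib_left)
    then show ?thesis by (simp only: algebra_simps) simp
  qed
  have "energy (refl_last x) = energy x + 2 * (\<Sum>n\<in>nodes. \<delta> n ^ 2) - (\<Sum>n\<in>nodes. \<Sum>n'\<in>nbrs n. \<delta> n * \<delta> n')
     + (4 * (\<Sum>n\<in>nodes. \<delta> n * x n) - ((\<Sum>n\<in>nodes. \<Sum>n'\<in>nbrs n. \<delta> n * x n') + (\<Sum>n\<in>nodes. \<Sum>n'\<in>nbrs n. x n * \<delta> n')))"
    unfolding energy_def r
    by (simp add: power2_eq_square algebra_simps sum.distrib sum_distrib_left)
  also have "(\<Sum>n\<in>nodes. \<Sum>n'\<in>nbrs n. x n * \<delta> n') = (\<Sum>n\<in>nodes. \<Sum>n'\<in>nbrs n. \<delta> n * x n')"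
    by (subst swap) (simp add: mult.commute)
  finally show ?thesis using dd cross by simp
qed

lemma energy_evolve: "energy ((evolve ^^ t) x) = energy x"
proof (induction t)
  case (Suc t)
  have "energy (evolve y) = energy y" for y :: "'i \<times> int \<Rightarrow> 'a"
    unfolding evolve_def using energy_rot[of "refl_last y"] energy_refl[of y] by simp
  then show ?case using Suc by simp
qed simp

section \<open>Positivity of the unfolded form and finite order of the time step\<close>

lemma form_coercive:
  obtains \<epsilon> :: real where "\<epsilon> > 0"
    "\<And>w. (\<Sum>i\<in>UNIV. \<Sum>j\<in>UNIV. w i * of_int (d i * c i j) * w j) \<ge> \<epsilon> * (\<Sum>i\<in>UNIV. (w i)\<^sup>2)"
proof -
  define B where "B w = (\<Sum>i\<in>UNIV. \<Sum>j\<in>UNIV. w i * of_int (d i * c i j) * w j)" for w :: "'i \<Rightarrow> real"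
  let ?S = "sphere 0 1 :: (real^'i) set"
  have "axis undefined 1 \<in> ?S" by simp
  then have ne: "?S \<noteq> {}" by blast
  have cont: "continuous_on ?S (\<lambda>v. B (($) v))"
    unfolding B_def by (intro continuous_intros)
  obtain v where v: "v \<in> ?S" "\<forall>u\<in>?S. B (($) v) \<le> B (($) u)"
    using continuous_attains_inf[OF compact_sphere ne cont] by metis
  have "v \<noteq> 0" using v(1) by auto
  then have "($) v \<noteq> (\<lambda>i. 0)" by (auto simp: vec_eq_iff fun_eq_iff)
  then have pos: "B (($) v) > 0" unfolding B_def by (rule pos_def)
  have "B w \<ge> B (($) v) * (\<Sum>i\<in>UNIV. (w i)\<^sup>2)" for w
  proof (cases "(\<chi> i. w i) = (0 :: real^'i)")
    case True
    then have "w = (\<lambda>i. 0)" by (auto simp: vec_eq_iff)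
    then show ?thesis by (simp add: B_def)
  next
    case False
    let ?u = "(\<chi> i. w i) :: real^'i" and ?r = "norm ((\<chi> i. w i) :: real^'i)"
    have r: "?r > 0" using False by simp
    have "sgn ?u \<in> ?S" using False by (simp add: norm_sgn)
    then have "B (($) v) \<le> B (($) (sgn ?u))" using v(2) by blast
    also have "($) (sgn ?u) = (\<lambda>i. w i / ?r)" by (simp add: sgn_div_norm fun_eq_iff divide_inverse)
    also have "B \<dots> = B w / ?r\<^sup>2"
      by (simp add: B_def sum_divide_distrib power2_eq_square)
    finally have "B (($) v) * ?r\<^sup>2 \<le> B w" using r by (simp add: field_simps)
    moreover have "?r\<^sup>2 = (\<Sum>i\<in>UNIV. (w i)\<^sup>2)" by (simp add: norm_vec_def L2_set_def sum_nonneg)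
    ultimately show ?thesis by simp
  qed
  then show ?thesis using that[of "B (($) v)"] pos by (simp only: B_def)
qed

text \<open>w i is normalized so that the diagonal terms agree. Between two adjacent windows the
  graph is biregular, each (i, k) having d j / min (d i) (d j) neighbours in window j, so
  Cauchy-Schwarz bounds the cross terms by max (d i) (d j) w_i w_j = - b_ij w_i w_j.\<close>

lemma energy_lower_bound:
  fixes x :: "'i \<times> int \<Rightarrow> real"
  defines "w \<equiv> \<lambda>i. sqrt ((\<Sum>k\<in>{- d i..<d i}. (x (i, k))\<^sup>2) / of_int (d i))"
  shows "energy x \<ge> (\<Sum>i\<in>UNIV. \<Sum>j\<in>UNIV. w i * of_int (d i * c i j) * w j)"
proof -
  let ?K = "\<lambda>i. {- d i..<d i}"
  have w0: "w i \<ge> 0" for i unfolding w_def using d_pos[of i] by (simp add: sum_nonneg)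
  have w2: "(\<Sum>k\<in>?K i. (x (i, k))\<^sup>2) = of_int (d i) * (w i)\<^sup>2" for i
    unfolding w_def using d_pos[of i] by (simp add: sum_nonneg)
  define P where "P i j = {(k, l). k \<in> ?K i \<and> l \<in> ?K j \<and> adj (i, k) (j, l)}" for i j
  have finP: "finite (P i j)" for i j
    by (rule finite_subset[of _ "?K i \<times> ?K j"]) (auto simp: P_def)
  have Pempty: "P i j = {}" if "\<not> c i j < 0" for i j using that by (auto simp: P_def adj_def)
  have deg: "(\<Sum>(k, l)\<in>P i j. f k) = of_int (d j div min (d i) (d j)) * (\<Sum>k\<in>?K i. f k)"
    if cn: "c i j < 0" for i j and f :: "int \<Rightarrow> real"
  proof -
    define L where
      "L k = {l\<in>?K j. (l - (k + max (d i) (d j))) mod (2 * min (d i) (d j)) = 0}" for k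
    have "P i j = Sigma (?K i) L" using cn by (auto simp: P_def adj_def L_def algebra_simps)
    moreover have "finite (L k)" for k
      by (rule finite_subset[of _ "?K j"]) (auto simp: L_def)
    ultimately have "(\<Sum>(k, l)\<in>P i j. f k) = (\<Sum>k\<in>?K i. \<Sum>l\<in>L k. f k)"
      using sum.Sigma[of "?K i" L "\<lambda>k l. f k"] by simp
    also have "\<dots> = (\<Sum>k\<in>?K i. of_int (d j div min (d i) (d j)) * f k)"
      using d_pos[of i] d_pos[of j] adjacent_b(3)[OF cn]
    proof (intro sum.cong refl)
      fix k
      have "card (L k) = nat (d j div min (d i) (d j))"
        unfolding L_def using adjacent_b(3)[OF cn] d_pos by (intro card_residues_in_interval) auto
      then show "(\<Sum>l\<in>L k. f k) = of_int (d j div min (d i) (d j)) * f k"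
        using d_pos[of i] d_pos[of j] by (simp add: pos_imp_zdiv_nonneg_iff)
    qed
    finally show ?thesis by (simp add: sum_distrib_left)
  qed
  have Psw: "(\<Sum>(k, l)\<in>P i j. g k l) = (\<Sum>(l, k)\<in>P j i. g k l)" for i j and g :: "int \<Rightarrow> int \<Rightarrow> real"
    by (rule sum.reindex_bij_witness[where i = prod.swap and j = prod.swap])
      (auto simp: P_def adj_sym)
  have pair: "(\<Sum>(k, l)\<in>P i j. x (i, k) * x (j, l)) \<le> of_int (max (d i) (d j)) * (w i * w j)"
    if cn: "c i j < 0" for i j
  proof -
    let ?M = "of_int (max (d i) (d j)) :: real"
    have M: "d j div min (d i) (d j) * d i = max (d i) (d j)" if "c i j < 0" for i j
      using adjacent_b(2,3)[OF that] d_pos[of i] d_pos[of j] by (auto simp: min_def max_def)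
    have M': "of_int (d j div min (d i) (d j)) * (of_int (d i) * y) = of_int (max (d i) (d j)) * y"
      if "c i j < 0" for i j and y :: real
      using arg_cong[OF M[OF that], of "\<lambda>t. of_int t * y"] by simp
    have 1: "(\<Sum>(k, l)\<in>P i j. (x (i, k))\<^sup>2) = ?M * (w i)\<^sup>2"
      unfolding deg[OF cn] w2 M'[OF cn] ..
    have 2: "(\<Sum>(k, l)\<in>P i j. (x (j, l))\<^sup>2) = ?M * (w j)\<^sup>2"
    proof -
      have "(\<Sum>(k, l)\<in>P i j. (x (j, l))\<^sup>2) = (\<Sum>(l, k)\<in>P j i. (x (j, l))\<^sup>2)" by (rule Psw)
      also have "\<dots> = ?M * (w j)\<^sup>2"
        unfolding deg[OF c_neg_sym[OF cn]] w2 M'[OF c_neg_sym[OF cn]] by (simp only: max.commute)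
      finally show ?thesis .
    qed
    have "(\<Sum>p\<in>P i j. x (i, fst p) * x (j, snd p))\<^sup>2 \<le>
       (\<Sum>p\<in>P i j. (x (i, fst p))\<^sup>2) * (\<Sum>p\<in>P i j. (x (j, snd p))\<^sup>2)"
      by (rule Cauchy_Schwarz_ineq_sum)
    then have "(\<Sum>(k, l)\<in>P i j. x (i, k) * x (j, l))\<^sup>2 \<le> (?M * (w i * w j))\<^sup>2"
      using 1 2 by (simp add: case_prod_unfold power_mult_distrib power2_eq_square algebra_simps)
    moreover have "0 \<le> ?M * (w i * w j)" using w0 d_pos[of i] by (simp add: le_max_iff_disj)
    ultimately show ?thesis by (rule power2_le_imp_le)
  qed
  have nodes_sum: "(\<Sum>n\<in>nodes. f n) = (\<Sum>i\<in>UNIV. \<Sum>k\<in>?K i. f (i, k))" for f :: "_ \<Rightarrow> real"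
    unfolding nodes_def by (subst sum.Sigma) auto
  have cross: "(\<Sum>n\<in>nodes. \<Sum>n'\<in>nbrs n. x n * x n') =
     (\<Sum>i\<in>UNIV. \<Sum>j\<in>UNIV. \<Sum>(k, l)\<in>P i j. x (i, k) * x (j, l))"
  proof -
    have "(\<Sum>n'\<in>nbrs (i, k). x (i, k) * x n') =
       (\<Sum>j\<in>UNIV. \<Sum>l\<in>?K j. if adj (i, k) (j, l) then x (i, k) * x (j, l) else 0)" for i k
      unfolding nodes_sum[symmetric, of "\<lambda>n'. if adj (i, k) n' then x (i, k) * x n' else 0"] nbrs_def
      by (simp add: sum.inter_filter)
    then have "(\<Sum>n\<in>nodes. \<Sum>n'\<in>nbrs n. x n * x n') = (\<Sum>i\<in>UNIV. \<Sum>k\<in>?K i. \<Sum>j\<in>UNIV. \<Sum>l\<in>?K j.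
       if adj (i, k) (j, l) then x (i, k) * x (j, l) else 0)"
      unfolding nodes_sum by simp
    also have "\<dots> = (\<Sum>i\<in>UNIV. \<Sum>j\<in>UNIV. \<Sum>k\<in>?K i. \<Sum>l\<in>?K j.
       if adj (i, k) (j, l) then x (i, k) * x (j, l) else 0)"
      by (intro sum.cong refl) (rule sum.swap)
    also have "\<dots> = (\<Sum>i\<in>UNIV. \<Sum>j\<in>UNIV. \<Sum>(k, l)\<in>P i j. x (i, k) * x (j, l))"
    proof (intro sum.cong refl)
      fix i j
      have "P i j = {p\<in>?K i \<times> ?K j. adj (i, fst p) (j, snd p)}" by (auto simp: P_def)
      then show "(\<Sum>k\<in>?K i. \<Sum>l\<in>?K j. if adj (i, k) (j, l) then x (i, k) * x (j, l) else 0) =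
         (\<Sum>(k, l)\<in>P i j. x (i, k) * x (j, l))"
        by (subst sum.cartesian_product) (simp add: sum.inter_filter case_prod_unfold)
    qed
    finally show ?thesis .
  qed
  have "energy x = (\<Sum>i\<in>UNIV. w i * of_int (d i * c i i) * w i)
      - (\<Sum>i\<in>UNIV. \<Sum>j\<in>UNIV. \<Sum>(k, l)\<in>P i j. x (i, k) * x (j, l))"
    unfolding energy_def cross unfolding nodes_sum w2
    by (simp add: c_diag sum_distrib_left power2_eq_square algebra_simps)
  moreover have "(\<Sum>i\<in>UNIV. \<Sum>j\<in>UNIV. \<Sum>(k, l)\<in>P i j. x (i, k) * x (j, l)) \<le>
      (\<Sum>i\<in>UNIV. \<Sum>j\<in>UNIV. if i = j then 0 else - (w i * of_int (d i * c i j) * w j))"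
  proof (intro sum_mono)
    fix i j
    show "(\<Sum>(k, l)\<in>P i j. x (i, k) * x (j, l)) \<le>
        (if i = j then 0 else - (w i * of_int (d i * c i j) * w j))"
    proof (cases "c i j < 0")
      case True
      then show ?thesis using pair[OF True] c_neg_neq[OF True] adjacent_b(1)[OF True]
        by (simp add: algebra_simps flip: of_int_mult of_int_minus)
    next
      case False
      then have "i = j \<or> c i j = 0" using c_offdiag[of i j] by fastforce
      then show ?thesis using Pempty[OF False] by auto
    qed
  qed
  moreover have "(\<Sum>i\<in>UNIV. \<Sum>j\<in>UNIV. w i * of_int (d i * c i j) * w j) =
     (\<Sum>i\<in>UNIV. w i * of_int (d i * c i i) * w i)
      - (\<Sum>i\<in>UNIV. \<Sum>j\<in>UNIV. if i = j then 0 else - (w i * of_int (d i * c i j) * w j))"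
  proof -
    have "(\<Sum>j\<in>UNIV. w i * of_int (d i * c i j) * w j) = w i * of_int (d i * c i i) * w i
      - (\<Sum>j\<in>UNIV. if i = j then 0 else - (w i * of_int (d i * c i j) * w j))" for i
    proof -
      have "(\<Sum>j\<in>UNIV. w i * of_int (d i * c i j) * w j) =
         (\<Sum>j\<in>UNIV. (if j = i then w i * of_int (d i * c i i) * w i else 0)
           - (if i = j then 0 else - (w i * of_int (d i * c i j) * w j)))"
        by (intro sum.cong) auto
      then show ?thesis by (simp add: sum_subtractf)
    qed
    then show ?thesis by (simp add: sum_subtractf)
  qed
  ultimately show ?thesis by linarith
qed

text \<open>Time steps preserve the energy, which is 2 on a basis vector, and coercivity turns this
  into a bound on the entries.\<close>

lemma evolve_bounded:
  obtains Bd :: int where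
    "\<And>t n n'. n \<in> nodes \<Longrightarrow> n' \<in> nodes \<Longrightarrow> \<bar>(evolve ^^ t) (\<lambda>k. if k = n then 1 else 0 :: int) n'\<bar> \<le> Bd"
proof -
  obtain \<epsilon> :: real where \<epsilon>: "\<epsilon> > 0"
    "\<And>w. (\<Sum>i\<in>UNIV. \<Sum>j\<in>UNIV. w i * of_int (d i * c i j) * w j) \<ge> \<epsilon> * (\<Sum>i\<in>UNIV. (w i)\<^sup>2)"
    by (rule form_coercive) blast
  define D where "D = real_of_int (Max (range d))"
  have D: "of_int (d i) \<le> D" for i by (simp add: D_def)
  have "D > 0" using D[of undefined] d_pos[of undefined] by (smt (verit) of_int_0_less_iff)
  have low: "\<epsilon> * (x n)\<^sup>2 \<le> D * energy x" if n: "n \<in> nodes" for x n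
  proof -
    obtain i k where ik: "n = (i, k)" by (cases n)
    let ?S = "\<lambda>i. \<Sum>k\<in>{- d i..<d i}. (x (i, k))\<^sup>2"
    define w where "w i = sqrt (?S i / of_int (d i))" for i
    have w2: "(w i)\<^sup>2 = ?S i / of_int (d i)" for i
      unfolding w_def using d_pos[of i] by (simp add: sum_nonneg)
    have "(x n)\<^sup>2 \<le> ?S i" using n ik member_le_sum[of k "{- d i..<d i}" "\<lambda>k. (x (i, k))\<^sup>2"]
      by (auto simp: nodes_def)
    also have "\<dots> = of_int (d i) * (w i)\<^sup>2" using w2[of i] d_pos[of i] by simp
    also have "\<dots> \<le> D * (\<Sum>i\<in>UNIV. (w i)\<^sup>2)"
      using D[of i] \<open>D > 0\<close> by (intro mult_mono member_le_sum) (auto simp: sum_nonneg)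
    finally have "\<epsilon> * (x n)\<^sup>2 \<le> D * (\<epsilon> * (\<Sum>i\<in>UNIV. (w i)\<^sup>2))"
      using \<epsilon>(1) by (simp add: mult.left_commute)
    also have "\<dots> \<le> D * energy x"
      using \<epsilon>(2)[of w] energy_lower_bound[of x] \<open>D > 0\<close>
      unfolding w_def by (intro mult_left_mono) linarith+
    finally show ?thesis .
  qed
  have of_int_energy: "energy (\<lambda>n. real_of_int (y n)) = of_int (energy y)" for y
    by (simp add: energy_def)
  have e1: "energy (\<lambda>k. if k = n then 1 else 0 :: int) = 2" if "n \<in> nodes" for n
  proof -
    have "\<not> adj n n" using c_diag by (simp add: adj_def)
    then have "(\<Sum>k\<in>nodes. \<Sum>k'\<in>nbrs k. (if k = n then 1 else 0) * (if k' = n then 1 else 0 :: int)) = 0"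
      by (intro sum.neutral ballI) (auto simp: nbrs_def)
    moreover have "(\<Sum>k\<in>nodes. (if k = n then 1 else 0 :: int) ^ 2) = 1"
      using that by (simp add: if_distrib[of "\<lambda>t. t ^ 2"] cong: if_cong)
    ultimately show ?thesis by (simp only: energy_def)
  qed
  define C where "C = D * 2 / \<epsilon>"
  have "C > 0" using \<open>D > 0\<close> \<epsilon>(1) by (simp add: C_def)
  have "\<bar>(evolve ^^ t) (\<lambda>k. if k = n then 1 else 0 :: int) n'\<bar> \<le> \<lceil>C\<rceil>"
    if n: "n \<in> nodes" "n' \<in> nodes" for t n n'
  proof -
    let ?y = "(evolve ^^ t) (\<lambda>k. if k = n then 1 else 0 :: int)"
    have "\<epsilon> * (of_int (?y n'))\<^sup>2 \<le> D * of_int (energy ?y)"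
      using low[OF n(2), of "\<lambda>k. of_int (?y k)"] of_int_energy[of ?y] by simp
    then have "\<epsilon> * (of_int (?y n'))\<^sup>2 \<le> D * 2" using e1[OF n(1)] by (simp add: energy_evolve)
    then have "of_int ((?y n')\<^sup>2) \<le> C" using \<epsilon>(1) by (simp add: C_def field_simps)
    then have "(?y n')\<^sup>2 \<le> \<lceil>C\<rceil>" by linarith
    moreover have "\<bar>?y n'\<bar> * 1 \<le> \<bar>?y n'\<bar> * \<bar>?y n'\<bar>" if "?y n' \<noteq> 0"
      using that by (intro mult_left_mono) linarith+
    ultimately show ?thesis using \<open>C > 0\<close> by (cases "?y n' = 0") (auto simp: power2_eq_square)
  qed
  then show ?thesis using that by blast
qed

text \<open>Pigeonhole: the matrices of the powers of \<open>evolve\<close> have bounded integer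
  entries, so two powers a < b coincide on the nodes. Applied to the eigenvector this gives q^a =
  q^b.\<close>

lemma evolve_eigenvalue:
  fixes x :: "'i \<times> int \<Rightarrow> complex"
  assumes eig: "\<And>n. n \<in> nodes \<Longrightarrow> evolve x n = q * x n"
    and n0: "n0 \<in> nodes" "x n0 \<noteq> 0" and q: "q \<noteq> 0"
  shows "\<exists>k>0. q ^ k = 1"
proof -
  let ?e = "\<lambda>n k. if k = n then 1 else 0 :: int"
  \<comment> \<open>Padding by 0 outside \<open>nodes\<close> turns coincidence on the nodes into
    equality of functions from a finite set.\<close>
  define U where "U t = (\<lambda>(n, n'). if n \<in> nodes \<and> n' \<in> nodes then (evolve ^^ t) (?e n) n' else 0)"
    for t :: nat
  obtain Bd where Bd: "\<And>t n n'. n \<in> nodes \<Longrightarrow> n' \<in> nodes \<Longrightarrow> \<bar>(evolve ^^ t) (?e n) n'\<bar> \<le> Bd"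
    by (rule evolve_bounded) blast
  have "range U \<subseteq> {f. \<forall>p. (p \<in> nodes \<times> nodes \<longrightarrow> f p \<in> {-Bd..Bd}) \<and> (p \<notin> nodes \<times> nodes \<longrightarrow> f p = 0)}"
  proof (intro subsetI CollectI allI)
    fix f p assume "f \<in> range U"
    then obtain t where t: "f = U t" by blast
    show "(p \<in> nodes \<times> nodes \<longrightarrow> f p \<in> {-Bd..Bd}) \<and> (p \<notin> nodes \<times> nodes \<longrightarrow> f p = 0)"
      using Bd[of "fst p" "snd p" t] by (cases p) (force simp: U_def t)
  qed
  moreover have "finite {f. \<forall>p. (p \<in> nodes \<times> nodes \<longrightarrow> f p \<in> {-Bd..Bd}) \<and> (p \<notin> nodes \<times> nodes \<longrightarrow> f p = (0::int))}"
    by (intro finite_set_of_finite_funs) auto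
  ultimately have "finite (range U)" using finite_subset by blast
  then have "\<not> inj U" using finite_imageD[of U UNIV] by auto
  then obtain a b where ab: "a < b" "U a = U b" unfolding inj_def by (metis linorder_neqE_nat)
  have nb: "nbrs n \<subseteq> nodes" for n by (auto simp: nbrs_def)
  have rn: "rot n \<in> nodes" if "n \<in> nodes" for n using rot_bij that by (auto simp: bij_betw_def)
  have cong: "evolve y n = evolve y' n" if "n \<in> nodes" "\<And>k. k \<in> nodes \<Longrightarrow> y k = y' k"
    for y y' :: "_ \<Rightarrow> complex" and n
    using that rn[OF that(1)] nb[of "rot n"] unfolding evolve_def refl_last_def
    by (auto intro!: sum.cong)
  have lin: "evolve (\<lambda>k. \<Sum>m\<in>nodes. z m * of_int (y m k)) n = (\<Sum>m\<in>nodes. z m * of_int (evolve (y m) n))"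
    for z :: "_ \<Rightarrow> complex" and y n
  proof -
    have "(\<Sum>n'\<in>nbrs k. \<Sum>m\<in>nodes. z m * of_int (y m n')) = (\<Sum>m\<in>nodes. z m * (\<Sum>n'\<in>nbrs k. of_int (y m n')))" for k
      by (subst sum.swap) (simp add: sum_distrib_left)
    then show ?thesis
      by (auto simp: evolve_def refl_last_def sum.distrib algebra_simps sum_subtractf sum_negf)
  qed
  have expand: "(evolve ^^ t) x n = (\<Sum>m\<in>nodes. x m * of_int ((evolve ^^ t) (?e m) n))"
    if "n \<in> nodes" for n t
    using that
  proof (induction t arbitrary: n)
    case 0
    have "(\<Sum>m\<in>nodes. x m * of_int (?e m n)) = (\<Sum>m\<in>nodes. if n = m then x m else 0)"
      by (intro sum.cong) auto
    then show ?case using 0 by simp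
  next
    case (Suc t)
    have "(evolve ^^ Suc t) x n = evolve (\<lambda>k. \<Sum>m\<in>nodes. x m * of_int ((evolve ^^ t) (?e m) k)) n"
      using cong[OF Suc.prems, of "(evolve ^^ t) x"] Suc.IH by simp
    then show ?case by (simp add: lin)
  qed
  have scale: "evolve (\<lambda>k. r * y k) n = r * evolve y n" for r :: complex and y n
    by (simp add: evolve_def refl_last_def sum_distrib_left algebra_simps)
  have pow: "(evolve ^^ t) x n = q ^ t * x n" if "n \<in> nodes" for n t
    using that
  proof (induction t arbitrary: n)
    case (Suc t)
    have "(evolve ^^ Suc t) x n = evolve (\<lambda>k. q ^ t * x k) n"
      using cong[OF Suc.prems, of "(evolve ^^ t) x"] Suc.IH by simp
    then show ?case using eig[OF Suc.prems] by (simp add: scale)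
  qed simp
  have "(evolve ^^ a) (?e m) n0 = (evolve ^^ b) (?e m) n0" if "m \<in> nodes" for m
    using fun_cong[OF ab(2), of "(m, n0)"] that n0(1) by (simp add: U_def)
  then have "q ^ a * x n0 = q ^ b * x n0"
    unfolding pow[OF n0(1), symmetric] expand[OF n0(1)] by simp
  then have "q ^ a = q ^ b" using n0(2) by simp
  moreover have "q ^ a * q ^ (b - a) = q ^ b" using ab(1) by (simp flip: power_add)
  ultimately have "q ^ a * q ^ (b - a) = q ^ a * 1" by simp
  then have "q ^ (b - a) = 1" using q by simp
  then show ?thesis using ab(1) by (intro exI[of _ "b - a"]) auto
qed

section \<open>Kernel vectors of B(q) as plane waves\<close>

lemma powi_diff_neq_0:
  fixes q :: complex
  assumes "q \<noteq> 0" "\<forall>n>0. q ^ n \<noteq> 1" "k \<noteq> 0"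
  shows "q powi k - q powi (- k) \<noteq> 0"
proof
  assume "q powi k - q powi (- k) = 0"
  then have "q powi k * q powi k = 1" using assms(1) by (simp add: power_int_minus field_simps)
  then have 1: "q powi (k + k) = 1" using assms(1) power_int_add[of q k k] by simp
  then have "q powi (- (k + k)) = 1" by (simp only: power_int_minus inverse_1)
  then have "q ^ nat \<bar>k + k\<bar> = 1" using 1 by (cases "k \<ge> 0") (simp_all add: power_int_def split: if_splits)
  then show False using assms(2,3) by (metis abs_zero nat_0_iff zero_less_nat_eq add_eq_0_iff_both_eq_0 abs_ge_zero add_diff_cancel double_eq_0_iff zero_less_abs_iff)
qed

text \<open>The neighbouring times form a progression with difference 2 min (d i) (d j). If d j
  \<le> d i it is the single time 0; otherwise the difference is 2 d i and the product with q^(d i)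
  - q^(- d i) telescopes.\<close>

lemma wave_coefficient:
  fixes q :: complex
  assumes q: "q \<noteq> 0" and cn: "c i j < 0"
  shows "(q powi d i - q powi (- d i)) *
      (\<Sum>l\<in>{l\<in>{- d j..<d j}. adj (i, - d i) (j, l)}. q powi l) =
      q powi (- (d i * c i j)) - q powi (d i * c i j)"
proof -
  let ?M = "max (d i) (d j)" and ?m = "min (d i) (d j)"
  note dp = d_pos[of i] d_pos[of j]
  have m: "?m > 0" "?m dvd d j" using adjacent_b[OF cn] dp by auto
  have set: "{l\<in>{- d j..<d j}. adj (i, - d i) (j, l)} =
      {l\<in>{- d j..<d j}. (l - (?M - d i)) mod (2 * ?m) = 0}"
    using cn by (auto simp: adj_def algebra_simps)
  let ?g = "\<lambda>t. - d j + (?M - d i + d j) mod (2 * ?m) + 2 * ?m * int t"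
  have "inj_on ?g {..<nat (d j div ?m)}" using m(1) by (auto simp: inj_on_def)
  then have S: "(\<Sum>l\<in>{l\<in>{- d j..<d j}. adj (i, - d i) (j, l)}. q powi l) =
      (\<Sum>t<nat (d j div ?m). q powi (?g t))"
    unfolding set residues_in_interval[OF m dp(2)] by (simp add: sum.reindex)
  show ?thesis
  proof (cases "d j \<le> d i")
    case True
    then show ?thesis unfolding S using dp adjacent_b(1)[OF cn] by simp
  next
    case False
    then obtain n where n: "d j = d i * n" using adjacent_b(3)[OF cn] by auto
    have n0: "n > 0" using n dp by (simp add: zero_less_mult_iff)
    have "(2 * d j - d i) mod (2 * d i) = d i"
    proof -
      have "2 * d j - d i = d i + 2 * d i * (n - 1)" using n by (simp add: algebra_simps)
      then show ?thesis using dp by (simp only: mod_mult_self2) simp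
    qed
    then have g: "?g t = d i - d j + 2 * d i * int t" for t using False by (simp add: algebra_simps)
    define f where "f t = q powi (2 * d i * int t - d j)" for t
    have "(q powi d i - q powi (- d i)) * q powi (?g t) = f (Suc t) - f t" for t
    proof -
      have "q powi d i * q powi (?g t) = f (Suc t)" "q powi (- d i) * q powi (?g t) = f t"
        unfolding g f_def using q by (simp_all flip: power_int_add add: algebra_simps)
      then show ?thesis by (simp only: left_diff_distrib)
    qed
    then have "(q powi d i - q powi (- d i)) * (\<Sum>t<nat (d j div ?m). q powi (?g t)) = f (nat n) - f 0"
      using False n dp by (simp only: sum_distrib_left sum_lessThan_telescope) simp
    also have "\<dots> = q powi d j - q powi (- d j)" using n n0 by (simp add: f_def mult.commute[of n])
    finally show ?thesis unfolding S adjacent_b(1)[OF cn] using False by simp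
  qed
qed

lemma qCartan_invertible:
  fixes q :: complex
  assumes q: "q \<noteq> 0" "\<forall>n>0. q ^ n \<noteq> 1"
  shows "invertible ((\<chi> i j. qnum q (d i * c i j)) :: complex^'i^'i)"
proof -
  let ?B = "(\<chi> i j. qnum q (d i * c i j)) :: complex^'i^'i"
  have "v = 0" if ker: "?B *v v = 0" for v :: "complex^'i"
  proof (rule ccontr)
    assume "v \<noteq> 0"
    then obtain i0 where i0: "v $ i0 \<noteq> 0" by (auto simp: vec_eq_iff)
    \<comment> \<open>The plane wave restricted to the windows. Away from the end of a window the
      eigenvalue equation is the rule for powers; at the end it is row i of the kernel equation,
      divided by q^(d i) - q^(- d i).\<close>
    define x where "x n = q powi snd n * v $ fst n" for n :: "'i \<times> int"
    have q1: "q - inverse q \<noteq> 0" using powi_diff_neq_0[OF q, of 1] by simp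
    have row: "(\<Sum>j\<in>UNIV. (q powi (d i * c i j) - q powi (- (d i * c i j))) * v $ j) = 0" for i
    proof -
      have "(\<Sum>j\<in>UNIV. qnum q (d i * c i j) * v $ j) = 0"
        using ker by (simp add: matrix_vector_mult_def vec_eq_iff)
      then have "(q - inverse q) * (\<Sum>j\<in>UNIV. qnum q (d i * c i j) * v $ j) = 0" by simp
      then show ?thesis using q1 by (simp add: sum_distrib_left qnum_def)
    qed
    have "evolve x n = q * x n" if n: "n \<in> nodes" for n
    proof -
      obtain i k where ik: "n = (i, k)" by (cases n)
      have k: "- d i \<le> k" "k < d i" using n by (auto simp: ik nodes_def)
      show ?thesis
      proof (cases "k = d i - 1")
        case False
        then show ?thesis using k q by (simp add: ik evolve_def refl_last_def rot_def x_def power_int_add)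
      next
        case True
        define S where "S j = (\<Sum>l\<in>{l\<in>{- d j..<d j}. adj (i, - d i) (j, l)}. q powi l)" for j
        let ?e = "q powi d i - q powi (- d i)"
        have e: "?e \<noteq> 0" using powi_diff_neq_0[OF q, of "d i"] d_pos[of i] by simp
        have fin: "finite {l\<in>{- d j..<d j}. adj (i, - d i) (j, l)}" for j
          by (rule finite_subset[of _ "{- d j..<d j}"]) auto
        have "nbrs (i, - d i) = (SIGMA j:UNIV. {l\<in>{- d j..<d j}. adj (i, - d i) (j, l)})"
          by (auto simp: nbrs_def nodes_def)
        then have nb: "(\<Sum>n'\<in>nbrs (i, - d i). x n') = (\<Sum>j\<in>UNIV. S j * v $ j)"
          unfolding S_def sum_distrib_right
          using sum.Sigma[of UNIV "\<lambda>j. {l\<in>{- d j..<d j}. adj (i, - d i) (j, l)}" "\<lambda>j l. q powi l * v $ j"] fin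
          by (simp add: x_def case_prod_unfold)
        have eS: "?e * S j = (if j = i then 0 else q powi (- (d i * c i j)) - q powi (d i * c i j))" for j
        proof (cases "c i j < 0")
          case True
          then show ?thesis using wave_coefficient[OF q(1) True] c_neg_neq[OF True] by (simp add: S_def)
        next
          case False
          then have "{l\<in>{- d j..<d j}. adj (i, - d i) (j, l)} = {}" by (auto simp: adj_def)
          then have "S j = 0" unfolding S_def by (simp only: sum.empty)
          moreover have "j = i \<or> c i j = 0" using c_offdiag[of i j] False by fastforce
          ultimately show ?thesis by auto
        qed
        have "?e * (\<Sum>j\<in>UNIV. S j * v $ j) = (\<Sum>j\<in>UNIV. (if j = i then
            (q powi (2 * d i) - q powi (- (2 * d i))) * v $ i else 0)
            - (q powi (d i * c i j) - q powi (- (d i * c i j))) * v $ j)"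
          unfolding sum_distrib_left mult.assoc[symmetric] eS
          by (rule sum.cong) (auto simp: c_diag algebra_simps)
        also have "\<dots> = (q powi (2 * d i) - q powi (- (2 * d i))) * v $ i"
          using row[of i] by (simp add: sum_subtractf)
        also have "q powi (2 * d i) - q powi (- (2 * d i)) = ?e * (q powi d i + q powi (- d i))"
        proof -
          have "q powi (2 * d i) = q powi d i * q powi d i"
            "q powi (- (2 * d i)) = q powi (- d i) * q powi (- d i)"
            using q(1) by (simp_all flip: power_int_add)
          then show ?thesis by (simp only: algebra_simps)
        qed
        finally have "(\<Sum>j\<in>UNIV. S j * v $ j) = (q powi d i + q powi (- d i)) * v $ i"
          using e by simp
        moreover have "q * x n = q powi d i * v $ i"
        proof -
          have "q * q powi (d i - 1) = q powi d i" using q(1) by (simp add: power_int_diff)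
          then show ?thesis by (simp add: ik x_def True mult.assoc[symmetric])
        qed
        moreover have "evolve x n = - x (i, - d i) + (\<Sum>n'\<in>nbrs (i, - d i). x n')"
          by (simp add: ik True evolve_def refl_last_def rot_def)
        moreover have "x (i, - d i) = q powi (- d i) * v $ i" by (simp add: x_def)
        ultimately show ?thesis by (simp add: nb distrib_right)
      qed
    qed
    moreover have "(i0, 0) \<in> nodes" using d_pos[of i0] by (simp add: nodes_def)
    moreover have "x (i0, 0) \<noteq> 0" using i0 by (simp add: x_def)
    ultimately have "\<exists>k>0. q ^ k = 1" using evolve_eigenvalue[of x q "(i0, 0)"] q(1) by blast
    then show False using q(2) by blast
  qed
  then show ?thesis unfolding invertible_left_inverse matrix_left_invertible_ker by simp
qed

end

unbundle no vec_syntax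

section \<open>Additive endomorphisms as a ring type\<close>

text \<open>A type gives access to power series over the endomorphisms. Linearity depends on the
  term \<open>scl\<close> and cannot be built into the type, so it is recovered later as commuting
  with scalars.\<close>

typedef (overloaded) 'v endo = "{f :: 'v::ab_group_add \<Rightarrow> 'v. \<forall>x y. f (x + y) = f x + f y}"
  morphisms app Endo
  by (rule exI[of _ "\<lambda>x. x"]) simp

setup_lifting type_definition_endo

instantiation endo :: (ab_group_add) ring
begin

lift_definition zero_endo :: "'a endo" is "\<lambda>_. 0" by simp
lift_definition plus_endo :: "'a endo \<Rightarrow> 'a endo \<Rightarrow> 'a endo" is "\<lambda>f g x. f x + g x"
  by (simp add: algebra_simps)
lift_definition uminus_endo :: "'a endo \<Rightarrow> 'a endo" is "\<lambda>f x. - f x"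
  by (simp add: algebra_simps)
lift_definition minus_endo :: "'a endo \<Rightarrow> 'a endo \<Rightarrow> 'a endo" is "\<lambda>f g x. f x - g x"
  by (simp add: algebra_simps)
lift_definition times_endo :: "'a endo \<Rightarrow> 'a endo \<Rightarrow> 'a endo" is "\<lambda>f g x. f (g x)"
  by simp

instance
  by standard (transfer, simp add: fun_eq_iff algebra_simps)+

end

instantiation endo :: (ab_group_add) monoid_mult
begin

lift_definition one_endo :: "'a endo" is "\<lambda>x. x" by simp

instance
  by standard (transfer, simp)+

end

lemma app_simps [simp]:
  "app 0 v = 0" "app (f + g) v = app f v + app g v" "app (- f) v = - app f v"
  "app (f - g) v = app f v - app g v" "app (f * g) v = app f (app g v)" "app 1 v = v"
  by (transfer, simp)+

lemma app_add_right: "app f (u + v) = app f u + app f v"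
  by transfer simp

lemma app_zero_right [simp]: "app f 0 = 0"
  using app_add_right[of f 0 0] by simp

lemma app_minus_right: "app f (u - v) = app f u - app f v"
  using app_add_right[of f "u - v" v] by (simp add: algebra_simps)

lemma app_sum: "app (\<Sum>i\<in>I. f i) v = (\<Sum>i\<in>I. app (f i) v)"
  by (induction I rule: infinite_finite_induct) simp_all

lemma app_sum_right: "app f (\<Sum>i\<in>I. v i) = (\<Sum>i\<in>I. app f (v i))"
  by (induction I rule: infinite_finite_induct) (simp_all add: app_add_right)

lemma endo_eqI: "(\<And>v. app f v = app g v) \<Longrightarrow> f = g"
  by transfer auto

lemma app_Endo: "(\<And>x y. f (x + y) = f x + f y) \<Longrightarrow> app (Endo f) = f"
  by (simp add: Endo_inverse)

text \<open>Endomorphisms of the zero group satisfy 0 = 1, so \<open>endo\<close> cannot belong to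
  \<open>ring_1\<close>. The sort \<open>ring\<close> with \<open>monoid_mult\<close> takes its
  place, also for series.\<close>

instance fps :: ("{semiring_0, monoid_mult}") monoid_mult
proof
  fix F :: "'a fps"
  have "(1 * F) $ n = F $ n" for n
  proof -
    have "(1 * F) $ n = (\<Sum>i = 0..n. if i = 0 then F $ n else 0)"
      unfolding fps_mult_nth by (intro sum.cong) auto
    then show ?thesis by simp
  qed
  then show "1 * F = F" by (intro fps_ext)
  have "(F * 1) $ n = F $ n" for n
  proof -
    have "(F * 1) $ n = (\<Sum>i = 0..n. if i = n then F $ n else 0)"
      unfolding fps_mult_nth by (intro sum.cong) auto
    then show ?thesis by simp
  qed
  then show "F * 1 = F" by (intro fps_ext)
qed

section \<open>Power series and logarithmic derivatives over a noncommutative ring\<close>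

text \<open>Natural multiples as repeated sums, since \<open>endo\<close> is not in
  \<open>semiring_1\<close>, to which \<open>of_nat\<close> belongs.\<close>

definition nsm :: "nat \<Rightarrow> 'a::comm_monoid_add \<Rightarrow> 'a" where
  "nsm k x = (\<Sum>_<k. x)"

lemma nsm_simps [simp]: "nsm 0 x = 0" "nsm (Suc k) x = nsm k x + x" "nsm k 0 = 0"
  by (simp_all add: nsm_def)

lemma nsm_add: "nsm (k + l) x = nsm k x + nsm l x"
  by (induction l) (simp_all add: add.assoc)

lemma nsm_sum: "nsm k (\<Sum>i\<in>I. f i) = (\<Sum>i\<in>I. nsm k (f i))"
  unfolding nsm_def by (rule sum.swap)

lemma nsm_mult_left: "nsm k (x * y) = nsm k x * (y :: 'a::semiring_0)"
  by (simp add: nsm_def sum_distrib_right)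

lemma nsm_mult_right: "nsm k (x * y) = x * nsm k (y :: 'a::semiring_0)"
  by (simp add: nsm_def sum_distrib_left)

lemma nsm_of_nat: "nsm k x = of_nat k * (x :: 'a::semiring_1)"
  by (simp add: nsm_def)

text \<open>The Euler derivation z d/dz.\<close>

definition theta :: "'a::comm_monoid_add fps \<Rightarrow> 'a fps" where
  "theta F = Abs_fps (\<lambda>k. nsm k (F $ k))"

lemma theta_nth [simp]: "theta F $ k = nsm k (F $ k)"
  by (simp add: theta_def)

lemma theta_mult: "theta (F * G) = theta F * G + F * theta (G :: 'a::semiring_0 fps)"
proof (intro fps_ext)
  fix n
  have "theta (F * G) $ n = (\<Sum>i = 0..n. nsm (i + (n - i)) (F $ i * G $ (n - i)))"
    by (simp add: fps_mult_nth nsm_sum)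
  also have "\<dots> = (theta F * G + F * theta G) $ n"
    unfolding nsm_add by (simp add: fps_mult_nth sum.distrib flip: nsm_mult_left nsm_mult_right)
  finally show "theta (F * G) $ n = (theta F * G + F * theta G) $ n" .
qed

lemma theta_const [simp]: "theta (fps_const x) = 0"
  by (intro fps_ext) (simp add: fps_const_def)

lemma theta_one [simp]: "theta (1 :: 'a::{comm_monoid_add,one} fps) = 0"
  by (intro fps_ext) simp

text \<open>\<gamma> is the left logarithmic derivative of G, stated without inverting G. The
  normalizations make each determine the other, see \<open>LD_unique_log\<close> and
  \<open>LD_unique\<close>.\<close>

definition LD :: "'a::{ring,monoid_mult} fps \<Rightarrow> 'a fps \<Rightarrow> bool" where
  "LD \<gamma> G \<longleftrightarrow> G $ 0 = 1 \<and> \<gamma> $ 0 = 0 \<and> theta G = \<gamma> * G"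

lemma fps_mult_nth_split_0:
  "(F * G) $ n = F $ 0 * G $ n + (\<Sum>i = 1..n. F $ i * G $ (n - i))"
  for F :: "'a::semiring_0 fps"
  by (simp add: fps_mult_nth sum.atLeast_Suc_atMost)

lemma fps_mult_nth_split_n:
  "(F * G) $ n = F $ n * G $ 0 + (\<Sum>i<n. F $ i * G $ (n - i))"
  for F :: "'a::semiring_0 fps"
proof -
  have "{0..n} = insert n {..<n}" by auto
  then show ?thesis by (simp add: fps_mult_nth)
qed

lemma fps_cancel_right:
  fixes F :: "'a::{ring,monoid_mult} fps"
  assumes "F * H = G * H" "H $ 0 = 1" shows "F = G"
proof (intro fps_ext)
  fix n show "F $ n = G $ n"
  proof (induction n rule: less_induct)
    case (less n)
    have "(F * H) $ n = (G * H) $ n" using assms(1) by simp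
    moreover have "(\<Sum>i<n. F $ i * H $ (n - i)) = (\<Sum>i<n. G $ i * H $ (n - i))"
      using less by (intro sum.cong) auto
    ultimately show ?case using assms(2) by (simp add: fps_mult_nth_split_n)
  qed
qed

lemma LD_unique_log: "LD \<gamma> G \<Longrightarrow> LD \<delta> G \<Longrightarrow> \<gamma> = \<delta>"
  by (rule fps_cancel_right[of _ G]) (auto simp: LD_def)

lemma LD_mult:
  assumes "LD \<gamma> G" "LD \<delta> H" "G * \<delta> = \<delta> * G"
  shows "LD (\<gamma> + \<delta>) (G * H)"
proof -
  have "theta (G * H) = \<gamma> * (G * H) + \<delta> * (G * H)"
    using assms by (simp add: LD_def theta_mult mult.assoc) (metis mult.assoc)
  then show ?thesis using assms by (simp add: LD_def distrib_right fps_mult_nth)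
qed

fun left_quot :: "'a::ring fps \<Rightarrow> 'a fps \<Rightarrow> nat \<Rightarrow> 'a" where
  "left_quot H G k = H $ k - (\<Sum>l<k. left_quot H G l * G $ (k - l))"

declare left_quot.simps [simp del]

lemma left_quot:
  fixes G :: "'a::{ring,monoid_mult} fps"
  assumes "G $ 0 = 1" shows "Abs_fps (left_quot H G) * G = H"
proof (intro fps_ext)
  fix n
  show "(Abs_fps (left_quot H G) * G) $ n = H $ n"
    by (simp add: fps_mult_nth_split_n assms left_quot.simps[of H G n])
qed

locale scalars =
  fixes sc :: "complex \<Rightarrow> 'r::{ring,monoid_mult}"
  assumes sc_add: "sc (a + b) = sc a + sc b"
    and sc_mult: "sc (a * b) = sc a * sc b"
    and sc_one [simp]: "sc 1 = 1"
begin

lemma sc_zero [simp]: "sc 0 = 0"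
  using sc_add[of 0 0] by simp

lemma sc_uminus: "sc (- a) = - sc a"
  using sc_add[of a "- a"] by (simp add: minus_unique)

lemma sc_diff: "sc (a - b) = sc a - sc b"
  using sc_add[of a "- b"] by (simp add: sc_uminus)

lemma sc_sum: "sc (\<Sum>i\<in>I. f i) = (\<Sum>i\<in>I. sc (f i))"
  by (induction I rule: infinite_finite_induct) (simp_all add: sc_add)

lemma sc_cancel: "a \<noteq> 0 \<Longrightarrow> sc a * x = sc a * y \<Longrightarrow> x = y"
  by (metis mult.assoc left_inverse mult_1 sc_mult sc_one)

lemma nsm_sc: "nsm k x = sc (of_nat k) * x"
proof (induction k)
  case (Suc k)
  have "sc (of_nat (Suc k)) * x = sc 1 * x + sc (of_nat k) * x"
    by (simp only: of_nat_Suc sc_add distrib_right)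
  then show ?case using Suc by (simp add: add.commute)
qed simp

lemma nsm_cancel: "k > 0 \<Longrightarrow> nsm k x = nsm k y \<Longrightarrow> x = (y :: 'r)"
  using sc_cancel[of "of_nat k" x y] by (simp add: nsm_sc)

text \<open>As \<gamma> has no constant term, coefficient n of the equation expresses n F_n through
  lower coefficients, and n is invertible among the scalars.\<close>

lemma theta_eq_unique:
  fixes F G \<gamma> :: "'r fps"
  assumes "theta F = \<gamma> * F" "theta G = \<gamma> * G" "\<gamma> $ 0 = 0" "F $ 0 = G $ 0"
  shows "F = G"
proof (intro fps_ext)
  fix n show "F $ n = G $ n"
  proof (induction n rule: less_induct)
    case (less n)
    show ?case
    proof (cases "n = 0")
      case False
      have "(\<Sum>i = 1..n. \<gamma> $ i * F $ (n - i)) = (\<Sum>i = 1..n. \<gamma> $ i * G $ (n - i))"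
        using less by (intro sum.cong) auto
      then have "(\<gamma> * F) $ n = (\<gamma> * G) $ n"
        unfolding fps_mult_nth_split_0[of \<gamma>] assms(3) by simp
      then have "nsm n (F $ n) = nsm n (G $ n)" by (simp flip: assms(1,2))
      then show ?thesis using False nsm_cancel by blast
    qed (use assms in simp)
  qed
qed

lemma LD_unique: "LD \<gamma> F \<Longrightarrow> LD \<gamma> G \<Longrightarrow> F = (G :: 'r fps)"
  by (rule theta_eq_unique) (auto simp: LD_def)

text \<open>For endomorphisms of a complex vector space these are the linear maps, by
  \<open>lin_iff\<close>.\<close>

definition lin :: "'r set" where
  "lin = {x. \<forall>c. sc c * x = x * sc c}"

lemma lin_sc: "x \<in> lin \<Longrightarrow> x * sc c = sc c * x"
  by (simp add: lin_def)

lemma lin_sc2: "x \<in> lin \<Longrightarrow> x * (sc c * y) = sc c * (x * y)"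
  by (metis lin_sc mult.assoc)

lemma lin_closed:
  "0 \<in> lin" "1 \<in> lin" "sc a \<in> lin" "x \<in> lin \<Longrightarrow> y \<in> lin \<Longrightarrow> x + y \<in> lin"
  "x \<in> lin \<Longrightarrow> y \<in> lin \<Longrightarrow> x * y \<in> lin"
  by (auto simp: lin_def distrib_left distrib_right mult.commute simp flip: sc_mult)
    (metis mult.assoc)

definition flin :: "'r fps \<Rightarrow> bool" where "flin F \<longleftrightarrow> (\<forall>k. F $ k \<in> lin)"

text \<open>Substitution of a z for z.\<close>

definition zs :: "complex \<Rightarrow> 'r fps \<Rightarrow> 'r fps" where
  "zs a F = Abs_fps (\<lambda>k. sc (a ^ k) * F $ k)"

lemma zs_nth [simp]: "zs a F $ k = sc (a ^ k) * F $ k"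
  by (simp add: zs_def)

lemma zs_mult:
  assumes "flin F" shows "zs a (F * G) = zs a F * zs a G"
proof (intro fps_ext)
  fix n
  have "sc (a ^ n) * (F $ i * G $ (n - i)) = sc (a ^ i) * F $ i * (sc (a ^ (n - i)) * G $ (n - i))"
    if "i \<le> n" for i
  proof -
    have "sc (a ^ n) = sc (a ^ i) * sc (a ^ (n - i))" using that by (simp flip: sc_mult power_add)
    moreover have "sc (a ^ (n - i)) * F $ i = F $ i * sc (a ^ (n - i))"
      using assms lin_sc[of "F $ i" "a ^ (n - i)"] by (simp add: flin_def)
    ultimately have "sc (a ^ n) * (F $ i * G $ (n - i)) = sc (a ^ i) * (F $ i * sc (a ^ (n - i))) * G $ (n - i)"
      by (simp only: mult.assoc[symmetric]) (simp only: mult.assoc)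
    then show ?thesis by (simp only: mult.assoc)
  qed
  then show "zs a (F * G) $ n = (zs a F * zs a G) $ n"
    by (simp add: fps_mult_nth sum_distrib_left)
qed

lemma theta_zs: "theta (zs a F) = zs a (theta F)"
  by (intro fps_ext) (simp add: nsm_mult_right)

lemma LD_zs: "LD \<gamma> G \<Longrightarrow> flin \<gamma> \<Longrightarrow> LD (zs a \<gamma>) (zs a G)"
  by (simp add: LD_def theta_zs zs_mult)

definition scf :: "complex fps \<Rightarrow> 'r fps" where
  "scf p = Abs_fps (\<lambda>k. sc (p $ k))"

lemma scf_nth [simp]: "scf p $ k = sc (p $ k)"
  by (simp add: scf_def)

lemma scf_mult: "scf (p * p') = scf p * scf p'"
  by (intro fps_ext) (simp add: fps_mult_nth sc_sum sc_mult)

lemma scf_LD: "LD \<gamma> p \<Longrightarrow> LD (scf \<gamma>) (scf p)"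
proof -
  assume *: "LD \<gamma> p"
  have "theta (scf p) = scf (theta p)"
    by (intro fps_ext) (simp add: nsm_sc nsm_of_nat sc_mult)
  then show ?thesis using * by (simp add: LD_def scf_mult)
qed

text \<open>
  The exponential of a series \<open>F\<close> without constant term, and the part of its \<open>k\<close>-th coefficient
  that only depends on coefficients of \<open>F\<close> of index less than \<open>k\<close>.
\<close>

definition texp :: "'r fps \<Rightarrow> 'r fps" where
  "texp F = Abs_fps (\<lambda>k. \<Sum>n\<le>k. sc (1 / fact n) * (F ^ n) $ k)"

lemma fps_power_low: "F $ 0 = 0 \<Longrightarrow> k < n \<Longrightarrow> (F ^ n) $ k = (0 :: 'r)"
proof (induction n arbitrary: k)
  case (Suc n)
  have "F $ i * (F ^ n) $ (k - i) = 0" if "i \<le> k" for i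
    using Suc that by (cases "i = 0") auto
  then show ?case by (simp add: fps_mult_nth)
qed simp

lemma theta_power:
  assumes "F * theta F = theta F * F"
  shows "theta (F ^ Suc n) = Abs_fps (\<lambda>k. nsm (Suc n) ((theta F * F ^ n) $ k :: 'r))"
proof (induction n)
  case 0
  then show ?case by (intro fps_ext) simp
next
  case (Suc n)
  have "theta (F ^ Suc (Suc n)) $ k = nsm (Suc (Suc n)) ((theta F * F ^ Suc n) $ k)" for k
  proof -
    let ?N = "Abs_fps (\<lambda>k. nsm (Suc n) ((theta F * F ^ n) $ k))"
    have "(F * ?N) $ k = nsm (Suc n) ((F * (theta F * F ^ n)) $ k)"
      by (simp only: fps_mult_nth[of F] nsm_sum nsm_mult_right fps_nth_Abs_fps)
    also have "F * (theta F * F ^ n) = theta F * F ^ Suc n"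
      by (simp only: power_Suc mult.assoc[symmetric] assms)
    finally show ?thesis
      by (subst power_Suc) (simp only: theta_mult Suc fps_add_nth, simp add: add.commute)
  qed
  then show ?case by (intro fps_ext) simp
qed

lemma LD_texp:
  assumes F: "F $ 0 = 0" "F * theta F = theta F * F" "flin (theta F)"
  shows "LD (theta F) (texp F)"
proof -
  have "theta (texp F) $ k = (theta F * texp F) $ k" for k
  proof (cases "k = 0")
    case False
    then obtain m where m: "k = Suc m" by (cases k) auto
    have "nsm k (sc (1 / fact n) * (F ^ n) $ k) = sc (1 / fact n) * (theta (F ^ n)) $ k" for n
      by (simp add: nsm_mult_right)
    then have "theta (texp F) $ k = (\<Sum>n\<le>Suc m. sc (1 / fact n) * theta (F ^ n) $ k)"
      by (simp only: theta_nth texp_def fps_nth_Abs_fps nsm_sum m)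
    also have "\<dots> = (\<Sum>n\<le>m. sc (1 / fact (Suc n)) * theta (F ^ Suc n) $ k)"
      by (subst sum.atMost_Suc_shift) simp
    also have "\<dots> = (\<Sum>n\<le>m. sc (1 / fact n) * (theta F * F ^ n) $ k)"
    proof (intro sum.cong refl)
      fix n
      have "sc (1 / fact (Suc n)) * nsm (Suc n) y = sc (1 / fact n) * y" for y
        unfolding nsm_sc mult.assoc[symmetric] sc_mult[symmetric] by (simp add: fact_Suc del: of_nat_Suc)
      then show "sc (1 / fact (Suc n)) * theta (F ^ Suc n) $ k = sc (1 / fact n) * (theta F * F ^ n) $ k"
        unfolding theta_power[OF F(2)] by (simp del: nsm_simps fact_Suc)
    qed
    also have "\<dots> = (\<Sum>i = 0..k. theta F $ i * (\<Sum>n\<le>m. sc (1 / fact n) * (F ^ n) $ (k - i)))"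
      using F(3) unfolding fps_mult_nth sum_distrib_left flin_def
      by (subst sum.swap) (simp only: lin_sc2)
    also have "\<dots> = (\<Sum>i = 0..k. theta F $ i * texp F $ (k - i))"
    proof (intro sum.cong refl)
      fix i
      show "theta F $ i * (\<Sum>n\<le>m. sc (1 / fact n) * (F ^ n) $ (k - i)) = theta F $ i * texp F $ (k - i)"
      proof (cases "i = 0")
        case False
        have "(\<Sum>n\<le>m. sc (1 / fact n) * (F ^ n) $ (k - i)) = (\<Sum>n\<le>k - i. sc (1 / fact n) * (F ^ n) $ (k - i))"
          using False m by (intro sum.mono_neutral_right) (auto simp: fps_power_low[OF F(1)])
        then show ?thesis by (simp add: texp_def)
      qed simp
    qed
    finally show ?thesis by (simp add: fps_mult_nth)
  qed simp
  then have "theta (texp F) = theta F * texp F" by (intro fps_ext)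
  then show ?thesis by (simp add: LD_def texp_def)
qed

text \<open>
  A scalar series \<open>s\<close> in the operator \<open>x\<^sub>n \<mapsto> z x\<^sub>n\<^sub>+\<^sub>1\<close> applied to the sequence \<open>x\<close>.
\<close>

definition act :: "complex fps \<Rightarrow> (int \<Rightarrow> 'r) \<Rightarrow> int \<Rightarrow> 'r fps" where
  "act s x n = Abs_fps (\<lambda>k. sc (s $ k) * x (n + int k))"

lemma act_nth [simp]: "act s x n $ k = sc (s $ k) * x (n + int k)"
  by (simp add: act_def)

lemma theta_act: "theta (act s x n) = act (theta s) x n"
  by (intro fps_ext) (simp add: nsm_sc nsm_of_nat sc_mult mult.assoc)

lemma bracket_act:
  assumes "\<And>k n. \<gamma> $ k * x n - x n * \<gamma> $ k = sc (g $ k) * x (n + int k)" "flin \<gamma>"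
  shows "\<gamma> * act s x n - act s x n * \<gamma> = act (g * s) x n"
proof (intro fps_ext)
  fix k
  have 1: "(act s x n * \<gamma>) $ k = (\<Sum>i = 0..k. sc (s $ (k - i)) * x (n + int (k - i)) * \<gamma> $ i)"
    unfolding fps_mult_nth by (rule sum.reindex_bij_witness[of _ "\<lambda>i. k - i" "\<lambda>i. k - i"]) auto
  have "\<gamma> $ i * (sc (s $ (k - i)) * x (n + int (k - i))) - sc (s $ (k - i)) * x (n + int (k - i)) * \<gamma> $ i
     = sc (g $ i * s $ (k - i)) * x (n + int k)" if "i \<le> k" for i
  proof -
    have "\<gamma> $ i * (sc (s $ (k - i)) * x (n + int (k - i))) - sc (s $ (k - i)) * x (n + int (k - i)) * \<gamma> $ i
      = sc (s $ (k - i)) * (\<gamma> $ i * x (n + int (k - i)) - x (n + int (k - i)) * \<gamma> $ i)"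
      using assms(2) lin_sc2 by (simp add: flin_def right_diff_distrib mult.assoc)
    also have "\<dots> = sc (s $ (k - i)) * (sc (g $ i) * x (n + int (k - i) + int i))"
      unfolding assms(1) ..
    finally show ?thesis using that by (simp add: sc_mult[symmetric] mult.assoc[symmetric] mult.commute)
  qed
  then have "(\<Sum>i = 0..k. \<gamma> $ i * (sc (s $ (k - i)) * x (n + int (k - i)))
      - sc (s $ (k - i)) * x (n + int (k - i)) * \<gamma> $ i) = act (g * s) x n $ k"
    by (simp add: fps_mult_nth sc_sum sum_distrib_right)
  then show "(\<gamma> * act s x n - act s x n * \<gamma>) $ k = act (g * s) x n $ k"
    by (simp only: fps_sub_nth 1 fps_mult_nth[of \<gamma>] act_nth sum_subtractf)
qed

text \<open>Both sides solve \<open>theta Y = \<gamma> * Y\<close> with the same constant term. This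
  integrates a bracket with the logarithmic derivative to conjugation by the series.\<close>

lemma conj_of_bracket:
  assumes LD: "LD \<gamma> G" and br: "\<And>k n. \<gamma> $ k * x n - x n * \<gamma> $ k = sc (g $ k) * x (n + int k)"
    and lin: "flin \<gamma>" and s: "theta s = g * s" "s $ 0 = 1"
  shows "G * fps_const (x n) = act s x n * G"
proof (rule theta_eq_unique[of _ \<gamma>])
  show "theta (G * fps_const (x n)) = \<gamma> * (G * fps_const (x n))"
    using LD by (simp add: theta_mult LD_def mult.assoc)
  have "theta (act s x n * G) = act (g * s) x n * G + act s x n * \<gamma> * G"
    using LD by (simp add: theta_mult theta_act s LD_def mult.assoc)
  also have "\<dots> = \<gamma> * act s x n * G"
    unfolding bracket_act[OF br lin, of s n, symmetric] by (simp add: left_diff_distrib)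
  finally show "theta (act s x n * G) = \<gamma> * (act s x n * G)" by (simp add: mult.assoc)
qed (use LD s in \<open>auto simp: LD_def fps_mult_nth\<close>)

text \<open>Differentiating the conjugation relation and cancelling G gives an identity of
  convolutions. In its k-th coefficient the brackets with index below k are known by induction, and
  \<open>s $ 0 = 1\<close> isolates the k-th one.\<close>

lemma bracket_of_conj:
  assumes LD: "LD \<gamma> G" and conj: "\<And>n. G * fps_const (x n) = act s x n * G"
    and lin: "flin \<gamma>" and s: "theta s = g * s" "s $ 0 = 1"
  shows "\<gamma> $ k * x n - x n * \<gamma> $ k = sc (g $ k) * x (n + int k)"
proof -
  have *: "\<gamma> * act s x n - act s x n * \<gamma> = act (g * s) x n" for n
  proof (rule fps_cancel_right[of _ G])
    have "theta (G * fps_const (x n)) = theta (act s x n * G)" by (simp only: conj)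
    then have "\<gamma> * (G * fps_const (x n)) = act (g * s) x n * G + act s x n * \<gamma> * G"
      using LD by (simp add: theta_mult theta_act s LD_def mult.assoc)
    then show "(\<gamma> * act s x n - act s x n * \<gamma>) * G = act (g * s) x n * G"
      unfolding conj by (simp add: left_diff_distrib mult.assoc)
  qed (use LD in \<open>simp add: LD_def\<close>)
  show ?thesis
  proof (induction k arbitrary: n rule: less_induct)
    case (less k)
    let ?t = "\<lambda>i. \<gamma> $ i * (sc (s $ (k - i)) * x (n + int (k - i))) - sc (s $ (k - i)) * x (n + int (k - i)) * \<gamma> $ i"
    have 1: "(act s x n * \<gamma>) $ k = (\<Sum>i = 0..k. sc (s $ (k - i)) * x (n + int (k - i)) * \<gamma> $ i)"
      unfolding fps_mult_nth by (rule sum.reindex_bij_witness[of _ "\<lambda>i. k - i" "\<lambda>i. k - i"]) auto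
    have "?t i = sc (g $ i * s $ (k - i)) * x (n + int k)" if "i < k" for i
    proof -
      have "?t i = sc (s $ (k - i)) * (\<gamma> $ i * x (n + int (k - i)) - x (n + int (k - i)) * \<gamma> $ i)"
        using lin lin_sc2 by (simp add: flin_def right_diff_distrib mult.assoc)
      also have "\<dots> = sc (s $ (k - i)) * (sc (g $ i) * x (n + int (k - i) + int i))"
        unfolding less.IH[OF that] ..
      finally show ?thesis using that by (simp add: sc_mult[symmetric] mult.assoc[symmetric] mult.commute)
    qed
    then have lower: "(\<Sum>i<k. ?t i) = (\<Sum>i<k. sc (g $ i * s $ (k - i)) * x (n + int k))" by simp
    have set: "{0..k} = insert k {..<k}" by auto
    have "(\<Sum>i = 0..k. ?t i) = (\<Sum>i = 0..k. sc (g $ i * s $ (k - i)) * x (n + int k))"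
      using arg_cong[OF *[of n], of "\<lambda>F. F $ k"]
      by (simp only: fps_sub_nth 1 fps_mult_nth[of \<gamma>] act_nth sum_subtractf)
        (simp add: fps_mult_nth sc_sum sum_distrib_right)
    then have "?t k = sc (g $ k * s $ 0) * x (n + int k)"
      unfolding set using lower by simp
    then show ?case using s by simp
  qed
qed

end

interpretation complex_scalars: scalars "id :: complex \<Rightarrow> complex"
  by unfold_locales auto

text \<open>The expansion of (1 - b z) / (1 - a z); \<open>ratlog\<close> is its logarithmic
  derivative.\<close>

definition ratser :: "complex \<Rightarrow> complex \<Rightarrow> complex fps" where
  "ratser a b = (1 - fps_const b * fps_X) * Abs_fps (\<lambda>k. a ^ k)"

definition ratlog :: "complex \<Rightarrow> complex \<Rightarrow> complex fps" where
  "ratlog a b = Abs_fps (\<lambda>k. a ^ k - b ^ k)"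

lemma one_minus_mult_nth:
  "((1 - fps_const b * fps_X) * F) $ n = F $ n - (if n = 0 then 0 else b * F $ (n - 1))"
  for b :: complex
proof -
  have *: "(1 - fps_const b * fps_X) * F = F - fps_const b * (fps_X * F)"
    by (simp only: left_diff_distrib mult_1_left mult.assoc)
  show ?thesis unfolding * fps_sub_nth fps_mult_left_const_nth fps_X_mult_nth by simp
qed

lemma geometric: "(1 - fps_const a * fps_X) * Abs_fps (\<lambda>k. a ^ k) = (1 :: complex fps)"
proof (intro fps_ext)
  fix n
  show "((1 - fps_const a * fps_X) * Abs_fps (\<lambda>k. a ^ k)) $ n = (1 :: complex fps) $ n"
    unfolding one_minus_mult_nth by (cases n) simp_all
qed

lemma theta_complex: "theta F = fps_X * fps_deriv (F :: complex fps)"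
proof (intro fps_ext)
  fix n show "theta F $ n = (fps_X * fps_deriv F) $ n" by (cases n) (simp_all add: nsm_of_nat del: nsm_simps)
qed

lemma ratser_props:
  "theta (ratser a b) = ratlog a b * ratser a b" "ratser a b $ 0 = 1"
  "ratser a b * ratser b a = 1" "k > 0 \<Longrightarrow> ratser 1 b $ k = 1 - b"
proof -
  define u v :: "complex fps" where "u = 1 - fps_const a * fps_X" and "v = 1 - fps_const b * fps_X"
  define iu iv :: "complex fps" where "iu = Abs_fps (\<lambda>k. a ^ k)" and "iv = Abs_fps (\<lambda>k. b ^ k)"
  have u: "u * iu = 1" and v: "v * iv = 1" using geometric by (simp_all add: u_def v_def iu_def iv_def)
  have tu: "theta u = u - 1" and tv: "theta v = v - 1"
    by (simp_all add: theta_complex u_def v_def)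
  have "theta (u * iu) = 0" by (simp add: u)
  then have "(u - 1) * iu + u * theta iu = 0" by (simp only: theta_mult tu)
  then have "u * theta iu = iu - u * iu"
    by (simp only: left_diff_distrib mult_1_left add_eq_0_iff minus_diff_eq)
  then have "iu * (u * theta iu) = iu * (iu - 1)" by (simp only: u)
  moreover have "iu * (u * theta iu) = (u * iu) * theta iu" by (simp only: ac_simps)
  ultimately have ti: "theta iu = iu * iu - iu" by (simp only: u right_diff_distrib mult_1_left mult_1_right)
  have r: "ratser a b = v * iu" by (simp add: ratser_def v_def iu_def)
  have g: "ratlog a b = iu - iv" by (intro fps_ext) (simp add: ratlog_def iu_def iv_def)
  have "theta (v * iu) = (v - 1) * iu + v * (iu * iu - iu)" by (simp add: theta_mult tv ti)
  also have "\<dots> = v * (iu * iu) - (v * iv) * iu"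
    unfolding v by (simp add: left_diff_distrib right_diff_distrib)
  also have "\<dots> = (iu - iv) * (v * iu)" by (simp only: left_diff_distrib right_diff_distrib ac_simps)
  finally show "theta (ratser a b) = ratlog a b * ratser a b" by (simp add: r g)
  show "ratser a b $ 0 = 1" unfolding ratser_def one_minus_mult_nth by simp
  have r': "ratser b a = u * iv" by (simp add: ratser_def u_def iv_def)
  have "v * iu * (u * iv) = (u * iu) * (v * iv)" by (simp only: ac_simps)
  then show "ratser a b * ratser b a = 1" using u v by (simp add: r r')
  show "ratser 1 b $ k = 1 - b" if "k > 0"
    unfolding ratser_def one_minus_mult_nth using that by simp
qed

section \<open>Representations by endomorphisms\<close>

locale complex_vs = V: vector_space scl for scl :: "complex \<Rightarrow> 'v::ab_group_add \<Rightarrow> 'v"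
begin

definition sc :: "complex \<Rightarrow> 'v endo" where "sc c = Endo (scl c)"

lemma app_sc [simp]: "app (sc c) v = scl c v"
  by (simp add: sc_def app_Endo V.scale_right_distrib)

sublocale S: scalars sc
  by unfold_locales (rule endo_eqI, simp add: V.scale_left_distrib V.scale_scale)+

lemma lin_iff: "f \<in> S.lin \<longleftrightarrow> (\<forall>c v. app f (scl c v) = scl c (app f v))"
proof
  assume f: "f \<in> S.lin"
  show "\<forall>c v. app f (scl c v) = scl c (app f v)"
  proof (intro allI)
    fix c v
    have "app (f * sc c) v = app (sc c * f) v" using S.lin_sc[OF f, of c] by simp
    then show "app f (scl c v) = scl c (app f v)" by simp
  qed
next
  assume "\<forall>c v. app f (scl c v) = scl c (app f v)"
  then show "f \<in> S.lin" by (auto simp: S.lin_def intro!: endo_eqI)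
qed

lemma end_alg_carrier_iff:
  "f \<in> carrier (end_alg scl) \<longleftrightarrow>
      (\<forall>u v. f (u + v) = f u + f v) \<and> (\<forall>c v. f (scl c v) = scl c (f v))"
  by (simp add: end_alg_def Vector_Spaces.linear_iff V.vector_space_axioms)

lemma end_calgebra: "calgebra (end_alg scl)"
proof -
  have lin: "Vector_Spaces.linear scl scl f \<longleftrightarrow>
      (\<forall>u v. f (u + v) = f u + f v) \<and> (\<forall>c v. f (scl c v) = scl c (f v))" for f
    by (simp add: Vector_Spaces.linear_iff V.vector_space_axioms)
  have R: "ring (end_alg scl)"
  proof (intro ringI abelian_groupI monoidI)
    fix f assume f: "f \<in> carrier (end_alg scl)"
    then have "(\<lambda>v. - f v) \<in> carrier (end_alg scl)"
      by (simp add: end_alg_def lin V.scale_minus_right)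
    then show "\<exists>g\<in>carrier (end_alg scl). g \<oplus>\<^bsub>end_alg scl\<^esub> f = \<zero>\<^bsub>end_alg scl\<^esub>"
      by (intro bexI[of _ "\<lambda>v. - f v"]) (simp add: end_alg_def)
  qed (auto simp: end_alg_def lin V.scale_right_distrib V.scale_zero_right algebra_simps fun_eq_iff)
  show ?thesis
    by (intro calgebra.intro calgebra_axioms.intro R)
      (auto simp: end_alg_def lin V.scale_right_distrib V.scale_left_distrib V.scale_scale
        fun_eq_iff mult.commute)
qed

end

locale alg_rep = calgebra A + complex_vs scl
  for A :: "'b calg" (structure) and scl :: "complex \<Rightarrow> 'v::ab_group_add \<Rightarrow> 'v" +
  fixes \<rho> :: "'b \<Rightarrow> 'v \<Rightarrow> 'v"
  assumes rho_module: "alg_module A scl \<rho>"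
begin

lemma rho_hom: "alg_hom A (end_alg scl) \<rho>"
  using rho_module by (simp add: alg_module_def alg_hom_def)

lemmas rho = alg_homD[OF rho_hom]

definition R :: "'b \<Rightarrow> 'v endo" where "R u = Endo (\<rho> u)"

lemma app_R: "u \<in> carrier A \<Longrightarrow> app (R u) = \<rho> u"
  using rho(1)[of u] unfolding R_def end_alg_carrier_iff by (intro app_Endo) simp

lemma R_add: "u \<in> carrier A \<Longrightarrow> v \<in> carrier A \<Longrightarrow> R (u \<oplus> v) = R u + R v"
  by (rule endo_eqI) (simp add: app_R rho(2), simp add: end_alg_def)

lemma R_mult: "u \<in> carrier A \<Longrightarrow> v \<in> carrier A \<Longrightarrow> R (u \<otimes> v) = R u * R v"
  by (rule endo_eqI) (simp add: app_R rho(3), simp add: end_alg_def)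

lemma R_one [simp]: "R \<one> = 1"
  by (rule endo_eqI) (simp add: app_R rho(4), simp add: end_alg_def)

lemma R_smult: "u \<in> carrier A \<Longrightarrow> R (c \<odot> u) = sc c * R u"
  by (rule endo_eqI) (simp add: app_R rho(5), simp add: end_alg_def)

lemma R_zero [simp]: "R \<zero> = 0"
  using R_add[of \<zero> \<zero>] by simp

lemma R_minus: "u \<in> carrier A \<Longrightarrow> v \<in> carrier A \<Longrightarrow> R (u \<ominus> v) = R u - R v"
  using R_add[of "u \<ominus> v" v] by (simp add: a_minus_def a_assoc l_neg)

lemma R_finsum:
  assumes "finite I" "f \<in> I \<rightarrow> carrier A" shows "R (finsum A f I) = (\<Sum>i\<in>I. R (f i))"
  using assms by (induction I) (simp_all add: R_add Pi_iff)

lemma R_pow: "u \<in> carrier A \<Longrightarrow> R (u [^] (n::nat)) = R u ^ n"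
  by (induction n) (simp_all add: R_mult power_Suc2 del: power_Suc)

lemma R_lin: "u \<in> carrier A \<Longrightarrow> R u \<in> S.lin"
  using rho(1)[of u] by (simp add: lin_iff app_R end_alg_carrier_iff)

lemma R_ser_power:
  assumes "\<And>k. F k \<in> carrier A"
  shows "R (ser_power A F n k) = (Abs_fps (\<lambda>k. R (F k)) ^ n) $ k"
proof (induction n arbitrary: k)
  case (Suc n)
  have "R (ser_power A F (Suc n) k) = (\<Sum>l\<le>k. R (F l) * R (ser_power A F n (k - l)))"
    using assms by (simp add: ser_mult_def R_finsum R_mult Pi_iff ser_power_closed)
  then show ?case using Suc by (simp add: fps_mult_nth atMost_atLeast0)
qed simp

lemma R_ser_exp:
  assumes "\<And>k. F k \<in> carrier A"
  shows "R (ser_exp A F k) = S.texp (Abs_fps (\<lambda>k. R (F k))) $ k"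
proof -
  have "R (ser_exp A F k) = (\<Sum>n\<le>k. sc (1 / fact n) * R (ser_power A F n k))"
    using assms unfolding ser_exp_def by (simp add: R_finsum R_smult Pi_iff ser_power_closed)
  then show ?thesis using assms by (simp add: S.texp_def R_ser_power)
qed

end

section \<open>The shifted quantum affine algebra\<close>

lemma base_rels_mem:
  fixes \<gamma> :: "'i::{finite,linorder} gen \<Rightarrow> 'g"
  shows "k < 0 \<Longrightarrow> fgen (\<gamma> (GPhi Pos i k)) \<in> base_rels c d q m \<gamma>"
    and "k > m i \<Longrightarrow> fgen (\<gamma> (GPhi Neg i k)) \<in> base_rels c d q m \<gamma>"
    and "fgen (\<gamma> (GPhi Pos i 0)) * fgen (\<gamma> (GPhi Neg i (m i))) * fgen (\<gamma> (GPhiInv i)) - 1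
      \<in> base_rels c d q m \<gamma>"
    and "fgen (\<gamma> (GPhiInv i)) * (fgen (\<gamma> (GPhi Pos i 0)) * fgen (\<gamma> (GPhi Neg i (m i)))) - 1
      \<in> base_rels c d q m \<gamma>"
    and "fgen (\<gamma> (GPhi Pos i 0)) * fgen (\<gamma> (GPhi Neg i (m i))) * fgen g
      - fgen g * (fgen (\<gamma> (GPhi Pos i 0)) * fgen (\<gamma> (GPhi Neg i (m i)))) \<in> base_rels c d q m \<gamma>"
    and "fgen (\<gamma> (GPhi \<delta> i k)) * fgen (\<gamma> (GPhi \<epsilon> j l))
      - fgen (\<gamma> (GPhi \<epsilon> j l)) * fgen (\<gamma> (GPhi \<delta> i k)) \<in> base_rels c d q m \<gamma>"
    and "fgen (\<gamma> (GX Pos i k)) * fgen (\<gamma> (GX Neg j l)) - fgen (\<gamma> (GX Neg j l)) * fgen (\<gamma> (GX Pos i k))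
      - (if i = j then fscal (1 / (qi d q i - inverse (qi d q i))) *
          (fgen (\<gamma> (GPhi Pos i (k + l))) - fgen (\<gamma> (GPhi Neg i (k + l)))) else 0)
      \<in> base_rels c d q m \<gamma>"
    and "fgen (\<gamma> (GPhi \<epsilon> i (k + 1))) * fgen (\<gamma> (GX \<delta> j l))
      - fscal (q powi (sgi \<delta> * bform c d i j)) * fgen (\<gamma> (GPhi \<epsilon> i k)) * fgen (\<gamma> (GX \<delta> j (l + 1)))
      - (fscal (q powi (sgi \<delta> * bform c d i j)) * fgen (\<gamma> (GX \<delta> j l)) * fgen (\<gamma> (GPhi \<epsilon> i (k + 1)))
        - fgen (\<gamma> (GX \<delta> j (l + 1))) * fgen (\<gamma> (GPhi \<epsilon> i k))) \<in> base_rels c d q m \<gamma>"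
    and "fgen (\<gamma> (GX \<delta> i (k + 1))) * fgen (\<gamma> (GX \<delta> j l))
      - fscal (q powi (sgi \<delta> * bform c d i j)) * fgen (\<gamma> (GX \<delta> i k)) * fgen (\<gamma> (GX \<delta> j (l + 1)))
      - (fscal (q powi (sgi \<delta> * bform c d i j)) * fgen (\<gamma> (GX \<delta> j l)) * fgen (\<gamma> (GX \<delta> i (k + 1)))
        - fgen (\<gamma> (GX \<delta> j (l + 1))) * fgen (\<gamma> (GX \<delta> i k))) \<in> base_rels c d q m \<gamma>"
    and "i \<noteq> j \<Longrightarrow> (\<Sum>s = 0..nat (1 - c i j). fscal ((- 1) ^ s * qbinom (qi d q i) (1 - c i j) s)
             * fgen (\<gamma> (GX \<delta> i 0)) ^ (nat (1 - c i j) - s) * fgen (\<gamma> (GX \<delta> j 0))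
             * fgen (\<gamma> (GX \<delta> i 0)) ^ s) \<in> base_rels c d q m \<gamma>"
  unfolding base_rels_def Let_def
  subgoal by (rule UnI1, rule UnI1, rule UnI1, rule UnI1, rule UnI1, rule UnI1, rule UnI1, rule UnI1, rule UnI1, rule CollectI, intro exI conjI, rule refl, assumption)
  subgoal by (rule UnI1, rule UnI1, rule UnI1, rule UnI1, rule UnI1, rule UnI1, rule UnI1, rule UnI1, rule UnI2, rule CollectI, intro exI conjI, rule refl, assumption)
  subgoal by (rule UnI1, rule UnI1, rule UnI1, rule UnI1, rule UnI1, rule UnI1, rule UnI1, rule UnI2, rule CollectI, intro exI conjI, rule refl, rule TrueI)
  subgoal by (rule UnI1, rule UnI1, rule UnI1, rule UnI1, rule UnI1, rule UnI1, rule UnI2, rule CollectI, intro exI conjI, rule refl, rule TrueI)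
  subgoal by (rule UnI1, rule UnI1, rule UnI1, rule UnI1, rule UnI1, rule UnI2, rule CollectI, intro exI conjI, rule refl, rule TrueI)
  subgoal by (rule UnI1, rule UnI1, rule UnI1, rule UnI1, rule UnI2, rule CollectI, intro exI conjI, rule refl, rule TrueI)
  subgoal by (rule UnI1, rule UnI1, rule UnI1, rule UnI2, rule CollectI, intro exI conjI, rule refl, rule TrueI)
  subgoal by (rule UnI1, rule UnI1, rule UnI2, rule CollectI, intro exI conjI, rule refl, rule TrueI)
  subgoal by (rule UnI1, rule UnI2, rule CollectI, intro exI conjI, rule refl, rule TrueI)
  subgoal by (rule UnI2, rule CollectI, intro exI conjI, rule refl, assumption)
  done

lemma base_rels_cases:
  fixes \<gamma> :: "'i::{finite,linorder} gen \<Rightarrow> 'g"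
  assumes "r \<in> base_rels c d q m \<gamma>"
  obtains
    (phi_pos) i k where "k < 0" "r = fgen (\<gamma> (GPhi Pos i k))"
  | (phi_neg) i k where "k > m i" "r = fgen (\<gamma> (GPhi Neg i k))"
  | (inv1) i where "r = fgen (\<gamma> (GPhi Pos i 0)) * fgen (\<gamma> (GPhi Neg i (m i))) * fgen (\<gamma> (GPhiInv i)) - 1"
  | (inv2) i where "r = fgen (\<gamma> (GPhiInv i)) * (fgen (\<gamma> (GPhi Pos i 0)) * fgen (\<gamma> (GPhi Neg i (m i)))) - 1"
  | (central) i g where "r = fgen (\<gamma> (GPhi Pos i 0)) * fgen (\<gamma> (GPhi Neg i (m i))) * fgen g
      - fgen g * (fgen (\<gamma> (GPhi Pos i 0)) * fgen (\<gamma> (GPhi Neg i (m i))))"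
  | (phi_phi) \<delta> \<epsilon> i j k l where "r = fgen (\<gamma> (GPhi \<delta> i k)) * fgen (\<gamma> (GPhi \<epsilon> j l))
      - fgen (\<gamma> (GPhi \<epsilon> j l)) * fgen (\<gamma> (GPhi \<delta> i k))"
  | (x_x) i j k l where "r = fgen (\<gamma> (GX Pos i k)) * fgen (\<gamma> (GX Neg j l)) - fgen (\<gamma> (GX Neg j l)) * fgen (\<gamma> (GX Pos i k))
      - (if i = j then fscal (1 / (qi d q i - inverse (qi d q i))) *
          (fgen (\<gamma> (GPhi Pos i (k + l))) - fgen (\<gamma> (GPhi Neg i (k + l)))) else 0)"
  | (phi_x) \<delta> \<epsilon> i j k l where "r = fgen (\<gamma> (GPhi \<epsilon> i (k + 1))) * fgen (\<gamma> (GX \<delta> j l))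
      - fscal (q powi (sgi \<delta> * bform c d i j)) * fgen (\<gamma> (GPhi \<epsilon> i k)) * fgen (\<gamma> (GX \<delta> j (l + 1)))
      - (fscal (q powi (sgi \<delta> * bform c d i j)) * fgen (\<gamma> (GX \<delta> j l)) * fgen (\<gamma> (GPhi \<epsilon> i (k + 1)))
        - fgen (\<gamma> (GX \<delta> j (l + 1))) * fgen (\<gamma> (GPhi \<epsilon> i k)))"
  | (x_quad) \<delta> i j k l where "r = fgen (\<gamma> (GX \<delta> i (k + 1))) * fgen (\<gamma> (GX \<delta> j l))
      - fscal (q powi (sgi \<delta> * bform c d i j)) * fgen (\<gamma> (GX \<delta> i k)) * fgen (\<gamma> (GX \<delta> j (l + 1)))
      - (fscal (q powi (sgi \<delta> * bform c d i j)) * fgen (\<gamma> (GX \<delta> j l)) * fgen (\<gamma> (GX \<delta> i (k + 1)))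
        - fgen (\<gamma> (GX \<delta> j (l + 1))) * fgen (\<gamma> (GX \<delta> i k)))"
  | (serre) \<delta> i j where "i \<noteq> j"
      "r = (\<Sum>s = 0..nat (1 - c i j). fscal ((- 1) ^ s * qbinom (qi d q i) (1 - c i j) s)
             * fgen (\<gamma> (GX \<delta> i 0)) ^ (nat (1 - c i j) - s) * fgen (\<gamma> (GX \<delta> j 0))
             * fgen (\<gamma> (GX \<delta> i 0)) ^ s)"
  using assms unfolding base_rels_def Let_def
  by (elim UnE CollectE exE conjE) (erule that; assumption)+

locale shifted = cartan_datum c d
  for c :: "'i::{finite,linorder} \<Rightarrow> 'i \<Rightarrow> int" and d :: "'i \<Rightarrow> int" +
  fixes q :: complex and m :: "'i \<Rightarrow> int"
  assumes q_nz: "q \<noteq> 0" and q_gen: "\<forall>n>0. q ^ n \<noteq> 1"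
begin

abbreviation U :: "'i gen falg set calg" where "U \<equiv> U_alg c d q m"
abbreviation ug :: "'i gen \<Rightarrow> 'i gen falg set" where "ug \<equiv> U_gen c d q m"
abbreviation uproj :: "'i gen falg \<Rightarrow> 'i gen falg set" where
  "uproj \<equiv> quot_proj free_alg (base_rels c d q m id)"
abbreviation ph :: "pm \<Rightarrow> 'i \<Rightarrow> int \<Rightarrow> 'i gen falg set" where "ph \<epsilon> i k \<equiv> ug (GPhi \<epsilon> i k)"

lemma U_calgebra: "calgebra U"
  unfolding U_alg_def by (rule calgebra.quot_calgebra[OF free_calgebra]) simp

lemma uproj_hom: "alg_hom free_alg U uproj"
  unfolding U_alg_def by (rule calgebra.quot_proj_hom[OF free_calgebra]) simp

lemma uproj_surj: "carrier U = range uproj"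
  unfolding U_alg_def by (subst calgebra.quot_proj_surj[OF free_calgebra]) simp_all

lemma uproj_rel: "r \<in> base_rels c d q m id \<Longrightarrow> uproj r = \<zero>\<^bsub>U\<^esub>"
  unfolding U_alg_def by (rule calgebra.quot_proj_rel[OF free_calgebra]) simp_all

lemma U_lift:
  assumes "calgebra B" "alg_hom free_alg B f" "\<And>r. r \<in> base_rels c d q m id \<Longrightarrow> f r = \<zero>\<^bsub>B\<^esub>"
  shows "quot_map f (uproj p) = f p" "alg_hom U B (quot_map f)"
  unfolding U_alg_def
  using calgebra.quot_map_proj[OF free_calgebra _ assms] calgebra.quot_map_hom(2)[OF free_calgebra _ assms]
  by simp_all

sublocale U: calgebra U by (rule U_calgebra)

lemma ug_closed [simp, intro]: "ug g \<in> carrier U"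
  unfolding U_gen_def using alg_homD(1)[OF uproj_hom] by simp

lemma U_rel_eq:
  assumes "p - p' \<in> base_rels c d q m (\<lambda>g. g)" shows "uproj p = uproj p'"
proof -
  have "uproj p = uproj ((p - p') + p')" by simp
  also have "\<dots> = uproj (p - p') \<oplus>\<^bsub>U\<^esub> uproj p'"
    using alg_homD(2)[OF uproj_hom, of "p - p'" p'] by simp
  finally show ?thesis using uproj_rel[OF assms[folded id_def]] alg_homD(1)[OF uproj_hom, of p'] by simp
qed

lemma uproj_mult: "uproj (p * p') = uproj p \<otimes>\<^bsub>U\<^esub> uproj p'"
  using alg_homD(3)[OF uproj_hom, of p p'] by simp

lemma uproj_one: "uproj 1 = \<one>\<^bsub>U\<^esub>"
  using alg_homD(4)[OF uproj_hom] by simp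

lemma ph_commute: "ph \<delta> i k \<otimes>\<^bsub>U\<^esub> ph \<epsilon> j l = ph \<epsilon> j l \<otimes>\<^bsub>U\<^esub> ph \<delta> i k"
  using U_rel_eq[OF base_rels_mem(6)[of "\<lambda>g. g"]] by (simp add: uproj_mult U_gen_def)

text \<open>The two elements commute and their product is invertible, so each of them has inverses
  on both sides.\<close>

lemma ph_units: "ph Pos i 0 \<in> Units U" "ph Neg i (m i) \<in> Units U"
proof -
  let ?a = "ph Pos i 0" and ?b = "ph Neg i (m i)" and ?z = "ug (GPhiInv i)"
  have 1: "?a \<otimes>\<^bsub>U\<^esub> ?b \<otimes>\<^bsub>U\<^esub> ?z = \<one>\<^bsub>U\<^esub>"
    using U_rel_eq[OF base_rels_mem(3)[of "\<lambda>g. g"]]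
    by (simp add: uproj_mult uproj_one U_gen_def)
  have 2: "?z \<otimes>\<^bsub>U\<^esub> (?a \<otimes>\<^bsub>U\<^esub> ?b) = \<one>\<^bsub>U\<^esub>"
    using U_rel_eq[OF base_rels_mem(4)[of "\<lambda>g. g"]]
    by (simp add: uproj_mult uproj_one U_gen_def)
  have unit: "x \<in> Units U" if "x \<in> carrier U" "y \<in> carrier U" "w \<in> carrier U"
    "x \<otimes>\<^bsub>U\<^esub> y = \<one>\<^bsub>U\<^esub>" "w \<otimes>\<^bsub>U\<^esub> x = \<one>\<^bsub>U\<^esub>" for x y w
    using that U.inv_unique[of w x y] unfolding Units_def by auto
  note ab = ph_commute[of Pos i 0 Neg i "m i"]
  have "?a \<otimes>\<^bsub>U\<^esub> (?b \<otimes>\<^bsub>U\<^esub> ?z) = \<one>\<^bsub>U\<^esub>" using 1 by (simp add: U.m_assoc)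
  moreover have "?z \<otimes>\<^bsub>U\<^esub> ?b \<otimes>\<^bsub>U\<^esub> ?a = \<one>\<^bsub>U\<^esub>" using 2 by (simp add: U.m_assoc ab)
  ultimately show "?a \<in> Units U" by (intro unit[of _ "?b \<otimes>\<^bsub>U\<^esub> ?z" "?z \<otimes>\<^bsub>U\<^esub> ?b"]) simp_all
  have "?b \<otimes>\<^bsub>U\<^esub> (?a \<otimes>\<^bsub>U\<^esub> ?z) = ?a \<otimes>\<^bsub>U\<^esub> ?b \<otimes>\<^bsub>U\<^esub> ?z" by (simp add: U.m_assoc[symmetric] ab)
  moreover have "?z \<otimes>\<^bsub>U\<^esub> ?a \<otimes>\<^bsub>U\<^esub> ?b = \<one>\<^bsub>U\<^esub>" using 2 by (simp add: U.m_assoc)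
  ultimately show "?b \<in> Units U"
    using 1 by (intro unit[of _ "?a \<otimes>\<^bsub>U\<^esub> ?z" "?z \<otimes>\<^bsub>U\<^esub> ?a"]) simp_all
qed

lemma phi_bar_closed [simp, intro]: "phi_bar c d q m \<epsilon> i k \<in> carrier U"
  using ph_units[of i] by (cases \<epsilon>) auto

lemma phi_bar_0: "phi_bar c d q m \<epsilon> i 0 = \<one>\<^bsub>U\<^esub>"
  using ph_units[of i] by (cases \<epsilon>) auto

lemma q_diff: "q - inverse q \<noteq> 0"
  using powi_diff_neq_0[OF q_nz q_gen, of 1] by simp

lemma sgi_nz: "complex_of_int (sgi \<epsilon>) \<noteq> 0" "sgi \<epsilon> \<noteq> 0" "\<epsilon> = Pos \<or> \<epsilon> = Neg"
  by (cases \<epsilon>; simp)+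

abbreviation hs :: "pm \<Rightarrow> complex" where "hs \<epsilon> \<equiv> of_int (sgi \<epsilon>) * (q - inverse q)"

lemma hs_nz: "hs \<epsilon> \<noteq> 0" using q_diff sgi_nz(1) by simp

lemma hs_inv: "hs \<epsilon> * inverse (hs \<epsilon>) = 1" "inverse (hs \<epsilon>) * hs \<epsilon> = 1"
  using hs_nz right_inverse left_inverse by blast+

text \<open>The normalized \<phi> has constant term 1 and thus a unique logarithm; this makes the
  definite description in \<open>h_ser\<close> meaningful.\<close>

lemma h_ser_ex1: "\<exists>!h. range h \<subseteq> carrier U \<and> h 0 = \<zero>\<^bsub>U\<^esub> \<and>
     ser_exp U (\<lambda>k. hs \<epsilon> \<odot>\<^bsub>U\<^esub> h k) = phi_bar c d q m \<epsilon> i"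
proof (rule ex_ex1I)
  obtain F where F: "\<And>k. F k \<in> carrier U" "F 0 = \<zero>\<^bsub>U\<^esub>" "\<And>k. ser_exp U F k = phi_bar c d q m \<epsilon> i k"
    using U.ser_exp_exists[of "phi_bar c d q m \<epsilon> i"] phi_bar_closed phi_bar_0 by metis
  have "hs \<epsilon> \<odot>\<^bsub>U\<^esub> (inverse (hs \<epsilon>) \<odot>\<^bsub>U\<^esub> F k) = F k" for k
    using F(1)[of k] by (simp only: U.smult_smult hs_inv U.smult_one)
  then show "\<exists>h. range h \<subseteq> carrier U \<and> h 0 = \<zero>\<^bsub>U\<^esub> \<and>
     ser_exp U (\<lambda>k. hs \<epsilon> \<odot>\<^bsub>U\<^esub> h k) = phi_bar c d q m \<epsilon> i"
    using F by (intro exI[of _ "\<lambda>k. inverse (hs \<epsilon>) \<odot>\<^bsub>U\<^esub> F k"]) (auto simp: fun_eq_iff)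
next
  fix h h' assume h: "range h \<subseteq> carrier U \<and> h 0 = \<zero>\<^bsub>U\<^esub> \<and>
     ser_exp U (\<lambda>k. hs \<epsilon> \<odot>\<^bsub>U\<^esub> h k) = phi_bar c d q m \<epsilon> i"
    "range h' \<subseteq> carrier U \<and> h' 0 = \<zero>\<^bsub>U\<^esub> \<and>
     ser_exp U (\<lambda>k. hs \<epsilon> \<odot>\<^bsub>U\<^esub> h' k) = phi_bar c d q m \<epsilon> i"
  then have c: "h k \<in> carrier U" "h' k \<in> carrier U" for k by (auto simp: subset_iff)
  have "hs \<epsilon> \<odot>\<^bsub>U\<^esub> h k = hs \<epsilon> \<odot>\<^bsub>U\<^esub> h' k" for k
    using h c by (intro U.ser_exp_unique[of "\<lambda>k. hs \<epsilon> \<odot>\<^bsub>U\<^esub> h k" "\<lambda>k. hs \<epsilon> \<odot>\<^bsub>U\<^esub> h' k"]) auto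
  then have "inverse (hs \<epsilon>) \<odot>\<^bsub>U\<^esub> (hs \<epsilon> \<odot>\<^bsub>U\<^esub> h k) = inverse (hs \<epsilon>) \<odot>\<^bsub>U\<^esub> (hs \<epsilon> \<odot>\<^bsub>U\<^esub> h' k)" for k by simp
  then show "h = h'" using c by (intro ext) (simp only: U.smult_smult hs_inv U.smult_one)
qed

abbreviation h :: "pm \<Rightarrow> 'i \<Rightarrow> nat \<Rightarrow> 'i gen falg set" where "h \<equiv> h_ser c d q m"

lemma h_props: "h \<epsilon> i k \<in> carrier U" "h \<epsilon> i 0 = \<zero>\<^bsub>U\<^esub>"
  "ser_exp U (\<lambda>k. hs \<epsilon> \<odot>\<^bsub>U\<^esub> h \<epsilon> i k) = phi_bar c d q m \<epsilon> i"
proof -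
  have t: "range (h \<epsilon> i) \<subseteq> carrier U \<and> h \<epsilon> i 0 = \<zero>\<^bsub>U\<^esub> \<and>
     ser_exp U (\<lambda>k. hs \<epsilon> \<odot>\<^bsub>U\<^esub> h \<epsilon> i k) = phi_bar c d q m \<epsilon> i"
    unfolding h_ser_def by (rule theI'[OF h_ser_ex1])
  show "h \<epsilon> i k \<in> carrier U" using conjunct1[OF t] by blast
  show "h \<epsilon> i 0 = \<zero>\<^bsub>U\<^esub>" using conjunct2[OF t] by (rule conjunct1)
  show "ser_exp U (\<lambda>k. hs \<epsilon> \<odot>\<^bsub>U\<^esub> h \<epsilon> i k) = phi_bar c d q m \<epsilon> i"
    using conjunct2[OF t] by (rule conjunct2)
qed

text \<open>An endomorphism fixing the normalized \<phi> maps their logarithm to a logarithm, which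
  is unique. It serves for the twist by a one-dimensional module, which only rescales the \<phi> by
  constants.\<close>

lemma h_hom_invariant:
  assumes f: "alg_hom U U f" and inv: "\<And>\<epsilon> i k. f (phi_bar c d q m \<epsilon> i k) = phi_bar c d q m \<epsilon> i k"
  shows "f (h \<epsilon> i k) = h \<epsilon> i k"
proof -
  interpret F: calg_hom U U f by unfold_locales (rule f)
  have pw: "f (ser_power U F n k) = ser_power U (\<lambda>k. f (F k)) n k" if "\<And>k. F k \<in> carrier U" for F n k
    using that
  proof (induction n arbitrary: k)
    case (Suc n)
    then show ?case
      by (simp add: ser_mult_def F.h_finsum U.ser_power_closed Pi_iff)
  qed simp
  have ex: "f (ser_exp U F k) = ser_exp U (\<lambda>k. f (F k)) k" if "\<And>k. F k \<in> carrier U" for F k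
    using that by (simp add: ser_exp_def F.h_finsum U.ser_power_closed Pi_iff pw)
  have "range (\<lambda>k. f (h \<epsilon> i k)) \<subseteq> carrier U \<and> f (h \<epsilon> i 0) = \<zero>\<^bsub>U\<^esub> \<and>
     ser_exp U (\<lambda>k. hs \<epsilon> \<odot>\<^bsub>U\<^esub> f (h \<epsilon> i k)) = phi_bar c d q m \<epsilon> i"
  proof (intro conjI ext)
    fix k
    have "ser_exp U (\<lambda>k. hs \<epsilon> \<odot>\<^bsub>U\<^esub> f (h \<epsilon> i k)) k = f (ser_exp U (\<lambda>k. hs \<epsilon> \<odot>\<^bsub>U\<^esub> h \<epsilon> i k) k)"
      by (subst ex) (simp_all add: h_props(1))
    then show "ser_exp U (\<lambda>k. hs \<epsilon> \<odot>\<^bsub>U\<^esub> f (h \<epsilon> i k)) k = phi_bar c d q m \<epsilon> i k"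
      by (simp add: h_props(3) inv)
  qed (use h_props in auto)
  moreover have "range (h \<epsilon> i) \<subseteq> carrier U \<and> h \<epsilon> i 0 = \<zero>\<^bsub>U\<^esub> \<and>
     ser_exp U (\<lambda>k. hs \<epsilon> \<odot>\<^bsub>U\<^esub> h \<epsilon> i k) = phi_bar c d q m \<epsilon> i"
    using h_props by auto
  ultimately have "(\<lambda>k. f (h \<epsilon> i k)) = h \<epsilon> i" using h_ser_ex1[of \<epsilon> i] by blast
  then show ?thesis by (simp add: fun_eq_iff)
qed

lemma T_ser_closed: "T_ser c d q m \<epsilon> i k \<in> carrier U"
  and A_ser_closed: "A_ser c d q m \<epsilon> i k \<in> carrier U"
  unfolding T_ser_def A_ser_def using h_props(1)
  by (intro U.ser_exp_closed, auto intro!: U.finsum_closed U.smult_closed)+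

lemma scrA_closed [simp, intro]: "scrA c d q m a \<epsilon> i k \<in> carrier U"
  unfolding scrA_def using A_ser_closed by (intro U.finsum_closed) auto

lemma scrA_hom_invariant:
  assumes f: "alg_hom U U f" and inv: "\<And>\<epsilon> i k. f (phi_bar c d q m \<epsilon> i k) = phi_bar c d q m \<epsilon> i k"
  shows "f (scrA c d q m a \<epsilon> i k) = scrA c d q m a \<epsilon> i k"
proof -
  interpret F: calg_hom U U f by unfold_locales (rule f)
  note hi = h_hom_invariant[OF f inv]
  have pw: "f (ser_power U F n k) = ser_power U F n k"
    if "\<And>k. F k \<in> carrier U" "\<And>k. f (F k) = F k" for F n k
    using that
  proof (induction n arbitrary: k)
    case (Suc n)
    then show ?case
      by (simp add: ser_mult_def F.h_finsum U.ser_power_closed Pi_iff)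
  qed simp
  have ex: "f (ser_exp U F k) = ser_exp U F k" if "\<And>k. F k \<in> carrier U" "\<And>k. f (F k) = F k" for F k
    using that by (simp add: ser_exp_def F.h_finsum U.ser_power_closed Pi_iff pw)
  have "f (A_ser c d q m \<epsilon> i k) = A_ser c d q m \<epsilon> i k" for k
    unfolding A_ser_def
    by (rule ex) (auto simp: F.h_finsum Pi_iff h_props(1) hi intro!: U.finsum_closed U.smult_closed)
  then show ?thesis
    by (simp add: scrA_def F.h_finsum Pi_iff A_ser_closed)
qed

end

section \<open>Commuting families of series\<close>

lemma fps_eq_iff_pos: "F $ 0 = G $ 0 \<Longrightarrow> F = G \<longleftrightarrow> (\<forall>k>0. F $ k = G $ k)"
  unfolding fps_eq_iff by (metis neq0_conv)

text \<open>The ambient ring is not commutative; confining coefficients to a commutative subset K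
  makes logarithmic derivatives additive on products.\<close>

locale comm_family = scalars sc for sc :: "complex \<Rightarrow> 'r::{ring,monoid_mult}" +
  fixes K :: "'r set"
  assumes K_sc [simp, intro]: "sc c \<in> K"
    and K_add [simp, intro]: "x \<in> K \<Longrightarrow> y \<in> K \<Longrightarrow> x + y \<in> K"
    and K_mult [simp, intro]: "x \<in> K \<Longrightarrow> y \<in> K \<Longrightarrow> x * y \<in> K"
    and K_comm: "x \<in> K \<Longrightarrow> y \<in> K \<Longrightarrow> x * y = y * x"
begin

lemma K_0 [simp, intro]: "0 \<in> K" and K_1 [simp, intro]: "1 \<in> K"
  using K_sc[of 0] K_sc[of 1] by (simp_all del: K_sc)

lemma K_uminus [simp, intro]: "x \<in> K \<Longrightarrow> - x \<in> K"
  using K_mult[OF K_sc[of "-1"], of x] by (simp add: sc_uminus)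

lemma K_diff [simp, intro]: "x \<in> K \<Longrightarrow> y \<in> K \<Longrightarrow> x - y \<in> K"
  using K_add[of x "- y"] by simp

lemma K_sum [intro]: "(\<And>i. i \<in> I \<Longrightarrow> f i \<in> K) \<Longrightarrow> sum f I \<in> K"
  by (induction I rule: infinite_finite_induct) auto

lemma K_nsm [simp, intro]: "x \<in> K \<Longrightarrow> nsm k x \<in> K"
  by (simp add: nsm_sc)

lemma K_lin: "x \<in> K \<Longrightarrow> x \<in> lin"
  using K_comm by (simp add: lin_def)

definition fK :: "'r fps \<Rightarrow> bool" where "fK F \<longleftrightarrow> (\<forall>k. F $ k \<in> K)"

lemma fK_D: "fK F \<Longrightarrow> F $ k \<in> K"
  by (simp add: fK_def)

lemma fK_lin: "fK F \<Longrightarrow> flin F"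
  by (simp add: fK_def flin_def K_lin)

lemma fK_closed [simp, intro]:
  "fK 0" "fK 1" "fK (scf p)" "fK F \<Longrightarrow> fK G \<Longrightarrow> fK (F + G)" "fK F \<Longrightarrow> fK G \<Longrightarrow> fK (F - G)"
  "fK F \<Longrightarrow> fK G \<Longrightarrow> fK (F * G)" "fK F \<Longrightarrow> fK (zs a F)" "fK F \<Longrightarrow> fK (theta F)"
  by (auto simp: fK_def fps_mult_nth intro!: K_sum)

lemma fK_power [simp, intro]: "fK F \<Longrightarrow> fK (F ^ n)"
  by (induction n) auto

lemma fK_texp [simp, intro]: "fK F \<Longrightarrow> fK (texp F)"
proof -
  assume "fK F"
  then have "(F ^ n) $ k \<in> K" for n k using fK_power fK_D by blast
  then show ?thesis by (auto simp: fK_def texp_def intro!: K_sum)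
qed

lemma fK_comm: "fK F \<Longrightarrow> fK G \<Longrightarrow> F * G = G * F"
proof (intro fps_ext)
  fix n assume *: "fK F" "fK G"
  have "(G * F) $ n = (\<Sum>i = 0..n. G $ (n - i) * F $ i)"
    unfolding fps_mult_nth by (rule sum.reindex_bij_witness[of _ "\<lambda>i. n - i" "\<lambda>i. n - i"]) auto
  also have "\<dots> = (F * G) $ n" unfolding fps_mult_nth
    using * by (intro sum.cong refl K_comm) (auto simp: fK_D)
  finally show "(F * G) $ n = (G * F) $ n" by simp
qed

lemma fK_left_quot: assumes "fK F" "fK G" shows "fK (Abs_fps (left_quot F G))"
proof -
  have "left_quot F G k \<in> K" for k
  proof (induction k rule: less_induct)
    case (less k)
    then show ?case using assms by (subst left_quot.simps) (auto simp: fK_D intro!: K_sum)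
  qed
  then show ?thesis by (simp add: fK_def)
qed

lemma LD_exists:
  assumes "fK G" "G $ 0 = 1" obtains \<gamma> where "LD \<gamma> G" "fK \<gamma>"
proof -
  let ?g = "Abs_fps (left_quot (theta G) G)"
  have "?g * G = theta G" by (rule left_quot) fact
  moreover have "?g $ 0 = 0" by (simp add: left_quot.simps[of _ _ 0])
  ultimately show ?thesis using that[of ?g] assms fK_left_quot[of "theta G" G]
    by (simp add: LD_def)
qed

lemma LD_fK: "LD \<gamma> G \<Longrightarrow> fK G \<Longrightarrow> fK \<gamma>"
proof -
  assume *: "LD \<gamma> G" "fK G"
  then have "G $ 0 = 1" by (simp add: LD_def)
  with *(2) obtain \<delta> where "LD \<delta> G" "fK \<delta>" by (rule LD_exists)
  then show ?thesis using LD_unique_log[OF *(1)] by blast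
qed

lemma LD_multK: "LD \<gamma> G \<Longrightarrow> LD \<delta> H \<Longrightarrow> fK G \<Longrightarrow> fK H \<Longrightarrow> LD (\<gamma> + \<delta>) (G * H)"
  by (rule LD_mult) (auto intro: fK_comm LD_fK)

lemma LD_zsK: "LD \<gamma> G \<Longrightarrow> fK G \<Longrightarrow> LD (zs a \<gamma>) (zs a G)"
  by (rule LD_zs) (auto intro: fK_lin LD_fK)

lemma fK_prod_list: "(\<And>x. x \<in> set xs \<Longrightarrow> fK (G x)) \<Longrightarrow> fK (prod_list (map G xs))"
  by (induction xs) auto

lemma LD_prod_list:
  assumes "\<And>x. x \<in> set xs \<Longrightarrow> LD (g x) (G x)" "\<And>x. x \<in> set xs \<Longrightarrow> fK (G x)"
  shows "LD (sum_list (map g xs)) (prod_list (map G xs))"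
  using assms
proof (induction xs)
  case Nil
  then show ?case by (simp add: LD_def)
next
  case (Cons x xs)
  then show ?case using LD_multK[of "g x" "G x"] fK_prod_list[of xs G] by simp
qed

lemma LD_texpK:
  assumes "fK F" "F $ 0 = 0" shows "LD (theta F) (texp F)"
  using assms by (intro LD_texp) (auto intro: fK_comm fK_lin)

end

context shifted
begin

section \<open>The deformed Cartan matrix and its inverse\<close>

lemma bform_sym: "bform c d i j = bform c d j i"
  using sym by (simp add: bform_def)

lemma powi_diff: "k \<noteq> 0 \<Longrightarrow> q powi k - q powi (- k) \<noteq> 0"
  by (rule powi_diff_neq_0[OF q_nz q_gen])

lemma powi_neq_1: "k \<noteq> 0 \<Longrightarrow> q powi k \<noteq> 1"
  using powi_diff[of k] by (auto simp: power_int_minus)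

lemma powi_inject: "q powi k = q powi l \<longleftrightarrow> k = l"
proof
  assume "q powi k = q powi l"
  then have "q powi (k - l) = 1" using q_nz by (simp add: power_int_diff)
  then show "k = l" using powi_neq_1[of "k - l"] by auto
qed simp

lemma qi_powi: "qi d q i powi k = q powi (d i * k)"
  by (simp add: qi_def power_int_mult)

lemma qi_nz: "qi d q i \<noteq> 0"
  using q_nz by (simp add: qi_def)

lemma Bmat_invertible:
  assumes "s \<noteq> 0" shows "invertible (Bmat c d (q powi s))"
proof -
  have "(q powi s) ^ n \<noteq> 1" if "n > 0" for n
  proof -
    have "(q powi s) ^ n = q powi (s * int n)" by (simp add: power_int_mult)
    then show ?thesis using assms that powi_neq_1[of "s * int n"] by simp
  qed
  then show ?thesis using qCartan_invertible[of "q powi s"] q_nz by (simp add: Bmat_def bform_def)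
qed

lemma Btilde_inverse:
  assumes "s \<noteq> 0"
  shows "(\<Sum>j\<in>UNIV. qnum (q powi s) (bform c d l j) * Btilde c d q s j i) = (if l = i then 1 else 0)"
    and "(\<Sum>j\<in>UNIV. Btilde c d q s i j * qnum (q powi s) (bform c d j l)) = (if i = l then 1 else 0)"
proof -
  let ?B = "Bmat c d (q powi s)"
  have inv: "?B ** matrix_inv ?B = mat 1 \<and> matrix_inv ?B ** ?B = mat 1"
    unfolding matrix_inv_def using Bmat_invertible[OF assms] unfolding invertible_def by (rule someI_ex)
  have nth: "vec_nth (vec_nth ?B i) j = qnum (q powi s) (bform c d i j)" for i j
    by (simp add: Bmat_def)
  have "vec_nth (vec_nth (?B ** matrix_inv ?B) l) i = vec_nth (vec_nth (mat 1) l) i" using inv by simp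
  then show "(\<Sum>j\<in>UNIV. qnum (q powi s) (bform c d l j) * Btilde c d q s j i) = (if l = i then 1 else 0)"
    unfolding matrix_matrix_mult_def mat_def by (simp add: nth Btilde_def)
  have "vec_nth (vec_nth (matrix_inv ?B ** ?B) i) l = vec_nth (vec_nth (mat 1) i) l" using inv by simp
  then show "(\<Sum>j\<in>UNIV. Btilde c d q s i j * qnum (q powi s) (bform c d j l)) = (if i = l then 1 else 0)"
    unfolding matrix_matrix_mult_def mat_def by (simp add: nth Btilde_def)
qed

text \<open>The inverse of the matrix \<open>A_coeff s\<close>.\<close>

definition ecoeff :: "int \<Rightarrow> 'i \<Rightarrow> 'i \<Rightarrow> complex" where
  "ecoeff s l i = (q powi (s * bform c d l i) - q powi (- (s * bform c d l i))) / (1 - qi d q i powi (- 2 * s))"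

lemma qi_diff: "s \<noteq> 0 \<Longrightarrow> 1 - qi d q i powi (- 2 * s) \<noteq> 0"
  using powi_neq_1[of "d i * (- 2 * s)"] d_pos[of i] by (simp add: qi_powi)

lemma qnum_powi: "qnum (q powi s) k = (q powi (s * k) - q powi (- (s * k))) / (q powi s - q powi (- s))"
  by (simp add: qnum_def power_int_mult[symmetric] power_int_minus)

lemma ecoeff_inverse:
  assumes s: "s \<noteq> 0"
  shows "(\<Sum>i\<in>UNIV. ecoeff s l i * A_coeff c d q s i j) = (if l = j then 1 else 0)"
    and "(\<Sum>j\<in>UNIV. A_coeff c d q s i j * ecoeff s j i') = (if i = i' then 1 else 0)"
proof -
  note D = powi_diff[OF s] and E = qi_diff[OF s]
  have "ecoeff s l i * A_coeff c d q s i j = Btilde c d q s j i * qnum (q powi s) (bform c d i l)" for i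
    using D E[of i] bform_sym[of l i] by (simp add: ecoeff_def A_coeff_def qnum_powi)
  then show "(\<Sum>i\<in>UNIV. ecoeff s l i * A_coeff c d q s i j) = (if l = j then 1 else 0)"
    using Btilde_inverse(2)[OF s, of j l] by simp
  have "A_coeff c d q s i j * ecoeff s j i' = (1 - qi d q i powi (- 2 * s)) / (1 - qi d q i' powi (- 2 * s))
      * (qnum (q powi s) (bform c d i' j) * Btilde c d q s j i)" for j
    using D bform_sym[of j i'] by (simp add: ecoeff_def A_coeff_def qnum_powi mult_ac)
  then show "(\<Sum>j\<in>UNIV. A_coeff c d q s i j * ecoeff s j i') = (if i = i' then 1 else 0)"
    using E[of i] by (simp only: sum_distrib_left[symmetric] Btilde_inverse(1)[OF s]) auto
qed

lemma ecoeff_diag: assumes "s \<noteq> 0" shows "ecoeff s l l = 1 + qi d q l powi (2 * s)"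
proof -
  have "q powi (s * bform c d l l) - q powi (- (s * bform c d l l))
      = (1 + qi d q l powi (2 * s)) * (1 - qi d q l powi (- 2 * s))"
    by (simp add: bform_def c_diag qi_powi algebra_simps power_int_minus q_nz)
  then show ?thesis using qi_diff[OF assms, of l] by (simp add: ecoeff_def)
qed

text \<open>The quotient is a finite geometric sum of - c_il powers of q_i. Each summand is the
  contribution of one shifted factor in the product formula, which is the origin of
  \<open>factors\<close>.\<close>

lemma ecoeff_offdiag:
  assumes "s \<noteq> 0" "l \<noteq> i"
  shows "ecoeff s l i = - (\<Sum>p<nat (- c i l). qi d q i powi (s * (- c i l - 2 * int p)))"
proof -
  define n where "n = nat (- c i l)"
  have n: "c i l = - int n" using c_offdiag[of i l] assms(2) by (simp add: n_def)
  define f where "f t = qi d q i powi (s * (int n - 2 * int t))" for t :: nat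
  have "(1 - qi d q i powi (- 2 * s)) * f p = f p - f (Suc p)" for p
  proof -
    have "f (Suc p) = qi d q i powi (- 2 * s) * f p"
      using qi_nz[of i] by (simp add: f_def power_int_add[symmetric] algebra_simps)
    then show ?thesis by (simp add: left_diff_distrib)
  qed
  then have "(1 - qi d q i powi (- 2 * s)) * (\<Sum>p<n. f p) = f 0 - f n"
    by (simp only: sum_distrib_left sum_lessThan_telescope')
  also have "\<dots> = - (q powi (s * bform c d l i) - q powi (- (s * bform c d l i)))"
    unfolding bform_sym[of l i] by (simp add: f_def bform_def n qi_powi algebra_simps)
  finally show ?thesis using qi_diff[OF assms(1), of i]
    by (simp add: ecoeff_def n f_def field_simps)
qed

lemma dual_expansion:
  fixes sc :: "complex \<Rightarrow> 'r::{ring,monoid_mult}" and \<Delta> b :: "'i \<Rightarrow> 'r"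
  assumes "scalars sc" "s \<noteq> 0"
  shows "(\<forall>l. \<Delta> l = (\<Sum>i\<in>UNIV. sc (ecoeff s l i) * b i)) \<longleftrightarrow>
    (\<forall>i. b i = (\<Sum>j\<in>UNIV. sc (A_coeff c d q s i j) * \<Delta> j))"
proof -
  interpret scalars sc by fact
  have inv: "(\<Sum>i\<in>UNIV. sc (M l i) * (\<Sum>j\<in>UNIV. sc (N i j) * y j)) = y l"
    if "\<And>l j. (\<Sum>i\<in>UNIV. M l i * N i j) = (if l = j then 1 else 0)" for M N :: "'i \<Rightarrow> 'i \<Rightarrow> complex" and y l
  proof -
    have "(\<Sum>i\<in>UNIV. sc (M l i) * (\<Sum>j\<in>UNIV. sc (N i j) * y j)) =
        (\<Sum>j\<in>UNIV. sc (\<Sum>i\<in>UNIV. M l i * N i j) * y j)"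
      by (simp add: sum_distrib_left sc_sum sc_mult sum_distrib_right mult.assoc) (rule sum.swap)
    also have "\<dots> = (\<Sum>j\<in>UNIV. if l = j then y j else 0)"
      unfolding that by (intro sum.cong) auto
    finally show ?thesis by simp
  qed
  show ?thesis using inv[OF ecoeff_inverse(1)[OF assms(2)]] inv[OF ecoeff_inverse(2)[OF assms(2)]]
    by (auto simp: fun_eq_iff)
qed

text \<open>
  The factors \<open>\<A>\<^sub>j(z q\<^sub>j\<^sup>e)\<close> in the expression of \<open>\<phi>\<^sub>l\<close> through the series \<open>\<A>\<^sub>j\<close>.
\<close>

definition factors :: "'i \<Rightarrow> ('i \<times> nat) list" where
  "factors l = concat (map (\<lambda>j. map (\<lambda>p. (j, p)) [0..<(if j = l then 0 else nat (- c j l))])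
     (sorted_list_of_set UNIV))"

definition fac_exp :: "pm \<Rightarrow> 'i \<Rightarrow> 'i \<times> nat \<Rightarrow> complex" where
  "fac_exp \<epsilon> l jp = qi d q (fst jp) powi (sgi \<epsilon> * (- c (fst jp) l - 2 * int (snd jp)))"

lemma factors_sum:
  fixes f :: "'i \<times> nat \<Rightarrow> 'b::comm_monoid_add"
  shows "sum_list (map f (factors l)) = (\<Sum>j\<in>UNIV - {l}. \<Sum>p<nat (- c j l). f (j, p))"
proof -
  have "sum_list (map f (concat (map (\<lambda>j. map (\<lambda>p. (j, p)) [0..<n j]) js))) =
      sum_list (map (\<lambda>j. \<Sum>p<n j. f (j, p)) js)" for n js
    by (induction js) (simp_all add: sum_list_distinct_conv_sum_set o_def atLeast0LessThan)
  then have "sum_list (map f (factors l)) =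
     (\<Sum>j\<in>UNIV. \<Sum>p<(if j = l then 0 else nat (- c j l)). f (j, p))"
    unfolding factors_def by (simp add: sum_list_distinct_conv_sum_set)
  also have "\<dots> = (\<Sum>j\<in>UNIV - {l}. \<Sum>p<(if j = l then 0 else nat (- c j l)). f (j, p))"
    by (rule sum.mono_neutral_right) auto
  finally show ?thesis by (auto intro: sum.cong)
qed

lemma factors_iff: "(j, p) \<in> set (factors l) \<longleftrightarrow> j \<noteq> l \<and> p < nat (- c j l)"
  by (auto simp: factors_def)

text \<open>
  Taking logarithmic derivatives, the multiplicative relation between the \<open>\<phi>\<^sub>l\<close> and series
  \<open>B\<^sub>i\<close> is the linear system whose inverse defines the A-series.
\<close>

lemma product_formula:
  fixes sc :: "complex \<Rightarrow> 'r::{ring,monoid_mult}" and F B :: "'i \<Rightarrow> 'r fps" and p :: "'i \<Rightarrow> complex fps"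
  assumes K: "comm_family sc K" and F: "\<And>l. LD (\<Gamma> l) (F l)" "\<And>l. comm_family.fK K (F l)"
    and B: "\<And>l. LD (\<beta> l) (B l)" "\<And>l. comm_family.fK K (B l)" and p: "\<And>l. LD (\<pi> l) (p l)"
  shows "(\<forall>l. F l * (B l * scalars.zs sc (qi d q l powi (2 * sgi \<epsilon>)) (B l)) =
       scalars.scf sc (p l) * prod_list (map (\<lambda>jp. scalars.zs sc (fac_exp \<epsilon> l jp) (B (fst jp))) (factors l)))
    \<longleftrightarrow> (\<forall>k>0. \<forall>i. \<beta> i $ k = (\<Sum>j\<in>UNIV. sc (A_coeff c d q (sgi \<epsilon> * int k) i j) * (sc (\<pi> j $ k) - \<Gamma> j $ k)))"
proof -
  interpret comm_family sc K by fact
  have pw: "(qi d q i powi (sgi \<epsilon> * e)) ^ k = qi d q i powi (sgi \<epsilon> * int k * e)" for i e k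
  proof -
    have "(qi d q i powi (sgi \<epsilon> * e)) ^ k = qi d q i powi (sgi \<epsilon> * e * int k)"
      by (simp only: power_int_mult power_int_of_nat)
    then show ?thesis by (simp only: ac_simps)
  qed
  let ?L = "\<lambda>l. \<Gamma> l + (\<beta> l + zs (qi d q l powi (2 * sgi \<epsilon>)) (\<beta> l))"
  let ?R = "\<lambda>l. scf (\<pi> l) + sum_list (map (\<lambda>jp. zs (fac_exp \<epsilon> l jp) (\<beta> (fst jp))) (factors l))"
  let ?PL = "\<lambda>l. F l * (B l * zs (qi d q l powi (2 * sgi \<epsilon>)) (B l))"
  let ?PR = "\<lambda>l. scf (p l) * prod_list (map (\<lambda>jp. zs (fac_exp \<epsilon> l jp) (B (fst jp))) (factors l))"
  have L: "LD (?L l) (?PL l)" for l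
    by (intro LD_multK LD_zsK F B fK_closed)
  have R: "LD (?R l) (?PR l)" for l
    by (intro LD_multK LD_prod_list fK_prod_list scf_LD p fK_closed LD_zsK B)
  have eq: "?PL l = ?PR l \<longleftrightarrow> ?L l = ?R l" for l
  proof
    assume "?PL l = ?PR l"
    then show "?L l = ?R l" using LD_unique_log[OF L] R by simp
  next
    assume "?L l = ?R l"
    then show "?PL l = ?PR l" using LD_unique[OF L] R by simp
  qed
  have sum_nth: "sum_list (map G xs) $ k = sum_list (map (\<lambda>x. G x $ k) xs)" for G :: "'i \<times> nat \<Rightarrow> 'r fps" and xs k
    by (induction xs) simp_all
  have nth: "?L l $ k = ?R l $ k \<longleftrightarrow> sc (\<pi> l $ k) - \<Gamma> l $ k = (\<Sum>i\<in>UNIV. sc (ecoeff (sgi \<epsilon> * int k) l i) * \<beta> i $ k)"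
    if k: "k > 0" for l k
  proof -
    let ?s = "sgi \<epsilon> * int k"
    have s: "?s \<noteq> 0" using k sgi_nz by simp
    have "(\<Sum>i\<in>UNIV. sc (ecoeff ?s l i) * \<beta> i $ k) = sc (ecoeff ?s l l) * \<beta> l $ k
        + (\<Sum>i\<in>UNIV - {l}. sc (ecoeff ?s l i) * \<beta> i $ k)"
      by (rule sum.remove) auto
    also have "(\<Sum>i\<in>UNIV - {l}. sc (ecoeff ?s l i) * \<beta> i $ k) =
        - (\<Sum>j\<in>UNIV - {l}. \<Sum>p<nat (- c j l). sc (fac_exp \<epsilon> l (j, p) ^ k) * \<beta> j $ k)"
      unfolding sum_negf[symmetric]
    proof (rule sum.cong[OF refl])
      fix i assume "i \<in> UNIV - {l}"
      then have "l \<noteq> i" by auto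
      then show "sc (ecoeff ?s l i) * \<beta> i $ k = (\<Sum>p<nat (- c i l). - (sc (fac_exp \<epsilon> l (i, p) ^ k) * \<beta> i $ k))"
        unfolding ecoeff_offdiag[OF s \<open>l \<noteq> i\<close>] fac_exp_def fst_conv snd_conv pw
        by (simp add: sc_uminus sc_sum sum_distrib_right sum_negf)
    qed
    also have "(\<Sum>j\<in>UNIV - {l}. \<Sum>p<nat (- c j l). sc (fac_exp \<epsilon> l (j, p) ^ k) * \<beta> j $ k) =
        sum_list (map (\<lambda>jp. zs (fac_exp \<epsilon> l jp) (\<beta> (fst jp))) (factors l)) $ k"
      unfolding sum_nth factors_sum by (simp add: fps_sum_nth)
    also have "sc (ecoeff ?s l l) * \<beta> l $ k = (\<beta> l + zs (qi d q l powi (2 * sgi \<epsilon>)) (\<beta> l)) $ k"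
      unfolding ecoeff_diag[OF s] using pw[of l 2 k] by (simp add: sc_add distrib_right mult.commute)
    finally have S: "(\<Sum>i\<in>UNIV. sc (ecoeff ?s l i) * \<beta> i $ k) = (\<beta> l + zs (qi d q l powi (2 * sgi \<epsilon>)) (\<beta> l)) $ k
       + - (sum_list (map (\<lambda>jp. zs (fac_exp \<epsilon> l jp) (\<beta> (fst jp))) (factors l)) $ k)" .
    have gen: "g + b = p + l \<longleftrightarrow> p - g = b + - l" for g b p l :: 'r
    proof
      assume "g + b = p + l"
      then have "p = g + b - l" by (metis add_diff_cancel_right')
      then show "p - g = b + - l" by simp
    next
      assume "p - g = b + - l"
      then have "p = b + - l + g" by (metis diff_add_cancel)
      then show "g + b = p + l" by (simp add: algebra_simps)
    qed
    show ?thesis unfolding S fps_add_nth[of "\<Gamma> l"] fps_add_nth[of "scf (\<pi> l)"] scf_nth by (rule gen)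
  qed
  \<comment> \<open>The linear system is inverted only for s \<noteq> 0. In degree 0 both
    logarithmic derivatives vanish.\<close>
  have L0: "?L l $ 0 = ?R l $ 0" for l using L[of l] R[of l] by (simp add: LD_def)
  have "(\<forall>l. ?PL l = ?PR l) \<longleftrightarrow> (\<forall>l. \<forall>k>0. ?L l $ k = ?R l $ k)"
    unfolding eq fps_eq_iff_pos[OF L0] ..
  also have "\<dots> \<longleftrightarrow> (\<forall>k>0. \<forall>l. sc (\<pi> l $ k) - \<Gamma> l $ k = (\<Sum>i\<in>UNIV. sc (ecoeff (sgi \<epsilon> * int k) l i) * \<beta> i $ k))"
    using nth by (auto simp only:)
  also have "\<dots> \<longleftrightarrow> (\<forall>k>0. \<forall>i. \<beta> i $ k = (\<Sum>j\<in>UNIV. sc (A_coeff c d q (sgi \<epsilon> * int k) i j) * (sc (\<pi> j $ k) - \<Gamma> j $ k)))"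
  proof -
    have "sgi \<epsilon> * int k \<noteq> 0" if "k > 0" for k using sgi_nz that by simp
    then have "(\<forall>l. sc (\<pi> l $ k) - \<Gamma> l $ k = (\<Sum>i\<in>UNIV. sc (ecoeff (sgi \<epsilon> * int k) l i) * \<beta> i $ k)) \<longleftrightarrow>
      (\<forall>i. \<beta> i $ k = (\<Sum>j\<in>UNIV. sc (A_coeff c d q (sgi \<epsilon> * int k) i j) * (sc (\<pi> j $ k) - \<Gamma> j $ k)))"
      if "k > 0" for k
      using dual_expansion[OF scalars_axioms, of "sgi \<epsilon> * int k" "\<lambda>l. sc (\<pi> l $ k) - \<Gamma> l $ k" "\<lambda>i. \<beta> i $ k"] that
      by simp
    then show ?thesis by simp
  qed
  finally show ?thesis .
qed

end

section \<open>Commutation relations as conjugation by rational series\<close>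

context scalars
begin

lemma ratser_rec: "ratser a b $ Suc i = a * ratser a b $ i - (if i = 0 then b else 0)"
  by (cases i) (simp_all add: ratser_def one_minus_mult_nth algebra_simps)

text \<open>Solving for G_(k+1) x_n and inserting the expansion already found for G_k x_(n+1)
  reproduces the recursion \<open>ratser_rec\<close> of the coefficients. In this way the relation
  between \<phi> and x becomes multiplication by a rational function.\<close>

lemma act_of_recursion:
  assumes lin: "flin G" and G0: "\<And>n. G $ 0 * x n = x n * G $ 0"
    and rec: "\<And>k n. G $ Suc k * x n - sc a * (G $ k * x (n + 1)) = x n * G $ Suc k - sc b * (x (n + 1) * G $ k)"
  shows "G * fps_const (x n) = act (ratser a b) x n * G"
proof (intro fps_ext)
  fix k
  have "G $ k * x n = (\<Sum>i\<le>k. sc (ratser a b $ i) * (x (n + int i) * G $ (k - i)))"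
  proof (induction k arbitrary: n)
    case 0
    then show ?case using G0 by (simp add: ratser_props(2))
  next
    case (Suc k)
    have "G $ Suc k * x n = x n * G $ Suc k + (sc a * (G $ k * x (n + 1)) - sc b * (x (n + 1) * G $ k))"
      using rec[of k n] by (simp add: algebra_simps)
    also have "sc a * (G $ k * x (n + 1)) - sc b * (x (n + 1) * G $ k) =
       (\<Sum>i\<le>k. sc (a * ratser a b $ i) * (x (n + 1 + int i) * G $ (k - i)))
        - (\<Sum>i\<le>k. if i = 0 then sc b * (x (n + 1 + int i) * G $ (k - i)) else 0)"
      unfolding Suc.IH by (simp add: sum_distrib_left sc_mult mult.assoc)
    also have "\<dots> = (\<Sum>i\<le>k. sc (ratser a b $ Suc i) * (x (n + int (Suc i)) * G $ (k - i)))"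
      unfolding sum_subtractf[symmetric] ratser_rec
      by (intro sum.cong refl) (simp add: sc_diff left_diff_distrib algebra_simps)
    finally show ?case by (subst sum.atMost_Suc_shift) (simp add: ratser_props(2))
  qed
  then show "(G * fps_const (x n)) $ k = (act (ratser a b) x n * G) $ k"
    by (simp add: fps_mult_right_const_nth fps_mult_nth[of "act _ _ _"] mult.assoc atMost_atLeast0)
qed

lemma recursion_of_act:
  assumes act: "\<And>n. G * fps_const (x n) = act (ratser a b) x n * G"
  shows "G $ Suc k * x n - sc a * (G $ k * x (n + 1)) = x n * G $ Suc k - sc b * (x (n + 1) * G $ k)"
proof -
  have nth: "G $ k * x n = (\<Sum>i\<le>k. sc (ratser a b $ i) * (x (n + int i) * G $ (k - i)))" for k n
    using arg_cong[OF act[of n], of "\<lambda>F. F $ k"] by (simp add: fps_mult_right_const_nth fps_mult_nth[of "act _ _ _"] mult.assoc atMost_atLeast0)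
  have "sc a * (G $ k * x (n + 1)) - sc b * (x (n + 1) * G $ k) =
       (\<Sum>i\<le>k. sc (a * ratser a b $ i) * (x (n + 1 + int i) * G $ (k - i)))
        - (\<Sum>i\<le>k. if i = 0 then sc b * (x (n + 1 + int i) * G $ (k - i)) else 0)"
    unfolding nth[of k] by (simp add: sum_distrib_left sc_mult mult.assoc)
  also have "\<dots> = (\<Sum>i\<le>k. sc (ratser a b $ Suc i) * (x (n + int (Suc i)) * G $ (k - i)))"
    unfolding sum_subtractf[symmetric] ratser_rec
    by (intro sum.cong refl) (simp add: sc_diff left_diff_distrib algebra_simps)
  also have "\<dots> = G $ Suc k * x n - x n * G $ Suc k"
    unfolding nth[of "Suc k"] by (subst sum.atMost_Suc_shift) (simp add: ratser_props(2))
  finally show ?thesis by (simp add: algebra_simps)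
qed

text \<open>The same recursion solved for the products with x on the left, which exchanges a and b
  and so yields the inverse rational function.\<close>

lemma right_expansion:
  assumes G0: "\<And>n. G $ 0 * x n = x n * G $ 0"
    and rec: "\<And>k n. G $ Suc k * x n - sc a * (G $ k * x (n + 1)) = x n * G $ Suc k - sc b * (x (n + 1) * G $ k)"
  shows "x n * G $ k = (\<Sum>i\<le>k. sc (ratser b a $ i) * (G $ (k - i) * x (n + int i)))"
proof (induction k arbitrary: n)
  case 0
  then show ?case using G0 by (simp add: ratser_props(2))
next
  case (Suc k)
  have "x n * G $ Suc k = G $ Suc k * x n + (sc b * (x (n + 1) * G $ k) - sc a * (G $ k * x (n + 1)))"
    using rec[of k n] by (simp add: algebra_simps)
  also have "sc b * (x (n + 1) * G $ k) - sc a * (G $ k * x (n + 1)) =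
     (\<Sum>i\<le>k. sc (b * ratser b a $ i) * (G $ (k - i) * x (n + 1 + int i)))
      - (\<Sum>i\<le>k. if i = 0 then sc a * (G $ (k - i) * x (n + 1 + int i)) else 0)"
    unfolding Suc.IH by (simp add: sum_distrib_left sc_mult mult.assoc)
  also have "\<dots> = (\<Sum>i\<le>k. sc (ratser b a $ Suc i) * (G $ (k - i) * x (n + int (Suc i))))"
    unfolding sum_subtractf[symmetric] ratser_rec
    by (intro sum.cong refl) (simp add: sc_diff left_diff_distrib algebra_simps)
  finally show ?case by (subst sum.atMost_Suc_shift) (simp add: ratser_props(2))
qed

text \<open>In degree t + 1 of the conjugation relation the coefficient of G vanishes. All
  coefficients of (1 - b z) / (1 - z) of positive degree equal 1 - b, so a nonzero multiple of the
  full sum remains and must be 0. The second sum comes from the inverse series (1 - z) / (1 - b z)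
  in the same way.\<close>

lemma annihilation:
  assumes act: "\<And>n. G * fps_const (x n) = act (ratser 1 b) x n * G"
    and G: "G $ 0 = 1" "\<And>k. k > t \<Longrightarrow> G $ k = 0" and b: "b \<noteq> 1" "b \<noteq> 0"
  shows "(\<Sum>r\<le>t. x (N - int r) * G $ r) = 0"
    and "(\<Sum>r\<le>t. sc (inverse b ^ r) * (G $ r * x (N - int r))) = 0"
proof -
  define n where "n = N - int (Suc t)"
  have idx: "n + int (Suc t - r) = N - int r" if "r \<le> t" for r using that by (simp add: n_def of_nat_diff)
  have rev: "(\<Sum>i\<le>t. f (Suc i)) = (\<Sum>r\<le>t. f (Suc t - r))" for f :: "nat \<Rightarrow> 'r"
    by (rule sum.reindex_bij_witness[of _ "\<lambda>i. t - i" "\<lambda>i. t - i"]) (auto simp: Suc_diff_le)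
  have "G $ Suc t * x n = (\<Sum>i\<le>Suc t. sc (ratser 1 b $ i) * (x (n + int i) * G $ (Suc t - i)))"
    using arg_cong[OF act[of n], of "\<lambda>F. F $ Suc t"]
    by (simp add: fps_mult_right_const_nth fps_mult_nth[of "act _ _ _"] mult.assoc atMost_atLeast0)
  also have "\<dots> = (\<Sum>i\<le>t. sc (1 - b) * (x (n + int (Suc i)) * G $ (Suc t - Suc i)))"
    by (subst sum.atMost_Suc_shift) (simp add: G ratser_props(4))
  also have "\<dots> = (\<Sum>r\<le>t. sc (1 - b) * (x (N - int r) * G $ r))"
    by (subst rev) (intro sum.cong refl, simp only: idx atMost_iff diff_diff_cancel le_SucI)
  finally have "sc (1 - b) * (\<Sum>r\<le>t. x (N - int r) * G $ r) = sc (1 - b) * 0"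
    by (simp add: G sum_distrib_left)
  then show "(\<Sum>r\<le>t. x (N - int r) * G $ r) = 0" by (rule sc_cancel[of "1 - b", rotated]) (use b in simp)
  have s: "ratser b 1 $ Suc i = (b - 1) * b ^ i" for i
    by (simp add: ratser_def one_minus_mult_nth algebra_simps)
  have "x n * G $ Suc t = (\<Sum>i\<le>Suc t. sc (ratser b 1 $ i) * (G $ (Suc t - i) * x (n + int i)))"
    by (rule right_expansion[where a = 1]) (use G recursion_of_act[OF act] in simp_all)
  also have "\<dots> = (\<Sum>i\<le>t. sc ((b - 1) * b ^ i) * (G $ (Suc t - Suc i) * x (n + int (Suc i))))"
    by (subst sum.atMost_Suc_shift) (simp add: G s)
  also have "\<dots> = (\<Sum>i\<le>t. (\<lambda>j. sc ((b - 1) * b ^ (j - 1)) * (G $ (Suc t - j) * x (n + int j))) (Suc i))"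
    by simp
  also have "\<dots> = (\<Sum>r\<le>t. sc ((b - 1) * b ^ (Suc t - r - 1)) * (G $ (Suc t - (Suc t - r)) * x (n + int (Suc t - r))))"
    by (rule rev)
  also have "\<dots> = (\<Sum>r\<le>t. sc ((b - 1) * b ^ t) * (sc (inverse b ^ r) * (G $ r * x (N - int r))))"
  proof (intro sum.cong refl)
    fix r assume "r \<in> {..t}"
    then have r: "r \<le> t" by simp
    have "Suc t - r - 1 = t - r" by simp
    moreover have "b ^ (t - r) = b ^ t * inverse b ^ r"
      using b r by (simp add: power_diff power_inverse field_simps)
    ultimately have "sc ((b - 1) * b ^ (Suc t - r - 1)) = sc ((b - 1) * b ^ t) * sc (inverse b ^ r)"
      by (simp only: sc_mult mult.assoc)
    moreover have "Suc t - (Suc t - r) = r" using r by simp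
    ultimately show "sc ((b - 1) * b ^ (Suc t - r - 1)) * (G $ (Suc t - (Suc t - r)) * x (n + int (Suc t - r)))
      = sc ((b - 1) * b ^ t) * (sc (inverse b ^ r) * (G $ r * x (N - int r)))"
      using idx[OF r] by (simp only: mult.assoc)
  qed
  finally have "sc ((b - 1) * b ^ t) * (\<Sum>r\<le>t. sc (inverse b ^ r) * (G $ r * x (N - int r))) = sc ((b - 1) * b ^ t) * 0"
    by (simp add: G sum_distrib_left)
  then show "(\<Sum>r\<le>t. sc (inverse b ^ r) * (G $ r * x (N - int r))) = 0"
    by (rule sc_cancel[of "(b - 1) * b ^ t", rotated]) (use b in simp)
qed

end

section \<open>Logarithms of scalar series\<close>

lemma fps_compose_exp: "fps_compose (fps_exp 1) f = complex_scalars.texp f"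
  by (intro fps_ext) (simp add: fps_compose_nth complex_scalars.texp_def atMost_atLeast0)

interpretation complex_comm: comm_family "id :: complex \<Rightarrow> complex" UNIV
  by unfold_locales (auto simp: mult.commute)

lemma complex_fK [simp]: "complex_comm.fK F"
  by (simp add: complex_comm.fK_def)

lemma LD_exp: "f $ 0 = 0 \<Longrightarrow> LD (theta f) (fps_compose (fps_exp 1) (f :: complex fps))"
  unfolding fps_compose_exp by (rule complex_comm.LD_texpK) auto

text \<open>The normalized polynomial has constant term 1. Dividing the coefficients of its
  logarithmic derivative by their degrees gives a logarithm, and any logarithm arises in this way,
  so the definite description in \<open>lw_log\<close> is justified.\<close>

lemma lw_log:
  assumes "poly p 0 \<noteq> 0"
  shows "LD (theta (lw_log \<epsilon> p)) (lw_normalized \<epsilon> p)" "lw_log \<epsilon> p $ 0 = 0"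
proof -
  have "p \<noteq> 0" "coeff p 0 \<noteq> 0" using assms by (auto simp: poly_0_coeff_0)
  then have G0: "lw_normalized \<epsilon> p $ 0 = 1" by (cases \<epsilon>) auto
  obtain \<gamma> where \<gamma>: "LD \<gamma> (lw_normalized \<epsilon> p)" using complex_comm.LD_exists[OF _ G0] by auto
  let ?f = "Abs_fps (\<lambda>k. \<gamma> $ k / of_nat k)"
  have "theta ?f = \<gamma>" using \<gamma> by (intro fps_ext) (auto simp: nsm_of_nat LD_def)
  then have f: "?f $ 0 = 0" "fps_compose (fps_exp 1) ?f = lw_normalized \<epsilon> p"
    using LD_exp[of ?f] \<gamma> complex_scalars.LD_unique by auto
  have "g = ?f" if g: "g $ 0 = 0" "fps_compose (fps_exp 1) g = lw_normalized \<epsilon> p" for g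
  proof -
    have "theta g = \<gamma>" using LD_exp[OF g(1)] \<gamma> LD_unique_log unfolding g(2) by blast
    then have "theta g $ k = \<gamma> $ k" for k by simp
    then have "of_nat k * g $ k = \<gamma> $ k" for k by (simp only: theta_nth nsm_of_nat)
    then have "g $ k = ?f $ k" for k
      using g(1) f(1) by (cases "k = 0") (auto simp: field_simps)
    then show ?thesis by (intro fps_ext)
  qed
  then have "lw_log \<epsilon> p = ?f" unfolding lw_log_def using f by (intro the_equality) auto
  then show "LD (theta (lw_log \<epsilon> p)) (lw_normalized \<epsilon> p)" "lw_log \<epsilon> p $ 0 = 0"
    using \<open>theta ?f = \<gamma>\<close> \<gamma> f(1) by auto
qed

section \<open>Operators on a representation\<close>

locale qrep = shifted c d q m + M: alg_rep "U_alg c d q m" scl \<rho>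
  for c :: "'i::{finite,linorder} \<Rightarrow> 'i \<Rightarrow> int" and d q m
    and scl :: "complex \<Rightarrow> 'v::ab_group_add \<Rightarrow> 'v" and \<rho>
begin

abbreviation "R \<equiv> M.R"
abbreviation "sc \<equiv> M.sc"

definition X :: "pm \<Rightarrow> 'i \<Rightarrow> int \<Rightarrow> 'v endo" where "X \<epsilon> i k = R (ug (GX \<epsilon> i k))"
definition Phi :: "pm \<Rightarrow> 'i \<Rightarrow> int \<Rightarrow> 'v endo" where "Phi \<epsilon> i k = R (ph \<epsilon> i k)"

lemma uproj_closed [simp, intro]: "uproj p \<in> carrier U"
  using alg_homD(1)[OF uproj_hom] by simp

lemma R_uproj:
  "R (uproj (p + p')) = R (uproj p) + R (uproj p')" "R (uproj (p - p')) = R (uproj p) - R (uproj p')"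
  "R (uproj (p * p')) = R (uproj p) * R (uproj p')" "R (uproj 0) = 0"
  "R (uproj (fscal a)) = sc a" "R (uproj (fgen (GX \<epsilon> i k))) = X \<epsilon> i k"
  "R (uproj (fgen (GPhi \<epsilon> i k))) = Phi \<epsilon> i k"
proof -
  note h = alg_homD[OF uproj_hom, simplified]
  show add: "R (uproj (p + p')) = R (uproj p) + R (uproj p')" for p p' using h(2)[of p p'] by (simp add: M.R_add)
  show "R (uproj (p - p')) = R (uproj p) - R (uproj p')" using add[of "p - p'" p'] by simp
  show "R (uproj 0) = 0" using add[of 0 0] by simp
  show "R (uproj (p * p')) = R (uproj p) * R (uproj p')" by (simp add: uproj_mult M.R_mult)
  show "R (uproj (fscal a)) = sc a" using h(5)[of a 1] by (simp add: uproj_one M.R_smult)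
  show "R (uproj (fgen (GX \<epsilon> i k))) = X \<epsilon> i k" "R (uproj (fgen (GPhi \<epsilon> i k))) = Phi \<epsilon> i k"
    by (simp_all add: X_def Phi_def U_gen_def)
qed

lemma R_rel: "r \<in> base_rels c d q m (\<lambda>g. g) \<Longrightarrow> R (uproj r) = 0"
  using uproj_rel[of r] by (simp add: id_def)

lemma Phi_zero: "k < 0 \<Longrightarrow> Phi Pos i k = 0" "k > m i \<Longrightarrow> Phi Neg i k = 0"
  using R_rel[OF base_rels_mem(1)] R_rel[OF base_rels_mem(2)[of m i k]] by (simp_all add: R_uproj)

lemma Phi_comm: "Phi \<delta> i k * Phi \<epsilon> j l = Phi \<epsilon> j l * Phi \<delta> i k"
  using R_rel[OF base_rels_mem(6)] by (simp add: R_uproj)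

lemma X_X: "X Pos i k * X Neg j l - X Neg j l * X Pos i k = (if i = j then
    sc (1 / (qi d q i - inverse (qi d q i))) * (Phi Pos i (k + l) - Phi Neg i (k + l)) else 0)"
  using R_rel[OF base_rels_mem(7)] by (cases "i = j") (simp_all add: R_uproj)

lemma Phi_X: "Phi \<epsilon> i (k + 1) * X \<delta> j l - sc (q powi (sgi \<delta> * bform c d i j)) * Phi \<epsilon> i k * X \<delta> j (l + 1)
   = sc (q powi (sgi \<delta> * bform c d i j)) * X \<delta> j l * Phi \<epsilon> i (k + 1) - X \<delta> j (l + 1) * Phi \<epsilon> i k"
  using R_rel[OF base_rels_mem(8)] by (simp add: R_uproj)

lemma Phi0_X: "Phi Pos i 0 * X \<delta> j l = sc (q powi (sgi \<delta> * bform c d i j)) * (X \<delta> j l * Phi Pos i 0)"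
  using Phi_X[of Pos i "-1" \<delta> j l] by (simp add: Phi_zero mult.assoc)

lemma X_lin [simp]: "X \<epsilon> i k \<in> M.S.lin" and Phi_lin [simp]: "Phi \<epsilon> i k \<in> M.S.lin"
  by (simp_all add: X_def Phi_def M.R_lin)

text \<open>The bicommutant of the \<open>Phi\<close> among linear maps. It is commutative because
  the \<open>Phi\<close> commute, and it contains the inverses of its elements by
  \<open>inverse_K\<close>.\<close>

definition K :: "'v endo set" where
  "K = {f. \<forall>g\<in>M.S.lin. (\<forall>\<epsilon> i k. g * Phi \<epsilon> i k = Phi \<epsilon> i k * g) \<longrightarrow> f * g = g * f}"

lemma K_I: "(\<And>g. g \<in> M.S.lin \<Longrightarrow> (\<And>\<epsilon> i k. g * Phi \<epsilon> i k = Phi \<epsilon> i k * g) \<Longrightarrow> f * g = g * f) \<Longrightarrow> f \<in> K"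
  by (simp add: K_def)

lemma K_D: "f \<in> K \<Longrightarrow> g \<in> M.S.lin \<Longrightarrow> (\<And>\<epsilon> i k. g * Phi \<epsilon> i k = Phi \<epsilon> i k * g) \<Longrightarrow> f * g = g * f"
  by (simp add: K_def)

lemma Phi_K: "Phi \<epsilon> i k \<in> K"
  by (rule K_I) simp

sublocale C: comm_family sc K
proof unfold_locales
  fix a show "sc a \<in> K" by (rule K_I) (simp add: M.S.lin_sc)
next
  fix x y assume x: "x \<in> K" and y: "y \<in> K"
  show "x + y \<in> K" using K_D[OF x] K_D[OF y] by (intro K_I) (simp add: distrib_left distrib_right)
  show "x * y \<in> K"
  proof (rule K_I)
    fix g assume g: "g \<in> M.S.lin" "\<And>\<epsilon> i k. g * Phi \<epsilon> i k = Phi \<epsilon> i k * g"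
    have "x * y * g = x * (g * y)" using K_D[OF y g] by (simp only: mult.assoc)
    also have "\<dots> = g * (x * y)" using K_D[OF x g] by (simp only: mult.assoc[symmetric])
    finally show "x * y * g = g * (x * y)" .
  qed
  have "y * sc a = sc a * y" for a
    by (rule K_D[OF y]) (simp_all add: M.S.lin_closed M.S.lin_sc)
  then have "y \<in> M.S.lin" by (simp add: M.S.lin_def)
  moreover have "y * Phi \<epsilon> i k = Phi \<epsilon> i k * y" for \<epsilon> i k
    by (rule K_D[OF y]) (simp_all add: Phi_comm)
  ultimately show "x * y = y * x" by (rule K_D[OF x])
qed

lemma inverse_K:
  assumes "x \<in> K" "y * x = 1" "x * y = 1" shows "y \<in> K"
proof (rule K_I)
  fix g assume g: "g \<in> M.S.lin" "\<And>\<epsilon> i k. g * Phi \<epsilon> i k = Phi \<epsilon> i k * g"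
  have "y * (x * g) * y = y * (g * x) * y" using K_D[OF assms(1) g] by simp
  then have "(y * x) * g * y = y * g * (x * y)" by (simp only: mult.assoc)
  then show "y * g = g * y" by (simp add: assms)
qed

lemma inv_K:
  assumes "x \<in> Units U" "R x \<in> K" shows "R (inv\<^bsub>U\<^esub> x) \<in> K"
proof (rule inverse_K[OF assms(2)])
  have c: "x \<in> carrier U" "inv\<^bsub>U\<^esub> x \<in> carrier U" using assms by auto
  then show "R (inv\<^bsub>U\<^esub> x) * R x = 1" "R x * R (inv\<^bsub>U\<^esub> x) = 1"
    using assms(1) by (simp_all flip: M.R_mult)
qed

abbreviation "Pinv \<epsilon> i \<equiv> R (inv\<^bsub>U\<^esub> (ph \<epsilon> i (case \<epsilon> of Pos \<Rightarrow> 0 | Neg \<Rightarrow> m i)))"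

lemma Pinv: "Pinv \<epsilon> i \<in> K"
  "Pinv Pos i * Phi Pos i 0 = 1" "Phi Pos i 0 * Pinv Pos i = 1"
  "Pinv Neg i * Phi Neg i (m i) = 1" "Phi Neg i (m i) * Pinv Neg i = 1"
  using ph_units[of i] inv_K Phi_K[unfolded Phi_def]
  by (cases \<epsilon>; simp add: Phi_def flip: M.R_mult)+

definition phib :: "pm \<Rightarrow> 'i \<Rightarrow> 'v endo fps" where
  "phib \<epsilon> i = Abs_fps (\<lambda>k. R (phi_bar c d q m \<epsilon> i k))"

lemma phib_nth: "phib Pos i $ k = Pinv Pos i * Phi Pos i (int k)"
  "phib Neg i $ k = Pinv Neg i * Phi Neg i (m i - int k)"
  using ph_units[of i] by (simp_all add: phib_def Phi_def M.R_mult)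

lemma phib_K [simp, intro]: "C.fK (phib \<epsilon> i)"
  unfolding C.fK_def using phib_nth[of i] Pinv(1)[of Pos i] Pinv(1)[of Neg i] Phi_K by (cases \<epsilon>) (auto intro!: C.K_mult)

definition hF :: "pm \<Rightarrow> 'i \<Rightarrow> 'v endo fps" where
  "hF \<epsilon> i = Abs_fps (\<lambda>k. R (hs \<epsilon> \<odot>\<^bsub>U\<^esub> h \<epsilon> i k))"

lemma hF_0: "hF \<epsilon> i $ 0 = 0"
  by (simp add: hF_def h_props(2))

lemma texp_hF: "M.S.texp (hF \<epsilon> i) = phib \<epsilon> i"
proof (intro fps_ext)
  fix k
  have "M.S.texp (hF \<epsilon> i) $ k = R (ser_exp U (\<lambda>k. hs \<epsilon> \<odot>\<^bsub>U\<^esub> h \<epsilon> i k) k)"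
    unfolding hF_def by (rule M.R_ser_exp[symmetric]) (simp add: h_props(1))
  then show "M.S.texp (hF \<epsilon> i) $ k = phib \<epsilon> i $ k" by (simp add: h_props(3) phib_def)
qed

text \<open>The \<open>h\<close> are given by a definite description, so membership in K needs an
  induction: coefficient k of the logarithm is that of the normalized \<phi> minus a part built from
  lower coefficients.\<close>

lemma hF_K [simp, intro]: "C.fK (hF \<epsilon> i)"
proof -
  let ?F = "\<lambda>k. hs \<epsilon> \<odot>\<^bsub>U\<^esub> h \<epsilon> i k"
  have F: "?F k \<in> carrier U" "?F 0 = \<zero>\<^bsub>U\<^esub>" for k by (simp_all add: h_props)
  have "R (?F k) \<in> K" for k
  proof (induction k rule: less_induct)
    case (less k)
    show ?case
    proof (cases "k = 0")
      case False
      \<comment> \<open>Cutting the series at k makes the k-th coefficient of its exponential equal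
        to that lower part.\<close>
      let ?G = "\<lambda>l. if l < k then ?F l else \<zero>\<^bsub>U\<^esub>"
      have G: "?G l \<in> carrier U" for l using F(1) by simp
      have "R (?G l) \<in> K" for l using less by simp
      then have 1: "R (ser_exp U ?G k) \<in> K"
        using C.fK_texp[of "Abs_fps (\<lambda>l. R (?G l))"] unfolding M.R_ser_exp[of ?G k, OF G] C.fK_def by simp
      have tail: "U.exp_tail ?G k = U.exp_tail ?F k"
        by (rule U.exp_tail_cong) (use G F False in auto)
      have "ser_exp U ?G k = U.exp_tail ?F k"
        using U.ser_exp_split[of ?G k, OF G] False tail U.exp_tail_closed[of ?F, OF F(1)] by simp
      moreover have "phi_bar c d q m \<epsilon> i k = ?F k \<oplus>\<^bsub>U\<^esub> U.exp_tail ?F k"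
        using U.ser_exp_split[of ?F k, OF F(1)] False h_props(3)[of \<epsilon> i] by simp
      ultimately have "R (phi_bar c d q m \<epsilon> i k) = R (?F k) + R (ser_exp U ?G k)"
        using M.R_add[OF F(1)[of k] U.exp_tail_closed[of ?F k, OF F(1)]] by simp
      then have "R (?F k) = phib \<epsilon> i $ k - R (ser_exp U ?G k)" by (simp add: phib_def)
      then show ?thesis using 1 C.fK_D[OF phib_K] by (simp add: C.K_diff)
    qed (use F in simp)
  qed
  then show ?thesis by (simp add: C.fK_def hF_def)
qed

definition Gam :: "pm \<Rightarrow> 'i \<Rightarrow> 'v endo fps" where "Gam \<epsilon> i = theta (hF \<epsilon> i)"

lemma Gam_K [simp, intro]: "C.fK (Gam \<epsilon> i)"
  by (simp add: Gam_def)

lemma LD_phib: "LD (Gam \<epsilon> i) (phib \<epsilon> i)"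
  unfolding Gam_def texp_hF[symmetric] by (rule C.LD_texpK) (auto simp: hF_0)

lemma LD_h_series:
  fixes w :: "nat \<Rightarrow> 'i \<Rightarrow> complex" and r u \<epsilon>
  assumes u: "u = r * hs \<epsilon>"
  defines "E \<equiv> ser_exp U (\<lambda>k. if k = 0 then \<zero>\<^bsub>U\<^esub> else
     u \<odot>\<^bsub>U\<^esub> (\<Oplus>\<^bsub>U\<^esub>j\<in>UNIV. w k j \<odot>\<^bsub>U\<^esub> h \<epsilon> j k))"
  shows "LD (Abs_fps (\<lambda>k. sc r * (\<Sum>j\<in>UNIV. sc (w k j) * Gam \<epsilon> j $ k))) (Abs_fps (\<lambda>k. R (E k)))"
    and "C.fK (Abs_fps (\<lambda>k. R (E k)))"
proof -
  let ?f = "\<lambda>k. if k = 0 then \<zero>\<^bsub>U\<^esub> else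
     u \<odot>\<^bsub>U\<^esub> (\<Oplus>\<^bsub>U\<^esub>j\<in>UNIV. w k j \<odot>\<^bsub>U\<^esub> h \<epsilon> j k)"
  let ?F = "Abs_fps (\<lambda>k. sc r * (\<Sum>j\<in>UNIV. sc (w k j) * hF \<epsilon> j $ k))"
  have cl: "(\<Oplus>\<^bsub>U\<^esub>j\<in>UNIV. w k j \<odot>\<^bsub>U\<^esub> h \<epsilon> j k) \<in> carrier U" for k
    by (intro U.finsum_closed) (auto simp: h_props(1))
  have f: "?f k \<in> carrier U" for k using cl by simp
  have Rf: "R (?f k) = ?F $ k" for k
  proof (cases "k = 0")
    case False
    have hF: "hF \<epsilon> j $ k = sc (hs \<epsilon>) * R (h \<epsilon> j k)" for j
      by (simp only: hF_def fps_nth_Abs_fps M.R_smult h_props(1))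
    have "sc (w k j) * hF \<epsilon> j $ k = sc (hs \<epsilon>) * (sc (w k j) * R (h \<epsilon> j k))" for j
      unfolding hF mult.assoc[symmetric] M.S.sc_mult[symmetric] by (simp only: mult.commute mult.left_commute)
    then have "(\<Sum>j\<in>UNIV. sc (w k j) * hF \<epsilon> j $ k) = sc (hs \<epsilon>) * (\<Sum>j\<in>UNIV. sc (w k j) * R (h \<epsilon> j k))"
      by (simp only: sum_distrib_left)
    moreover have "R (\<Oplus>\<^bsub>U\<^esub>j\<in>UNIV. w k j \<odot>\<^bsub>U\<^esub> h \<epsilon> j k) = (\<Sum>j\<in>UNIV. sc (w k j) * R (h \<epsilon> j k))"
      by (subst M.R_finsum) (auto simp: M.R_smult h_props(1))
    ultimately show ?thesis using False M.R_smult[OF cl, of u k]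
      by (simp only: u M.S.sc_mult mult.assoc if_False fps_nth_Abs_fps)
  qed (simp add: hF_0)
  have "R (E k) = M.S.texp ?F $ k" for k
    unfolding E_def M.R_ser_exp[of ?f, OF f] Rf by simp
  then have E: "Abs_fps (\<lambda>k. R (E k)) = M.S.texp ?F" by (intro fps_ext) simp
  have FK: "C.fK ?F"
    using C.fK_D[OF hF_K] unfolding C.fK_def by (auto intro!: C.K_mult C.K_sum)
  have "LD (theta ?F) (M.S.texp ?F)" by (rule C.LD_texpK[OF FK]) (simp add: hF_0)
  moreover have "theta ?F = Abs_fps (\<lambda>k. sc r * (\<Sum>j\<in>UNIV. sc (w k j) * Gam \<epsilon> j $ k))"
    by (intro fps_ext) (simp add: Gam_def nsm_sum nsm_mult_right)
  ultimately show "LD (Abs_fps (\<lambda>k. sc r * (\<Sum>j\<in>UNIV. sc (w k j) * Gam \<epsilon> j $ k))) (Abs_fps (\<lambda>k. R (E k)))"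
    by (simp add: E)
  show "C.fK (Abs_fps (\<lambda>k. R (E k)))" unfolding E by (rule C.fK_texp[OF FK])
qed

definition TF :: "pm \<Rightarrow> 'i \<Rightarrow> 'v endo fps" where
  "TF \<epsilon> i = Abs_fps (\<lambda>k. R (T_ser c d q m \<epsilon> i k))"

definition AF :: "pm \<Rightarrow> 'i \<Rightarrow> 'v endo fps" where
  "AF \<epsilon> i = Abs_fps (\<lambda>k. R (A_ser c d q m \<epsilon> i k))"

lemma LD_TF: "LD (Abs_fps (\<lambda>k. \<Sum>j\<in>UNIV. sc (T_coeff c d q (sgi \<epsilon> * int k) i j) * Gam \<epsilon> j $ k)) (TF \<epsilon> i)"
  and TF_K [simp, intro]: "C.fK (TF \<epsilon> i)"
  using LD_h_series[where r = 1 and u = "hs \<epsilon>" and \<epsilon> = \<epsilon> and w = "\<lambda>k j. T_coeff c d q (sgi \<epsilon> * int k) i j"]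
  by (simp_all add: TF_def T_ser_def)

lemma LD_AF: "LD (Abs_fps (\<lambda>k. - (\<Sum>j\<in>UNIV. sc (A_coeff c d q (sgi \<epsilon> * int k) i j) * Gam \<epsilon> j $ k))) (AF \<epsilon> i)"
  and AF_K [simp, intro]: "C.fK (AF \<epsilon> i)"
proof -
  have "of_int (sgi \<epsilon>) * (inverse q - q) = -1 * hs \<epsilon>" by (simp add: algebra_simps)
  then show "LD (Abs_fps (\<lambda>k. - (\<Sum>j\<in>UNIV. sc (A_coeff c d q (sgi \<epsilon> * int k) i j) * Gam \<epsilon> j $ k))) (AF \<epsilon> i)"
     "C.fK (AF \<epsilon> i)"
    using LD_h_series[where r = "-1" and u = "of_int (sgi \<epsilon>) * (inverse q - q)" and \<epsilon> = \<epsilon> and w = "\<lambda>k j. A_coeff c d q (sgi \<epsilon> * int k) i j"]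
    by (simp_all add: AF_def A_ser_def M.S.sc_uminus)
qed

end

section \<open>Reversal of polynomials\<close>

text \<open>The polynomial z^n F(1/z). The bound n is explicit because the coefficient of z^n may
  vanish.\<close>

definition rv :: "nat \<Rightarrow> 'a::zero fps \<Rightarrow> 'a fps" where
  "rv n F = Abs_fps (\<lambda>k. if k \<le> n then F $ (n - k) else 0)"

definition bdeg :: "nat \<Rightarrow> 'a::zero fps \<Rightarrow> bool" where
  "bdeg n F \<longleftrightarrow> (\<forall>k>n. F $ k = 0)"

lemma rv_nth: "rv n F $ k = (if k \<le> n then F $ (n - k) else 0)"
  by (simp add: rv_def)

lemma fps_mult_bdeg:
  fixes F G :: "'a::semiring_0 fps"
  assumes "bdeg n F" "bdeg m G"
  shows "bdeg (n + m) (F * G)" "(F * G) $ (n + m) = F $ n * G $ m" "rv (n + m) (F * G) = rv n F * rv m G"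
proof -
  have gen: "(F * G) $ k = (\<Sum>i\<in>{i. i \<le> n \<and> i \<le> k \<and> k - i \<le> m}. F $ i * G $ (k - i))" for k
  proof -
    have z: "F $ i * G $ (k - i) = 0" if "\<not> (i \<le> n \<and> k - i \<le> m)" for i
      using that assms by (cases "i \<le> n") (auto simp: bdeg_def)
    show ?thesis unfolding fps_mult_nth by (rule sum.mono_neutral_right) (use z in auto)
  qed
  show "bdeg (n + m) (F * G)"
    unfolding bdeg_def gen by (auto intro!: sum.neutral)
  have "{i. i \<le> n \<and> i \<le> n + m \<and> n + m - i \<le> m} = {n}" by auto
  then show "(F * G) $ (n + m) = F $ n * G $ m" by (simp add: gen)
  have "rv (n + m) (F * G) $ k = (rv n F * rv m G) $ k" for k
  proof -
    have R: "(rv n F * rv m G) $ k = (\<Sum>i\<in>{i. i \<le> k \<and> i \<le> n \<and> k - i \<le> m}. F $ (n - i) * G $ (m - (k - i)))"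
      unfolding fps_mult_nth rv_nth by (intro sum.mono_neutral_cong_right) auto
    show ?thesis
    proof (cases "k \<le> n + m")
      case True
      have "(F * G) $ (n + m - k) = (\<Sum>i\<in>{i. i \<le> k \<and> i \<le> n \<and> k - i \<le> m}. F $ (n - i) * G $ (m - (k - i)))"
        unfolding gen
        by (rule sum.reindex_bij_witness[of _ "\<lambda>i. n - i" "\<lambda>i. n - i"])
          (use True in \<open>auto intro!: arg_cong2[of _ _ _ _ "(*)"] arg_cong[of _ _ "fps_nth G"]\<close>)
      then show ?thesis using True R by (simp add: rv_nth)
    next
      case False
      then have "{i. i \<le> k \<and> i \<le> n \<and> k - i \<le> m} = {}" by auto
      then show ?thesis using False by (simp only: R rv_nth sum.empty if_False)
    qed
  qed
  then show "rv (n + m) (F * G) = rv n F * rv m G" by (intro fps_ext)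
qed

lemma rv_1 [simp]: "rv 0 (1 :: 'a::{zero,one} fps) = 1" "bdeg 0 (1 :: 'a::{zero,one} fps)"
  by (auto intro!: fps_ext simp: rv_nth bdeg_def)

lemma prod_list_bdeg:
  fixes G :: "'b \<Rightarrow> 'a::{ring,monoid_mult} fps"
  assumes "\<And>x. x \<in> set xs \<Longrightarrow> bdeg (n x) (G x)"
  shows "bdeg (sum_list (map n xs)) (prod_list (map G xs))"
    "prod_list (map G xs) $ sum_list (map n xs) = prod_list (map (\<lambda>x. G x $ n x) xs)"
    "rv (sum_list (map n xs)) (prod_list (map G xs)) = prod_list (map (\<lambda>x. rv (n x) (G x)) xs)"
proof -
  have "bdeg (sum_list (map n xs)) (prod_list (map G xs)) \<and>
    prod_list (map G xs) $ sum_list (map n xs) = prod_list (map (\<lambda>x. G x $ n x) xs) \<and>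
    rv (sum_list (map n xs)) (prod_list (map G xs)) = prod_list (map (\<lambda>x. rv (n x) (G x)) xs)"
    using assms
  proof (induction xs)
    case (Cons x xs)
    then have "bdeg (n x) (G x)" and IH: "bdeg (sum_list (map n xs)) (prod_list (map G xs))" by auto
    from fps_mult_bdeg[OF this] Cons show ?case by simp
  qed simp
  then show "bdeg (sum_list (map n xs)) (prod_list (map G xs))"
    "prod_list (map G xs) $ sum_list (map n xs) = prod_list (map (\<lambda>x. G x $ n x) xs)"
    "rv (sum_list (map n xs)) (prod_list (map G xs)) = prod_list (map (\<lambda>x. rv (n x) (G x)) xs)"
    by auto
qed

lemma (in comm_family) prod_list_const:
  assumes "\<And>x. x \<in> set xs \<Longrightarrow> e x \<in> K" "\<And>x. x \<in> set xs \<Longrightarrow> fK (H x)"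
  shows "prod_list (map (\<lambda>x. fps_const (e x) * H x) xs) =
      fps_const (prod_list (map e xs)) * prod_list (map H xs)" "prod_list (map e xs) \<in> K"
proof -
  have "prod_list (map (\<lambda>x. fps_const (e x) * H x) xs) =
      fps_const (prod_list (map e xs)) * prod_list (map H xs) \<and> prod_list (map e xs) \<in> K"
    using assms
  proof (induction xs)
    case Nil
    then show ?case by (simp add: fps_const_1_eq_1)
  next
    case (Cons x xs)
    let ?P = "prod_list (map e xs)" and ?Q = "prod_list (map H xs)"
    have P: "?P \<in> K" using Cons by simp
    then have "fK (fps_const ?P)" by (simp add: fK_def fps_const_def)
    then have c: "H x * fps_const ?P = fps_const ?P * H x" using Cons.prems(2) by (intro fK_comm) auto
    have "fps_const (e x) * H x * (fps_const ?P * ?Q) = fps_const (e x) * (H x * fps_const ?P) * ?Q"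
      by (simp only: mult.assoc)
    also have "\<dots> = fps_const (e x) * fps_const ?P * (H x * ?Q)" unfolding c by (simp only: mult.assoc)
    also have "fps_const (e x) * fps_const ?P = fps_const (e x * ?P)" by (simp add: fps_const_mult)
    finally show ?case using Cons P by simp
  qed
  then show "prod_list (map (\<lambda>x. fps_const (e x) * H x) xs) =
      fps_const (prod_list (map e xs)) * prod_list (map H xs)" "prod_list (map e xs) \<in> K" by auto
qed

section \<open>The truncation series on a representation\<close>

locale trunc_rep = qrep c d q m scl \<rho>
  for c :: "'i::{finite,linorder} \<Rightarrow> 'i \<Rightarrow> int" and d q m
    and scl :: "complex \<Rightarrow> 'v::ab_group_add \<Rightarrow> 'v" and \<rho> +
  fixes a :: "'i \<Rightarrow> complex poly"
  assumes a_lweight: "poly_lweight a"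
begin

lemma a_nz: "poly (a i) 0 \<noteq> 0" "coeff (a i) 0 \<noteq> 0" "lead_coeff (a i) \<noteq> 0" "a i \<noteq> 0"
proof -
  show 1: "poly (a i) 0 \<noteq> 0" using a_lweight by (simp add: poly_lweight_def)
  then show "coeff (a i) 0 \<noteq> 0" by (simp add: poly_0_coeff_0)
  show "a i \<noteq> 0" using 1 by auto
  then show "lead_coeff (a i) \<noteq> 0" by simp
qed

lemmas PI = Pinv(2-5)[unfolded pm.case]
lemmas PK = Pinv(1)[of Pos, unfolded pm.case] Pinv(1)[of Neg, unfolded pm.case]
lemmas phib_nth' = phib_nth[unfolded pm.case]

abbreviation "scA \<equiv> scrA c d q m a"
abbreviation "lwn \<equiv> lw_normalized"

definition SA :: "pm \<Rightarrow> 'i \<Rightarrow> 'v endo fps" where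
  "SA \<epsilon> i = Abs_fps (\<lambda>k. R (scA \<epsilon> i k))"

lemma SA_eq: "SA \<epsilon> i = M.S.scf (lw_star c d q a \<epsilon> i) * AF \<epsilon> i"
proof (intro fps_ext)
  fix k
  have "R (scA \<epsilon> i k) = (\<Sum>l\<le>k. sc (lw_star c d q a \<epsilon> i $ l) * R (A_ser c d q m \<epsilon> i (k - l)))"
    unfolding scrA_def by (subst M.R_finsum) (auto simp: M.R_smult A_ser_closed)
  then show "SA \<epsilon> i $ k = (M.S.scf (lw_star c d q a \<epsilon> i) * AF \<epsilon> i) $ k"
    by (simp add: SA_def AF_def fps_mult_nth atMost_atLeast0)
qed

lemma SA_K [simp, intro]: "C.fK (SA \<epsilon> i)"
  unfolding SA_eq by simp

abbreviation ell :: "pm \<Rightarrow> 'i \<Rightarrow> complex fps" where "ell \<epsilon> j \<equiv> theta (lw_log \<epsilon> (a j))"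

lemma LD_lwn: "LD (ell \<epsilon> j) (lwn \<epsilon> (a j))"
  by (rule lw_log(1)) (rule a_nz)

lemma LD_lw_star: "LD (Abs_fps (\<lambda>k. \<Sum>j\<in>UNIV. A_coeff c d q (sgi \<epsilon> * int k) i j * ell \<epsilon> j $ k)) (lw_star c d q a \<epsilon> i)"
proof -
  let ?f = "Abs_fps (\<lambda>k. if k = 0 then 0 else
     (\<Sum>j\<in>UNIV. A_coeff c d q (sgi \<epsilon> * int k) i j * fps_nth (lw_log \<epsilon> (a j)) k))"
  have "theta ?f = Abs_fps (\<lambda>k. \<Sum>j\<in>UNIV. A_coeff c d q (sgi \<epsilon> * int k) i j * ell \<epsilon> j $ k)"
    by (intro fps_ext) (simp add: nsm_sum nsm_mult_right)
  moreover have "LD (theta ?f) (lw_star c d q a \<epsilon> i)"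
    unfolding lw_star_def by (rule LD_exp) simp
  ultimately show ?thesis by simp
qed

definition SL :: "pm \<Rightarrow> 'i \<Rightarrow> 'v endo fps" where
  "SL \<epsilon> i = Abs_fps (\<lambda>k. \<Sum>j\<in>UNIV. sc (A_coeff c d q (sgi \<epsilon> * int k) i j) * (sc (ell \<epsilon> j $ k) - Gam \<epsilon> j $ k))"

lemma LD_SA: "LD (SL \<epsilon> i) (SA \<epsilon> i)"
proof -
  let ?s = "Abs_fps (\<lambda>k. \<Sum>j\<in>UNIV. A_coeff c d q (sgi \<epsilon> * int k) i j * ell \<epsilon> j $ k)"
  let ?t = "Abs_fps (\<lambda>k. - (\<Sum>j\<in>UNIV. sc (A_coeff c d q (sgi \<epsilon> * int k) i j) * Gam \<epsilon> j $ k))"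
  have "LD (M.S.scf ?s + ?t) (SA \<epsilon> i)"
    unfolding SA_eq by (rule C.LD_multK[OF M.S.scf_LD[OF LD_lw_star] LD_AF]) auto
  moreover have "M.S.scf ?s + ?t = SL \<epsilon> i"
    by (intro fps_ext) (simp add: SL_def M.S.sc_sum M.S.sc_mult right_diff_distrib sum_subtractf)
  ultimately show ?thesis by simp
qed

lemma SA_0: "SA \<epsilon> i $ 0 = 1"
  using LD_SA by (simp add: LD_def)

text \<open>The product formula characterizes \<open>SA \<epsilon>\<close> among families of series
  over K with logarithmic derivatives. The direction from the formula to \<open>SA\<close> is what
  identifies the reversed polynomials with \<open>SA Neg\<close>.\<close>

lemma star_iff:
  assumes B: "\<And>l. LD (\<beta> l) (B l)" "\<And>l. C.fK (B l)"
  shows "(\<forall>l. phib \<epsilon> l * (B l * M.S.zs (qi d q l powi (2 * sgi \<epsilon>)) (B l)) =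
       M.S.scf (lwn \<epsilon> (a l)) * prod_list (map (\<lambda>jp. M.S.zs (fac_exp \<epsilon> l jp) (B (fst jp))) (factors l)))
    \<longleftrightarrow> (\<forall>i. B i = SA \<epsilon> i)"
proof -
  have SL0: "SL \<epsilon> i $ 0 = 0" "\<beta> i $ 0 = 0" for i using LD_SA B by (auto simp: LD_def)
  have "(\<forall>k>0. \<forall>i. \<beta> i $ k = (\<Sum>j\<in>UNIV. sc (A_coeff c d q (sgi \<epsilon> * int k) i j) * (sc (ell \<epsilon> j $ k) - Gam \<epsilon> j $ k)))
     \<longleftrightarrow> (\<forall>i. \<beta> i = SL \<epsilon> i)"
    using SL0 by (subst fps_eq_iff_pos) (auto simp: SL_def)
  also have "\<dots> \<longleftrightarrow> (\<forall>i. B i = SA \<epsilon> i)"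
  proof (intro iffI allI)
    fix i assume "\<forall>i. \<beta> i = SL \<epsilon> i"
    then show "B i = SA \<epsilon> i" using M.S.LD_unique[OF B(1)[of i]] LD_SA[of \<epsilon> i] by simp
  next
    fix i assume "\<forall>i. B i = SA \<epsilon> i"
    then show "\<beta> i = SL \<epsilon> i" using LD_unique_log[OF B(1)[of i]] LD_SA[of \<epsilon> i] by simp
  qed
  finally show ?thesis
    using product_formula[OF C.comm_family_axioms, where F = "phib \<epsilon>" and \<Gamma> = "Gam \<epsilon>" and B = B
        and \<beta> = \<beta> and p = "\<lambda>l. lwn \<epsilon> (a l)" and \<pi> = "ell \<epsilon>" and \<epsilon> = \<epsilon>,
        OF LD_phib phib_K B LD_lwn] by (simp only:)
qed

lemma star: "phib \<epsilon> l * (SA \<epsilon> l * M.S.zs (qi d q l powi (2 * sgi \<epsilon>)) (SA \<epsilon> l)) =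
       M.S.scf (lwn \<epsilon> (a l)) * prod_list (map (\<lambda>jp. M.S.zs (fac_exp \<epsilon> l jp) (SA \<epsilon> (fst jp))) (factors l))"
  using star_iff[of "SL \<epsilon>" "SA \<epsilon>" \<epsilon>, OF LD_SA SA_K] by blast

text \<open>\<open>A_coeff\<close> is \<open>T_coeff\<close> times 1 - q_i^(-2 s), and the A-series
  carries the opposite sign in the exponent. So before multiplication by the scalar series the
  product with T_i(z) is T_i(q_i^(-2) z).\<close>

lemma SA_TF: "SA Pos i * TF Pos i = M.S.scf (lw_star c d q a Pos i) * M.S.zs (qi d q i powi -2) (TF Pos i)"
proof -
  let ?t = "Abs_fps (\<lambda>k. \<Sum>j\<in>UNIV. sc (T_coeff c d q (sgi Pos * int k) i j) * Gam Pos j $ k)"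
  let ?a = "Abs_fps (\<lambda>k. - (\<Sum>j\<in>UNIV. sc (A_coeff c d q (sgi Pos * int k) i j) * Gam Pos j $ k))"
  have 1: "LD (?a + ?t) (AF Pos i * TF Pos i)"
    by (rule C.LD_multK[OF LD_AF LD_TF]) auto
  have 2: "LD (M.S.zs (qi d q i powi -2) ?t) (M.S.zs (qi d q i powi -2) (TF Pos i))"
    by (rule C.LD_zsK[OF LD_TF]) auto
  have "?a + ?t = M.S.zs (qi d q i powi -2) ?t"
  proof (intro fps_ext)
    fix k
    have "qi d q i powi (- 2 * int k) = (qi d q i powi - 2) ^ k"
      by (simp only: power_int_mult power_int_of_nat)
    then have "T_coeff c d q (int k) i j - A_coeff c d q (int k) i j = (qi d q i powi -2) ^ k * T_coeff c d q (int k) i j" for j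
      by (simp add: A_coeff_def T_coeff_def diff_divide_distrib right_diff_distrib)
    then have "sc (T_coeff c d q (int k) i j) - sc (A_coeff c d q (int k) i j) = sc ((qi d q i powi -2) ^ k) * sc (T_coeff c d q (int k) i j)" for j
      by (simp only: M.S.sc_diff[symmetric] M.S.sc_mult)
    then show "(?a + ?t) $ k = M.S.zs (qi d q i powi -2) ?t $ k"
      by (simp add: sum_distrib_left mult.assoc[symmetric] sum_subtractf[symmetric] left_diff_distrib[symmetric])
  qed
  then have "AF Pos i * TF Pos i = M.S.zs (qi d q i powi -2) (TF Pos i)"
    using M.S.LD_unique[OF 1] 2 by simp
  then show ?thesis unfolding SA_eq by (simp only: mult.assoc)
qed

text \<open>Conjugation of x_j by the normalized \<phi>_i multiplies by (1 - z / Q) / (1 - Q z) with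
  Q = q^(b_ij) or its inverse; the logarithmic derivative of this fraction gives the
  bracket.\<close>

lemma bracket_Gam:
  "Gam Pos i $ k * X \<delta> j n - X \<delta> j n * Gam Pos i $ k =
     sc (q powi (int k * (sgi \<delta> * bform c d i j)) - q powi (- (int k * (sgi \<delta> * bform c d i j)))) * X \<delta> j (n + int k)"
proof -
  define Q where "Q = q powi (sgi \<delta> * bform c d i j)"
  have Q: "Q \<noteq> 0" using q_nz by (simp add: Q_def)
  have PX: "R (inv\<^bsub>U\<^esub> ph Pos i 0) * X \<delta> j n = sc (inverse Q) * (X \<delta> j n * R (inv\<^bsub>U\<^esub> ph Pos i 0))" for n
  proof -
    have "Phi Pos i 0 * X \<delta> j n * R (inv\<^bsub>U\<^esub> ph Pos i 0) = sc Q * (X \<delta> j n * (Phi Pos i 0 * R (inv\<^bsub>U\<^esub> ph Pos i 0)))"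
      using Phi0_X[of i \<delta> j n] by (simp add: Q_def mult.assoc)
    then have "R (inv\<^bsub>U\<^esub> ph Pos i 0) * (Phi Pos i 0 * X \<delta> j n * R (inv\<^bsub>U\<^esub> ph Pos i 0)) = R (inv\<^bsub>U\<^esub> ph Pos i 0) * (sc Q * X \<delta> j n)"
      by (simp add: PI)
    then have "(R (inv\<^bsub>U\<^esub> ph Pos i 0) * Phi Pos i 0) * (X \<delta> j n * R (inv\<^bsub>U\<^esub> ph Pos i 0)) = (R (inv\<^bsub>U\<^esub> ph Pos i 0) * sc Q) * X \<delta> j n"
      by (simp only: mult.assoc)
    then have "X \<delta> j n * R (inv\<^bsub>U\<^esub> ph Pos i 0) = sc Q * (R (inv\<^bsub>U\<^esub> ph Pos i 0) * X \<delta> j n)"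
      using M.S.lin_sc[OF C.K_lin[OF PK(1)], of i Q] by (simp add: PI mult.assoc)
    then have "sc (inverse Q) * (X \<delta> j n * R (inv\<^bsub>U\<^esub> ph Pos i 0)) = sc (inverse Q * Q) * (R (inv\<^bsub>U\<^esub> ph Pos i 0) * X \<delta> j n)"
      by (simp only: M.S.sc_mult mult.assoc)
    then show ?thesis using Q by simp
  qed
  have cj: "phib Pos i * fps_const (X \<delta> j n) = M.S.act (ratser Q (inverse Q)) (X \<delta> j) n * phib Pos i" for n
  proof (rule M.S.act_of_recursion)
    show "M.S.flin (phib Pos i)" by (rule C.fK_lin) simp
    show "phib Pos i $ 0 * X \<delta> j n = X \<delta> j n * phib Pos i $ 0" for n
      by (simp add: phib_nth' PI)
    fix k n
    let ?P = "R (inv\<^bsub>U\<^esub> ph Pos i 0)"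
    have scP: "?P * (sc b * y) = sc b * (?P * y)" for b y
      by (rule M.S.lin_sc2[OF C.K_lin[OF PK(1)]])
    have "Phi Pos i (int (Suc k)) * X \<delta> j n - sc Q * Phi Pos i (int k) * X \<delta> j (n + 1)
       = sc Q * X \<delta> j n * Phi Pos i (int (Suc k)) - X \<delta> j (n + 1) * Phi Pos i (int k)"
      using Phi_X[of Pos i "int k" \<delta> j n] unfolding Q_def by (simp only: of_nat_Suc add.commute)
    then have "?P * (Phi Pos i (int (Suc k)) * X \<delta> j n - sc Q * Phi Pos i (int k) * X \<delta> j (n + 1))
       = ?P * (sc Q * X \<delta> j n * Phi Pos i (int (Suc k)) - X \<delta> j (n + 1) * Phi Pos i (int k))"
      by (simp only:)
    then have "?P * Phi Pos i (int (Suc k)) * X \<delta> j n - sc Q * (?P * Phi Pos i (int k) * X \<delta> j (n + 1))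
       = sc Q * (?P * X \<delta> j n * Phi Pos i (int (Suc k))) - ?P * X \<delta> j (n + 1) * Phi Pos i (int k)"
      by (simp only: right_diff_distrib scP mult.assoc)
    also have "\<dots> = sc (Q * inverse Q) * (X \<delta> j n * (?P * Phi Pos i (int (Suc k)))) - sc (inverse Q) * (X \<delta> j (n + 1) * (?P * Phi Pos i (int k)))"
      unfolding PX M.S.sc_mult by (simp only: mult.assoc)
    finally show "phib Pos i $ Suc k * X \<delta> j n - sc Q * (phib Pos i $ k * X \<delta> j (n + 1)) =
       X \<delta> j n * phib Pos i $ Suc k - sc (inverse Q) * (X \<delta> j (n + 1) * phib Pos i $ k)"
      using Q by (simp add: phib_nth')
  qed
  have "Gam Pos i $ k * X \<delta> j n - X \<delta> j n * Gam Pos i $ k = sc (ratlog Q (inverse Q) $ k) * X \<delta> j (n + int k)"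
    by (rule M.S.bracket_of_conj[OF LD_phib cj]) (auto intro: C.fK_lin ratser_props)
  moreover have Qk: "Q ^ k = q powi (int k * (sgi \<delta> * bform c d i j))"
    by (simp only: Q_def power_int_of_nat[symmetric] power_int_mult[symmetric] mult.commute)
  moreover have "inverse Q ^ k = q powi (- (int k * (sgi \<delta> * bform c d i j)))"
    by (simp only: power_inverse Qk power_int_minus)
  ultimately show ?thesis by (simp add: ratlog_def)
qed

abbreviation "bb i \<equiv> qi d q i powi (- 2)"

lemma bb: "bb i \<noteq> 1" "bb i \<noteq> 0" "inverse (bb i) = qi d q i ^ 2"
proof -
  show "bb i \<noteq> 1" using qi_diff[of 1 i] by simp
  show "bb i \<noteq> 0" using qi_nz by simp
  show "inverse (bb i) = qi d q i ^ 2" by (simp add: power_int_minus)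
qed

text \<open>The brackets with x_i^- form column i of \<open>ecoeff\<close> up to the factor 1 -
  q_i^(-2 k), and \<open>A_coeff\<close> inverts that matrix. What remains is this factor, the k-th
  coefficient of the logarithmic derivative of (1 - q_i^(-2) z) / (1 - z).\<close>

lemma SA_X: "SA Pos i * fps_const (X Neg i n) = M.S.act (ratser 1 (bb i)) (X Neg i) n * SA Pos i"
proof (rule M.S.conj_of_bracket[OF LD_SA])
  show "M.S.flin (SL Pos i)" by (rule C.fK_lin[OF C.LD_fK[OF LD_SA]]) simp
  fix k n
  have "SL Pos i $ k * X Neg i n - X Neg i n * SL Pos i $ k =
     (\<Sum>j\<in>UNIV. sc (A_coeff c d q (int k) i j) * - (Gam Pos j $ k * X Neg i n - X Neg i n * Gam Pos j $ k))"
  proof -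
    have x: "X Neg i n * (sc b * y) = sc b * (X Neg i n * y)" for b y by (rule M.S.lin_sc2) simp
    have "X Neg i n * sc b = sc b * X Neg i n" for b by (rule M.S.lin_sc) simp
    then have "sc (A_coeff c d q (int k) i j) * (sc (ell Pos j $ k) - Gam Pos j $ k) * X Neg i n
       - X Neg i n * (sc (A_coeff c d q (int k) i j) * (sc (ell Pos j $ k) - Gam Pos j $ k))
       = sc (A_coeff c d q (int k) i j) * - (Gam Pos j $ k * X Neg i n - X Neg i n * Gam Pos j $ k)" for j
      unfolding x by (simp add: algebra_simps)
    then show ?thesis by (simp add: SL_def sum_distrib_left sum_distrib_right sum_subtractf[symmetric])
  qed
  also have "\<dots> = sc (ratlog 1 (bb i) $ k) * X Neg i (n + int k)"
  proof (cases "k = 0")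
    case False
    have "- sc (q powi (int k * (sgi Neg * bform c d j i)) - q powi (- (int k * (sgi Neg * bform c d j i))))
       = sc ((1 - qi d q i powi (- 2 * int k)) * ecoeff (int k) j i)" for j
      using qi_diff[of "int k" i] False by (simp add: ecoeff_def M.S.sc_uminus[symmetric])
    then have "(\<Sum>j\<in>UNIV. sc (A_coeff c d q (int k) i j) * - (Gam Pos j $ k * X Neg i n - X Neg i n * Gam Pos j $ k))
      = (\<Sum>j\<in>UNIV. sc (A_coeff c d q (int k) i j * ((1 - qi d q i powi (- 2 * int k)) * ecoeff (int k) j i)) * X Neg i (n + int k))"
      unfolding bracket_Gam minus_mult_left by (simp only: M.S.sc_mult[of "A_coeff _ _ _ _ _ _"] mult.assoc)
    also have "\<dots> = sc ((1 - qi d q i powi (- 2 * int k)) * (\<Sum>j\<in>UNIV. A_coeff c d q (int k) i j * ecoeff (int k) j i)) * X Neg i (n + int k)"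
      by (simp add: M.S.sc_sum sum_distrib_left sum_distrib_right mult.left_commute)
    also have "\<dots> = sc (1 - qi d q i powi (- 2 * int k)) * X Neg i (n + int k)"
      using ecoeff_inverse(2)[of "int k" i i] False by simp
    also have "qi d q i powi (- 2 * int k) = bb i ^ k"
      by (simp only: power_int_mult power_int_of_nat)
    finally show ?thesis by (simp add: ratlog_def)
  qed (use LD_phib in \<open>simp add: ratlog_def LD_def\<close>)
  finally show "SL Pos i $ k * X Neg i n - X Neg i n * SL Pos i $ k = sc (ratlog 1 (bb i) $ k) * X Neg i (n + int k)" .
qed (rule ratser_props)+

end

section \<open>Consequences of T-polynomiality\<close>

locale tpoly = trunc_rep c d q m scl \<rho> a
  for c :: "'i::{finite,linorder} \<Rightarrow> 'i \<Rightarrow> int" and d q m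
    and scl :: "complex \<Rightarrow> 'v::ab_group_add \<Rightarrow> 'v" and \<rho> and a +
  fixes \<Lambda> :: "'i \<Rightarrow> complex" and f :: "'i \<Rightarrow> complex fps"
  assumes top: "top_graded c d q m scl \<rho> \<Lambda>"
    and T_eigen: "\<And>i k v. v \<in> wt_space c d q m scl \<rho> \<Lambda> \<Longrightarrow>
      \<rho> (T_ser c d q m Pos i k) v = scl (fps_nth (f i) k) v"
    and T_degree: "\<And>i k \<beta> v. k > \<beta> i \<Longrightarrow> v \<in> wt_space c d q m scl \<rho> (lower_wt c d q \<Lambda> \<beta>) \<Longrightarrow>
      normalized_T c d q m scl \<rho> f i k v = 0"
    and T_lead: "\<And>i \<beta>. bij_betw (normalized_T c d q m scl \<rho> f i (\<beta> i))
      (wt_space c d q m scl \<rho> (lower_wt c d q \<Lambda> \<beta>)) (wt_space c d q m scl \<rho> (lower_wt c d q \<Lambda> \<beta>))"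
    and stab: "\<And>i. stabilizes_polynomials (\<lambda>k. \<rho> (scrA c d q m a Pos i k))"
begin

definition W :: "('i \<Rightarrow> nat) \<Rightarrow> 'v set" where
  "W \<beta> = wt_space c d q m scl \<rho> (lower_wt c d q \<Lambda> \<beta>)"

lemma app_Phi: "app (Phi \<epsilon> i k) v = \<rho> (ph \<epsilon> i k) v"
  by (simp add: Phi_def M.app_R)

lemma W_iff: "v \<in> W \<beta> \<longleftrightarrow> (\<forall>i. app (Phi Pos i 0) v = scl (lower_wt c d q \<Lambda> \<beta> i) v)"
  by (simp add: W_def wt_space_def app_Phi)

lemma app_scl: "x \<in> M.S.lin \<Longrightarrow> app x (scl b v) = scl b (app x v)"
  by (simp add: M.lin_iff)

lemma W_subspace: "M.V.subspace (W \<beta>)"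
  unfolding M.V.subspace_def
  by (auto simp: W_iff app_add_right M.V.scale_right_distrib app_scl mult.commute)

lemma W_zero [simp]: "0 \<in> W \<beta>"
  using M.V.subspace_0[OF W_subspace] .

lemma W_scale [intro]: "v \<in> W \<beta> \<Longrightarrow> scl b v \<in> W \<beta>"
  using M.V.subspace_scale[OF W_subspace] .

lemma W_K: assumes "x \<in> K" "v \<in> W \<beta>" shows "app x v \<in> W \<beta>"
  unfolding W_iff
proof
  fix i
  have "app (Phi Pos i 0) (app x v) = app (x * Phi Pos i 0) v"
    using C.K_comm[OF assms(1) Phi_K, of Pos i 0] by simp
  then show "app (Phi Pos i 0) (app x v) = scl (lower_wt c d q \<Lambda> \<beta> i) (app x v)"
    using assms W_iff[of v \<beta>] by (simp add: app_scl C.K_lin)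
qed

lemma W_decompose: obtains B g where "finite B" "\<And>\<beta>. \<beta> \<in> B \<Longrightarrow> g \<beta> \<in> W \<beta>" "v = (\<Sum>\<beta>\<in>B. g \<beta>)"
proof -
  have wg: "weight_graded c d q m scl \<rho>" and cone: "weights c d q m scl \<rho> \<subseteq> weight_cone c d q \<Lambda>"
    using top by (simp_all add: top_graded_def)
  obtain F where F': "finite {L. F L \<noteq> 0} \<and> (\<forall>L. L \<notin> t_dual \<longrightarrow> F L = 0) \<and>
        (\<forall>L\<in>t_dual. F L \<in> wt_space c d q m scl \<rho> L) \<and> v = (\<Sum>L | F L \<noteq> 0. F L)"
    using ex1_implies_ex[OF spec[OF wg[unfolded weight_graded_def], of v]] by (rule exE)
  have F: "finite {L. F L \<noteq> 0}" "\<And>L. L \<notin> t_dual \<Longrightarrow> F L = 0"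
    "\<And>L. L \<in> t_dual \<Longrightarrow> F L \<in> wt_space c d q m scl \<rho> L" "v = (\<Sum>L | F L \<noteq> 0. F L)"
    using F' by simp_all
  have "\<exists>\<beta>. L = lower_wt c d q \<Lambda> \<beta>" if "F L \<noteq> 0" for L
  proof -
    have "L \<in> t_dual" "F L \<in> wt_space c d q m scl \<rho> L" using F(2,3) that by blast+
    then have "L \<in> weights c d q m scl \<rho>" using that by (auto simp: weights_def)
    then show ?thesis using cone by (auto simp: weight_cone_def)
  qed
  then obtain b where b: "\<And>L. F L \<noteq> 0 \<Longrightarrow> L = lower_wt c d q \<Lambda> (b L)" by metis
  have inj: "inj_on b {L. F L \<noteq> 0}"
  proof (rule inj_onI)
    fix L L' assume "L \<in> {L. F L \<noteq> 0}" "L' \<in> {L. F L \<noteq> 0}" "b L = b L'"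
    then show "L = L'" using b[of L] b[of L'] by simp
  qed
  have e: "F (lower_wt c d q \<Lambda> (b L)) = F L" if "F L \<noteq> 0" for L
    by (rule arg_cong[of _ _ F]) (rule b[OF that, symmetric])
  have "(\<Sum>\<beta>\<in>b ` {L. F L \<noteq> 0}. F (lower_wt c d q \<Lambda> \<beta>)) = (\<Sum>L | F L \<noteq> 0. F L)"
    unfolding sum.reindex[OF inj] o_def by (rule sum.cong) (simp_all add: e)
  then have v: "v = (\<Sum>\<beta>\<in>b ` {L. F L \<noteq> 0}. F (lower_wt c d q \<Lambda> \<beta>))"
    unfolding F(4) by (rule HOL.sym)
  have "F (lower_wt c d q \<Lambda> \<beta>) \<in> W \<beta>" if "\<beta> \<in> b ` {L. F L \<noteq> 0}" for \<beta>
  proof -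
    obtain L where L: "F L \<noteq> 0" "\<beta> = b L" using \<open>\<beta> \<in> b ` {L. F L \<noteq> 0}\<close> by blast
    have "L \<in> t_dual" using F(2) L(1) by blast
    then have "F L \<in> wt_space c d q m scl \<rho> L" by (rule F(3))
    then have "F L \<in> W (b L)" unfolding W_def by (subst b[OF L(1), symmetric])
    then show ?thesis using e[OF L(1)] L(2) by simp
  qed
  from that[OF finite_imageI[OF F(1)] this v] show ?thesis by simp
qed

lemma endo_eq_on_W:
  assumes "\<And>\<beta> v. v \<in> W \<beta> \<Longrightarrow> app x v = app y v" shows "x = y"
proof (rule endo_eqI)
  fix v
  obtain B g where B: "finite B" "\<And>\<beta>. \<beta> \<in> B \<Longrightarrow> g \<beta> \<in> W \<beta>" "v = (\<Sum>\<beta>\<in>B. g \<beta>)"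
    by (rule W_decompose) blast
  show "app x v = app y v" unfolding B(3) app_sum_right by (rule sum.cong[OF refl]) (rule assms[OF B(2)])
qed

lemma lower_wt_0: "lower_wt c d q \<Lambda> (\<lambda>i. 0) = \<Lambda>"
  by (simp add: lower_wt_def root_bar_def fun_eq_iff)

definition v0 :: 'v where "v0 = (SOME v. v \<in> W (\<lambda>i. 0) \<and> v \<noteq> 0)"

lemma v0: "v0 \<in> W (\<lambda>i. 0)" "v0 \<noteq> 0"
proof -
  have "M.V.dim (W (\<lambda>i. 0)) = 1" using top by (simp add: W_def lower_wt_0 top_graded_def)
  moreover have "M.V.dim {0} = 0"
    using M.V.dim_eq_card_independent[OF M.V.independent_empty] M.V.dim_span[of "{}"] by simp
  ultimately have "W (\<lambda>i. 0) \<noteq> {0}" by force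
  then have "\<exists>v. v \<in> W (\<lambda>i. 0) \<and> v \<noteq> 0" using W_zero by blast
  then have "v0 \<in> W (\<lambda>i. 0) \<and> v0 \<noteq> 0" unfolding v0_def by (rule someI_ex)
  then show "v0 \<in> W (\<lambda>i. 0)" "v0 \<noteq> 0" by simp_all
qed

lemma f_0: "f i $ 0 = 1"
proof -
  have "TF Pos i $ 0 = 1" using LD_TF[of Pos i] by (simp add: LD_def)
  then have "R (T_ser c d q m Pos i 0) = 1" by (simp add: TF_def)
  then have "\<rho> (T_ser c d q m Pos i 0) v0 = v0" by (metis M.app_R T_ser_closed app_simps(6))
  then have "scl (f i $ 0) v0 = v0" using T_eigen[of v0 i 0] v0(1) by (simp add: W_def lower_wt_0)
  then show ?thesis using v0(2) by (metis M.V.scale_one M.V.scale_right_imp_eq)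
qed

section \<open>The functional equation linking the A-series and the normalized T-series\<close>

definition Tb :: "'i \<Rightarrow> 'v endo fps" where "Tb i = M.S.scf (inverse (f i)) * TF Pos i"

lemma Tb_K: "C.fK (Tb i)"
  by (simp add: Tb_def)

lemma app_Tb: "app (Tb i $ k) v = normalized_T c d q m scl \<rho> f i k v"
  by (simp add: Tb_def fps_mult_nth app_sum normalized_T_def TF_def M.app_R T_ser_closed atMost_atLeast0)

lemma TF_Tb: "TF Pos i = M.S.scf (f i) * Tb i"
proof -
  have "f i * inverse (f i) = 1" using f_0[of i] by (simp add: inverse_mult_eq_1')
  then have "M.S.scf (f i) * M.S.scf (inverse (f i)) = M.S.scf 1" by (simp flip: M.S.scf_mult)
  moreover have "M.S.scf 1 = 1" by (intro fps_ext) simp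
  ultimately show ?thesis unfolding Tb_def by (simp flip: mult.assoc)
qed

text \<open>The scalar series in the functional equation after normalizing T. By
  \<open>SA_v0\<close> it is the eigenvalue of \<open>SA Pos i\<close> on the top vector.\<close>

definition p :: "'i \<Rightarrow> complex fps" where
  "p i = inverse (f i) * (lw_star c d q a Pos i * complex_scalars.zs (bb i) (f i))"

lemma SA_Tb: "SA Pos i * Tb i = M.S.scf (p i) * M.S.zs (bb i) (Tb i)"
proof -
  have "SA Pos i * Tb i = M.S.scf (inverse (f i)) * (SA Pos i * TF Pos i)"
    unfolding Tb_def mult.assoc[symmetric] using C.fK_comm[OF SA_K, of "M.S.scf (inverse (f i))"] by simp
  also have "\<dots> = M.S.scf (inverse (f i)) * (M.S.scf (lw_star c d q a Pos i) * M.S.zs (bb i) (M.S.scf (f i) * Tb i))"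
    unfolding SA_TF by (simp flip: TF_Tb)
  also have "M.S.zs (bb i) (M.S.scf (f i) * Tb i) = M.S.scf (complex_scalars.zs (bb i) (f i)) * M.S.zs (bb i) (Tb i)"
  proof -
    have "M.S.zs (bb i) (M.S.scf (f i)) = M.S.scf (complex_scalars.zs (bb i) (f i))"
      by (intro fps_ext) (simp add: M.S.sc_mult)
    then show ?thesis using M.S.zs_mult[of "M.S.scf (f i)" "bb i" "Tb i"] C.fK_lin[of "M.S.scf (f i)"] by simp
  qed
  finally show ?thesis by (simp add: p_def M.S.scf_mult mult.assoc)
qed

lemma Tb_W: "v \<in> W \<beta> \<Longrightarrow> k > \<beta> i \<Longrightarrow> app (Tb i $ k) v = 0"
  unfolding app_Tb W_def by (rule T_degree)

lemma Tb_inj: "u \<in> W \<beta> \<Longrightarrow> v \<in> W \<beta> \<Longrightarrow> app (Tb i $ \<beta> i) u = app (Tb i $ \<beta> i) v \<Longrightarrow> u = v"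
  using T_lead[of i \<beta>] unfolding app_Tb W_def bij_betw_def inj_on_def by blast

lemma SA_Tb_app:
  "(\<Sum>l\<le>k. app (Tb i $ l) (app (SA Pos i $ (k - l)) v)) =
   (\<Sum>l\<le>k. scl (p i $ l * bb i ^ (k - l)) (app (Tb i $ (k - l)) v))"
proof -
  have "app ((Tb i * SA Pos i) $ k) v = app ((M.S.scf (p i) * M.S.zs (bb i) (Tb i)) $ k) v"
    unfolding C.fK_comm[OF Tb_K SA_K] SA_Tb ..
  then show ?thesis by (simp add: fps_mult_nth app_sum atMost_atLeast0)
qed

text \<open>On the top weight space the degree bound for the normalized T-series is 0, so it acts as
  its constant term 1.\<close>

lemma SA_v0: "app (SA Pos i $ k) v0 = scl (p i $ k) v0"
proof -
  have T0: "Tb i $ 0 = 1"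
    using LD_TF[of Pos i] f_0[of i] by (simp add: Tb_def LD_def)
  have z: "app (Tb i $ l) v0 = 0" if "l > 0" for l
    using Tb_W[OF v0(1), where i = i and k = l] that by simp
  have z': "app (Tb i $ l) (app (SA Pos i $ r) v0) = 0" if "l > 0" for l r
    using Tb_W[OF W_K[OF C.fK_D[OF SA_K] v0(1)], where i = i and k = l] that by simp
  have "(\<Sum>l\<le>k. app (Tb i $ l) (app (SA Pos i $ (k - l)) v0)) = (\<Sum>l\<in>{0}. app (Tb i $ l) (app (SA Pos i $ (k - l)) v0))"
    by (rule sum.mono_neutral_right) (use z' in auto)
  moreover have "(\<Sum>l\<le>k. scl (p i $ l * bb i ^ (k - l)) (app (Tb i $ (k - l)) v0)) =
     (\<Sum>l\<in>{k}. scl (p i $ l * bb i ^ (k - l)) (app (Tb i $ (k - l)) v0))"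
    by (rule sum.mono_neutral_right) (use z in auto)
  ultimately show ?thesis using SA_Tb_app[where v = v0 and i = i and k = k] by (simp add: T0)
qed

lemma SA_finite: "finite {k. app (SA Pos i $ k) v \<noteq> 0}"
proof -
  \<comment> \<open>The stability of V[z] is applied to the constant polynomial v.\<close>
  let ?s = "\<lambda>k::nat. if k = 0 then v else 0"
  have "finite {k. (\<Sum>l\<le>k. \<rho> (scA Pos i l) (?s (k - l))) \<noteq> 0}"
    using stab[of i] unfolding stabilizes_polynomials_def by (rule allE[of _ ?s]) simp
  moreover have "(\<Sum>l\<le>k. \<rho> (scA Pos i l) (?s (k - l))) = app (SA Pos i $ k) v" for k
  proof -
    have "\<rho> (scA Pos i l) 0 = 0" for l by (metis M.app_R app_zero_right scrA_closed)
    then have "(\<Sum>l\<le>k. \<rho> (scA Pos i l) (?s (k - l))) = (\<Sum>l\<le>k. if l = k then \<rho> (scA Pos i l) v else 0)"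
      by (intro sum.cong) auto
    then show ?thesis by (simp add: SA_def M.app_R scrA_closed)
  qed
  ultimately show ?thesis by simp
qed

text \<open>The degree of p i; \<open>trunc_t_eq\<close> identifies it with the solution of the
  Cartan system in the definition of truncatability.\<close>

definition t :: "'i \<Rightarrow> nat" where "t i = Max {k. p i $ k \<noteq> 0}"

abbreviation "lam i \<equiv> p i $ t i"

lemma p_t: "lam i \<noteq> 0" "k > t i \<Longrightarrow> p i $ k = 0"
proof -
  have "{k. p i $ k \<noteq> 0} = {k. app (SA Pos i $ k) v0 \<noteq> 0}"
    using v0(2) by (simp add: SA_v0)
  then have fin: "finite {k. p i $ k \<noteq> 0}" using SA_finite[of i v0] by simp
  have "app (SA Pos i $ 0) v0 = v0" by (simp add: SA_0)
  then have "0 \<in> {k. p i $ k \<noteq> 0}" using SA_v0[of i 0] v0(2) by auto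
  then have "t i \<in> {k. p i $ k \<noteq> 0}" unfolding t_def using fin by (intro Max_in) auto
  then show "lam i \<noteq> 0" by simp
  show "k > t i \<Longrightarrow> p i $ k = 0"
    using Max_ge[OF fin, of k] unfolding t_def by (cases "p i $ k = 0") auto
qed

text \<open>Let N > t i be the largest degree in which A acts non-trivially on u, which exists by
  \<open>SA_finite\<close>. In degree N + \<beta> i of the functional equation the right side
  vanishes, and the left side is the leading coefficient of T applied to the nonzero vector A_N u,
  contradicting injectivity.\<close>

lemma SA_W_zero:
  assumes "u \<in> W \<beta>" "k > t i" shows "app (SA Pos i $ k) u = 0"
proof (rule ccontr)
  assume nz: "app (SA Pos i $ k) u \<noteq> 0"
  define N where "N = Max {k. app (SA Pos i $ k) u \<noteq> 0}"
  have N: "app (SA Pos i $ N) u \<noteq> 0" "N \<ge> k"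
    using Max_in[OF SA_finite[of i u]] Max_ge[OF SA_finite[of i u], of k] nz unfolding N_def by auto
  have above: "app (SA Pos i $ l) u = 0" if "l > N" for l
    using Max_ge[OF SA_finite[of i u], of l] that unfolding N_def by fastforce
  have W: "app (SA Pos i $ l) u \<in> W \<beta>" for l using W_K[OF C.fK_D[OF SA_K] assms(1)] .
  have "(\<Sum>l\<le>N + \<beta> i. app (Tb i $ l) (app (SA Pos i $ (N + \<beta> i - l)) u)) =
     (\<Sum>l\<in>{\<beta> i}. app (Tb i $ l) (app (SA Pos i $ (N + \<beta> i - l)) u))"
  proof (intro sum.mono_neutral_right ballI)
    fix l assume l: "l \<in> {..N + \<beta> i} - {\<beta> i}"
    show "app (Tb i $ l) (app (SA Pos i $ (N + \<beta> i - l)) u) = 0"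
      using above[of "N + \<beta> i - l"] Tb_W[OF W, of i l] l by (cases "l > \<beta> i") auto
  qed auto
  moreover have "(\<Sum>l\<le>N + \<beta> i. scl (p i $ l * bb i ^ (N + \<beta> i - l)) (app (Tb i $ (N + \<beta> i - l)) u)) = 0"
  proof (rule sum.neutral, rule ballI)
    fix l
    show "scl (p i $ l * bb i ^ (N + \<beta> i - l)) (app (Tb i $ (N + \<beta> i - l)) u) = 0"
      using p_t(2)[of i l] Tb_W[OF assms(1), of i "N + \<beta> i - l"] N(2) assms(2) by (cases "l > t i") auto
  qed
  ultimately have "app (Tb i $ \<beta> i) (app (SA Pos i $ N) u) = app (Tb i $ \<beta> i) 0"
    using SA_Tb_app[where v = u and i = i and k = "N + \<beta> i"] by simp
  then have "app (SA Pos i $ N) u = 0" by (rule Tb_inj[OF W W_zero])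
  then show False using N(1) by simp
qed

text \<open>Degree t i + \<beta> i of the functional equation. The substitution of q_i^(-2) z for z
  on the right produces \<open>bb i ^ \<beta> i\<close>, and the leading coefficient of T
  cancels.\<close>

lemma SA_W_lead:
  assumes u: "u \<in> W \<beta>" shows "app (SA Pos i $ t i) u = scl (lam i * bb i ^ \<beta> i) u"
proof -
  have W: "app (SA Pos i $ l) u \<in> W \<beta>" for l using W_K[OF C.fK_D[OF SA_K] u] .
  have "(\<Sum>l\<le>t i + \<beta> i. app (Tb i $ l) (app (SA Pos i $ (t i + \<beta> i - l)) u)) =
     (\<Sum>l\<in>{\<beta> i}. app (Tb i $ l) (app (SA Pos i $ (t i + \<beta> i - l)) u))"
  proof (intro sum.mono_neutral_right ballI)
    fix l assume l: "l \<in> {..t i + \<beta> i} - {\<beta> i}"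
    show "app (Tb i $ l) (app (SA Pos i $ (t i + \<beta> i - l)) u) = 0"
      using SA_W_zero[OF u, of i "t i + \<beta> i - l"] Tb_W[OF W, of i l] l by (cases "l > \<beta> i") auto
  qed auto
  moreover have "(\<Sum>l\<le>t i + \<beta> i. scl (p i $ l * bb i ^ (t i + \<beta> i - l)) (app (Tb i $ (t i + \<beta> i - l)) u)) =
     (\<Sum>l\<in>{t i}. scl (p i $ l * bb i ^ (t i + \<beta> i - l)) (app (Tb i $ (t i + \<beta> i - l)) u))"
  proof (intro sum.mono_neutral_right ballI)
    fix l assume l: "l \<in> {..t i + \<beta> i} - {t i}"
    show "scl (p i $ l * bb i ^ (t i + \<beta> i - l)) (app (Tb i $ (t i + \<beta> i - l)) u) = 0"
      using p_t(2)[of i l] Tb_W[OF u, of i "t i + \<beta> i - l"] l by (cases "l > t i") auto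
  qed auto
  ultimately have "app (Tb i $ \<beta> i) (app (SA Pos i $ t i) u) = scl (lam i * bb i ^ \<beta> i) (app (Tb i $ \<beta> i) u)"
    using SA_Tb_app[where v = u and i = i and k = "t i + \<beta> i"] by simp
  also have "\<dots> = app (Tb i $ \<beta> i) (scl (lam i * bb i ^ \<beta> i) u)"
    by (simp add: app_scl C.K_lin C.fK_D[OF Tb_K])
  finally show ?thesis by (rule Tb_inj[OF W W_scale[OF u]])
qed

lemma SA_zero: "k > t i \<Longrightarrow> SA Pos i $ k = 0"
  by (rule endo_eq_on_W) (simp add: SA_W_zero)

lemma SA_bdeg: "bdeg (t i) (SA Pos i)"
  by (simp add: bdeg_def SA_zero)

lemma X_SA: "(\<Sum>r\<le>t i. X Neg i (N - int r) * SA Pos i $ r) = 0"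
  and SA_X_zero: "(\<Sum>r\<le>t i. sc ((qi d q i ^ 2) ^ r) * (SA Pos i $ r * X Neg i (N - int r))) = 0"
  using M.S.annihilation[where G = "SA Pos i" and x = "X Neg i" and b = "bb i" and t = "t i" and N = N, OF SA_X SA_0 SA_zero bb(1,2)]
  unfolding bb(3) by simp_all

section \<open>The rational function expanded by both \<phi>_i^+ and \<phi>_i^-\<close>

definition DD :: "'i \<Rightarrow> 'v endo fps" where
  "DD i = SA Pos i * M.S.zs (qi d q i ^ 2) (SA Pos i)"

lemma DD_nth: "DD i $ k = (\<Sum>(r, r')\<in>{(r, r'). r \<le> t i \<and> r' \<le> t i \<and> r + r' = k}. sc ((qi d q i ^ 2) ^ r) * SA Pos i $ r * SA Pos i $ r')"
proof -
  have "DD i = M.S.zs (qi d q i ^ 2) (SA Pos i) * SA Pos i"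
    unfolding DD_def by (rule C.fK_comm) auto
  then have "DD i $ k = (\<Sum>r = 0..k. sc ((qi d q i ^ 2) ^ r) * SA Pos i $ r * SA Pos i $ (k - r))"
    by (simp add: fps_mult_nth)
  also have "\<dots> = (\<Sum>r\<in>{r. r \<le> t i \<and> r \<le> k \<and> k - r \<le> t i}. sc ((qi d q i ^ 2) ^ r) * SA Pos i $ r * SA Pos i $ (k - r))"
  proof (intro sum.mono_neutral_right ballI)
    fix r assume r: "r \<in> {0..k} - {r. r \<le> t i \<and> r \<le> k \<and> k - r \<le> t i}"
    then have "r > t i \<or> k - r > t i" by auto
    then show "sc ((qi d q i ^ 2) ^ r) * SA Pos i $ r * SA Pos i $ (k - r) = 0"
      by (auto simp: SA_zero)
  qed auto
  also have "\<dots> = (\<Sum>(r, r')\<in>{(r, r'). r \<le> t i \<and> r' \<le> t i \<and> r + r' = k}. sc ((qi d q i ^ 2) ^ r) * SA Pos i $ r * SA Pos i $ r')"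
    by (rule sum.reindex_bij_witness[of _ fst "\<lambda>r. (r, k - r)"]) auto
  finally show ?thesis .
qed

lemma DD_K: "C.fK (DD i)" by (simp add: DD_def)

lemma DD_bdeg: "bdeg (2 * t i) (DD i)"
proof -
  have "bdeg (t i) (M.S.zs (qi d q i ^ 2) (SA Pos i))" using SA_bdeg by (simp add: bdeg_def)
  from fps_mult_bdeg(1)[OF SA_bdeg this] show ?thesis by (simp add: DD_def mult_2)
qed

text \<open>
  \<open>X_SA\<close> and \<open>SA_X_zero\<close> say that \<open>x\<^sub>i\<^sup>-(z)\<close> is annihilated by \<open>\<A>\<^sub>i(z)\<close> on the right and by
  \<open>\<A>\<^sub>i(q\<^sub>i\<^sup>2 z)\<close> on the left, so \<open>\<A>\<^sub>i(q\<^sub>i\<^sup>2 z) [x\<^sub>i\<^sup>+\<^sub>,\<^sub>0, x\<^sub>i\<^sup>-(z)] \<A>\<^sub>i(z)\<close> vanishes.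
\<close>

lemma phi_rational: "(\<Sum>e\<le>2 * t i. DD i $ e * Phi Pos i (N - int e)) = (\<Sum>e\<le>2 * t i. DD i $ e * Phi Neg i (N - int e))"
proof -
  let ?q = "qi d q i" and ?S = "\<lambda>r. SA Pos i $ r" and ?X = "X Pos i 0"
  let ?c = "1 / (?q - inverse ?q)"
  have powi_ne: "?q - inverse ?q \<noteq> 0"
    using powi_diff[of "d i"] d_pos[of i] by (simp add: qi_def power_int_minus)
  have K: "?S r \<in> K" for r by (rule C.fK_D) simp
  have br: "?X * X Neg i M - X Neg i M * ?X = sc ?c * (Phi Pos i M - Phi Neg i M)" for M
    using X_X[of i 0 i M] by simp
  define \<Delta> where "\<Delta> M = Phi Pos i M - Phi Neg i M" for M
  have \<Delta>K: "\<Delta> M \<in> K" for M by (simp add: \<Delta>_def Phi_K)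
  \<comment> \<open>\<open>DD\<close> is split into its two factors, so that one of them can stand
    to the right of \<Delta>; all of these operators lie in K.\<close>
  have "sc ?c * (\<Sum>e\<le>2 * t i. DD i $ e * \<Delta> (N - int e)) =
     (\<Sum>r\<le>t i. \<Sum>r'\<le>t i. sc ((?q^2)^r) * ?S r * (sc ?c * \<Delta> (N - int r - int r')) * ?S r')"
  proof -
    have "(\<Sum>e\<le>2 * t i. DD i $ e * \<Delta> (N - int e)) =
      (\<Sum>e\<le>2 * t i. \<Sum>(r, r')\<in>{(r, r'). r \<le> t i \<and> r' \<le> t i \<and> r + r' = e}. sc ((?q^2)^r) * ?S r * ?S r' * \<Delta> (N - int (r + r')))"
      unfolding DD_nth sum_distrib_right by (intro sum.cong) auto
    also have "\<dots> = (\<Sum>(e, rr)\<in>(SIGMA e:{..2 * t i}. {(r, r'). r \<le> t i \<and> r' \<le> t i \<and> r + r' = e}).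
        sc ((?q^2)^fst rr) * ?S (fst rr) * ?S (snd rr) * \<Delta> (N - int (fst rr + snd rr)))"
    proof (subst sum.Sigma)
      have "finite {(r, r'). r \<le> t i \<and> r' \<le> t i \<and> r + r' = e}" for e
        by (rule finite_subset[of _ "{..t i} \<times> {..t i}"]) auto
      then show "\<forall>e\<in>{..2 * t i}. finite {(r, r'). r \<le> t i \<and> r' \<le> t i \<and> r + r' = e}" by blast
    qed (auto simp: case_prod_unfold)
    also have "\<dots> = (\<Sum>(r, r')\<in>{..t i} \<times> {..t i}. sc ((?q^2)^r) * ?S r * ?S r' * \<Delta> (N - int (r + r')))"
      by (rule sum.reindex_bij_witness[of _ "\<lambda>(r, r'). (r + r', (r, r'))" snd]) auto
    also have "\<dots> = (\<Sum>r\<le>t i. \<Sum>r'\<le>t i. sc ((?q^2)^r) * ?S r * (\<Delta> (N - int r - int r') * ?S r'))"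
      using C.K_comm[OF K \<Delta>K] by (simp add: sum.cartesian_product mult.assoc algebra_simps)
    finally show ?thesis
    proof -
      assume *: "(\<Sum>e\<le>2 * t i. DD i $ e * \<Delta> (N - int e)) = (\<Sum>r\<le>t i. \<Sum>r'\<le>t i. sc ((?q^2)^r) * ?S r * (\<Delta> (N - int r - int r') * ?S r'))"
      have "sc ?c * (sc ((?q^2)^r) * ?S r * (y * ?S r')) = sc ((?q^2)^r) * ?S r * (sc ?c * y) * ?S r'" for r r' y
      proof -
        have "sc ?c * (sc ((?q^2)^r) * ?S r) = sc ((?q^2)^r) * ?S r * sc ?c"
          using K by (intro C.K_comm) auto
        then show ?thesis by (simp only: mult.assoc[symmetric])
      qed
      then show ?thesis unfolding * sum_distrib_left by simp
    qed
  qed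
  \<comment> \<open>\<Delta> is replaced by the commutator. The two resulting double sums are
    ordered differently, so that each inner sum is an instance of \<open>X_SA\<close> or
    \<open>SA_X_zero\<close>.\<close>
  also have "\<dots> = (\<Sum>r\<le>t i. \<Sum>r'\<le>t i. sc ((?q^2)^r) * ?S r * ?X * (X Neg i (N - int r - int r') * ?S r'))
     - (\<Sum>r'\<le>t i. \<Sum>r\<le>t i. sc ((?q^2)^r) * (?S r * X Neg i (N - int r' - int r)) * (?X * ?S r'))"
  proof -
    have *: "sc ((?q^2)^r) * ?S r * (sc ?c * \<Delta> M) * ?S r' =
       sc ((?q^2)^r) * ?S r * ?X * (X Neg i M * ?S r') - sc ((?q^2)^r) * (?S r * X Neg i M) * (?X * ?S r')" for r r' M
      unfolding \<Delta>_def br[symmetric] by (simp only: right_diff_distrib left_diff_distrib mult.assoc)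
    have "(\<Sum>r'\<le>t i. \<Sum>r\<le>t i. sc ((?q^2)^r) * (?S r * X Neg i (N - int r' - int r)) * (?X * ?S r')) =
       (\<Sum>r\<le>t i. \<Sum>r'\<le>t i. sc ((?q^2)^r) * (?S r * X Neg i (N - int r - int r')) * (?X * ?S r'))"
      by (subst sum.swap) (simp only: diff_diff_eq add.commute)
    then show ?thesis unfolding * by (simp only: sum_subtractf)
  qed
  also have "\<dots> = 0"
  proof -
    have "(\<Sum>r'\<le>t i. sc ((?q^2)^r) * ?S r * ?X * (X Neg i (N - int r - int r') * ?S r')) = 0" for r
      using X_SA[of i "N - int r"] by (simp only: sum_distrib_left[symmetric] mult_zero_right)
    moreover have "(\<Sum>r\<le>t i. sc ((?q^2)^r) * (?S r * X Neg i (N - int r' - int r)) * (?X * ?S r')) = 0" for r'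
      using SA_X_zero[of i "N - int r'"] by (simp only: sum_distrib_right[symmetric] mult_zero_left)
    ultimately show ?thesis by simp
  qed
  finally have "sc ?c * (\<Sum>e\<le>2 * t i. DD i $ e * \<Delta> (N - int e)) = sc ?c * 0" by simp
  then have "(\<Sum>e\<le>2 * t i. DD i $ e * \<Delta> (N - int e)) = 0"
    by (rule M.S.sc_cancel[rotated]) (use powi_ne in simp)
  then show ?thesis by (simp add: \<Delta>_def right_diff_distrib sum_subtractf)
qed

end

section \<open>The truncation relations\<close>

lemma endo_inverse:
  assumes "bij (app x)" obtains y where "y * x = 1" "x * y = (1 :: 'v::ab_group_add endo)"
proof -
  have i: "app x (inv_into UNIV (app x) v) = v" "inv_into UNIV (app x) (app x v) = v" for v
    using assms by (simp_all add: bij_def surj_f_inv_f inv_f_f)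
  have "inv_into UNIV (app x) (u + v) = inv_into UNIV (app x) u + inv_into UNIV (app x) v" for u v
  proof -
    have "inv_into UNIV (app x) (app x (inv_into UNIV (app x) u + inv_into UNIV (app x) v)) = inv_into UNIV (app x) u + inv_into UNIV (app x) v" by (rule i(2))
    then show ?thesis by (simp only: app_add_right i(1))
  qed
  then have "app (Endo (inv_into UNIV (app x))) = inv_into UNIV (app x)" by (rule app_Endo)
  then show ?thesis using that[of "Endo (inv_into UNIV (app x))"] by (simp add: endo_eqI i)
qed

lemma prod_powi_arith: "x \<noteq> 0 \<Longrightarrow> (\<Prod>p<n. x powi (b - 2 * int p)) = (x :: complex) powi (int n * b - int n * (int n - 1))"
  by (induction n) (simp_all add: power_int_add[symmetric] algebra_simps)

context cartan_datum
begin

lemma form_nondegenerate: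
  fixes x :: "'i \<Rightarrow> real"
  assumes "\<And>i. (\<Sum>j\<in>UNIV. of_int (d i * c i j) * x j) = 0" shows "x = (\<lambda>i. 0)"
proof (rule ccontr)
  assume "x \<noteq> (\<lambda>i. 0)"
  then have "0 < (\<Sum>i\<in>UNIV. \<Sum>j\<in>UNIV. x i * of_int (d i * c i j) * x j)" by (rule pos_def)
  also have "\<dots> = (\<Sum>i\<in>UNIV. x i * (\<Sum>j\<in>UNIV. of_int (d i * c i j) * x j))"
    by (simp add: sum_distrib_left mult.assoc)
  finally show False using assms by simp
qed

text \<open>After division of the coordinates by d_j the transposed Cartan matrix becomes the
  symmetric form.\<close>

lemma cartan_transpose_injective:
  fixes u :: "'i \<Rightarrow> rat"
  assumes "\<And>i. (\<Sum>j\<in>UNIV. of_int (c j i) * u j) = 0" shows "u j = 0"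
proof -
  define x :: "'i \<Rightarrow> real" where "x j = of_rat (u j) / of_int (d j)" for j
  have "(\<Sum>j\<in>UNIV. of_int (d i * c i j) * x j) = of_rat (\<Sum>j\<in>UNIV. of_int (c j i) * u j)" for i
    unfolding of_rat_sum
  proof (rule sum.cong[OF refl])
    fix j show "of_int (d i * c i j) * x j = of_rat (of_int (c j i) * u j)"
      unfolding sym[of i j] using d_pos[of j] by (simp add: x_def of_rat_mult)
  qed
  then have "x = (\<lambda>i. 0)" using assms by (intro form_nondegenerate) simp
  then have "x j = 0" by simp
  then show ?thesis using d_pos[of j] by (simp add: x_def)
qed

end

context tpoly
begin

lemma lower_wt_powi: "lower_wt c d q \<Lambda> \<beta> i = \<Lambda> i * q powi (- (\<Sum>j\<in>UNIV. bform c d j i * int (\<beta> j)))"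
proof -
  have "(\<Prod>j\<in>S. q powi (g j)) = q powi (\<Sum>j\<in>S. g j)" for S :: "'i set" and g
    using q_nz by (induction S rule: infinite_finite_induct) (simp_all add: power_int_add)
  then show ?thesis unfolding lower_wt_def root_bar_def
    by (simp add: power_int_mult[symmetric] sum_negf)
qed

lemma L_nz: "\<Lambda> i \<noteq> 0"
  using top by (simp add: top_graded_def t_dual_def)

lemma lower_wt_inject: "lower_wt c d q \<Lambda> \<beta> = lower_wt c d q \<Lambda> \<beta>' \<longleftrightarrow> \<beta> = \<beta>'"
proof
  assume "lower_wt c d q \<Lambda> \<beta> = lower_wt c d q \<Lambda> \<beta>'"
  then have "q powi (- (\<Sum>j\<in>UNIV. bform c d j i * int (\<beta> j))) = q powi (- (\<Sum>j\<in>UNIV. bform c d j i * int (\<beta>' j)))" for i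
    using L_nz[of i] by (auto simp: lower_wt_powi fun_eq_iff)
  then have 1: "(\<Sum>j\<in>UNIV. bform c d j i * int (\<beta> j)) = (\<Sum>j\<in>UNIV. bform c d j i * int (\<beta>' j))" for i
    unfolding powi_inject by simp
  have "(\<Sum>j\<in>UNIV. of_int (d i * c i j) * (real (\<beta> j) - real (\<beta>' j))) =
      of_int ((\<Sum>j\<in>UNIV. bform c d j i * int (\<beta> j)) - (\<Sum>j\<in>UNIV. bform c d j i * int (\<beta>' j)))" for i
    unfolding bform_sym[of _ i] by (simp add: bform_def right_diff_distrib sum_subtractf)
  then have "(\<lambda>j. real (\<beta> j) - real (\<beta>' j)) = (\<lambda>j. 0)"
    using 1 by (intro form_nondegenerate) simp
  then show "\<beta> = \<beta>'" by (simp add: fun_eq_iff)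
qed simp

text \<open>Different \<beta> give different weights by \<open>lower_wt_inject\<close>. Hence some
  \<phi>_(i,0)^+ minus a scalar removes the summand of \<beta>0 and multiplies a given other one by
  a nonzero number.\<close>

lemma graded_subspace:
  assumes Y: "M.V.subspace Y" and st: "\<And>i y. y \<in> Y \<Longrightarrow> app (Phi Pos i 0) y \<in> Y"
    and "finite B"
  shows "(\<And>\<beta>. \<beta> \<in> B \<Longrightarrow> g \<beta> \<in> W \<beta>) \<Longrightarrow> (\<Sum>\<beta>\<in>B. g \<beta>) \<in> Y \<Longrightarrow> \<beta> \<in> B \<Longrightarrow> g \<beta> \<in> Y"
  using \<open>finite B\<close>
proof (induction B arbitrary: g \<beta> rule: finite_induct)
  case (insert \<beta>0 B)
  let ?w = "\<lambda>\<beta>. lower_wt c d q \<Lambda> \<beta>"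
  have B: "g \<gamma> \<in> Y" if \<gamma>: "\<gamma> \<in> B" for \<gamma>
  proof -
    have "\<gamma> \<noteq> \<beta>0" using insert.hyps \<gamma> by auto
    then obtain i where i: "?w \<gamma> i \<noteq> ?w \<beta>0 i" using lower_wt_inject by (metis ext)
    let ?y = "\<Sum>\<beta>\<in>insert \<beta>0 B. g \<beta>"
    have "app (Phi Pos i 0) ?y - scl (?w \<beta>0 i) ?y \<in> Y"
      using M.V.subspace_diff[OF Y st M.V.subspace_scale[OF Y]] insert.prems(2) by blast
    also have "app (Phi Pos i 0) ?y - scl (?w \<beta>0 i) ?y = (\<Sum>\<beta>\<in>insert \<beta>0 B. scl (?w \<beta> i - ?w \<beta>0 i) (g \<beta>))"
      unfolding app_sum_right M.V.scale_sum_right sum_subtractf[symmetric]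
    proof (rule sum.cong[OF refl])
      fix \<beta> assume "\<beta> \<in> insert \<beta>0 B"
      then have "app (Phi Pos i 0) (g \<beta>) = scl (?w \<beta> i) (g \<beta>)" using insert.prems(1) W_iff by blast
      then show "app (Phi Pos i 0) (g \<beta>) - scl (?w \<beta>0 i) (g \<beta>) = scl (?w \<beta> i - ?w \<beta>0 i) (g \<beta>)"
        by (simp add: M.V.scale_left_diff_distrib)
    qed
    also have "\<dots> = (\<Sum>\<beta>\<in>B. scl (?w \<beta> i - ?w \<beta>0 i) (g \<beta>))" using insert.hyps by simp
    finally have "scl (?w \<gamma> i - ?w \<beta>0 i) (g \<gamma>) \<in> Y"
      by (rule insert.IH[rotated]) (use insert.prems(1) \<gamma> in auto)
    then have "scl (inverse (?w \<gamma> i - ?w \<beta>0 i)) (scl (?w \<gamma> i - ?w \<beta>0 i) (g \<gamma>)) \<in> Y"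
      by (rule M.V.subspace_scale[OF Y])
    then show ?thesis using i by simp
  qed
  have "g \<beta>0 = (\<Sum>\<beta>\<in>insert \<beta>0 B. g \<beta>) - (\<Sum>\<beta>\<in>B. g \<beta>)" using insert.hyps by simp
  also have "\<dots> \<in> Y" by (rule M.V.subspace_diff[OF Y insert.prems(2) M.V.subspace_sum[OF Y B]])
  finally show ?case using B insert.prems(3) by blast
qed simp

text \<open>The kernel of x is stable under the \<phi>_(i,0)^+, hence graded, and so it is detected
  on weight spaces, where x is a nonzero scalar.\<close>

lemma K_acts_invertibly:
  assumes x: "x \<in> K" and s: "\<And>\<beta> u. u \<in> W \<beta> \<Longrightarrow> app x u = scl (s \<beta>) u" "\<And>\<beta>. s \<beta> \<noteq> 0"
  obtains y where "y \<in> K" "y * x = 1" "x * y = 1"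
proof -
  have "v = 0" if "app x v = 0" for v
  proof -
    obtain B g where B: "finite B" "\<And>\<beta>. \<beta> \<in> B \<Longrightarrow> g \<beta> \<in> W \<beta>" "v = (\<Sum>\<beta>\<in>B. g \<beta>)"
      by (rule W_decompose) blast
    let ?Y = "{v. app x v = 0}"
    have sub: "M.V.subspace ?Y"
      unfolding M.V.subspace_def by (simp add: app_add_right app_scl C.K_lin[OF x])
    have st: "app (Phi Pos i 0) y \<in> ?Y" if "y \<in> ?Y" for i y
    proof -
      have "app (x * Phi Pos i 0) y = app (Phi Pos i 0 * x) y" by (simp only: C.K_comm[OF x Phi_K])
      then show ?thesis using that by simp
    qed
    have "g \<beta> = 0" if "\<beta> \<in> B" for \<beta>
    proof -
      have "g \<beta> \<in> ?Y" by (rule graded_subspace[OF sub st B(1,2) _ that]) (use B(3) \<open>app x v = 0\<close> in auto)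
      then show ?thesis using s(1)[OF B(2)[OF that]] s(2)[of \<beta>] by simp
    qed
    then show ?thesis using B(3) by simp
  qed
  then have "inj (app x)" by (intro injI) (metis app_minus_right eq_iff_diff_eq_0)
  moreover have "\<exists>u. v = app x u" for v
  proof -
    obtain B g where B: "finite B" "\<And>\<beta>. \<beta> \<in> B \<Longrightarrow> g \<beta> \<in> W \<beta>" "v = (\<Sum>\<beta>\<in>B. g \<beta>)"
      by (rule W_decompose) blast
    have "app x (\<Sum>\<beta>\<in>B. scl (inverse (s \<beta>)) (g \<beta>)) = v"
      unfolding app_sum_right B(3)
      by (intro sum.cong refl) (use s(1)[OF B(2)] s(2) in \<open>simp add: app_scl C.K_lin[OF x]\<close>)
    then show ?thesis by metis
  qed
  ultimately have "bij (app x)" by (simp add: bij_def surj_def)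
  then obtain y where "y * x = 1" "x * y = 1" by (rule endo_inverse)
  then show ?thesis using that inverse_K[OF x] by blast
qed

abbreviation "St i \<equiv> SA Pos i $ t i"

definition Li :: "'i \<Rightarrow> 'v endo" where "Li i = (SOME y. y \<in> K \<and> y * St i = 1 \<and> St i * y = 1)"

lemma Li: "Li i \<in> K" "Li i * St i = 1" "St i * Li i = 1"
proof -
  have "\<exists>y. y \<in> K \<and> y * St i = 1 \<and> St i * y = 1"
  proof (rule K_acts_invertibly[where x = "St i" and s = "\<lambda>\<beta>. lam i * bb i ^ \<beta> i"])
    show "St i \<in> K" by (rule C.fK_D) simp
    show "lam i * bb i ^ \<beta> i \<noteq> 0" for \<beta> using p_t(1)[of i] bb(2)[of i] by simp
  qed (simp_all add: SA_W_lead, blast)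
  then have "Li i \<in> K \<and> Li i * St i = 1 \<and> St i * Li i = 1" unfolding Li_def by (rule someI_ex)
  then show "Li i \<in> K" "Li i * St i = 1" "St i * Li i = 1" by auto
qed

abbreviation "P0 i \<equiv> Phi Pos i 0"
abbreviation "N0 i \<equiv> Phi Neg i (m i)"

section \<open>Comparison of the two expansions: degrees and leading coefficients\<close>

definition ndeg :: "'i \<Rightarrow> nat" where
  "ndeg i = degree (a i) + sum_list (map (\<lambda>jp. t (fst jp)) (factors i))"

definition RR :: "'i \<Rightarrow> 'v endo fps" where
  "RR i = M.S.scf (lwn Pos (a i)) * prod_list (map (\<lambda>jp. M.S.zs (fac_exp Pos i jp) (SA Pos (fst jp))) (factors i))"

lemma phib_DD: "phib Pos i * DD i = RR i"
  using star[of Pos i] by (simp add: DD_def RR_def)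

lemma zs_bdeg: "bdeg n F \<Longrightarrow> bdeg n (M.S.zs e F)"
  by (simp add: bdeg_def)

lemma lwn_bdeg: "bdeg (degree (a i)) (M.S.scf (lwn Pos (a i)))"
  by (simp add: bdeg_def coeff_eq_0)

lemma factor_bdeg: "bdeg (t (fst jp)) (M.S.zs (fac_exp Pos i jp) (SA Pos (fst jp)))"
  by (rule zs_bdeg[OF SA_bdeg])

lemma RR_bdeg: "bdeg (ndeg i) (RR i)"
  unfolding RR_def ndeg_def by (rule fps_mult_bdeg(1)[OF lwn_bdeg prod_list_bdeg(1)]) (rule factor_bdeg)

definition cR :: "'i \<Rightarrow> 'v endo" where
  "cR i = sc (inverse (coeff (a i) 0) * lead_coeff (a i)) *
     prod_list (map (\<lambda>jp. sc (fac_exp Pos i jp ^ t (fst jp)) * St (fst jp)) (factors i))"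

lemma RR_lead: "RR i $ ndeg i = cR i"
proof -
  let ?G = "\<lambda>jp. M.S.zs (fac_exp Pos i jp) (SA Pos (fst jp))"
  have "RR i $ ndeg i = M.S.scf (lwn Pos (a i)) $ degree (a i) * prod_list (map ?G (factors i)) $ sum_list (map (\<lambda>jp. t (fst jp)) (factors i))"
    unfolding RR_def ndeg_def by (rule fps_mult_bdeg(2)[OF lwn_bdeg prod_list_bdeg(1)]) (rule factor_bdeg)
  also have "prod_list (map ?G (factors i)) $ sum_list (map (\<lambda>jp. t (fst jp)) (factors i))
      = prod_list (map (\<lambda>jp. ?G jp $ t (fst jp)) (factors i))"
    by (rule prod_list_bdeg(2)) (rule factor_bdeg)
  finally show ?thesis by (simp add: cR_def)
qed

lemma DD_lead: "DD i $ (2 * t i) = sc ((qi d q i ^ 2) ^ t i) * St i * St i"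
proof -
  have "DD i $ (t i + t i) = St i * (sc ((qi d q i ^ 2) ^ t i) * St i)"
    unfolding DD_def using fps_mult_bdeg(2)[OF SA_bdeg zs_bdeg[OF SA_bdeg], of i "qi d q i ^ 2" i] by simp
  also have "\<dots> = sc ((qi d q i ^ 2) ^ t i) * St i * St i"
    using C.K_comm[OF C.fK_D[OF SA_K] C.K_sc, of Pos i "t i"] by (simp only: mult.assoc[symmetric])
  finally show ?thesis by (simp add: mult_2)
qed

lemma Phi_Pos_phib: "Phi Pos i (int k) = P0 i * phib Pos i $ k"
  by (simp add: phib_nth' PI mult.assoc[symmetric])

lemma Phi_Neg_phib: "Phi Neg i (m i - int k) = N0 i * phib Neg i $ k"
  by (simp add: phib_nth' PI mult.assoc[symmetric])

lemma KK: "DD i $ k \<in> K" "phib \<epsilon> i $ k \<in> K" "RR i $ k \<in> K"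
proof -
  show "DD i $ k \<in> K" "phib \<epsilon> i $ k \<in> K" by (simp_all add: C.fK_D DD_K)
  have "C.fK (RR i)" unfolding phib_DD[symmetric] by (simp add: DD_K)
  then show "RR i $ k \<in> K" by (rule C.fK_D)
qed

text \<open>Modes of \<phi>_i^+ below 0 vanish and \<open>DD i\<close> has degree at most 2 t_i, so
  the cut sum is a full coefficient of a product, which is \<open>RR i\<close> by the product
  formula.\<close>

lemma left_side:
  "(\<Sum>e\<le>2 * t i. DD i $ e * Phi Pos i (N - int e)) = (if N \<ge> 0 then P0 i * RR i $ nat N else 0)"
proof (cases "N \<ge> 0")
  case False
  then show ?thesis by (simp add: Phi_zero)
next
  case True
  then obtain n where n: "N = int n" using nonneg_int_cases by blast
  have "(\<Sum>e\<le>2 * t i. DD i $ e * Phi Pos i (N - int e)) = (\<Sum>e\<in>{e. e \<le> 2 * t i \<and> e \<le> n}. DD i $ e * Phi Pos i (N - int e))"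
  proof (intro sum.mono_neutral_right ballI)
    fix e assume "e \<in> {..2 * t i} - {e. e \<le> 2 * t i \<and> e \<le> n}"
    then have "N - int e < 0" by (auto simp: n)
    then show "DD i $ e * Phi Pos i (N - int e) = 0" by (simp add: Phi_zero)
  qed auto
  also have "\<dots> = (\<Sum>e\<in>{e. e \<le> 2 * t i \<and> e \<le> n}. P0 i * (DD i $ e * phib Pos i $ (n - e)))"
  proof (rule sum.cong[OF refl])
    fix e assume "e \<in> {e. e \<le> 2 * t i \<and> e \<le> n}"
    then have "N - int e = int (n - e)" by (simp add: n of_nat_diff)
    then have "DD i $ e * Phi Pos i (N - int e) = (DD i $ e * P0 i) * phib Pos i $ (n - e)"
      by (simp only: Phi_Pos_phib mult.assoc)
    also have "DD i $ e * P0 i = P0 i * DD i $ e" by (rule C.K_comm[OF KK(1) Phi_K])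
    finally show "DD i $ e * Phi Pos i (N - int e) = P0 i * (DD i $ e * phib Pos i $ (n - e))"
      by (simp only: mult.assoc)
  qed
  also have "\<dots> = P0 i * (\<Sum>e = 0..n. DD i $ e * phib Pos i $ (n - e))"
    unfolding sum_distrib_left
  proof (intro sum.mono_neutral_left ballI)
    fix e assume "e \<in> {0..n} - {e. e \<le> 2 * t i \<and> e \<le> n}"
    then have "e > 2 * t i" by auto
    then have "DD i $ e = 0" using DD_bdeg[of i] unfolding bdeg_def by blast
    then show "P0 i * (DD i $ e * phib Pos i $ (n - e)) = 0" by simp
  qed auto
  also have "(\<Sum>e = 0..n. DD i $ e * phib Pos i $ (n - e)) = RR i $ n"
    unfolding phib_DD[symmetric] C.fK_comm[OF phib_K DD_K] fps_mult_nth ..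
  finally show ?thesis using True by (simp add: n)
qed

text \<open>The sum over \<phi>_i^- can be nonzero only for N up to m_i + 2 t_i. Counting down from
  there replaces \<open>DD i\<close> by its reversal and \<phi>_i^- by its normalized series in
  1/z.\<close>

lemma right_side:
  "(\<Sum>e\<le>2 * t i. DD i $ e * Phi Neg i (m i + 2 * int (t i) - int k - int e)) =
    N0 i * (rv (2 * t i) (DD i) * phib Neg i) $ k"
proof -
  let ?T = "2 * t i"
  have "(\<Sum>e\<le>?T. DD i $ e * Phi Neg i (m i + 2 * int (t i) - int k - int e)) =
     (\<Sum>g\<le>?T. DD i $ (?T - g) * Phi Neg i (m i - (int k - int g)))"
    by (rule sum.reindex_bij_witness[of _ "\<lambda>e. ?T - e" "\<lambda>e. ?T - e"]) (auto simp: of_nat_diff algebra_simps)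
  also have "\<dots> = (\<Sum>g\<in>{g. g \<le> ?T \<and> g \<le> k}. DD i $ (?T - g) * Phi Neg i (m i - (int k - int g)))"
  proof (intro sum.mono_neutral_right ballI)
    fix g assume "g \<in> {..?T} - {g. g \<le> ?T \<and> g \<le> k}"
    then have "m i - (int k - int g) > m i" by auto
    then show "DD i $ (?T - g) * Phi Neg i (m i - (int k - int g)) = 0" by (simp add: Phi_zero)
  qed auto
  also have "\<dots> = (\<Sum>g\<in>{g. g \<le> ?T \<and> g \<le> k}. N0 i * (rv ?T (DD i) $ g * phib Neg i $ (k - g)))"
  proof (rule sum.cong[OF refl])
    fix g assume g: "g \<in> {g. g \<le> ?T \<and> g \<le> k}"
    then have "int k - int g = int (k - g)" by (simp add: of_nat_diff)
    then have "DD i $ (?T - g) * Phi Neg i (m i - (int k - int g)) = (DD i $ (?T - g) * N0 i) * phib Neg i $ (k - g)"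
      by (simp only: Phi_Neg_phib mult.assoc)
    also have "DD i $ (?T - g) * N0 i = N0 i * DD i $ (?T - g)" by (rule C.K_comm[OF KK(1) Phi_K])
    finally show "DD i $ (?T - g) * Phi Neg i (m i - (int k - int g)) = N0 i * (rv ?T (DD i) $ g * phib Neg i $ (k - g))"
      using g by (simp add: rv_nth mult.assoc)
  qed
  also have "\<dots> = N0 i * (\<Sum>g = 0..k. rv ?T (DD i) $ g * phib Neg i $ (k - g))"
    unfolding sum_distrib_left by (intro sum.mono_neutral_left) (auto simp: rv_nth)
  finally show ?thesis by (simp only: fps_mult_nth)
qed

lemma phi_identity:
  "N0 i * (rv (2 * t i) (DD i) * phib Neg i) $ k =
    (if m i + 2 * int (t i) - int k \<ge> 0 then P0 i * RR i $ nat (m i + 2 * int (t i) - int k) else 0)"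
  using phi_rational[of i "m i + 2 * int (t i) - int k"] unfolding left_side right_side by simp

lemma RR_above: assumes "int n > m i + 2 * int (t i)" shows "RR i $ n = 0"
proof -
  have "(\<Sum>e\<le>2 * t i. DD i $ e * Phi Neg i (int n - int e)) = 0"
  proof (rule sum.neutral, rule ballI)
    fix e assume "e \<in> {..2 * t i}"
    show "DD i $ e * Phi Neg i (int n - int e) = 0"
    proof (cases "int n - int e > m i")
      case False
      then have "e > 2 * t i" using assms by linarith
      then show ?thesis using DD_bdeg[of i] by (simp add: bdeg_def)
    qed (simp add: Phi_zero)
  qed
  then have "P0 i * RR i $ n = 0" using phi_rational[of i "int n"] left_side[of i "int n"] by simp
  then have "R (inv\<^bsub>U\<^esub> ph Pos i 0) * P0 i * RR i $ n = 0" by (simp add: mult.assoc)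
  then show ?thesis by (simp add: PI)
qed

lemma St_W: "u \<in> W \<beta> \<Longrightarrow> app (St i) u = scl (lam i * bb i ^ \<beta> i) u"
  by (rule SA_W_lead)

abbreviation "ls \<beta> j \<equiv> lam j * bb j ^ \<beta> j"

lemma ls_nz: "ls \<beta> j \<noteq> 0"
  using p_t(1) bb(2) by simp

lemma app_prod_list:
  assumes "\<And>x. x \<in> set xs \<Longrightarrow> app (e x) u = scl (s x) u" "\<And>x. x \<in> set xs \<Longrightarrow> e x \<in> M.S.lin"
  shows "app (prod_list (map e xs)) u = scl (prod_list (map s xs)) u"
  using assms by (induction xs) (simp_all add: app_scl mult.commute)

definition cs :: "('i \<Rightarrow> nat) \<Rightarrow> 'i \<Rightarrow> complex" where
  "cs \<beta> i = inverse (coeff (a i) 0) * lead_coeff (a i) * prod_list (map (\<lambda>jp. fac_exp Pos i jp ^ t (fst jp) * ls \<beta> (fst jp)) (factors i))"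

lemma cR_W: assumes "u \<in> W \<beta>" shows "app (cR i) u = scl (cs \<beta> i) u"
proof -
  have "app (prod_list (map (\<lambda>jp. sc (fac_exp Pos i jp ^ t (fst jp)) * St (fst jp)) (factors i))) u =
     scl (prod_list (map (\<lambda>jp. fac_exp Pos i jp ^ t (fst jp) * ls \<beta> (fst jp)) (factors i))) u"
    by (rule app_prod_list) (simp_all add: St_W[OF assms] C.fK_D C.K_lin)
  then show ?thesis by (simp add: cR_def cs_def mult.assoc)
qed

lemma fac_exp_nz: "fac_exp \<epsilon> i jp \<noteq> 0"
  using qi_nz by (simp add: fac_exp_def)

lemma cs_nz: "cs \<beta> i \<noteq> 0"
proof -
  have "prod_list (map (\<lambda>jp. fac_exp Pos i jp ^ t (fst jp) * ls \<beta> (fst jp)) xs) \<noteq> 0" for xs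
    using fac_exp_nz ls_nz by (induction xs) auto
  then show ?thesis using a_nz[of i] by (simp add: cs_def)
qed

text \<open>The coefficient of \<open>RR i\<close> in degree m_i + 2 t_i is nonzero by
  \<open>phi_identity\<close> at k = 0, and all higher ones vanish by \<open>RR_above\<close>. On
  the other hand \<open>RR i\<close> has degree at most \<open>ndeg i\<close>, with a coefficient
  there that is nonzero on the top vector.\<close>

lemma degree_identity: "int (ndeg i) = m i + 2 * int (t i)"
proof -
  have rv0: "(rv (2 * t i) (DD i) * phib Neg i) $ 0 = DD i $ (2 * t i)"
    using LD_phib[of Neg i] by (simp add: rv_nth LD_def)
  have "app (DD i $ (2 * t i)) v0 = scl ((qi d q i ^ 2) ^ t i * ls (\<lambda>i. 0) i * ls (\<lambda>i. 0) i) v0"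
    unfolding DD_lead using St_W[OF v0(1), of i] by (simp add: app_scl C.K_lin C.fK_D mult.commute)
  then have "app (DD i $ (2 * t i)) v0 \<noteq> 0" using v0(2) qi_nz[of i] ls_nz[where \<beta> = "\<lambda>i. 0" and j = i] by simp
  then have "DD i $ (2 * t i) \<noteq> 0" by auto
  moreover have "DD i $ (2 * t i) = R (inv\<^bsub>U\<^esub> ph Neg i (m i)) * (N0 i * DD i $ (2 * t i))"
    by (simp add: PI mult.assoc[symmetric])
  ultimately have "N0 i * DD i $ (2 * t i) \<noteq> 0" by auto
  then have *: "m i + 2 * int (t i) \<ge> 0" "RR i $ nat (m i + 2 * int (t i)) \<noteq> 0"
    using phi_identity[of i 0] unfolding rv0 by (auto split: if_splits)
  then have "nat (m i + 2 * int (t i)) \<le> ndeg i"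
    using RR_bdeg[of i] unfolding bdeg_def by (meson not_le)
  moreover have "app (RR i $ ndeg i) v0 \<noteq> 0"
    unfolding RR_lead using cR_W[OF v0(1)] cs_nz v0(2) by simp
  then have "\<not> int (ndeg i) > m i + 2 * int (t i)" using RR_above[where i = i and n = "ndeg i"] by auto
  ultimately show ?thesis using *(1) by linarith
qed

lemma cartan_t: "(\<Sum>j\<in>UNIV. c j i * int (t j)) = int (degree (a i)) - m i"
proof -
  have "int (sum_list (map (\<lambda>jp. t (fst jp)) (factors i))) = (\<Sum>j\<in>UNIV - {i}. - c j i * int (t j))"
    unfolding factors_sum of_nat_sum using c_offdiag by (intro sum.cong) (auto simp: nat_0_le)
  moreover have "(\<Sum>j\<in>UNIV. c j i * int (t j)) = c i i * int (t i) + (\<Sum>j\<in>UNIV - {i}. c j i * int (t j))"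
    by (rule sum.remove) auto
  ultimately show ?thesis using degree_identity[of i] by (simp add: ndeg_def c_diag sum_negf)
qed

lemma trunc_sol_eq: "trunc_sol c m a = (\<lambda>j. of_nat (t j))"
  unfolding trunc_sol_def
proof (rule the_equality)
  have e: "(\<Sum>j\<in>UNIV. of_int (c j i) * of_nat (t j)) = (of_int (int (degree (a i)) - m i) :: rat)" for i
    unfolding cartan_t[symmetric] by simp
  then show "\<forall>i. (\<Sum>j\<in>UNIV. of_int (c j i) * of_nat (t j)) = (of_int (int (degree (a i)) - m i) :: rat)" by blast
  fix s :: "'i \<Rightarrow> rat" assume s: "\<forall>i. (\<Sum>j\<in>UNIV. of_int (c j i) * s j) = of_int (int (degree (a i)) - m i)"
  have "(\<Sum>j\<in>UNIV. of_int (c j i) * (s j - of_nat (t j))) = 0" for i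
    using s e[of i] by (simp add: right_diff_distrib sum_subtractf)
  then have "s j - of_nat (t j) = 0" for j by (rule cartan_transpose_injective)
  then show "s = (\<lambda>j. of_nat (t j))" by (simp add: fun_eq_iff)
qed

lemma truncatable: "truncatable c m a" and trunc_t_eq: "trunc_t c m a = t"
  by (simp_all add: truncatable_def trunc_t_def trunc_sol_eq fun_eq_iff)

text \<open>The case k = 0 of \<open>phi_identity\<close>. On weight spaces it becomes the last
  relation of the truncation, see \<open>N0_W\<close>.\<close>

lemma lead_identity: "N0 i * (sc ((qi d q i ^ 2) ^ t i) * St i * St i) = P0 i * cR i"
proof -
  have "(rv (2 * t i) (DD i) * phib Neg i) $ 0 = DD i $ (2 * t i)"
    using LD_phib[of Neg i] by (simp add: rv_nth LD_def)
  then show ?thesis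
    using phi_identity[of i 0] degree_identity[of i, symmetric] by (simp add: DD_lead RR_lead)
qed

text \<open>The reversal of the polynomial \<open>SA Pos i\<close>, normalized to have constant term
  1. It is the candidate for \<open>SA Neg i\<close>.\<close>

definition A' :: "'i \<Rightarrow> 'v endo fps" where "A' i = fps_const (Li i) * rv (t i) (SA Pos i)"

lemma A'_K: "C.fK (A' i)"
  using Li(1) C.fK_D[OF SA_K] by (auto simp: A'_def C.fK_def rv_nth)

lemma A'_0: "A' i $ 0 = 1"
  by (simp add: A'_def rv_nth Li)

lemma rv_zs_SA:
  assumes "e \<noteq> 0" shows "rv (t i) (M.S.zs e (SA Pos i)) = fps_const (sc (e ^ t i) * St i) * M.S.zs (inverse e) (A' i)"
proof (intro fps_ext)
  fix k
  show "rv (t i) (M.S.zs e (SA Pos i)) $ k = (fps_const (sc (e ^ t i) * St i) * M.S.zs (inverse e) (A' i)) $ k"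
  proof (cases "k \<le> t i")
    case True
    have 1: "e ^ (t i - k) = e ^ t i * inverse e ^ k"
      using assms True by (simp add: power_diff power_inverse field_simps)
    have "sc (e ^ t i) * St i * (sc (inverse e ^ k) * (Li i * y)) = sc (e ^ t i) * sc (inverse e ^ k) * (St i * Li i) * y" for y
      using M.S.lin_sc2[OF C.K_lin[OF C.fK_D[OF SA_K]], of Pos i "t i"] by (simp only: mult.assoc)
    then show ?thesis using True by (simp add: rv_nth A'_def Li 1 M.S.sc_mult)
  qed (simp add: rv_nth A'_def)
qed

lemma rv_lwn: "rv (degree (a i)) (M.S.scf (lwn Pos (a i))) =
   fps_const (sc (inverse (coeff (a i) 0) * lead_coeff (a i))) * M.S.scf (lwn Neg (a i))"
proof (intro fps_ext)
  fix k
  show "rv (degree (a i)) (M.S.scf (lwn Pos (a i))) $ k =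
    (fps_const (sc (inverse (coeff (a i) 0) * lead_coeff (a i))) * M.S.scf (lwn Neg (a i))) $ k"
  proof -
    have *: "lead_coeff (a i) * (inverse (lead_coeff (a i)) * y) = y" for y
      using a_nz(3)[of i] by (simp add: mult.assoc[symmetric])
    show ?thesis by (simp add: rv_nth coeff_reflect_poly M.S.sc_mult[symmetric] mult.assoc *)
  qed
qed

lemma fac_exp_Neg: "fac_exp Neg i jp = inverse (fac_exp Pos i jp)"
  by (simp add: fac_exp_def power_int_minus[symmetric])

text \<open>By \<open>degree_identity\<close> both sides of \<open>phi_identity\<close> are
  coefficients of reversals of matching degree. Reversing each factor turns a shift by e into one by
  1 / e and pulls out a constant. The constants agree on the two sides by
  \<open>lead_identity\<close> and are then cancelled.\<close>

lemma A'_star: "phib Neg i * (A' i * M.S.zs (qi d q i powi (2 * sgi Neg)) (A' i)) =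
    M.S.scf (lwn Neg (a i)) * prod_list (map (\<lambda>jp. M.S.zs (fac_exp Neg i jp) (A' (fst jp))) (factors i))"
proof -
  let ?q2 = "qi d q i ^ 2"
  let ?cD = "sc (?q2 ^ t i) * St i * St i"
  let ?A = "A' i * M.S.zs (qi d q i powi (2 * sgi Neg)) (A' i)"
  let ?Pi = "prod_list (map (\<lambda>jp. M.S.zs (fac_exp Neg i jp) (A' (fst jp))) (factors i))"
  let ?G = "\<lambda>jp. M.S.zs (fac_exp Pos i jp) (SA Pos (fst jp))"
  have SK: "St j \<in> K" for j by (rule C.fK_D) simp
  have fcK: "C.fK (fps_const x)" if "x \<in> K" for x using that by (simp add: C.fK_def fps_const_def)
  have q2: "qi d q i powi (2 * sgi Neg) = inverse ?q2" by (simp add: power_int_minus)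
  have z1: "M.S.zs 1 F = F" for F by (intro fps_ext) simp
  have r1: "rv (t i) (SA Pos i) = fps_const (St i) * A' i"
    using rv_zs_SA[of 1 i] by (simp add: z1)
  have "rv (2 * t i) (DD i) = rv (t i) (SA Pos i) * rv (t i) (M.S.zs ?q2 (SA Pos i))"
    unfolding DD_def mult_2 by (rule fps_mult_bdeg(3)[OF SA_bdeg zs_bdeg[OF SA_bdeg]])
  also have "\<dots> = fps_const (St i) * A' i * (fps_const (sc (?q2 ^ t i) * St i) * M.S.zs (inverse ?q2) (A' i))"
    unfolding r1 using rv_zs_SA[of ?q2 i] qi_nz[of i] by simp
  also have "\<dots> = fps_const (St i) * (A' i * fps_const (sc (?q2 ^ t i) * St i)) * M.S.zs (inverse ?q2) (A' i)"
    by (simp only: mult.assoc)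
  also have "A' i * fps_const (sc (?q2 ^ t i) * St i) = fps_const (sc (?q2 ^ t i) * St i) * A' i"
    by (intro C.fK_comm A'_K fcK C.K_mult SK C.K_sc)
  also have "fps_const (St i) * (fps_const (sc (?q2 ^ t i) * St i) * A' i) * M.S.zs (inverse ?q2) (A' i) =
      fps_const (St i * (sc (?q2 ^ t i) * St i)) * ?A"
    unfolding q2 fps_const_mult[symmetric] by (simp only: mult.assoc)
  also have "St i * (sc (?q2 ^ t i) * St i) = ?cD"
    using C.K_comm[OF SK C.K_sc, of i] by (simp only: mult.assoc[symmetric])
  finally have D: "rv (2 * t i) (DD i) = fps_const ?cD * ?A" .
  have "rv (ndeg i) (RR i) = rv (degree (a i)) (M.S.scf (lwn Pos (a i))) *
     rv (sum_list (map (\<lambda>jp. t (fst jp)) (factors i))) (prod_list (map ?G (factors i)))"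
    unfolding RR_def ndeg_def by (rule fps_mult_bdeg(3)[OF lwn_bdeg prod_list_bdeg(1)]) (rule factor_bdeg)
  also have "rv (sum_list (map (\<lambda>jp. t (fst jp)) (factors i))) (prod_list (map ?G (factors i))) =
     prod_list (map (\<lambda>jp. rv (t (fst jp)) (?G jp)) (factors i))"
    by (rule prod_list_bdeg(3)) (rule factor_bdeg)
  also have "\<dots> = prod_list (map (\<lambda>jp. fps_const (sc (fac_exp Pos i jp ^ t (fst jp)) * St (fst jp)) * M.S.zs (fac_exp Neg i jp) (A' (fst jp))) (factors i))"
    by (simp only: rv_zs_SA[OF fac_exp_nz] fac_exp_Neg)
  also have "\<dots> = fps_const (prod_list (map (\<lambda>jp. sc (fac_exp Pos i jp ^ t (fst jp)) * St (fst jp)) (factors i))) * ?Pi"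
    by (rule C.prod_list_const(1)) (auto intro: SK A'_K)
  finally have "rv (ndeg i) (RR i) = fps_const (sc (inverse (coeff (a i) 0) * lead_coeff (a i))) * M.S.scf (lwn Neg (a i)) *
      (fps_const (prod_list (map (\<lambda>jp. sc (fac_exp Pos i jp ^ t (fst jp)) * St (fst jp)) (factors i))) * ?Pi)"
    unfolding rv_lwn .
  also have "\<dots> = fps_const (sc (inverse (coeff (a i) 0) * lead_coeff (a i))) * (M.S.scf (lwn Neg (a i)) *
      fps_const (prod_list (map (\<lambda>jp. sc (fac_exp Pos i jp ^ t (fst jp)) * St (fst jp)) (factors i)))) * ?Pi"
    by (simp only: mult.assoc)
  also have "M.S.scf (lwn Neg (a i)) * fps_const (prod_list (map (\<lambda>jp. sc (fac_exp Pos i jp ^ t (fst jp)) * St (fst jp)) (factors i)))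
     = fps_const (prod_list (map (\<lambda>jp. sc (fac_exp Pos i jp ^ t (fst jp)) * St (fst jp)) (factors i))) * M.S.scf (lwn Neg (a i))"
    by (intro C.fK_comm C.fK_closed fcK C.prod_list_const(2)[where H = "\<lambda>_. 1"]) (auto intro: SK)
  finally have Rr: "rv (ndeg i) (RR i) = fps_const (cR i) * (M.S.scf (lwn Neg (a i)) * ?Pi)"
    unfolding cR_def fps_const_mult[symmetric] by (simp only: mult.assoc)
  have "fps_const (N0 i) * (rv (2 * t i) (DD i) * phib Neg i) = fps_const (P0 i) * rv (ndeg i) (RR i)"
  proof (intro fps_ext)
    fix k
    show "(fps_const (N0 i) * (rv (2 * t i) (DD i) * phib Neg i)) $ k = (fps_const (P0 i) * rv (ndeg i) (RR i)) $ k"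
      using phi_identity[of i k] unfolding degree_identity[symmetric] fps_mult_left_const_nth rv_nth[of "ndeg i"]
      by (cases "k \<le> ndeg i") (simp_all add: nat_diff_distrib')
  qed
  then have "fps_const (N0 i * ?cD) * (?A * phib Neg i) = fps_const (P0 i * cR i) * (M.S.scf (lwn Neg (a i)) * ?Pi)"
    unfolding D Rr fps_const_mult[symmetric] by (simp only: mult.assoc)
  then have eq: "fps_const (N0 i * ?cD) * (?A * phib Neg i) = fps_const (N0 i * ?cD) * (M.S.scf (lwn Neg (a i)) * ?Pi)"
    unfolding lead_identity .
  \<comment> \<open>A left inverse of the common constant \<open>N0 i * ?cD\<close>, assembled from
    the inverses of its factors.\<close>
  define y where "y = Li i * Li i * sc (inverse (?q2 ^ t i)) * R (inv\<^bsub>U\<^esub> ph Neg i (m i))"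
  have "y * (N0 i * ?cD) = 1"
  proof -
    have "y * (N0 i * ?cD) = Li i * (Li i * (sc (inverse (?q2 ^ t i)) * ((R (inv\<^bsub>U\<^esub> ph Neg i (m i)) * N0 i) * (sc (?q2 ^ t i) * (St i * St i)))))"
      unfolding y_def by (simp only: mult.assoc)
    also have "\<dots> = Li i * (Li i * ((sc (inverse (?q2 ^ t i)) * sc (?q2 ^ t i)) * (St i * St i)))"
      by (simp only: PI mult_1_left mult.assoc)
    also have "sc (inverse (?q2 ^ t i)) * sc (?q2 ^ t i) = 1"
      using qi_nz[of i] by (simp flip: M.S.sc_mult)
    also have "Li i * (Li i * (1 * (St i * St i))) = Li i * ((Li i * St i) * St i)" by (simp only: mult_1_left mult.assoc)
    finally show ?thesis by (simp add: Li)
  qed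
  then have one: "fps_const y * fps_const (N0 i * ?cD) = 1" by (simp add: fps_const_mult)
  have "fps_const y * (fps_const (N0 i * ?cD) * (?A * phib Neg i)) = fps_const y * (fps_const (N0 i * ?cD) * (M.S.scf (lwn Neg (a i)) * ?Pi))"
    by (simp only: eq)
  then have "?A * phib Neg i = M.S.scf (lwn Neg (a i)) * ?Pi"
    unfolding mult.assoc[symmetric, of "fps_const y"] one by simp
  moreover have "phib Neg i * ?A = ?A * phib Neg i" by (intro C.fK_comm phib_K C.fK_closed A'_K)
  ultimately show ?thesis by simp
qed

text \<open>Uniqueness in \<open>star_iff\<close>, applied to the reversed product formula.\<close>

lemma SA_Neg: "SA Neg i = A' i"
proof -
  have "\<exists>\<beta>. LD \<beta> (A' l)" for l
    using C.LD_exists[OF A'_K A'_0] by metis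
  then obtain \<beta> where "\<And>l. LD (\<beta> l) (A' l)" by metis
  from iffD1[OF star_iff[where B = A' and \<epsilon> = Neg, OF this A'_K] allI[OF A'_star]] show ?thesis by simp
qed

end

lemma (in shifted) factors_prod:
  fixes f :: "'i \<times> nat \<Rightarrow> 'a::comm_monoid_mult"
  shows "prod_list (map f (factors l)) = (\<Prod>j\<in>UNIV - {l}. \<Prod>p<nat (- c j l). f (j, p))"
proof -
  have "prod_list (map f (concat (map (\<lambda>j. map (\<lambda>p. (j, p)) [0..<n j]) js))) =
      prod_list (map (\<lambda>j. \<Prod>p<n j. f (j, p)) js)" for n js
    by (induction js) (simp_all add: prod.distinct_set_conv_list[symmetric] o_def atLeast0LessThan)
  then have "prod_list (map f (factors l)) =
     (\<Prod>j\<in>UNIV. \<Prod>p<(if j = l then 0 else nat (- c j l)). f (j, p))"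
    unfolding factors_def by (simp add: prod.distinct_set_conv_list[symmetric])
  also have "\<dots> = (\<Prod>j\<in>UNIV - {l}. \<Prod>p<(if j = l then 0 else nat (- c j l)). f (j, p))"
    by (rule prod.mono_neutral_right) auto
  finally show ?thesis by (auto intro: prod.cong)
qed

lemma (in shifted) trunc_rels_closed: "trunc_rels c d q m a \<subseteq> carrier U"
proof -
  have 1: "scrA_int c d q m a \<epsilon> i k \<in> carrier U" for \<epsilon> i k by (simp add: scrA_int_def)
  have 2: "alg_prod U (\<lambda>j. (x j \<odot>\<^bsub>U\<^esub> scrA c d q m a Pos j (n j)) [^]\<^bsub>U\<^esub> (k j :: nat)) J \<in> carrier U" for x n k J
    unfolding alg_prod_def by (rule U.alg_prod_list_closed) auto
  show ?thesis unfolding trunc_rels_def Let_def using 1 2 by auto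
qed

lemma alg_module_comp:
  assumes "alg_hom A B f" "alg_module B scl \<rho>" shows "alg_module A scl (\<lambda>u. \<rho> (f u))"
  using assms alg_hom_comp[OF assms(1), of "end_alg scl" \<rho>] by (simp add: alg_module_def alg_hom_def)

context tpoly
begin

lemma factors_eigen:
  "coeff (a i) 0 * cs \<beta> i =
    lead_coeff (a i) * (\<Prod>j\<in>{j. c j i < 0}. (qi d q j ^ t j * ls \<beta> j) ^ nat (- c j i))"
proof -
  have "prod_list (map (\<lambda>jp. fac_exp Pos i jp ^ t (fst jp) * ls \<beta> (fst jp)) (factors i)) =
      (\<Prod>j\<in>UNIV - {i}. (qi d q j ^ t j * ls \<beta> j) ^ nat (- c j i))"
    unfolding factors_prod
  proof (rule prod.cong[OF refl])
    fix j assume "j \<in> UNIV - {i}"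
    then have n: "- c j i = int (nat (- c j i))" using c_offdiag[of j i] by simp
    define n where "n = nat (- c j i)"
    \<comment> \<open>The exponents n - 2 p for p < n add up to n.\<close>
    have "(\<Prod>p<n. qi d q j powi (int n - 2 * int p)) = qi d q j ^ n"
      unfolding prod_powi_arith[OF qi_nz] by (simp add: algebra_simps)
    then have "(\<Prod>p<n. (qi d q j powi (int n - 2 * int p)) ^ t j * ls \<beta> j) = (qi d q j ^ n) ^ t j * ls \<beta> j ^ n"
      by (simp add: prod.distrib prod_power_distrib[symmetric])
    then show "(\<Prod>p<nat (- c j i). fac_exp Pos i (j, p) ^ t (fst (j, p)) * ls \<beta> (fst (j, p))) =
        (qi d q j ^ t j * ls \<beta> j) ^ nat (- c j i)"
      using n by (simp add: fac_exp_def n_def power_mult_distrib power_mult[symmetric] mult.commute)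
  qed
  also have "\<dots> = (\<Prod>j\<in>{j. c j i < 0}. (qi d q j ^ t j * ls \<beta> j) ^ nat (- c j i))"
  proof (intro prod.mono_neutral_right ballI)
    show "{j. c j i < 0} \<subseteq> UNIV - {i}" using c_neg_neq by auto
  qed auto
  finally show ?thesis using a_nz(2)[of i] by (simp add: cs_def)
qed

lemma N0_W:
  assumes "u \<in> W \<beta>"
  shows "scl ((qi d q i ^ t i * ls \<beta> i)\<^sup>2) (app (N0 i) u) = scl (cs \<beta> i) (app (P0 i) u)"
proof -
  have "app (N0 i * (sc ((qi d q i ^ 2) ^ t i) * St i * St i)) u = app (P0 i * cR i) u"
    by (simp only: lead_identity)
  then show ?thesis using assms
    by (simp add: St_W cR_W app_scl C.K_lin C.fK_D power_mult_distrib power2_eq_square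
        power_mult[symmetric] mult_ac)
qed

text \<open>The twist \<tau> covers both the identity and the tensor product with a one-dimensional
  module. Since \<tau> fixes the normalized \<phi> it fixes the A-series, and the last relation is
  linear in \<phi>_(i,0)^+ and \<phi>_(i,m_i)^-, which are scaled alike.\<close>

lemma trunc_rels_vanish:
  assumes f: "alg_hom U U \<tau>" and bar: "\<And>\<epsilon> i k. \<tau> (phi_bar c d q m \<epsilon> i k) = phi_bar c d q m \<epsilon> i k"
    and L: "\<And>i. R (\<tau> (ph Pos i 0)) = sc (L i) * P0 i" "\<And>i. R (\<tau> (ph Neg i (m i))) = sc (L i) * N0 i"
    and r: "r \<in> trunc_rels c d q m a"
  shows "R (\<tau> r) = 0"
proof -
  interpret F: alg_rep U scl "\<lambda>u. \<rho> (\<tau> u)"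
    using alg_module_comp[OF f M.rho_module] by unfold_locales
  have FR: "F.R u = R (\<tau> u)" for u by (simp add: F.R_def M.R_def)
  have fA: "F.R (scA \<epsilon> i k) = SA \<epsilon> i $ k" for \<epsilon> i k
    by (simp add: FR scrA_hom_invariant[OF f bar] SA_def)
  have int_closed: "scrA_int c d q m a \<epsilon> i k \<in> carrier U" for \<epsilon> i k by (simp add: scrA_int_def)
  have fint: "F.R (scrA_int c d q m a \<epsilon> i k) = (if sgi \<epsilon> * k \<ge> 0 then SA \<epsilon> i $ nat (sgi \<epsilon> * k) else 0)" for \<epsilon> i k
    by (simp add: scrA_int_def fA)
  consider i k where "k > t i" "r = scA Pos i k"
    | i k where "r = scrA_int c d q m a Neg i k \<ominus>\<^bsub>U\<^esub>
        scrA_int c d q m a Neg i (- int (t i)) \<otimes>\<^bsub>U\<^esub> scrA_int c d q m a Pos i (k + int (t i))"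
    | i where "r = lead_coeff (a i) \<odot>\<^bsub>U\<^esub> (ph Pos i 0 \<otimes>\<^bsub>U\<^esub>
          alg_prod U (\<lambda>j. (qi d q j ^ t j \<odot>\<^bsub>U\<^esub> scA Pos j (t j)) [^]\<^bsub>U\<^esub> nat (- c j i)) {j. c j i < 0})
        \<ominus>\<^bsub>U\<^esub> coeff (a i) 0 \<odot>\<^bsub>U\<^esub> (ph Neg i (m i) \<otimes>\<^bsub>U\<^esub>
          (qi d q i ^ t i \<odot>\<^bsub>U\<^esub> scA Pos i (t i)) [^]\<^bsub>U\<^esub> (2::nat))"
    using r unfolding trunc_rels_def Let_def trunc_t_eq by blast
  then have "F.R r = 0"
  proof cases
    case (1 i k)
    then show ?thesis by (simp add: fA SA_zero)
  next
    case (2 i k)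
    \<comment> \<open>For k > 0 the right side is a coefficient of degree above t_i, and for k < -
      t_i both sides vanish as well; in between this is the definition of the reversal.\<close>
    have "(if - k \<ge> 0 then SA Neg i $ nat (- k) else 0) =
        SA Neg i $ t i * (if k + int (t i) \<ge> 0 then SA Pos i $ nat (k + int (t i)) else 0)"
    proof -
      have "SA Neg i $ l = (if l \<le> t i then Li i * SA Pos i $ (t i - l) else 0)" for l
        by (simp add: SA_Neg A'_def rv_nth)
      moreover have "nat (k + int (t i)) = t i - nat (- k)" if "k \<le> 0"
        using that by simp
      moreover have "SA Pos i $ nat (k + int (t i)) = 0" if "k > 0"
        by (rule SA_zero) (use that in simp)
      ultimately show ?thesis by (auto simp: SA_0)
    qed
    then show ?thesis unfolding 2 by (auto simp: F.R_minus F.R_mult int_closed fint split: if_splits)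
  next
    case (3 i)
    let ?g = "\<lambda>j. (qi d q j ^ t j \<odot>\<^bsub>U\<^esub> scA Pos j (t j)) [^]\<^bsub>U\<^esub> nat (- c j i)"
    let ?e = "\<lambda>j. (sc (qi d q j ^ t j) * St j) ^ nat (- c j i)"
    let ?J = "sorted_list_of_set {j. c j i < 0}"
    have eK: "?e j \<in> K" for j
    proof -
      have "x ^ n \<in> K" if "x \<in> K" for x n using that C.K_sc[of 1] by (induction n) (auto intro: C.K_mult)
      then show ?thesis by (simp add: C.K_mult C.fK_D)
    qed
    have gc: "set (map ?g xs) \<subseteq> carrier U" for xs by auto
    have prod: "F.R (alg_prod_list U (map ?g xs)) = prod_list (map ?e xs)" for xs
    proof (induction xs)
      case (Cons j xs)
      then show ?case
        using U.alg_prod_list_closed[OF gc[of xs]] by (simp add: F.R_mult F.R_pow F.R_smult fA)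
    qed simp
    have Re: "F.R r = sc (lead_coeff (a i)) * (sc (L i) * P0 i * prod_list (map ?e ?J)) -
       sc (coeff (a i) 0) * (sc (L i) * N0 i * (sc (qi d q i ^ t i) * St i)\<^sup>2)"
      unfolding 3 alg_prod_def
      using U.alg_prod_list_closed[OF gc[of ?J]] L[of i]
      by (simp add: F.R_minus F.R_mult F.R_smult F.R_pow fA prod FR[of "ph _ _ _"])
    show "F.R r = 0"
    proof (rule endo_eq_on_W)
      fix \<beta> u assume u: "u \<in> W \<beta>"
      have pw: "app ((sc x * St j) ^ n) u = scl ((x * ls \<beta> j) ^ n) u" for x j n
      proof (induction n)
        case (Suc n)
        have "app ((sc x * St j) ^ Suc n) u = app ((sc x * St j) ^ n) (scl (x * ls \<beta> j) u)"
          using St_W[OF u, of j] by (simp add: power_Suc2 del: power_Suc)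
        also have "\<dots> = scl (x * ls \<beta> j) (app ((sc x * St j) ^ n) u)"
        proof -
          have "(sc x * St j) ^ n \<in> K"
            using C.K_sc[of 1] by (induction n) (auto intro!: C.K_mult simp: C.fK_D)
          then show ?thesis by (simp add: app_scl C.K_lin)
        qed
        finally show ?case by (simp add: Suc mult.commute)
      qed simp
      have "app (prod_list (map ?e ?J)) u = scl (prod_list (map (\<lambda>j. (qi d q j ^ t j * ls \<beta> j) ^ nat (- c j i)) ?J)) u"
        by (rule app_prod_list) (rule pw, rule C.K_lin[OF eK])
      also have "prod_list (map (\<lambda>j. (qi d q j ^ t j * ls \<beta> j) ^ nat (- c j i)) ?J) =
         (\<Prod>j\<in>{j. c j i < 0}. (qi d q j ^ t j * ls \<beta> j) ^ nat (- c j i))"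
        by (simp add: prod.distinct_set_conv_list[symmetric])
      finally have 1: "app (sc (lead_coeff (a i)) * (sc (L i) * P0 i * prod_list (map ?e ?J))) u =
          scl (L i * (coeff (a i) 0 * cs \<beta> i)) (app (P0 i) u)"
        unfolding factors_eigen by (simp add: app_scl mult_ac)
      have "app (sc (coeff (a i) 0) * (sc (L i) * N0 i * (sc (qi d q i ^ t i) * St i)\<^sup>2)) u =
          scl (L i * coeff (a i) 0) (scl ((qi d q i ^ t i * ls \<beta> i)\<^sup>2) (app (N0 i) u))"
        using pw[of "qi d q i ^ t i" i 2] by (simp add: app_scl mult_ac)
      also have "\<dots> = scl (L i * (coeff (a i) 0 * cs \<beta> i)) (app (P0 i) u)"
        unfolding N0_W[OF u] by (simp add: mult_ac)
      finally show "app (F.R r) u = app 0 u" unfolding Re using 1 by simp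
    qed
  qed
  then show ?thesis by (simp add: FR)
qed

lemma trunc_module:
  assumes f: "alg_hom U U \<tau>" "\<And>\<epsilon> i k. \<tau> (phi_bar c d q m \<epsilon> i k) = phi_bar c d q m \<epsilon> i k"
    "\<And>i. R (\<tau> (ph Pos i 0)) = sc (L i) * P0 i" "\<And>i. R (\<tau> (ph Neg i (m i))) = sc (L i) * N0 i"
  shows "alg_module (trunc_alg c d q m a) scl (quot_map (\<lambda>u. \<rho> (\<tau> u)))"
    and "is_pullback U (to_trunc c d q m a) (quot_map (\<lambda>u. \<rho> (\<tau> u))) (\<lambda>u. \<rho> (\<tau> u))"
proof -
  have hom: "alg_hom U (end_alg scl) (\<lambda>u. \<rho> (\<tau> u))" by (rule alg_hom_comp[OF f(1) M.rho_hom])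
  have 0: "\<rho> (\<tau> r) = \<zero>\<^bsub>end_alg scl\<^esub>" if "r \<in> trunc_rels c d q m a" for r
  proof -
    have "\<tau> r \<in> carrier U" using trunc_rels_closed that alg_homD(1)[OF f(1)] by blast
    then have "\<rho> (\<tau> r) = app (R (\<tau> r))" by (simp add: M.app_R)
    then show ?thesis unfolding trunc_rels_vanish[OF f that] by (simp add: end_alg_def fun_eq_iff)
  qed
  note q = U.quot_map_hom[OF trunc_rels_closed M.end_calgebra hom 0]
  show "alg_module (trunc_alg c d q m a) scl (quot_map (\<lambda>u. \<rho> (\<tau> u)))"
    using q(2) M.rho_module by (simp add: alg_module_def alg_hom_def trunc_alg_def)
  show "is_pullback U (to_trunc c d q m a) (quot_map (\<lambda>u. \<rho> (\<tau> u))) (\<lambda>u. \<rho> (\<tau> u))"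
    using q(1) by (simp add: is_pullback_def to_trunc_def)
qed

theorem factors_through_truncation:
  "\<exists>\<rho>'. alg_module (trunc_alg c d q m a) scl \<rho>' \<and> is_pullback U (to_trunc c d q m a) \<rho>' \<rho>"
  using trunc_module[of "\<lambda>u. u" "\<lambda>i. 1"] by (auto simp: Phi_def intro!: alg_homI)

end

section \<open>The adjoint version\<close>

lemma free_endo_simps:
  fixes \<phi> :: "'g \<Rightarrow> 'h falg"
  shows "free_lift free_alg \<phi> (p + p') = free_lift free_alg \<phi> p + free_lift free_alg \<phi> p'"
    "free_lift free_alg \<phi> (p * p') = free_lift free_alg \<phi> p * free_lift free_alg \<phi> p'"
    "free_lift free_alg \<phi> (fscal b) = fscal b" "free_lift free_alg \<phi> 1 = 1" "free_lift free_alg \<phi> 0 = 0"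
    "free_lift free_alg \<phi> (p - p') = free_lift free_alg \<phi> p - free_lift free_alg \<phi> p'"
    "free_lift free_alg \<phi> (p ^ n) = free_lift free_alg \<phi> p ^ n"
    "free_lift free_alg \<phi> (fgen g) = \<phi> g"
    "free_lift free_alg \<phi> (sum F S) = (\<Sum>x\<in>S. free_lift free_alg \<phi> (F x))"
proof -
  interpret F: calgebra "free_alg :: 'h falg calg" by (rule free_calgebra)
  let ?G = "free_lift free_alg \<phi>"
  have hom: "alg_hom free_alg free_alg ?G" by (rule F.free_lift_hom) simp
  note h = alg_homD[OF hom, simplified]
  show add: "?G (p + p') = ?G p + ?G p'" for p p' by (rule h)
  show m: "?G (p * p') = ?G p * ?G p'" for p p' by (rule h)
  show one: "?G 1 = 1" by (rule h)
  have "?G 0 + ?G 0 = ?G 0" using add[of 0 0] by simp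
  then show zero: "?G 0 = 0" by simp
  have "?G (p - p') + ?G p' = ?G p" using add[of "p - p'" p'] by simp
  then show "?G (p - p') = ?G p - ?G p'" by (simp add: eq_diff_eq)
  show "?G (fscal b) = fscal b" using h(5)[of b 1] one by simp
  show "?G (p ^ n) = ?G p ^ n" by (induction n) (simp_all add: one m)
  show "?G (fgen g) = \<phi> g" by (rule F.free_lift_fgen) simp
  show "?G (sum F S) = (\<Sum>x\<in>S. ?G (F x))"
    by (induction S rule: infinite_finite_induct) (simp_all add: zero add)
qed

text \<open>Homogeneity of p when the generator g has multiplicative weight w g.\<close>

definition scales :: "('g \<Rightarrow> complex) \<Rightarrow> complex \<Rightarrow> 'g falg \<Rightarrow> bool" where
  "scales w s p \<longleftrightarrow> free_lift free_alg (\<lambda>g. fscal (w g) * fgen g) p = fscal s * p"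

lemma scales_intros:
  "scales w 1 (fscal b)" "scales w 1 1" "scales w (w g) (fgen g)"
  "scales w s p \<Longrightarrow> scales w s' p' \<Longrightarrow> scales w (s * s') (p * p')"
  "scales w s p \<Longrightarrow> scales w s' p' \<Longrightarrow> s = s' \<Longrightarrow> scales w s (p - p')"
  "scales w s p \<Longrightarrow> scales w (s ^ n) (p ^ n)"
  "(\<And>x. x \<in> S \<Longrightarrow> scales w s (F x)) \<Longrightarrow> scales w s (sum F S)"
  "scales w s 0"
proof -
  have mult: "scales w s p \<Longrightarrow> scales w s' p' \<Longrightarrow> scales w (s * s') (p * p')" for s s' p p'
  proof -
    have "fscal s * p * (fscal s' * p') = fscal s * (p * fscal s') * p'" by (simp only: mult.assoc)
    also have "\<dots> = fscal (s * s') * (p * p')" by (simp only: fscal_commute[of s' p, symmetric] mult.assoc fscal_mult)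
    finally show "scales w s p \<Longrightarrow> scales w s' p' \<Longrightarrow> scales w (s * s') (p * p')"
      by (simp add: scales_def free_endo_simps)
  qed
  then show "scales w s p \<Longrightarrow> scales w s' p' \<Longrightarrow> scales w (s * s') (p * p')" .
  show one: "scales w 1 1" by (simp add: scales_def free_endo_simps)
  show "scales w s p \<Longrightarrow> scales w (s ^ n) (p ^ n)" by (induction n) (simp_all add: one mult)
  show "(\<And>x. x \<in> S \<Longrightarrow> scales w s (F x)) \<Longrightarrow> scales w s (sum F S)"
    by (simp add: scales_def free_endo_simps sum_distrib_left)
qed (simp_all add: scales_def free_endo_simps right_diff_distrib)

lemma scales_cong: "scales w s p \<Longrightarrow> s = s' \<Longrightarrow> scales w s' p"
  by simp

context shifted
begin

subsection \<open>Tensor products with one-dimensional modules\<close>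

fun gwt :: "('i \<Rightarrow> complex) \<Rightarrow> 'i gen \<Rightarrow> complex" where
  "gwt L (GX \<epsilon> i k) = (if \<epsilon> = Pos then L i else 1)"
| "gwt L (GPhi \<epsilon> i k) = L i"
| "gwt L (GPhiInv i) = inverse (L i ^ 2)"

lemma L0_gen_eq: "L0_gen c d q m L g = gwt L g \<odot>\<^bsub>U\<^esub> ug g"
proof (cases g)
  case (GX \<epsilon> i k)
  then show ?thesis by (cases \<epsilon>) simp_all
qed simp_all

abbreviation "G0 L \<equiv> free_lift free_alg (\<lambda>g. fscal (gwt L g) * fgen g)"

lemma L0_lift_eq: "free_lift U (L0_gen c d q m L) p = uproj (G0 L p)"
proof -
  have gc: "L0_gen c d q m L g \<in> carrier U" for g by (simp add: L0_gen_eq)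
  have hom: "alg_hom free_alg free_alg (G0 L)"
    by (rule calgebra.free_lift_hom[OF free_calgebra]) simp
  have "uproj (fscal b * p) = b \<odot>\<^bsub>U\<^esub> uproj p" for b p
    using alg_homD(5)[OF uproj_hom, of p b] by simp
  then have "free_lift U (L0_gen c d q m L) (fgen g) = uproj (G0 L (fgen g))" for g
    unfolding U.free_lift_fgen[OF gc] free_endo_simps L0_gen_eq U_gen_def by simp
  then show ?thesis
    by (rule U.free_hom_eqI[OF U.free_lift_hom[OF gc] alg_hom_comp[OF hom uproj_hom]])
qed

text \<open>Every defining relation is homogeneous for the weights of the twist, so the scaling of
  the generators descends to the quotient.\<close>

lemma base_rels_scale:
  assumes L: "\<And>i. L i \<noteq> 0" and r: "r \<in> base_rels c d q m (\<lambda>g. g)"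
  shows "\<exists>s. scales (gwt L) s r"
proof -
  let ?x = "\<lambda>\<delta> i. (if \<delta> = Pos then L i else 1)"
  note I = scales_intros[where w = "gwt L"]
  have X: "scales (gwt L) (?x \<delta> i) (fgen (GX \<delta> i k))" for \<delta> i k by (rule scales_cong[OF I(3)]) simp
  have P: "scales (gwt L) (L i) (fgen (GPhi \<delta> i k))" for \<delta> i k by (rule scales_cong[OF I(3)]) simp
  have V: "scales (gwt L) (inverse (L i ^ 2)) (fgen (GPhiInv i))" for i by (rule scales_cong[OF I(3)]) simp
  show ?thesis using r
  proof (cases rule: base_rels_cases)
    case (phi_pos i k) then show ?thesis using P by blast
  next
    case (phi_neg i k) then show ?thesis using P by blast
  next
    case (inv1 i)
    have "scales (gwt L) (L i * L i * inverse (L i ^ 2)) r" unfolding inv1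
      by (rule I(5)[OF I(4)[OF I(4)[OF P P] V] I(2)]) (use L[of i] in \<open>simp add: power2_eq_square field_simps\<close>)
    then show ?thesis by blast
  next
    case (inv2 i)
    have "scales (gwt L) (inverse (L i ^ 2) * (L i * L i)) r" unfolding inv2
      by (rule I(5)[OF I(4)[OF V I(4)[OF P P]] I(2)]) (use L[of i] in \<open>simp add: power2_eq_square field_simps\<close>)
    then show ?thesis by blast
  next
    case (central i g)
    have "scales (gwt L) (L i * L i * gwt L g) r" unfolding central
      by (rule I(5)[OF I(4)[OF I(4)[OF P P] I(3)] I(4)[OF I(3) I(4)[OF P P]]]) simp
    then show ?thesis by blast
  next
    case (phi_phi \<delta> \<epsilon> i j k l)
    have "scales (gwt L) (L i * L j) r" unfolding phi_phi
      by (rule I(5)[OF I(4)[OF P P] I(4)[OF P P]]) simp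
    then show ?thesis by blast
  next
    case (x_x i j k l)
    have s0: "scales (gwt L) (?x Pos i * ?x Neg j) (fgen (GX Pos i k) * fgen (GX Neg j l) - fgen (GX Neg j l) * fgen (GX Pos i k))"
      by (rule I(5)[OF I(4)[OF X X] I(4)[OF X X]]) simp
    have s1: "scales (gwt L) (1 * L i) (fscal (1 / (qi d q i - inverse (qi d q i))) *
          (fgen (GPhi Pos i (k + l)) - fgen (GPhi Neg i (k + l))))"
      by (rule I(4)[OF I(1) I(5)[OF P P refl]])
    show ?thesis
    proof (cases "i = j")
      case True
      then show ?thesis unfolding x_x using I(5)[OF s0 s1] by auto
    next
      case False
      then show ?thesis unfolding x_x using s0 by auto
    qed
  next
    case (phi_x \<delta> \<epsilon> i j k l)
    have "scales (gwt L) (L i * ?x \<delta> j) r" unfolding phi_x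
      by (rule I(5)[OF I(5)[OF I(4)[OF P X] I(4)[OF I(4)[OF I(1) P] X]] I(5)[OF I(4)[OF I(4)[OF I(1) X] P] I(4)[OF X P]]]) simp_all
    then show ?thesis by blast
  next
    case (x_quad \<delta> i j k l)
    have "scales (gwt L) (?x \<delta> i * ?x \<delta> j) r" unfolding x_quad
      by (rule I(5)[OF I(5)[OF I(4)[OF X X] I(4)[OF I(4)[OF I(1) X] X]] I(5)[OF I(4)[OF I(4)[OF I(1) X] X] I(4)[OF X X]]]) simp_all
    then show ?thesis by blast
  next
    case (serre \<delta> i j)
    have "scales (gwt L) (?x \<delta> i ^ nat (1 - c i j) * ?x \<delta> j) r" unfolding serre(2)
    proof (rule I(7))
      fix s assume "s \<in> {0..nat (1 - c i j)}"
      then have e: "?x \<delta> i ^ (nat (1 - c i j) - s) * ?x \<delta> i ^ s = ?x \<delta> i ^ nat (1 - c i j)"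
        by (simp add: power_add[symmetric])
      show "scales (gwt L) (?x \<delta> i ^ nat (1 - c i j) * ?x \<delta> j)
         (fscal ((- 1) ^ s * qbinom (qi d q i) (1 - c i j) s) * fgen (GX \<delta> i 0) ^ (nat (1 - c i j) - s) *
            fgen (GX \<delta> j 0) * fgen (GX \<delta> i 0) ^ s)"
        by (rule scales_cong[OF I(4)[OF I(4)[OF I(4)[OF I(1) I(6)[OF X]] X] I(6)[OF X]]]) (simp flip: e)
    qed
    then show ?thesis by blast
  qed
qed

lemma L0_auto:
  assumes L: "\<And>i. L i \<noteq> 0"
  shows L0_auto_hom: "alg_hom U U (L0_auto c d q m L)"
    and L0_auto_proj: "L0_auto c d q m L (uproj p) = uproj (G0 L p)"
    and L0_auto_ug: "L0_auto c d q m L (ug g) = gwt L g \<odot>\<^bsub>U\<^esub> ug g"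
    and L0_auto_bar: "L0_auto c d q m L (phi_bar c d q m \<epsilon> i k) = phi_bar c d q m \<epsilon> i k"
proof -
  have gc: "L0_gen c d q m L g \<in> carrier U" for g by (simp add: L0_gen_eq)
  have hom: "alg_hom free_alg U (free_lift U (L0_gen c d q m L))" by (rule U.free_lift_hom) (rule gc)
  have 0: "free_lift U (L0_gen c d q m L) r = \<zero>\<^bsub>U\<^esub>" if r: "r \<in> base_rels c d q m id" for r
  proof -
    obtain s where "G0 L r = fscal s * r"
      using base_rels_scale[where L = L and r = r, OF L] r unfolding scales_def id_def by blast
    moreover have "uproj (fscal s * r) = s \<odot>\<^bsub>U\<^esub> uproj r"
      using alg_homD(5)[OF uproj_hom, of r s] by simp
    ultimately show ?thesis unfolding L0_lift_eq uproj_rel[OF r] by (simp add: uproj_rel[OF r])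
  qed
  note q = U_lift[OF U_calgebra hom 0]
  show hom': "alg_hom U U (L0_auto c d q m L)" unfolding L0_auto_def by (rule q(2))
  show p: "L0_auto c d q m L (uproj p) = uproj (G0 L p)" for p
    unfolding L0_auto_def by (rule trans[OF q(1) L0_lift_eq])
  show g: "L0_auto c d q m L (ug g) = gwt L g \<odot>\<^bsub>U\<^esub> ug g" for g
    unfolding U_gen_def p using alg_homD(5)[OF uproj_hom, of "fgen g" "gwt L g"] by (simp add: free_endo_simps)
  interpret F: calg_hom U U "L0_auto c d q m L" by unfold_locales (rule hom')
  have bar: "L0_auto c d q m L (inv\<^bsub>U\<^esub> x \<otimes>\<^bsub>U\<^esub> y) = inv\<^bsub>U\<^esub> x \<otimes>\<^bsub>U\<^esub> y"
    if xy: "x \<in> Units U" "y \<in> carrier U" "s \<noteq> 0" "L0_auto c d q m L x = s \<odot>\<^bsub>U\<^esub> x" "L0_auto c d q m L y = s \<odot>\<^bsub>U\<^esub> y" for x y s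
  proof -
    have xc: "x \<in> carrier U" "inv\<^bsub>U\<^esub> x \<in> carrier U" using xy(1) by auto
    have "inv\<^bsub>U\<^esub> (s \<odot>\<^bsub>U\<^esub> x) = inverse s \<odot>\<^bsub>U\<^esub> inv\<^bsub>U\<^esub> x"
    proof (rule U.inv_unique'[symmetric])
      show "(s \<odot>\<^bsub>U\<^esub> x) \<otimes>\<^bsub>U\<^esub> (inverse s \<odot>\<^bsub>U\<^esub> inv\<^bsub>U\<^esub> x) = \<one>\<^bsub>U\<^esub>"
        using xy(1,3) xc by (simp add: U.smult_mult_left U.smult_mult_right U.smult_smult)
      show "(inverse s \<odot>\<^bsub>U\<^esub> inv\<^bsub>U\<^esub> x) \<otimes>\<^bsub>U\<^esub> (s \<odot>\<^bsub>U\<^esub> x) = \<one>\<^bsub>U\<^esub>"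
        using xy(1,3) xc by (simp add: U.smult_mult_left U.smult_mult_right U.smult_smult)
    qed (use xc in auto)
    then show ?thesis
      using xy xc by (simp add: F.h_inv U.smult_mult_left U.smult_mult_right U.smult_smult)
  qed
  show "L0_auto c d q m L (phi_bar c d q m \<epsilon> i k) = phi_bar c d q m \<epsilon> i k"
    by (cases \<epsilon>; simp only: phi_bar.simps; rule bar[of _ _ "L i"]) (simp_all add: ph_units L g)
qed

subsection \<open>The adjoint algebra\<close>

abbreviation "Uad \<equiv> Uad_alg c d q m"
abbreviation "uad \<equiv> Uad_gen c d q m"
abbreviation "adproj \<equiv> quot_proj free_alg (ad_rels c d q m)"
abbreviation mapB :: "'i gen falg \<Rightarrow> 'i adgen falg" where
  "mapB \<equiv> free_lift free_alg (\<lambda>g. fgen (GBase g))"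

text \<open>These relations are images of relations of the shifted algebra, except that centrality
  is now also demanded against the \<psi>; such cases are caught by the second alternative.\<close>

lemma base_rels_GBase:
  assumes r: "r \<in> base_rels c d q m GBase"
  obtains r0 where "r0 \<in> base_rels c d q m (\<lambda>g. g)" "r = mapB r0"
  | i g where "r = fgen (GBase (GPhi Pos i 0)) * fgen (GBase (GPhi Neg i (m i))) * fgen g
      - fgen g * (fgen (GBase (GPhi Pos i 0)) * fgen (GBase (GPhi Neg i (m i))))"
  using r
proof (cases rule: base_rels_cases)
  case (phi_pos i k)
  show ?thesis by (rule that(1)[OF base_rels_mem(1)[OF phi_pos(1)]]) (simp add: phi_pos(2) free_endo_simps)
next
  case (phi_neg i k)
  show ?thesis by (rule that(1)[OF base_rels_mem(2)[where m = m and i = i and k = k, OF phi_neg(1)]]) (simp add: phi_neg(2) free_endo_simps)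
next
  case (inv1 i)
  show ?thesis by (rule that(1)[OF base_rels_mem(3)[of _ i]]) (simp add: inv1 free_endo_simps)
next
  case (inv2 i)
  show ?thesis by (rule that(1)[OF base_rels_mem(4)[of _ i]]) (simp add: inv2 free_endo_simps)
next
  case (central i g)
  show ?thesis by (rule that(2)[OF central])
next
  case (phi_phi \<delta> \<epsilon> i j k l)
  show ?thesis by (rule that(1)[OF base_rels_mem(6)[of _ \<delta> i k \<epsilon> j l]]) (simp add: phi_phi free_endo_simps)
next
  case (x_x i j k l)
  show ?thesis by (rule that(1)[OF base_rels_mem(7)[of _ i k j l]]) (simp add: x_x free_endo_simps)
next
  case (phi_x \<delta> \<epsilon> i j k l)
  show ?thesis by (rule that(1)[OF base_rels_mem(8)[of _ \<epsilon> i k \<delta> j l]]) (simp add: phi_x free_endo_simps)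
next
  case (x_quad \<delta> i j k l)
  show ?thesis by (rule that(1)[OF base_rels_mem(9)[of _ \<delta> i k j l]]) (simp add: x_quad free_endo_simps)
next
  case (serre \<delta> i j)
  show ?thesis by (rule that(1)[OF base_rels_mem(10)[where i = i and j = j and \<delta> = \<delta>]]) (simp_all add: serre free_endo_simps)
qed

lemma mapB_rel:
  assumes r: "r \<in> base_rels c d q m (\<lambda>g. g)" shows "mapB r \<in> base_rels c d q m GBase"
  using r
proof (cases rule: base_rels_cases)
  case (phi_pos i k)
  show ?thesis using base_rels_mem(1)[OF phi_pos(1), of GBase] by (simp add: phi_pos(2) free_endo_simps)
next
  case (phi_neg i k)
  show ?thesis using base_rels_mem(2)[where m = m and i = i and k = k and \<gamma> = GBase, OF phi_neg(1)] by (simp add: phi_neg(2) free_endo_simps)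
next
  case (inv1 i)
  show ?thesis using base_rels_mem(3)[of GBase i] by (simp add: inv1 free_endo_simps)
next
  case (inv2 i)
  show ?thesis using base_rels_mem(4)[of GBase i] by (simp add: inv2 free_endo_simps)
next
  case (central i g)
  show ?thesis using base_rels_mem(5)[of GBase i] by (simp add: central free_endo_simps)
next
  case (phi_phi \<delta> \<epsilon> i j k l)
  show ?thesis using base_rels_mem(6)[of GBase \<delta> i k \<epsilon> j l] by (simp add: phi_phi free_endo_simps)
next
  case (x_x i j k l)
  show ?thesis using base_rels_mem(7)[of GBase i k j l] by (cases "i = j") (simp_all add: x_x free_endo_simps)
next
  case (phi_x \<delta> \<epsilon> i j k l)
  show ?thesis using base_rels_mem(8)[of GBase \<epsilon> i k \<delta> j l] by (simp add: phi_x free_endo_simps)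
next
  case (x_quad \<delta> i j k l)
  show ?thesis using base_rels_mem(9)[of GBase \<delta> i k j l] by (simp add: x_quad free_endo_simps)
next
  case (serre \<delta> i j)
  show ?thesis using base_rels_mem(10)[OF serre(1), where \<gamma> = GBase and \<delta> = \<delta>] by (simp add: serre(2) free_endo_simps)
qed

lemma Uad_calgebra: "calgebra Uad"
  unfolding Uad_alg_def by (rule calgebra.quot_calgebra[OF free_calgebra]) simp

lemma adproj_hom: "alg_hom free_alg Uad adproj"
  unfolding Uad_alg_def by (rule calgebra.quot_proj_hom[OF free_calgebra]) simp

lemma adproj_rel: "r \<in> ad_rels c d q m \<Longrightarrow> adproj r = \<zero>\<^bsub>Uad\<^esub>"
  unfolding Uad_alg_def by (rule calgebra.quot_proj_rel[OF free_calgebra]) simp_all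

lemma Uad_lift:
  assumes "calgebra B" "alg_hom free_alg B f" "\<And>r. r \<in> ad_rels c d q m \<Longrightarrow> f r = \<zero>\<^bsub>B\<^esub>"
  shows "quot_map f (adproj p) = f p" "alg_hom Uad B (quot_map f)"
  unfolding Uad_alg_def
  using calgebra.quot_map_proj[OF free_calgebra _ assms] calgebra.quot_map_hom(2)[OF free_calgebra _ assms]
  by simp_all

sublocale Ua: calgebra Uad by (rule Uad_calgebra)

lemma uad_closed [simp, intro]: "uad g \<in> carrier Uad"
  unfolding Uad_gen_def using alg_homD(1)[OF adproj_hom] by simp

lemma base_rels_ad: "base_rels c d q m GBase \<subseteq> ad_rels c d q m"
  unfolding ad_rels_def Let_def by blast

lemma ad_rel_eq:
  assumes "p - p' \<in> ad_rels c d q m" shows "adproj p = adproj p'"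
proof -
  have "adproj p = adproj ((p - p') + p')" by simp
  also have "\<dots> = adproj (p - p') \<oplus>\<^bsub>Uad\<^esub> adproj p'"
    using alg_homD(2)[OF adproj_hom, of "p - p'" p'] by simp
  finally show ?thesis using adproj_rel[OF assms] alg_homD(1)[OF adproj_hom, of p'] by simp
qed

lemma to_ad:
  shows to_ad_hom: "alg_hom U Uad (to_ad c d q m)"
    and to_ad_proj: "to_ad c d q m (uproj p) = adproj (mapB p)"
    and to_ad_ug: "to_ad c d q m (ug g) = uad (GBase g)"
proof -
  have hom: "alg_hom free_alg Uad (free_lift Uad (\<lambda>g. uad (GBase g)))" by (rule Ua.free_lift_hom) simp
  have homB: "alg_hom free_alg free_alg mapB" by (rule calgebra.free_lift_hom[OF free_calgebra]) simp
  have eq: "free_lift Uad (\<lambda>g. uad (GBase g)) p = adproj (mapB p)" for p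
    by (rule Ua.free_hom_eqI[OF hom alg_hom_comp[OF homB adproj_hom]])
      (simp add: free_endo_simps Ua.free_lift_fgen, simp add: Uad_gen_def)
  have 0: "free_lift Uad (\<lambda>g. uad (GBase g)) r = \<zero>\<^bsub>Uad\<^esub>" if r: "r \<in> base_rels c d q m id" for r
    unfolding eq by (rule adproj_rel) (use mapB_rel[of r] r base_rels_ad in \<open>auto simp: id_def\<close>)
  note u = U_lift[OF Uad_calgebra hom 0]
  show "alg_hom U Uad (to_ad c d q m)" unfolding to_ad_def by (rule u(2))
  show p: "to_ad c d q m (uproj p) = adproj (mapB p)" for p unfolding to_ad_def by (rule trans[OF u(1) eq])
  show "to_ad c d q m (ug g) = uad (GBase g)" unfolding U_gen_def p by (simp add: free_endo_simps Uad_gen_def)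
qed

end

section \<open>The adjoint truncation\<close>

context calgebra
begin

lemma alg_prod_list_commute:
  assumes "y \<in> carrier A" "\<And>x. x \<in> set xs \<Longrightarrow> x \<in> carrier A" "\<And>x. x \<in> set xs \<Longrightarrow> y \<otimes> x = x \<otimes> y"
  shows "y \<otimes> alg_prod_list A xs = alg_prod_list A xs \<otimes> y"
  using assms
proof (induction xs)
  case (Cons x xs)
  have c: "alg_prod_list A xs \<in> carrier A" using Cons.prems by (intro alg_prod_list_closed) auto
  have cl: "y \<in> carrier A" "x \<in> carrier A" using Cons.prems by auto
  have yx: "y \<otimes> x = x \<otimes> y" and IH: "y \<otimes> alg_prod_list A xs = alg_prod_list A xs \<otimes> y"
    using Cons by auto
  have "y \<otimes> (x \<otimes> alg_prod_list A xs) = (y \<otimes> x) \<otimes> alg_prod_list A xs"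
    using cl c by (simp add: m_assoc)
  also have "\<dots> = x \<otimes> (y \<otimes> alg_prod_list A xs)" unfolding yx using cl c by (simp add: m_assoc)
  also have "\<dots> = (x \<otimes> alg_prod_list A xs) \<otimes> y" unfolding IH using cl c by (simp add: m_assoc)
  finally show ?case by simp
qed simp

lemma alg_prod_list_mult:
  assumes "\<And>x. x \<in> set xs \<Longrightarrow> f x \<in> carrier A" "\<And>x. x \<in> set xs \<Longrightarrow> g x \<in> carrier A"
    "\<And>x y. x \<in> set xs \<Longrightarrow> y \<in> set xs \<Longrightarrow> g x \<otimes> f y = f y \<otimes> g x"
  shows "alg_prod_list A (map (\<lambda>x. f x \<otimes> g x) xs) = alg_prod_list A (map f xs) \<otimes> alg_prod_list A (map g xs)"
  using assms
proof (induction xs)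
  case (Cons x xs)
  let ?F = "alg_prod_list A (map f xs)" and ?G = "alg_prod_list A (map g xs)"
  have c: "?F \<in> carrier A" "?G \<in> carrier A" "f x \<in> carrier A" "g x \<in> carrier A"
    using Cons.prems(1,2) by (auto intro!: alg_prod_list_closed)
  have gF: "g x \<otimes> ?F = ?F \<otimes> g x"
    using Cons.prems by (intro alg_prod_list_commute c) auto
  have "f x \<otimes> g x \<otimes> (?F \<otimes> ?G) = f x \<otimes> (g x \<otimes> ?F) \<otimes> ?G" using c by (simp add: m_assoc)
  also have "\<dots> = f x \<otimes> ?F \<otimes> (g x \<otimes> ?G)" unfolding gF using c by (simp add: m_assoc)
  finally show ?case using Cons by simp
qed simp

lemma alg_prod_list_smult:
  assumes "\<And>x. x \<in> set xs \<Longrightarrow> f x \<in> carrier A"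
  shows "alg_prod_list A (map (\<lambda>x. s x \<odot> f x) xs) = prod_list (map s xs) \<odot> alg_prod_list A (map f xs)"
  using assms
proof (induction xs)
  case (Cons x xs)
  have "alg_prod_list A (map f xs) \<in> carrier A" using Cons.prems by (intro alg_prod_list_closed) auto
  then show ?case using Cons by (simp add: smult_mult_left smult_mult_right smult_smult mult.commute)
qed simp

lemma alg_prod_extend:
  fixes f :: "'i::{finite,linorder} \<Rightarrow> 'b"
  assumes "\<And>j. f j \<in> carrier A"
  shows "alg_prod A f J = alg_prod_list A (map (\<lambda>j. if j \<in> J then f j else \<one>) (sorted_list_of_set UNIV))"
proof -
  have "sorted_list_of_set J = filter (\<lambda>j. j \<in> J) (sorted_list_of_set UNIV)"
    by (rule sorted_distinct_set_unique) (auto intro: sorted_wrt_filter)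
  moreover have "alg_prod_list A (map f (filter (\<lambda>j. j \<in> J) xs)) = alg_prod_list A (map (\<lambda>j. if j \<in> J then f j else \<one>) xs)" for xs
  proof (induction xs)
    case (Cons j xs)
    have "alg_prod_list A (map (\<lambda>j. if j \<in> J then f j else \<one>) xs) \<in> carrier A"
      using assms by (intro alg_prod_list_closed) auto
    then show ?case using Cons by auto
  qed simp
  ultimately show ?thesis by (simp add: alg_prod_def)
qed

lemma smult_pow: "x \<in> carrier A \<Longrightarrow> (s \<odot> x) [^] (n::nat) = s ^ n \<odot> x [^] n"
  by (induction n) (simp_all add: smult_mult_left smult_mult_right smult_smult mult.commute)

text \<open>For commuting elements S this is a commutative set containing S and closed under
  products, powers and scalars. It supplies the commutations among products of the \<psi> at
  once.\<close>

definition bicommutant :: "'b set \<Rightarrow> 'b set" where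
  "bicommutant S = {x \<in> carrier A. \<forall>y\<in>carrier A. (\<forall>s\<in>S. y \<otimes> s = s \<otimes> y) \<longrightarrow> x \<otimes> y = y \<otimes> x}"

lemma bicommutant_closed: "x \<in> bicommutant S \<Longrightarrow> x \<in> carrier A"
  by (simp add: bicommutant_def)

lemma bicommutant_intros:
  assumes "S \<subseteq> carrier A"
  shows "s \<in> S \<Longrightarrow> s \<in> bicommutant S" "\<one> \<in> bicommutant S"
    "x \<in> bicommutant S \<Longrightarrow> y \<in> bicommutant S \<Longrightarrow> x \<otimes> y \<in> bicommutant S"
    "x \<in> bicommutant S \<Longrightarrow> b \<odot> x \<in> bicommutant S"
    "x \<in> bicommutant S \<Longrightarrow> x [^] (n::nat) \<in> bicommutant S"
proof -
  show "s \<in> S \<Longrightarrow> s \<in> bicommutant S" using assms by (auto simp: bicommutant_def)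
  show one: "\<one> \<in> bicommutant S" by (simp add: bicommutant_def)
  show mult: "x \<otimes> y \<in> bicommutant S" if "x \<in> bicommutant S" "y \<in> bicommutant S" for x y
    unfolding bicommutant_def
  proof (intro CollectI conjI ballI impI)
    have c: "x \<in> carrier A" "y \<in> carrier A" using that by (auto simp: bicommutant_def)
    then show "x \<otimes> y \<in> carrier A" by simp
    fix w assume w: "w \<in> carrier A" "\<forall>s\<in>S. w \<otimes> s = s \<otimes> w"
    have e: "x \<otimes> w = w \<otimes> x" "y \<otimes> w = w \<otimes> y" using that w by (auto simp: bicommutant_def)
    have "x \<otimes> y \<otimes> w = x \<otimes> (w \<otimes> y)" using c w e by (simp add: m_assoc)
    also have "\<dots> = (x \<otimes> w) \<otimes> y" using c w by (simp add: m_assoc)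
    also have "\<dots> = w \<otimes> (x \<otimes> y)" unfolding e using c w by (simp add: m_assoc)
    finally show "x \<otimes> y \<otimes> w = w \<otimes> (x \<otimes> y)" .
  qed
  show "x \<in> bicommutant S \<Longrightarrow> b \<odot> x \<in> bicommutant S"
    by (simp add: bicommutant_def smult_mult_left smult_mult_right)
  show "x \<in> bicommutant S \<Longrightarrow> x [^] (n::nat) \<in> bicommutant S"
    by (induction n) (simp_all add: one mult)
qed

lemma bicommutant_commute:
  assumes S: "S \<subseteq> carrier A" "\<And>s s'. s \<in> S \<Longrightarrow> s' \<in> S \<Longrightarrow> s \<otimes> s' = s' \<otimes> s"
    and x: "x \<in> bicommutant S" and y: "y \<in> bicommutant S"
  shows "x \<otimes> y = y \<otimes> x"
proof -
  have "y \<otimes> s = s \<otimes> y" if "s \<in> S" for s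
    using y S that unfolding bicommutant_def by blast
  then show ?thesis using x y unfolding bicommutant_def by blast
qed

end

text \<open>Pure algebra, with no module involved: its outcome is that the map between the two
  truncations is well defined, as \<open>quot_map\<close> presupposes.\<close>

locale adjoint_truncation = shifted c d q m
  for c :: "'i::{finite,linorder} \<Rightarrow> 'i \<Rightarrow> int" and d q m +
  fixes a :: "'i \<Rightarrow> complex poly" and z :: "'i \<Rightarrow> complex"
  assumes a_nonzero: "poly_lweight a"
    and z_nonzero: "z i \<noteq> 0"
    and z_eq: "(\<Prod>j\<in>UNIV. z j powi c j i) = inverse (coeff (a i) 0) * lead_coeff (a i)"
begin

abbreviation "tt \<equiv> trunc_t c m a"
abbreviation "T \<equiv> ad_trunc_alg c d q m a z"
abbreviation "SS \<equiv> ad_trunc_rels c d q m a z"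

definition pp :: "'i adgen falg set \<Rightarrow> 'i adgen falg set set" where "pp = quot_proj Uad SS"

lemma qi_neq_0: "qi d q i \<noteq> 0"
  using q_nz by (simp add: qi_def)

lemma scrA_int_closed: "scrA_int c d q m a \<epsilon> i k \<in> carrier U"
  by (simp add: scrA_int_def)

lemma SS_closed: "SS \<subseteq> carrier Uad"
  using scrA_int_closed alg_homD(1)[OF to_ad_hom] unfolding ad_trunc_rels_def Let_def by auto

lemma T_calgebra: "calgebra T"
  unfolding ad_trunc_alg_def by (rule Ua.quot_calgebra[OF SS_closed])

sublocale T: calgebra T by (rule T_calgebra)

lemma pp_hom: "alg_hom Uad T pp"
  unfolding ad_trunc_alg_def pp_def by (rule Ua.quot_proj_hom[OF SS_closed])

sublocale Pp: calg_hom Uad T pp by unfold_locales (rule pp_hom)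
sublocale ta: calg_hom U Uad "to_ad c d q m" by unfold_locales (rule to_ad_hom)

lemma pp_rel: "r \<in> SS \<Longrightarrow> pp r = \<zero>\<^bsub>T\<^esub>"
  unfolding ad_trunc_alg_def pp_def by (rule Ua.quot_proj_rel[OF SS_closed])

lemma pp_eq:
  assumes "x \<ominus>\<^bsub>Uad\<^esub> y \<in> SS" "x \<in> carrier Uad" "y \<in> carrier Uad" shows "pp x = pp y"
proof -
  have "pp x = (pp x \<ominus>\<^bsub>T\<^esub> pp y) \<oplus>\<^bsub>T\<^esub> pp y"
    using assms(2,3) by (simp add: T.minus_eq T.a_assoc T.l_neg)
  then show ?thesis using pp_rel[OF assms(1)] assms(2,3) by simp
qed

definition pr :: "'i adgen falg \<Rightarrow> 'i adgen falg set set" where "pr p = pp (adproj p)"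

lemma pr_hom: "alg_hom free_alg T pr"
  unfolding pr_def by (rule alg_hom_comp[OF adproj_hom pp_hom])

sublocale free: calgebra "free_alg :: 'i adgen falg calg" by (rule free_calgebra)
sublocale Pr: calg_hom free_alg T pr by unfold_locales (rule pr_hom)

lemma pr_simps: "pr (p * p') = pr p \<otimes>\<^bsub>T\<^esub> pr p'" "pr (p ^ n) = pr p [^]\<^bsub>T\<^esub> n" "pr 1 = \<one>\<^bsub>T\<^esub>"
    "pr p \<in> carrier T"
  using Pr.h_mult[of p p'] Pr.h_nat_pow[of p n] Pr.h_one Pr.h_closed[of p] by simp_all

abbreviation "P j \<equiv> pr (fgen (GPsi Pos j))"
abbreviation "M j \<equiv> pr (fgen (GPsi Neg j))"
abbreviation "V j \<equiv> pr (fgen (GPsiInv j))"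

text \<open>In the truncation \<psi>_j^+ \<psi>_j^- is the scalar \<open>ww j\<close>, and q_j^(t_j)
  times the leading coefficient of the A-series is \<open>uu j\<close> times (\<psi>_j^+)^2, see
  \<open>tau_q_scrA\<close>.\<close>

definition uu :: "'i \<Rightarrow> complex" where "uu j = (- qi d q j) ^ tt j"
definition ww :: "'i \<Rightarrow> complex" where "ww j = z j / uu j"

lemma uu_ww: "uu j \<noteq> 0" "ww j \<noteq> 0" "uu j * ww j = z j" "uu j = qi d q j ^ tt j * (- 1) ^ tt j"
proof -
  show 1: "uu j \<noteq> 0" using qi_neq_0 by (simp add: uu_def)
  then show "ww j \<noteq> 0" "uu j * ww j = z j" using z_nonzero by (simp_all add: ww_def)
  show "uu j = qi d q j ^ tt j * (- 1) ^ tt j" unfolding uu_def power_mult_distrib[symmetric] by simp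
qed

lemma psi_commute: "pr (fgen (GPsi \<delta> i)) \<otimes>\<^bsub>T\<^esub> pr (fgen (GPsi \<epsilon> j)) = pr (fgen (GPsi \<epsilon> j)) \<otimes>\<^bsub>T\<^esub> pr (fgen (GPsi \<delta> i))"
proof -
  have "fgen (GPsi \<delta> i) * fgen (GPsi \<epsilon> j) - fgen (GPsi \<epsilon> j) * fgen (GPsi \<delta> i) \<in> ad_rels c d q m"
    unfolding ad_rels_def Let_def by blast
  from ad_rel_eq[OF this] show ?thesis by (simp add: pr_simps(1)[symmetric]) (simp add: pr_def)
qed

lemma PM: "P j \<otimes>\<^bsub>T\<^esub> M j = ww j \<odot>\<^bsub>T\<^esub> \<one>\<^bsub>T\<^esub>" "M j \<otimes>\<^bsub>T\<^esub> P j = ww j \<odot>\<^bsub>T\<^esub> \<one>\<^bsub>T\<^esub>"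
proof -
  have w: "(- qi d q j) powi (- int (tt j)) * z j = ww j"
    by (simp add: ww_def uu_def power_int_minus field_simps)
  have "uad (GPsi Pos j) \<otimes>\<^bsub>Uad\<^esub> uad (GPsi Neg j) \<ominus>\<^bsub>Uad\<^esub> ww j \<odot>\<^bsub>Uad\<^esub> \<one>\<^bsub>Uad\<^esub> \<in> SS"
    unfolding ad_trunc_rels_def Let_def w[symmetric] by blast
  from pp_eq[OF this] show 1: "P j \<otimes>\<^bsub>T\<^esub> M j = ww j \<odot>\<^bsub>T\<^esub> \<one>\<^bsub>T\<^esub>"
    by (simp add: pr_def Uad_gen_def[symmetric])
  then show "M j \<otimes>\<^bsub>T\<^esub> P j = ww j \<odot>\<^bsub>T\<^esub> \<one>\<^bsub>T\<^esub>" by (simp add: psi_commute[of Neg])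
qed

lemma V_eq: "V j = inverse (ww j) \<odot>\<^bsub>T\<^esub> \<one>\<^bsub>T\<^esub>"
proof -
  have "fgen (GPsiInv j) * (fgen (GPsi Pos j) * fgen (GPsi Neg j)) - 1 \<in> ad_rels c d q m"
    unfolding ad_rels_def Let_def by blast
  from ad_rel_eq[OF this] have "V j \<otimes>\<^bsub>T\<^esub> (P j \<otimes>\<^bsub>T\<^esub> M j) = \<one>\<^bsub>T\<^esub>"
    by (simp add: pr_simps(1,3)[symmetric]) (simp add: pr_def)
  then have "ww j \<odot>\<^bsub>T\<^esub> V j = \<one>\<^bsub>T\<^esub>" by (simp add: PM pr_simps(4) T.smult_mult_right)
  then have "inverse (ww j) \<odot>\<^bsub>T\<^esub> (ww j \<odot>\<^bsub>T\<^esub> V j) = inverse (ww j) \<odot>\<^bsub>T\<^esub> \<one>\<^bsub>T\<^esub>" by simp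
  then show ?thesis using uu_ww(2)[of j] by (simp add: T.smult_smult pr_simps(4))
qed

definition pw :: "pm \<Rightarrow> 'i \<Rightarrow> int \<Rightarrow> 'i adgen falg set set" where
  "pw \<epsilon> j k = (if k \<ge> 0 then pr (fgen (GPsi \<epsilon> j)) [^]\<^bsub>T\<^esub> nat k
     else (inverse (ww j) \<odot>\<^bsub>T\<^esub> pr (fgen (GPsi (opp \<epsilon>) j))) [^]\<^bsub>T\<^esub> nat (- k))"

lemma pr_psi_powi: "pr (psi_powi \<epsilon> j k) = pw \<epsilon> j k"
  by (simp add: psi_powi_def pw_def pr_simps V_eq T.smult_mult_right)

abbreviation "is \<equiv> sorted_list_of_set (UNIV :: 'i set)"

lemma pr_alg_prod: "pr (alg_prod free_alg (\<lambda>j. psi_powi \<epsilon> j (c j i)) UNIV) = alg_prod_list T (map (\<lambda>j. pw \<epsilon> j (c j i)) is)"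
  unfolding alg_prod_def by (subst Pr.h_alg_prod_list) (simp_all add: o_def pr_psi_powi)

definition tau :: "'i gen falg set \<Rightarrow> 'i adgen falg set set" where "tau u = pp (to_ad c d q m u)"

lemma tau_hom: "alg_hom U T tau"
  unfolding tau_def by (rule alg_hom_comp[OF to_ad_hom pp_hom])

sublocale tau: calg_hom U T tau by unfold_locales (rule tau_hom)

lemma tau_phi: "tau (ph Pos i 0) = alg_prod_list T (map (\<lambda>j. pw Pos j (c j i)) is)"
  "tau (ph Neg i (m i)) = alg_prod_list T (map (\<lambda>j. pw Neg j (c j i)) is)"
proof -
  have e: "tau (ug g) = pr (fgen (GBase g))" for g
    by (simp add: tau_def to_ad_ug pr_def Uad_gen_def)
  have r: "fgen (GBase (GPhi Pos i 0)) - alg_prod free_alg (\<lambda>j. psi_powi Pos j (c j i)) UNIV \<in> ad_rels c d q m"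
     "fgen (GBase (GPhi Neg i (m i))) - alg_prod free_alg (\<lambda>j. psi_powi Neg j (c j i)) UNIV \<in> ad_rels c d q m"
    unfolding ad_rels_def Let_def by blast+
  show "tau (ph Pos i 0) = alg_prod_list T (map (\<lambda>j. pw Pos j (c j i)) is)"
    unfolding e pr_alg_prod[symmetric] unfolding pr_def ad_rel_eq[OF r(1)] ..
  show "tau (ph Neg i (m i)) = alg_prod_list T (map (\<lambda>j. pw Neg j (c j i)) is)"
    unfolding e pr_alg_prod[symmetric] unfolding pr_def ad_rel_eq[OF r(2)] ..
qed

lemma tau_scrA: "tau (scrA c d q m a Pos j (tt j)) = (- 1) ^ tt j \<odot>\<^bsub>T\<^esub> (P j \<otimes>\<^bsub>T\<^esub> P j)"
proof -
  have "to_ad c d q m (scrA c d q m a Pos j (tt j)) \<ominus>\<^bsub>Uad\<^esub>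
        (- 1) ^ tt j \<odot>\<^bsub>Uad\<^esub> (uad (GPsi Pos j) [^]\<^bsub>Uad\<^esub> (2::nat)) \<in> SS"
    unfolding ad_trunc_rels_def Let_def by blast
  then have "pp (to_ad c d q m (scrA c d q m a Pos j (tt j))) = pp ((- 1) ^ tt j \<odot>\<^bsub>Uad\<^esub> (uad (GPsi Pos j) [^]\<^bsub>Uad\<^esub> (2::nat)))"
    by (rule pp_eq) auto
  then have "tau (scrA c d q m a Pos j (tt j)) = (- 1) ^ tt j \<odot>\<^bsub>T\<^esub> (P j [^]\<^bsub>T\<^esub> (2::nat))"
    by (simp add: tau_def pr_def Uad_gen_def[symmetric])
  then show ?thesis by (simp add: numeral_2_eq_2 pr_simps)
qed

lemma tau_q_scrA: "tau (qi d q j ^ tt j \<odot>\<^bsub>U\<^esub> scrA c d q m a Pos j (tt j)) = uu j \<odot>\<^bsub>T\<^esub> (P j \<otimes>\<^bsub>T\<^esub> P j)"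
  by (simp add: tau_scrA T.smult_smult pr_simps uu_ww(4))

definition psis :: "'i adgen falg set set set" where "psis = range P \<union> range M"

lemma psis: "psis \<subseteq> carrier T" "s \<in> psis \<Longrightarrow> s' \<in> psis \<Longrightarrow> s \<otimes>\<^bsub>T\<^esub> s' = s' \<otimes>\<^bsub>T\<^esub> s"
  by (auto simp: psis_def pr_simps psi_commute)

abbreviation "Z \<equiv> T.bicommutant psis"

lemmas Z_intros = T.bicommutant_intros[OF psis(1)]
lemma Z_commute: "x \<in> Z \<Longrightarrow> y \<in> Z \<Longrightarrow> x \<otimes>\<^bsub>T\<^esub> y = y \<otimes>\<^bsub>T\<^esub> x"
  by (rule T.bicommutant_commute[OF psis(1)]) (rule psis(2), assumption+)

lemma psi_Z: "pr (fgen (GPsi \<epsilon> j)) \<in> Z"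
  by (rule Z_intros(1)) (cases \<epsilon>; simp add: psis_def)

lemma pw_Z: "pw \<epsilon> j k \<in> Z"
  using Z_intros(5)[OF psi_Z[of \<epsilon> j], of "nat k"]
    Z_intros(5)[OF Z_intros(4)[OF psi_Z[of "opp \<epsilon>" j]], of "inverse (ww j)" "nat (- k)"]
  by (simp only: pw_def split: if_split) blast

lemma MP_cancel: "y \<in> carrier T \<Longrightarrow> M j \<otimes>\<^bsub>T\<^esub> (P j \<otimes>\<^bsub>T\<^esub> y) = ww j \<odot>\<^bsub>T\<^esub> y"
  using PM(2)[of j] by (simp add: T.m_assoc[symmetric] pr_simps T.smult_mult_left)

text \<open>The last relation of the simply-connected truncation, one node j at a time. It follows
  from \<psi>_j^+ \<psi>_j^- = \<open>ww j\<close> and \<open>uu j * ww j = z j\<close>, separately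
  for c_ji equal to 2, zero or negative. The product of the z_j^(- c_ji) over j is then absorbed by
  the hypothesis on z.\<close>

lemma factor_identity:
  "pw Pos j (c j i) \<otimes>\<^bsub>T\<^esub> (if j \<in> {j. c j i < 0} then (uu j \<odot>\<^bsub>T\<^esub> (P j \<otimes>\<^bsub>T\<^esub> P j)) [^]\<^bsub>T\<^esub> nat (- c j i) else \<one>\<^bsub>T\<^esub>) =
   z j powi (- c j i) \<odot>\<^bsub>T\<^esub>
     (pw Neg j (c j i) \<otimes>\<^bsub>T\<^esub> (if j \<in> {i} then (uu j \<odot>\<^bsub>T\<^esub> (P j \<otimes>\<^bsub>T\<^esub> P j)) [^]\<^bsub>T\<^esub> (2::nat) else \<one>\<^bsub>T\<^esub>))"
proof -
  consider "j = i" | "j \<noteq> i" "c j i = 0" | "j \<noteq> i" "c j i < 0" using c_offdiag[of j i] by force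
  then show ?thesis
  proof cases
    case 1
    have "z i powi (- 2) * (uu i * uu i * ww i * ww i) = 1"
      using uu_ww(3)[of i] z_nonzero[of i] by (simp add: power_int_minus field_simps power2_eq_square)
    then have "P i \<otimes>\<^bsub>T\<^esub> P i = z i powi (- 2) \<odot>\<^bsub>T\<^esub> (M i \<otimes>\<^bsub>T\<^esub> M i \<otimes>\<^bsub>T\<^esub> ((uu i \<odot>\<^bsub>T\<^esub> (P i \<otimes>\<^bsub>T\<^esub> P i)) \<otimes>\<^bsub>T\<^esub> (uu i \<odot>\<^bsub>T\<^esub> (P i \<otimes>\<^bsub>T\<^esub> P i))))"
      by (simp add: T.smult_mult_left T.smult_mult_right T.smult_smult T.m_assoc pr_simps MP_cancel mult_ac)
    then show ?thesis using 1 by (simp add: c_diag pw_def numeral_2_eq_2 pr_simps)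
  next
    case 2
    then show ?thesis by (simp add: pw_def)
  next
    case 3
    define n where "n = nat (- c j i)"
    have n: "- c j i = int n" using 3 by (simp add: n_def)
    let ?a = "inverse (ww j) \<odot>\<^bsub>T\<^esub> M j" and ?b = "uu j \<odot>\<^bsub>T\<^esub> (P j \<otimes>\<^bsub>T\<^esub> P j)"
    have Zab: "?a \<in> Z" "?b \<in> Z" by (auto intro!: Z_intros(2-5) psi_Z)
    have "?a [^]\<^bsub>T\<^esub> n \<otimes>\<^bsub>T\<^esub> ?b [^]\<^bsub>T\<^esub> n = (?a \<otimes>\<^bsub>T\<^esub> ?b) [^]\<^bsub>T\<^esub> n"
      by (rule T.pow_mult_distrib[symmetric]) (use Z_commute[OF Zab] Zab in \<open>auto intro: T.bicommutant_closed\<close>)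
    also have "?a \<otimes>\<^bsub>T\<^esub> ?b = z j \<odot>\<^bsub>T\<^esub> (inverse (ww j) \<odot>\<^bsub>T\<^esub> P j)"
    proof -
      have e: "inverse (ww j) * (uu j * ww j) = uu j" "z j * inverse (ww j) = uu j"
        using uu_ww(2,3)[of j] by (auto simp: field_simps)
      have "?a \<otimes>\<^bsub>T\<^esub> ?b = (inverse (ww j) * (uu j * ww j)) \<odot>\<^bsub>T\<^esub> P j"
        by (simp add: T.smult_mult_left T.smult_mult_right T.smult_smult pr_simps(4) MP_cancel mult_ac)
      also have "\<dots> = z j \<odot>\<^bsub>T\<^esub> (inverse (ww j) \<odot>\<^bsub>T\<^esub> P j)"
        by (simp only: e T.smult_smult pr_simps(4))
      finally show ?thesis .
    qed
    also have "\<dots> [^]\<^bsub>T\<^esub> n = z j ^ n \<odot>\<^bsub>T\<^esub> ((inverse (ww j) \<odot>\<^bsub>T\<^esub> P j) [^]\<^bsub>T\<^esub> n)"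
      by (rule T.smult_pow) (simp add: pr_simps)
    finally have *: "?a [^]\<^bsub>T\<^esub> n \<otimes>\<^bsub>T\<^esub> ?b [^]\<^bsub>T\<^esub> n = z j ^ n \<odot>\<^bsub>T\<^esub> ((inverse (ww j) \<odot>\<^bsub>T\<^esub> P j) [^]\<^bsub>T\<^esub> n)" .
    have p: "pw Pos j (c j i) = ?a [^]\<^bsub>T\<^esub> n" "pw Neg j (c j i) = (inverse (ww j) \<odot>\<^bsub>T\<^esub> P j) [^]\<^bsub>T\<^esub> n"
      "nat (- c j i) = n"
      using 3 by (simp_all add: pw_def n_def)
    have zp: "z j powi (- c j i) = z j ^ n" unfolding n by simp
    have i: "j \<in> {j. c j i < 0}" "j \<notin> {i}" using 3 by auto
    have cl: "(inverse (ww j) \<odot>\<^bsub>T\<^esub> P j) [^]\<^bsub>T\<^esub> n \<in> carrier T" by (simp add: pr_simps(4))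
    show ?thesis unfolding p zp if_P[OF i(1)] if_not_P[OF i(2)] T.r_one[OF cl] by (rule *)
  qed
qed

lemma tau_relation:
  "lead_coeff (a i) \<odot>\<^bsub>T\<^esub> (tau (ph Pos i 0) \<otimes>\<^bsub>T\<^esub> alg_prod T (\<lambda>j. (uu j \<odot>\<^bsub>T\<^esub> (P j \<otimes>\<^bsub>T\<^esub> P j)) [^]\<^bsub>T\<^esub> nat (- c j i)) {j. c j i < 0}) =
   coeff (a i) 0 \<odot>\<^bsub>T\<^esub> (tau (ph Neg i (m i)) \<otimes>\<^bsub>T\<^esub> (uu i \<odot>\<^bsub>T\<^esub> (P i \<otimes>\<^bsub>T\<^esub> P i)) [^]\<^bsub>T\<^esub> (2::nat))"
proof -
  let ?b = "\<lambda>j. uu j \<odot>\<^bsub>T\<^esub> (P j \<otimes>\<^bsub>T\<^esub> P j)"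
  let ?f = "\<lambda>\<epsilon> j. pw \<epsilon> j (c j i)"
  let ?g = "\<lambda>j. if j \<in> {j. c j i < 0} then ?b j [^]\<^bsub>T\<^esub> nat (- c j i) else \<one>\<^bsub>T\<^esub>"
  let ?h = "\<lambda>j. if j \<in> {i} then ?b j [^]\<^bsub>T\<^esub> (2::nat) else \<one>\<^bsub>T\<^esub>"
  have Zb: "?b j \<in> Z" for j by (auto intro!: Z_intros(2-5) psi_Z)
  have Zg: "?g j \<in> Z" "?h j \<in> Z" for j
    by (cases "j \<in> {j. c j i < 0}"; simp only: if_True if_False Z_intros(2) Z_intros(5)[OF Zb])
      (cases "j \<in> {i}"; simp only: if_True if_False Z_intros(2) Z_intros(5)[OF Zb])
  note ZC = T.bicommutant_closed
  have "alg_prod T (\<lambda>j. ?b j [^]\<^bsub>T\<^esub> nat (- c j i)) {j. c j i < 0} = alg_prod_list T (map ?g is)"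
    by (rule T.alg_prod_extend) (rule ZC[OF Z_intros(5)[OF Zb]])
  then have "tau (ph Pos i 0) \<otimes>\<^bsub>T\<^esub> alg_prod T (\<lambda>j. ?b j [^]\<^bsub>T\<^esub> nat (- c j i)) {j. c j i < 0} =
      alg_prod_list T (map (\<lambda>j. ?f Pos j \<otimes>\<^bsub>T\<^esub> ?g j) is)"
    unfolding tau_phi
    by (simp only:) (rule T.alg_prod_list_mult[symmetric], rule ZC[OF pw_Z], rule ZC[OF Zg(1)], rule Z_commute[OF Zg(1) pw_Z])
  also have "\<dots> = alg_prod_list T (map (\<lambda>j. z j powi (- c j i) \<odot>\<^bsub>T\<^esub> (?f Neg j \<otimes>\<^bsub>T\<^esub> ?h j)) is)"
    by (simp only: factor_identity)
  also have "\<dots> = prod_list (map (\<lambda>j. z j powi (- c j i)) is) \<odot>\<^bsub>T\<^esub> alg_prod_list T (map (\<lambda>j. ?f Neg j \<otimes>\<^bsub>T\<^esub> ?h j) is)"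
    by (rule T.alg_prod_list_smult) (rule ZC[OF Z_intros(3)[OF pw_Z Zg(2)]])
  also have "alg_prod_list T (map (\<lambda>j. ?f Neg j \<otimes>\<^bsub>T\<^esub> ?h j) is) = tau (ph Neg i (m i)) \<otimes>\<^bsub>T\<^esub> alg_prod_list T (map ?h is)"
    unfolding tau_phi by (rule T.alg_prod_list_mult, rule ZC[OF pw_Z], rule ZC[OF Zg(2)], rule Z_commute[OF Zg(2) pw_Z])
  also have "alg_prod_list T (map ?h is) = alg_prod T (\<lambda>j. ?b j [^]\<^bsub>T\<^esub> (2::nat)) {i}"
    by (rule T.alg_prod_extend[symmetric]) (rule ZC[OF Z_intros(5)[OF Zb]])
  also have "\<dots> = ?b i [^]\<^bsub>T\<^esub> (2::nat)"
    using ZC[OF Z_intros(5)[OF Zb[of i], where n = 2]] by (simp add: alg_prod_def del: T.nat_pow_mult)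
  also have "prod_list (map (\<lambda>j. z j powi (- c j i)) is) = inverse (\<Prod>j\<in>UNIV. z j powi c j i)"
    using prod_inversef[of "\<lambda>j. z j powi c j i" UNIV]
    by (simp add: prod.distinct_set_conv_list[symmetric] power_int_minus o_def)
  finally have e: "tau (ph Pos i 0) \<otimes>\<^bsub>T\<^esub> alg_prod T (\<lambda>j. ?b j [^]\<^bsub>T\<^esub> nat (- c j i)) {j. c j i < 0} =
     inverse (\<Prod>j\<in>UNIV. z j powi c j i) \<odot>\<^bsub>T\<^esub> (tau (ph Neg i (m i)) \<otimes>\<^bsub>T\<^esub> ?b i [^]\<^bsub>T\<^esub> (2::nat))" .
  have nz: "coeff (a i) 0 \<noteq> 0" using a_nonzero by (simp add: poly_lweight_def poly_0_coeff_0)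
  then have "lead_coeff (a i) \<noteq> 0" by auto
  have "lead_coeff (a i) * inverse (\<Prod>j\<in>UNIV. z j powi c j i) = coeff (a i) 0"
    unfolding z_eq using nz \<open>lead_coeff (a i) \<noteq> 0\<close> by simp
  moreover have "tau (ph Neg i (m i)) \<otimes>\<^bsub>T\<^esub> ?b i [^]\<^bsub>T\<^esub> (2::nat) \<in> carrier T"
    using ZC[OF Z_intros(5)[OF Zb[of i], where n = 2]] by (intro T.m_closed tau.h_closed) auto
  ultimately show ?thesis unfolding e by (simp add: T.smult_smult)
qed

lemma tau_trunc_rels:
  assumes "r \<in> trunc_rels c d q m a" shows "tau r = \<zero>\<^bsub>T\<^esub>"
proof -
  consider i k where "k > tt i" "r = scrA c d q m a Pos i k"
    | i k where "r = scrA_int c d q m a Neg i k \<ominus>\<^bsub>U\<^esub>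
        scrA_int c d q m a Neg i (- int (tt i)) \<otimes>\<^bsub>U\<^esub> scrA_int c d q m a Pos i (k + int (tt i))"
    | i where "r = lead_coeff (a i) \<odot>\<^bsub>U\<^esub> (ph Pos i 0 \<otimes>\<^bsub>U\<^esub>
          alg_prod U (\<lambda>j. (qi d q j ^ tt j \<odot>\<^bsub>U\<^esub> scrA c d q m a Pos j (tt j)) [^]\<^bsub>U\<^esub> nat (- c j i)) {j. c j i < 0})
        \<ominus>\<^bsub>U\<^esub> coeff (a i) 0 \<odot>\<^bsub>U\<^esub> (ph Neg i (m i) \<otimes>\<^bsub>U\<^esub>
          (qi d q i ^ tt i \<odot>\<^bsub>U\<^esub> scrA c d q m a Pos i (tt i)) [^]\<^bsub>U\<^esub> (2::nat))"
    using assms unfolding trunc_rels_def Let_def by blast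
  then show ?thesis
  proof cases
    case (1 i k)
    then have "to_ad c d q m r \<in> SS" unfolding ad_trunc_rels_def Let_def by blast
    then show ?thesis unfolding tau_def by (rule pp_rel)
  next
    case (2 i k)
    have "to_ad c d q m r \<in> SS"
      unfolding 2 by (simp only: ta.h_minus ta.h_mult scrA_int_closed U.m_closed ad_trunc_rels_def Let_def) blast
    then show ?thesis unfolding tau_def by (rule pp_rel)
  next
    case (3 i)
    let ?g = "\<lambda>j. (qi d q j ^ tt j \<odot>\<^bsub>U\<^esub> scrA c d q m a Pos j (tt j)) [^]\<^bsub>U\<^esub> nat (- c j i)"
    have gc: "set (map ?g xs) \<subseteq> carrier U" for xs by auto
    have "tau (alg_prod U ?g J) = alg_prod T (\<lambda>j. (uu j \<odot>\<^bsub>T\<^esub> (P j \<otimes>\<^bsub>T\<^esub> P j)) [^]\<^bsub>T\<^esub> nat (- c j i)) J" for J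
      unfolding alg_prod_def tau.h_alg_prod_list[OF gc]
      by (simp add: o_def tau_q_scrA[symmetric] del: tau.h_smult)
    moreover have c1: "alg_prod U ?g J \<in> carrier U" for J
      unfolding alg_prod_def by (rule U.alg_prod_list_closed[OF gc])
    ultimately show ?thesis
      unfolding 3 using tau_relation[of i] tau_q_scrA[of i]
      by (simp add: c1 tau.h_minus del: T.nat_pow_mult) (simp add: T.r_neg T.minus_eq pr_simps c1)
  qed
qed

lemma trunc_to_ad_trunc:
  "alg_hom (trunc_alg c d q m a) T (trunc_to_ad_trunc c d q m a z)"
  "u \<in> carrier U \<Longrightarrow> trunc_to_ad_trunc c d q m a z (to_trunc c d q m a u) = tau u"
  using U.quot_map_hom[OF trunc_rels_closed T_calgebra tau_hom tau_trunc_rels]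
  unfolding trunc_to_ad_trunc_def trunc_alg_def to_trunc_def tau_def pp_def by blast+

end

section \<open>Extension to the adjoint truncation\<close>

context tpoly
begin

section \<open>Operators diagonal on the weight decomposition\<close>

definition dec :: "'v \<Rightarrow> ('i \<Rightarrow> nat) set \<Rightarrow> (('i \<Rightarrow> nat) \<Rightarrow> 'v) \<Rightarrow> bool" where
  "dec v B g \<longleftrightarrow> finite B \<and> (\<forall>\<beta>. g \<beta> \<in> W \<beta>) \<and> (\<forall>\<beta>. \<beta> \<notin> B \<longrightarrow> g \<beta> = 0) \<and> v = (\<Sum>\<beta>\<in>B. g \<beta>)"

lemma dec_exists: obtains B g where "dec v B g"
proof -
  obtain B g where "finite B" "\<And>\<beta>. \<beta> \<in> B \<Longrightarrow> g \<beta> \<in> W \<beta>" "v = (\<Sum>\<beta>\<in>B. g \<beta>)"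
    by (rule W_decompose) blast
  then have "dec v B (\<lambda>\<beta>. if \<beta> \<in> B then g \<beta> else 0)" by (simp add: dec_def)
  then show ?thesis by (rule that)
qed

lemma dec_superset: "dec v B g \<Longrightarrow> B \<subseteq> C \<Longrightarrow> finite C \<Longrightarrow> dec v C g"
  unfolding dec_def by (auto intro: sum.mono_neutral_left)

lemma dec_unique: assumes "dec v B g" "dec v B' g'" shows "g = g'"
proof
  fix \<beta>
  let ?C = "B \<union> B'"
  have fin: "finite ?C" using assms by (simp add: dec_def)
  have C: "dec v ?C g" "dec v ?C g'"
    by (rule dec_superset[OF assms(1) _ fin] dec_superset[OF assms(2) _ fin], simp)+
  have Y: "M.V.subspace {0}" by (simp add: M.V.subspace_def)
  have "(\<Sum>\<gamma>\<in>?C. g \<gamma> - g' \<gamma>) = 0" using C by (simp add: dec_def sum_subtractf)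
  moreover have "g \<gamma> - g' \<gamma> \<in> W \<gamma>" for \<gamma>
    using C M.V.subspace_diff[OF W_subspace] by (simp add: dec_def)
  moreover have "finite ?C" using C by (simp add: dec_def)
  ultimately have "\<beta> \<in> ?C \<Longrightarrow> g \<beta> - g' \<beta> \<in> {0}"
    using graded_subspace[OF Y, where B = ?C and g = "\<lambda>\<gamma>. g \<gamma> - g' \<gamma>" and \<beta> = \<beta>] by simp
  then show "g \<beta> = g' \<beta>" using C by (cases "\<beta> \<in> ?C") (auto simp: dec_def)
qed

text \<open>The operator with eigenvalue s \<beta> on \<open>W \<beta>\<close>. Decompositions are
  unique by \<open>dec_unique\<close>, up to the choice of a finite set containing the support, so
  the value does not depend on the choice made.\<close>

definition dia :: "(('i \<Rightarrow> nat) \<Rightarrow> complex) \<Rightarrow> 'v endo" where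
  "dia s = Endo (\<lambda>v. SOME w. \<exists>B g. dec v B g \<and> w = (\<Sum>\<beta>\<in>B. scl (s \<beta>) (g \<beta>)))"

lemma app_dia: assumes v: "dec v B g" shows "app (dia s) v = (\<Sum>\<beta>\<in>B. scl (s \<beta>) (g \<beta>))"
proof -
  define F where "F v = (SOME w. \<exists>B g. dec v B g \<and> w = (\<Sum>\<beta>\<in>B. scl (s \<beta>) (g \<beta>)))" for v
  have F: "F v = (\<Sum>\<beta>\<in>B. scl (s \<beta>) (g \<beta>))" if v: "dec v B g" for v B g
    unfolding F_def
  proof (rule some_equality)
    fix w assume "\<exists>B g. dec v B g \<and> w = (\<Sum>\<beta>\<in>B. scl (s \<beta>) (g \<beta>))"
    then obtain B' g' where 1: "dec v B' g'" "w = (\<Sum>\<beta>\<in>B'. scl (s \<beta>) (g' \<beta>))" by blast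
    have g: "g' = g" by (rule dec_unique[OF 1(1) v])
    have z: "g \<beta> = 0" if "\<beta> \<notin> B \<or> \<beta> \<notin> B'" for \<beta> using v 1(1) that unfolding g dec_def by blast
    have fin: "finite B" "finite B'" using v 1(1) by (auto simp: dec_def)
    have "(\<Sum>\<beta>\<in>B'. scl (s \<beta>) (g \<beta>)) = (\<Sum>\<beta>\<in>B \<union> B'. scl (s \<beta>) (g \<beta>))"
      by (rule sum.mono_neutral_left) (use fin z in auto)
    also have "\<dots> = (\<Sum>\<beta>\<in>B. scl (s \<beta>) (g \<beta>))"
      by (rule sum.mono_neutral_right) (use fin z in auto)
    finally show "w = (\<Sum>\<beta>\<in>B. scl (s \<beta>) (g \<beta>))" using 1(2) g by simp
  qed (use v in blast)
  have "F (v + w) = F v + F w" for v w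
  proof -
    obtain B g where 1: "dec v B g" by (rule dec_exists)
    obtain B' g' where 2: "dec w B' g'" by (rule dec_exists)
    let ?C = "B \<union> B'"
    have fin: "finite ?C" using 1 2 by (simp add: dec_def)
    have C: "dec v ?C g" "dec w ?C g'"
      by (rule dec_superset[OF 1 _ fin] dec_superset[OF 2 _ fin], simp)+
    then have "dec (v + w) ?C (\<lambda>\<beta>. g \<beta> + g' \<beta>)"
      using M.V.subspace_add[OF W_subspace] by (simp add: dec_def sum.distrib)
    from F[OF this] show ?thesis using F[OF C(1)] F[OF C(2)] by (simp add: M.V.scale_right_distrib sum.distrib)
  qed
  then have "app (Endo F) = F" by (rule app_Endo)
  then show ?thesis using F[OF v] unfolding dia_def F_def by simp
qed

lemma dia_W: assumes "u \<in> W \<beta>" shows "app (dia s) u = scl (s \<beta>) u"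
proof -
  have "dec u {\<beta>} (\<lambda>\<gamma>. if \<gamma> = \<beta> then u else 0)" using assms by (simp add: dec_def)
  from app_dia[OF this] show ?thesis by simp
qed

lemma dia_lin: "dia s \<in> M.S.lin"
proof -
  have "dia s * sc b = sc b * dia s" for b
  proof (rule endo_eq_on_W)
    fix \<beta> v assume "v \<in> W \<beta>"
    then show "app (dia s * sc b) v = app (sc b * dia s) v"
      using dia_W[OF W_scale, of v \<beta> s b] dia_W[of v \<beta> s] by (simp add: mult.commute)
  qed
  then show ?thesis by (simp add: M.S.lin_def)
qed

lemma dia_K: assumes "x \<in> K" shows "x * dia s = dia s * x"
proof (rule endo_eq_on_W)
  fix \<beta> v assume "v \<in> W \<beta>"
  then show "app (x * dia s) v = app (dia s * x) v"
    using assms dia_W[OF W_K, of x v \<beta> s] dia_W[of v \<beta> s] by (simp add: app_scl C.K_lin)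
qed

lemma dia_dia: "dia s * dia s' = dia (\<lambda>\<beta>. s \<beta> * s' \<beta>)"
proof (rule endo_eq_on_W)
  fix \<beta> v assume "v \<in> W \<beta>"
  then show "app (dia s * dia s') v = app (dia (\<lambda>\<beta>. s \<beta> * s' \<beta>)) v"
    using dia_W[OF W_scale, of v \<beta> s "s' \<beta>"] dia_W[of v \<beta> s'] dia_W[of v \<beta> "\<lambda>\<beta>. s \<beta> * s' \<beta>"] by simp
qed

lemma dia_const: "dia (\<lambda>\<beta>. b) = sc b"
  by (rule endo_eq_on_W) (simp add: dia_W)

text \<open>The vector is a joint eigenvector of the \<phi>_(i,0)^+ for the shifted weight. Having a
  nonzero component in some \<open>W \<gamma>\<close>, it has the weight of \<gamma>, and
  nondegeneracy of the form recovers \<gamma>. As \<gamma> takes values in the naturals, x_j^+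
  vanishes on \<open>W \<beta>\<close> if \<beta> j = 0.\<close>

lemma X_shift:
  assumes u: "u \<in> W \<beta>" and nz: "app (X \<delta> j l) u \<noteq> 0"
  obtains \<gamma> where "app (X \<delta> j l) u \<in> W \<gamma>" "\<And>k. int (\<gamma> k) = int (\<beta> k) - (if k = j then sgi \<delta> else 0)"
proof -
  define w where "w i = q powi (sgi \<delta> * bform c d i j) * lower_wt c d q \<Lambda> \<beta> i" for i
  let ?y = "app (X \<delta> j l) u"
  have y: "app (P0 i) ?y = scl (w i) ?y" for i
  proof -
    have "app (P0 i * X \<delta> j l) u = app (sc (q powi (sgi \<delta> * bform c d i j)) * (X \<delta> j l * P0 i)) u"
      by (simp only: Phi0_X)
    then show ?thesis using u by (simp add: W_iff w_def app_scl)
  qed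
  let ?Y = "{y. \<forall>i. app (P0 i) y = scl (w i) y}"
  have sub: "M.V.subspace ?Y"
    unfolding M.V.subspace_def by (auto simp: app_add_right M.V.scale_right_distrib app_scl mult.commute)
  have st: "app (P0 i) y \<in> ?Y" if "y \<in> ?Y" for i y
    using that M.V.subspace_scale[OF sub] by auto
  obtain B g where B: "finite B" "\<And>\<beta>. \<beta> \<in> B \<Longrightarrow> g \<beta> \<in> W \<beta>" "?y = (\<Sum>\<beta>\<in>B. g \<beta>)"
    by (rule W_decompose) blast
  have "\<exists>\<gamma>\<in>B. g \<gamma> \<noteq> 0" using nz B(3) by (metis sum.neutral)
  then obtain \<gamma> where \<gamma>: "\<gamma> \<in> B" "g \<gamma> \<noteq> 0" by blast
  have "g \<gamma> \<in> ?Y" by (rule graded_subspace[OF sub st B(1,2) _ \<gamma>(1)]) (use y B(3) in auto)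
  then have 1: "app (P0 i) (g \<gamma>) = scl (w i) (g \<gamma>)" for i by simp
  have 2: "app (P0 i) (g \<gamma>) = scl (lower_wt c d q \<Lambda> \<gamma> i) (g \<gamma>)" for i
    using B(2)[OF \<gamma>(1)] W_iff by simp
  have "scl (w i) (g \<gamma>) = scl (lower_wt c d q \<Lambda> \<gamma> i) (g \<gamma>)" for i
    by (rule trans[OF 1[symmetric] 2])
  then have w: "w i = lower_wt c d q \<Lambda> \<gamma> i" for i using \<gamma>(2) unfolding M.V.scale_cancel_right by blast
  have e: "(\<Sum>k\<in>UNIV. bform c d k i * int (\<gamma> k)) = (\<Sum>k\<in>UNIV. bform c d k i * int (\<beta> k)) - sgi \<delta> * bform c d i j" for i
  proof -
    have "q powi (sgi \<delta> * bform c d i j - (\<Sum>k\<in>UNIV. bform c d k i * int (\<beta> k))) = q powi (- (\<Sum>k\<in>UNIV. bform c d k i * int (\<gamma> k)))"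
      using w[of i] L_nz[of i] q_nz by (simp add: w_def lower_wt_powi power_int_diff power_int_minus field_simps)
    then show ?thesis unfolding powi_inject by simp
  qed
  define x where "x k = real (\<gamma> k) - real (\<beta> k) + (if k = j then of_int (sgi \<delta>) else 0)" for k
  have "(\<Sum>k\<in>UNIV. of_int (d i * c i k) * x k) =
      of_int ((\<Sum>k\<in>UNIV. bform c d k i * int (\<gamma> k)) - (\<Sum>k\<in>UNIV. bform c d k i * int (\<beta> k)) + bform c d i j * sgi \<delta>)" for i
  proof -
    have "(\<Sum>k\<in>UNIV. of_int (d i * c i k) * x k) = (\<Sum>k\<in>UNIV. of_int (bform c d i k) * real (\<gamma> k)) -
       (\<Sum>k\<in>UNIV. of_int (bform c d i k) * real (\<beta> k)) + (\<Sum>k\<in>UNIV. if k = j then of_int (bform c d i j) * of_int (sgi \<delta>) else 0)"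
      unfolding sum_subtractf[symmetric] sum.distrib[symmetric]
      by (rule sum.cong) (auto simp: x_def bform_def algebra_simps)
    then show ?thesis by (simp add: bform_sym[of _ i])
  qed
  then have "x = (\<lambda>k. 0)" by (intro form_nondegenerate) (simp add: e)
  then have "x k = 0" for k by simp
  moreover have "x k = of_int (int (\<gamma> k) - (int (\<beta> k) - (if k = j then sgi \<delta> else 0)))" for k
    by (simp add: x_def)
  ultimately have "int (\<gamma> k) - (int (\<beta> k) - (if k = j then sgi \<delta> else 0)) = 0" for k
    by (metis of_int_eq_0_iff)
  then have "int (\<gamma> k) = int (\<beta> k) - (if k = j then sgi \<delta> else 0)" for k
    by (metis eq_iff_diff_eq_0)
  moreover have "?y \<in> W \<gamma>" unfolding W_iff using y w by simp
  ultimately show ?thesis using that by blast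
qed

end

locale tpoly_adjoint = tpoly c d q m scl \<rho> a \<Lambda> f + AT: adjoint_truncation c d q m a z
  for c :: "'i::{finite,linorder} \<Rightarrow> 'i \<Rightarrow> int" and d q m
    and scl :: "complex \<Rightarrow> 'v::ab_group_add \<Rightarrow> 'v" and \<rho> a \<Lambda> f z
begin

abbreviation "ww \<equiv> AT.ww"

text \<open>The value of \<psi>_j^+ on the top vector. Its square is prescribed by the relation
  between (\<psi>_j^+)^2 and the leading coefficient of the A-series, whose eigenvalue there is
  \<open>lam j\<close>.\<close>

definition kap :: "'i \<Rightarrow> complex" where "kap j = csqrt ((- 1) ^ t j * lam j)"

lemma kap: "kap j ^ 2 = (- 1) ^ t j * lam j" "kap j \<noteq> 0"
proof -
  show "kap j ^ 2 = (- 1) ^ t j * lam j" unfolding kap_def by (rule power2_csqrt)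
  then show "kap j \<noteq> 0" using p_t(1)[of j] by auto
qed

definition ss :: "'i \<Rightarrow> ('i \<Rightarrow> nat) \<Rightarrow> complex" where
  "ss j \<beta> = kap j * qi d q j powi (- int (\<beta> j))"

lemma ss_nz: "ss j \<beta> \<noteq> 0"
  using kap(2) qi_nz by (simp add: ss_def)

lemma ss_square: "ss j \<beta> * ss j \<beta> = (- 1) ^ t j * ls \<beta> j"
proof -
  have "qi d q j powi (- int (\<beta> j)) * qi d q j powi (- int (\<beta> j)) = bb j ^ \<beta> j"
    using qi_nz[of j] by (simp add: power_int_add[symmetric] power_int_power[symmetric] power_int_minus power_mult[symmetric] power_add[symmetric] mult_2 power_inverse[symmetric] flip: power_mult)
  then have "ss j \<beta> * ss j \<beta> = kap j ^ 2 * bb j ^ \<beta> j" by (simp add: ss_def power2_eq_square mult_ac)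
  then show ?thesis by (simp add: kap(1))
qed

fun sp :: "pm \<Rightarrow> 'i \<Rightarrow> ('i \<Rightarrow> nat) \<Rightarrow> complex" where
  "sp Pos j \<beta> = ss j \<beta>"
| "sp Neg j \<beta> = ww j * inverse (ss j \<beta>)"

lemma sp: "sp \<epsilon> j \<beta> \<noteq> 0" "sp \<epsilon> j \<beta> * sp (opp \<epsilon>) j \<beta> = ww j"
  using ss_nz AT.uu_ww(2) by (cases \<epsilon>; simp)+

text \<open>The twist that makes \<phi>_(i,0)^+ equal to the product of the (\<psi>_j^+)^(c_ji) on
  the top weight space. By \<open>Lw_weight\<close> the equality then holds on every weight
  space.\<close>

definition Lw :: "'i \<Rightarrow> complex" where "Lw i = (\<Prod>j\<in>UNIV. kap j powi c j i) / \<Lambda> i"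

lemma Lw_nz: "Lw i \<noteq> 0"
  using kap(2) L_nz by (simp add: Lw_def)

lemma prod_q_powi: "(\<Prod>j\<in>S. q powi g j) = q powi (\<Sum>j\<in>S. g j)" for S :: "'i set"
  using q_nz by (induction S rule: infinite_finite_induct) (simp_all add: power_int_add)

lemma prod_powi_distrib: "(\<Prod>j\<in>S. (x j * y j :: complex) powi n j) = (\<Prod>j\<in>S. x j powi n j) * (\<Prod>j\<in>S. y j powi n j)"
  by (simp add: power_int_mult_distrib prod.distrib)

lemma Lw_weight: "Lw i * lower_wt c d q \<Lambda> \<beta> i = (\<Prod>j\<in>UNIV. ss j \<beta> powi c j i)"
proof -
  have "(qi d q j powi (- int (\<beta> j))) powi c j i = q powi (- (bform c d j i * int (\<beta> j)))" for j
    by (simp add: qi_powi power_int_mult[symmetric] bform_def algebra_simps)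
  then have "(\<Prod>j\<in>UNIV. ss j \<beta> powi c j i) = (\<Prod>j\<in>UNIV. kap j powi c j i) * q powi (- (\<Sum>j\<in>UNIV. bform c d j i * int (\<beta> j)))"
    unfolding ss_def prod_powi_distrib by (simp add: prod_q_powi sum_negf)
  then show ?thesis using L_nz[of i] by (simp add: Lw_def lower_wt_powi)
qed

text \<open>The eigenvalue of \<phi>_(i,m_i)^- is known from that of \<phi>_(i,0)^+ and the leading
  coefficients, by \<open>N0_W\<close>. The hypothesis on z replaces the ratio of the two extreme
  coefficients of a_i by a product over j, so that everything becomes a product of c_ji-th
  powers.\<close>

lemma Lw_N0:
  assumes u: "u \<in> W \<beta>" shows "scl (Lw i) (app (N0 i) u) = scl (\<Prod>j\<in>UNIV. sp Neg j \<beta> powi c j i) u"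
proof -
  define g where "g j = qi d q j ^ t j * ls \<beta> j" for j
  have g: "g j \<noteq> 0" "g j = AT.uu j * (ss j \<beta> * ss j \<beta>)" for j
  proof -
    have "(- 1) ^ t j * ((- 1) ^ t j * x) = (x :: complex)" for x
      by (simp add: mult.assoc[symmetric] power_mult_distrib[symmetric])
    then show 1: "g j = AT.uu j * (ss j \<beta> * ss j \<beta>)"
      unfolding g_def ss_square AT.uu_ww(4) trunc_t_eq by (simp add: mult_ac)
    show "g j \<noteq> 0" unfolding 1 using AT.uu_ww(1) ss_nz by simp
  qed
  have "coeff (a i) 0 * cs \<beta> i = lead_coeff (a i) * (\<Prod>j\<in>{j. c j i < 0}. g j ^ nat (- c j i))"
    using factors_eigen by (simp add: g_def)
  also have "(\<Prod>j\<in>{j. c j i < 0}. g j ^ nat (- c j i)) = (\<Prod>j\<in>UNIV - {i}. g j powi (- c j i))"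
  proof -
    have "(\<Prod>j\<in>UNIV - {i}. g j powi (- c j i)) = (\<Prod>j\<in>UNIV - {i}. g j ^ nat (- c j i))"
      using c_offdiag by (intro prod.cong) (auto simp: power_int_def)
    also have "\<dots> = (\<Prod>j\<in>{j. c j i < 0}. g j ^ nat (- c j i))"
    proof (intro prod.mono_neutral_right ballI)
      show "{j. c j i < 0} \<subseteq> UNIV - {i}" using c_neg_neq by auto
    qed auto
    finally show ?thesis by simp
  qed
  finally have cs: "coeff (a i) 0 * cs \<beta> i = lead_coeff (a i) * (\<Prod>j\<in>UNIV - {i}. g j powi (- c j i))" .
  have "(\<Prod>j\<in>UNIV. g j powi (- c j i)) = g i powi (- c i i) * (\<Prod>j\<in>UNIV - {i}. g j powi (- c j i))"
    by (rule prod.remove) auto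
  then have G: "(g i)\<^sup>2 * (\<Prod>j\<in>UNIV. g j powi (- c j i)) = (\<Prod>j\<in>UNIV - {i}. g j powi (- c j i))"
    using g(1)[of i] by (simp add: c_diag power_int_minus)
  have cs': "cs \<beta> i = (\<Prod>j\<in>UNIV. z j powi c j i) * ((g i)\<^sup>2 * (\<Prod>j\<in>UNIV. g j powi (- c j i)))"
    unfolding G AT.z_eq using cs a_nz(2)[of i] by (simp add: field_simps)
  have "scl ((g i)\<^sup>2) (app (N0 i) u) = scl (cs \<beta> i * lower_wt c d q \<Lambda> \<beta> i) u"
    using N0_W[OF u, of i] u by (simp add: g_def W_iff)
  then have "scl (inverse ((g i)\<^sup>2)) (scl ((g i)\<^sup>2) (app (N0 i) u)) = scl (inverse ((g i)\<^sup>2)) (scl (cs \<beta> i * lower_wt c d q \<Lambda> \<beta> i) u)"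
    by simp
  then have "app (N0 i) u = scl ((\<Prod>j\<in>UNIV. z j powi c j i) * (\<Prod>j\<in>UNIV. g j powi (- c j i)) * lower_wt c d q \<Lambda> \<beta> i) u"
    using g(1)[of i] unfolding cs' by (simp add: field_simps)
  then have "scl (Lw i) (app (N0 i) u) = scl ((\<Prod>j\<in>UNIV. z j powi c j i) * (\<Prod>j\<in>UNIV. g j powi (- c j i)) * (Lw i * lower_wt c d q \<Lambda> \<beta> i)) u"
    by (simp add: mult_ac)
  also have "(\<Prod>j\<in>UNIV. z j powi c j i) * (\<Prod>j\<in>UNIV. g j powi (- c j i)) * (Lw i * lower_wt c d q \<Lambda> \<beta> i) =
      (\<Prod>j\<in>UNIV. (z j * inverse (g j) * ss j \<beta>) powi c j i)"
    unfolding Lw_weight prod_powi_distrib by (simp add: power_int_minus power_int_inverse)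
  also have "(\<Prod>j\<in>UNIV. (z j * inverse (g j) * ss j \<beta>) powi c j i) = (\<Prod>j\<in>UNIV. sp Neg j \<beta> powi c j i)"
  proof -
    have "z j * inverse (g j) * ss j \<beta> = sp Neg j \<beta>" for j
      unfolding g(2) using ss_nz[of j \<beta>] AT.uu_ww(1)[of j] by (simp add: AT.ww_def field_simps)
    then show ?thesis by simp
  qed
  finally show ?thesis .
qed

subsection \<open>The action of the adjoint algebra\<close>

fun adg :: "'i adgen \<Rightarrow> 'v endo" where
  "adg (GBase g) = R (L0_auto c d q m Lw (ug g))"
| "adg (GPsi \<epsilon> j) = dia (sp \<epsilon> j)"
| "adg (GPsiInv j) = sc (inverse (ww j))"

lemmas L0 = L0_auto[OF Lw_nz]

lemma L0_closed [simp]: "u \<in> carrier U \<Longrightarrow> L0_auto c d q m Lw u \<in> carrier U"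
  by (rule alg_homD(1)[OF L0(1)])

lemma adg_lin: "adg g \<in> M.S.lin"
proof (cases g)
  case (GPsiInv j)
  then show ?thesis using C.K_lin[OF C.K_sc] by simp
qed (simp_all add: M.R_lin dia_lin)

definition H :: "'i adgen falg \<Rightarrow> 'v \<Rightarrow> 'v" where "H = free_lift (end_alg scl) (\<lambda>g. app (adg g))"

lemma adg_closed: "app (adg g) \<in> carrier (end_alg scl)"
  using adg_lin[of g] by (simp add: M.end_alg_carrier_iff M.lin_iff app_add_right)

lemma H_hom: "alg_hom free_alg (end_alg scl) H"
  unfolding H_def by (rule calgebra.free_lift_hom[OF M.end_calgebra adg_closed])

sublocale Fr: alg_rep "free_alg :: 'i adgen falg calg" scl H
proof -
  show "alg_rep (free_alg :: 'i adgen falg calg) scl H"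
    by (intro alg_rep.intro alg_rep_axioms.intro free_calgebra M.complex_vs_axioms)
      (use H_hom M.rho_module in \<open>simp add: alg_module_def alg_hom_def\<close>)
qed

abbreviation "E \<equiv> Fr.R"

lemma E_simps: "E (y * y') = E y * E y'" "E (y - y') = E y - E y'" "E (y ^ n) = E y ^ n" "E 1 = 1"
  "E (fscal b * y) = sc b * E y" "E (fgen g) = adg g" "E (fscal b) = sc b"
proof -
  show "E (y * y') = E y * E y'" "E (y - y') = E y - E y'" "E (y ^ n) = E y ^ n" "E 1 = 1" "E (fscal b * y) = sc b * E y"
    using Fr.R_mult[of y y'] Fr.R_minus[of y y'] Fr.R_pow[of y n] Fr.R_one Fr.R_smult[of y b] by simp_all
  show "E (fscal b) = sc b" using Fr.R_smult[of 1 b] Fr.R_one by simp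
  have "app (E (fgen g)) = H (fgen g)" by (rule Fr.app_R) simp
  also have "\<dots> = app (adg g)" unfolding H_def by (rule calgebra.free_lift_fgen[OF M.end_calgebra adg_closed])
  finally show "E (fgen g) = adg g" by (intro endo_eqI) simp
qed

lemma E_mapB: "E (mapB y) = R (L0_auto c d q m Lw (uproj y))"
proof -
  have homB: "alg_hom free_alg free_alg mapB" by (rule calgebra.free_lift_hom[OF free_calgebra]) simp
  have "H (mapB y) = \<rho> (L0_auto c d q m Lw (uproj y))"
  proof (rule calgebra.free_hom_eqI[OF M.end_calgebra alg_hom_comp[OF homB H_hom]
      alg_hom_comp[OF alg_hom_comp[OF uproj_hom L0(1)] M.rho_hom]])
    fix g
    show "H (mapB (fgen g)) = \<rho> (L0_auto c d q m Lw (uproj (fgen g)))"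
      unfolding free_endo_simps H_def calgebra.free_lift_fgen[OF M.end_calgebra adg_closed] adg.simps
      by (simp add: M.app_R U_gen_def[symmetric])
  qed
  then show ?thesis by (simp add: Fr.R_def M.R_def)
qed

lemma E_Phi: "E (fgen (GBase (GPhi \<epsilon> i k))) = sc (Lw i) * Phi \<epsilon> i k"
  by (simp add: E_simps L0(3) M.R_smult Phi_def)

lemma E_X: "E (fgen (GBase (GX \<epsilon> i k))) = sc (if \<epsilon> = Pos then Lw i else 1) * X \<epsilon> i k"
  by (simp add: E_simps L0(3) M.R_smult X_def)

lemma E_lin: "E y \<in> M.S.lin"
  by (rule Fr.R_lin) simp

lemma app_power: "x \<in> M.S.lin \<Longrightarrow> app x u = scl s u \<Longrightarrow> app (x ^ n) u = scl (s ^ n) u"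
  by (induction n) (simp_all add: app_scl mult.commute)

lemma E_psi_powi: assumes u: "u \<in> W \<beta>" shows "app (E (psi_powi \<epsilon> j k)) u = scl (sp \<epsilon> j \<beta> powi k) u"
proof (cases "k \<ge> 0")
  case True
  have "app (E (fgen (GPsi \<epsilon> j)) ^ nat k) u = scl (sp \<epsilon> j \<beta> ^ nat k) u"
    by (rule app_power[OF E_lin]) (simp add: E_simps dia_W[OF u])
  then show ?thesis using True by (simp add: psi_powi_def E_simps power_int_def)
next
  case False
  have "sp (opp \<epsilon>) j \<beta> * inverse (ww j) = inverse (sp \<epsilon> j \<beta>)"
    unfolding sp(2)[of \<epsilon> j \<beta>, symmetric] using sp(1)[of \<epsilon> j \<beta>] sp(1)[of "opp \<epsilon>" j \<beta>] by (simp add: field_simps)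
  then have "app (E (fgen (GPsi (opp \<epsilon>) j) * fgen (GPsiInv j))) u = scl (inverse (sp \<epsilon> j \<beta>)) u"
    by (simp add: E_simps dia_W[OF W_scale[OF u]])
  from app_power[OF E_lin this, of "nat (- k)"] show ?thesis
    using False by (simp add: psi_powi_def E_simps power_int_def)
qed

lemma E_alg_prod:
  assumes u: "u \<in> W \<beta>"
  shows "app (E (alg_prod free_alg (\<lambda>j. psi_powi \<epsilon> j (c j i)) UNIV)) u = scl (\<Prod>j\<in>UNIV. sp \<epsilon> j \<beta> powi c j i) u"
proof -
  have 1: "E (prod_list ps) = prod_list (map E ps)" for ps
    by (induction ps) (simp_all add: E_simps)
  have "app (prod_list (map (\<lambda>j. E (psi_powi \<epsilon> j (c j i))) js)) u = scl (prod_list (map (\<lambda>j. sp \<epsilon> j \<beta> powi c j i) js)) u" for js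
    by (rule app_prod_list) (rule E_psi_powi[OF u], rule E_lin)
  then show ?thesis
    by (simp add: alg_prod_def alg_prod_list_free 1 o_def prod.distinct_set_conv_list[symmetric])
qed

lemma lin_sc_comm: "x \<in> M.S.lin \<Longrightarrow> sc b * x = x * sc b"
  by (simp add: M.S.lin_def)

lemma E_ad_rels:
  assumes r: "r \<in> ad_rels c d q m" shows "E r = 0"
proof -
  have kap_E: "E (fgen (GPsi Pos i)) * E (fgen (GPsi Neg i)) = sc (ww i)" for i
  proof -
    have "E (fgen (GPsi Pos i)) * E (fgen (GPsi Neg i)) = dia (\<lambda>\<beta>. ww i)"
      unfolding E_simps adg.simps dia_dia using sp(2)[of Pos i] by (simp del: sp.simps)
    then show ?thesis by (simp add: dia_const)
  qed
  have wi: "ww i * inverse (ww i) = 1" "inverse (ww i) * ww i = 1" for i using AT.uu_ww(2)[of i] by simp_all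
  from r show ?thesis unfolding ad_rels_def Let_def
  proof (elim UnE CollectE exE conjE)
    assume "r \<in> base_rels c d q m GBase"
    then show ?thesis
    proof (cases rule: base_rels_GBase)
      case (1 r0)
      have "uproj r0 = \<zero>\<^bsub>U\<^esub>" by (rule uproj_rel) (use 1(1) in \<open>simp add: id_def\<close>)
      moreover have "L0_auto c d q m Lw \<zero>\<^bsub>U\<^esub> = \<zero>\<^bsub>U\<^esub>"
      proof -
        interpret L: calg_hom U U "L0_auto c d q m Lw" by unfold_locales (rule L0(1))
        show ?thesis by simp
      qed
      ultimately show ?thesis unfolding 1(2) E_mapB by simp
    next
      case (2 i g)
      show ?thesis
      proof (cases g)
        case (GBase g0)
        have "r = mapB (fgen (GPhi Pos i 0) * fgen (GPhi Neg i (m i)) * fgen g0 - fgen g0 * (fgen (GPhi Pos i 0) * fgen (GPhi Neg i (m i))))"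
          unfolding 2 GBase by (simp add: free_endo_simps)
        moreover have "uproj (fgen (GPhi Pos i 0) * fgen (GPhi Neg i (m i)) * fgen g0 - fgen g0 * (fgen (GPhi Pos i 0) * fgen (GPhi Neg i (m i)))) = \<zero>\<^bsub>U\<^esub>"
          by (rule uproj_rel) (use base_rels_mem(5)[of "\<lambda>g. g" i m g0] in \<open>simp add: id_def\<close>)
        moreover have "L0_auto c d q m Lw \<zero>\<^bsub>U\<^esub> = \<zero>\<^bsub>U\<^esub>"
        proof -
          interpret L: calg_hom U U "L0_auto c d q m Lw" by unfold_locales (rule L0(1))
          show ?thesis by simp
        qed
        ultimately show ?thesis by (simp only: E_mapB M.R_zero)
      next
        case (GPsi \<epsilon> j)
        have "sc (Lw i) * P0 i * (sc (Lw i) * N0 i) \<in> K" by (intro C.K_mult C.K_sc Phi_K)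
        from dia_K[OF this, of "sp \<epsilon> j"] show ?thesis
          unfolding 2 GPsi by (simp only: E_simps(1,2) E_Phi) (simp add: E_simps(6))
      next
        case (GPsiInv j)
        have "sc (Lw i) * P0 i * (sc (Lw i) * N0 i) \<in> K" by (intro C.K_mult C.K_sc Phi_K)
        from C.K_comm[OF this C.K_sc, of "inverse (ww j)"] show ?thesis
          unfolding 2 GPsiInv by (simp only: E_simps(1,2) E_Phi) (simp add: E_simps(6))
      qed
    qed
  next
    fix \<delta> \<epsilon> i j
    assume r: "r = fgen (GPsi \<delta> i) * fgen (GPsi \<epsilon> j) - fgen (GPsi \<epsilon> j) * fgen (GPsi \<delta> i)"
    show ?thesis unfolding r by (simp add: E_simps dia_dia mult.commute)
  next
    fix i assume r: "r = fgen (GPsi Pos i) * fgen (GPsi Neg i) * fgen (GPsiInv i) - 1"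
    show ?thesis unfolding r E_simps(1,2) kap_E by (simp add: E_simps wi flip: M.S.sc_mult)
  next
    fix i assume r: "r = fgen (GPsiInv i) * (fgen (GPsi Pos i) * fgen (GPsi Neg i)) - 1"
    show ?thesis unfolding r E_simps(1,2) kap_E by (simp add: E_simps wi flip: M.S.sc_mult)
  next
    fix i g assume r: "r = fgen (GPsi Pos i) * fgen (GPsi Neg i) * fgen g - fgen g * (fgen (GPsi Pos i) * fgen (GPsi Neg i))"
    show ?thesis unfolding r E_simps(1,2) kap_E by (simp add: lin_sc_comm[OF E_lin])
  next
    fix i assume r: "r = fgen (GBase (GPhi Pos i 0)) - alg_prod free_alg (\<lambda>j. psi_powi Pos j (c j i)) UNIV"
    show ?thesis
    proof (rule endo_eq_on_W)
      fix \<beta> u assume u: "u \<in> W \<beta>"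
      have "app (P0 i) u = scl (lower_wt c d q \<Lambda> \<beta> i) u" using u by (simp add: W_iff)
      then show "app (E r) u = app 0 u"
        unfolding r E_simps(2) E_Phi using E_alg_prod[OF u, of Pos i] by (simp add: Lw_weight)
    qed
  next
    fix i assume r: "r = fgen (GBase (GPhi Neg i (m i))) - alg_prod free_alg (\<lambda>j. psi_powi Neg j (c j i)) UNIV"
    show ?thesis
    proof (rule endo_eq_on_W)
      fix \<beta> u assume u: "u \<in> W \<beta>"
      show "app (E r) u = app 0 u"
        unfolding r E_simps(2) E_Phi using E_alg_prod[OF u, of Neg i] Lw_N0[OF u, of i] by (simp del: sp.simps)
    qed
  next
    fix \<epsilon> i j k assume r: "r = fgen (GPsi Pos i) * fgen (GBase (GPhi \<epsilon> j k)) - fgen (GBase (GPhi \<epsilon> j k)) * fgen (GPsi Pos i)"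
    have "sc (Lw j) * Phi \<epsilon> j k \<in> K" by (intro C.K_mult C.K_sc Phi_K)
    from dia_K[OF this, of "sp Pos i"] show ?thesis unfolding r E_simps(1,2) E_Phi by (simp add: E_simps(6))
  next
    fix \<epsilon> i j k assume r: "r = fgen (GPsi Pos i) * fgen (GBase (GX \<epsilon> j k))
          - fscal (if i = j then qi d q i powi sgi \<epsilon> else 1) * fgen (GBase (GX \<epsilon> j k)) * fgen (GPsi Pos i)"
    let ?l = "if \<epsilon> = Pos then Lw j else 1" and ?e = "if i = j then qi d q i powi sgi \<epsilon> else 1"
    \<comment> \<open>x_j moves \<open>W \<beta>\<close> to a weight space with \<beta> j changed by
      1, where the eigenvalue of \<psi>_i^+ differs by a factor q_i or its inverse if i = j and is
      the same otherwise.\<close>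
    have key: "app (dia (sp Pos i)) (app (X \<epsilon> j k) u) = scl (?e * ss i \<beta>) (app (X \<epsilon> j k) u)" if u: "u \<in> W \<beta>" for u \<beta>
    proof (cases "app (X \<epsilon> j k) u = 0")
      case False
      then obtain \<gamma> where g: "app (X \<epsilon> j k) u \<in> W \<gamma>" "\<And>l. int (\<gamma> l) = int (\<beta> l) - (if l = j then sgi \<epsilon> else 0)"
        using X_shift[OF u] by metis
      have "ss i \<gamma> = ?e * ss i \<beta>"
        unfolding ss_def g(2) using qi_nz[of i] by (simp add: power_int_diff power_int_minus field_simps)
      then show ?thesis by (simp add: dia_W[OF g(1)])
    qed simp
    show ?thesis
    proof (rule endo_eq_on_W)
      fix \<beta> u assume u: "u \<in> W \<beta>"
      have "E r = E (fgen (GPsi Pos i)) * E (fgen (GBase (GX \<epsilon> j k))) - sc ?e * (E (fgen (GBase (GX \<epsilon> j k))) * E (fgen (GPsi Pos i)))"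
        unfolding r by (simp only: E_simps(1,2,7) mult.assoc)
      also have "\<dots> = dia (sp Pos i) * (sc ?l * X \<epsilon> j k) - sc ?e * (sc ?l * X \<epsilon> j k * dia (sp Pos i))"
        by (simp only: E_X) (simp only: E_simps(6) adg.simps)
      finally show "app (E r) u = app 0 u"
        using key[OF u] dia_W[OF u, of "sp Pos i"] by (simp add: app_scl dia_lin mult_ac)
    qed
  qed
qed

definition rad :: "'i adgen falg set \<Rightarrow> 'v \<Rightarrow> 'v" where "rad = quot_map H"

lemma rad: "alg_hom Uad (end_alg scl) rad" "rad (adproj y) = H y"
proof -
  have 0: "H r = \<zero>\<^bsub>end_alg scl\<^esub>" if "r \<in> ad_rels c d q m" for r
  proof -
    have "H r = app (E r)" by (simp add: Fr.app_R)
    then show ?thesis using E_ad_rels[OF that] by (simp add: end_alg_def fun_eq_iff)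
  qed
  note q = Uad_lift[OF M.end_calgebra H_hom 0]
  show "alg_hom Uad (end_alg scl) rad" unfolding rad_def by (rule q(2))
  show "rad (adproj y) = H y" unfolding rad_def by (rule q(1))
qed

sublocale Ad: alg_rep Uad scl rad
proof -
  show "alg_rep Uad scl rad"
    by (intro alg_rep.intro alg_rep_axioms.intro Uad_calgebra M.complex_vs_axioms)
      (use rad(1) M.rho_module in \<open>simp add: alg_module_def alg_hom_def\<close>)
qed

lemma Ad_adproj: "Ad.R (adproj y) = E y"
  by (simp add: Ad.R_def Fr.R_def rad(2))

lemma Ad_to_ad: "u \<in> carrier U \<Longrightarrow> Ad.R (to_ad c d q m u) = R (L0_auto c d q m Lw u)"
  unfolding uproj_surj by (auto simp: to_ad_proj Ad_adproj E_mapB)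

lemma L0_vanish: "r \<in> trunc_rels c d q m a \<Longrightarrow> R (L0_auto c d q m Lw r) = 0"
  by (rule trunc_rels_vanish[OF L0(1) L0(4), where L = Lw]) (simp_all add: L0(3) M.R_smult Phi_def)

lemma SS_vanish:
  assumes "r \<in> ad_trunc_rels c d q m a z" shows "Ad.R r = 0"
proof -
  have uad: "Ad.R (uad g) = adg g" for g by (simp add: Uad_gen_def Ad_adproj E_simps)
  have pull: "Ad.R (to_ad c d q m u) = 0" if "u \<in> trunc_rels c d q m a" for u
    using that trunc_rels_closed by (subst Ad_to_ad) (auto simp: L0_vanish)
  consider i k where "k > t i" "r = to_ad c d q m (scA Pos i k)"
    | i k where "r = to_ad c d q m (scrA_int c d q m a Neg i k) \<ominus>\<^bsub>Uad\<^esub>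
        to_ad c d q m (scrA_int c d q m a Neg i (- int (t i))) \<otimes>\<^bsub>Uad\<^esub> to_ad c d q m (scrA_int c d q m a Pos i (k + int (t i)))"
    | i where "r = uad (GPsi Pos i) \<otimes>\<^bsub>Uad\<^esub> uad (GPsi Neg i) \<ominus>\<^bsub>Uad\<^esub> ((- qi d q i) powi (- int (t i)) * z i) \<odot>\<^bsub>Uad\<^esub> \<one>\<^bsub>Uad\<^esub>"
    | i where "r = to_ad c d q m (scA Pos i (t i)) \<ominus>\<^bsub>Uad\<^esub> (- 1) ^ t i \<odot>\<^bsub>Uad\<^esub> (uad (GPsi Pos i) [^]\<^bsub>Uad\<^esub> (2::nat))"
    using assms unfolding ad_trunc_rels_def Let_def trunc_t_eq by blast
  then show ?thesis
  proof cases
    case (1 i k)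
    have "scA Pos i k \<in> trunc_rels c d q m a" unfolding trunc_rels_def Let_def trunc_t_eq using 1(1) by blast
    then show ?thesis unfolding 1(2) by (rule pull)
  next
    case (2 i k)
    let ?x = "scrA_int c d q m a"
    have "?x Neg i k \<ominus>\<^bsub>U\<^esub> ?x Neg i (- int (t i)) \<otimes>\<^bsub>U\<^esub> ?x Pos i (k + int (t i)) \<in> trunc_rels c d q m a"
      unfolding trunc_rels_def Let_def trunc_t_eq by blast
    from pull[OF this] show ?thesis unfolding 2 by (simp add: AT.scrA_int_closed)
  next
    case (3 i)
    have "(- qi d q i) powi (- int (t i)) * z i = ww i"
      by (simp add: AT.ww_def AT.uu_def trunc_t_eq power_int_minus field_simps)
    moreover have "dia (sp Pos i) * dia (sp Neg i) = sc (ww i)"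
      unfolding dia_dia using sp(2)[of Pos i] by (simp add: dia_const del: sp.simps)
    ultimately show ?thesis unfolding 3 by (simp add: Ad.R_minus Ad.R_mult Ad.R_smult uad)
  next
    case (4 i)
    have "SA Pos i $ t i = sc ((- 1) ^ t i) * dia (sp Pos i) ^ 2"
    proof (rule endo_eq_on_W)
      fix \<beta> u assume u: "u \<in> W \<beta>"
      have "(- 1) ^ t i * (ss i \<beta> * ss i \<beta>) = ls \<beta> i"
        unfolding ss_square by (simp add: mult.assoc[symmetric] power_mult_distrib[symmetric])
      then show "app (SA Pos i $ t i) u = app (sc ((- 1) ^ t i) * dia (sp Pos i) ^ 2) u"
        using St_W[OF u, of i] dia_W[OF u, of "sp Pos i"] by (simp add: app_scl dia_lin power2_eq_square)
    qed
    moreover have "Ad.R (to_ad c d q m (scA Pos i (t i))) = SA Pos i $ t i"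
      by (simp add: Ad_to_ad scrA_hom_invariant[OF L0(1) L0(4)] SA_def)
    ultimately show ?thesis unfolding 4 by (simp add: Ad.R_minus Ad.R_smult Ad.R_pow uad)
  qed
qed

theorem extends_to_adjoint_truncation:
  "\<exists>L. (\<forall>i. L i \<noteq> 0) \<and>
     (\<exists>\<rho>'. alg_module (trunc_alg c d q m a) scl \<rho>' \<and>
        is_pullback U (to_trunc c d q m a) \<rho>' (L0_tensor c d q m L \<rho>) \<and>
        (\<exists>\<rho>''. alg_module (ad_trunc_alg c d q m a z) scl \<rho>'' \<and>
           is_pullback (trunc_alg c d q m a) (trunc_to_ad_trunc c d q m a z) \<rho>'' \<rho>'))"
proof -
  let ?f = "L0_auto c d q m Lw"
  define \<rho>1 where "\<rho>1 = quot_map (\<lambda>u. \<rho> (?f u))"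
  have "R (?f (ph Pos i 0)) = sc (Lw i) * P0 i" "R (?f (ph Neg i (m i))) = sc (Lw i) * N0 i" for i
    by (simp_all add: L0(3) M.R_smult Phi_def)
  note t = trunc_module[OF L0(1) L0(4) this, folded \<rho>1_def]
  have 0: "rad r = \<zero>\<^bsub>end_alg scl\<^esub>" if "r \<in> ad_trunc_rels c d q m a z" for r
  proof -
    have "rad r = app (Ad.R r)" using AT.SS_closed that by (subst Ad.app_R) auto
    then show ?thesis using SS_vanish[OF that] by (simp add: end_alg_def fun_eq_iff)
  qed
  note q = Ua.quot_map_hom[OF AT.SS_closed M.end_calgebra rad(1) 0]
  have "alg_module (ad_trunc_alg c d q m a z) scl (quot_map rad)"
    using q(2) M.rho_module by (simp add: alg_module_def alg_hom_def ad_trunc_alg_def)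
  moreover have "is_pullback (trunc_alg c d q m a) (trunc_to_ad_trunc c d q m a z) (quot_map rad) \<rho>1"
    unfolding is_pullback_def
  proof
    fix x assume "x \<in> carrier (trunc_alg c d q m a)"
    then obtain u where u: "u \<in> carrier U" "x = to_trunc c d q m a u"
      unfolding trunc_alg_def U.quot_proj_surj[OF trunc_rels_closed] to_trunc_def by blast
    have ta: "to_ad c d q m u \<in> carrier Uad" by (rule alg_homD(1)[OF to_ad_hom u(1)])
    have "quot_map rad (trunc_to_ad_trunc c d q m a z x) = rad (to_ad c d q m u)"
      unfolding u(2) AT.trunc_to_ad_trunc(2)[OF u(1)] AT.tau_def AT.pp_def by (rule q(1)[OF _ ta])
    also have "\<dots> = app (Ad.R (to_ad c d q m u))" using ta by (simp add: Ad.app_R)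
    also have "\<dots> = \<rho> (?f u)" using u(1) by (simp add: Ad_to_ad M.app_R)
    also have "\<dots> = \<rho>1 x" using t(2) u by (simp add: is_pullback_def)
    finally show "\<rho>1 x = quot_map rad (trunc_to_ad_trunc c d q m a z x)" ..
  qed
  ultimately show ?thesis using Lw_nz t by (auto simp: L0_tensor_def[abs_def] \<rho>1_def)
qed

end

section \<open>Finite length\<close>

lemma (in vector_space) dim_subspaces:
  assumes XY: "X \<subseteq> Y" "Y \<subseteq> span B" "finite B" and sub: "subspace X" "subspace Y"
  shows "dim X \<le> dim Y" "X \<noteq> Y \<Longrightarrow> dim X < dim Y"
proof -
  obtain bX where bX: "bX \<subseteq> X" "independent bX" "X \<subseteq> span bX" by (rule maximal_independent_subset)
  obtain bY where bY: "bX \<subseteq> bY" "bY \<subseteq> Y" "independent bY" "Y \<subseteq> span bY"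
    by (rule maximal_independent_subset_extend[of bX Y]) (use bX XY in auto)
  have "bY \<subseteq> span B" using bY(2) XY(2) by (rule subset_trans)
  then have fin: "finite bY" using independent_span_bound[OF XY(3) bY(3)] by simp
  have d: "dim X = card bX" "dim Y = card bY"
    using basis_card_eq_dim[OF bX(1,3,2)] basis_card_eq_dim[OF bY(2,4,3)] by simp_all
  show "dim X \<le> dim Y" unfolding d by (rule card_mono[OF fin bY(1)])
  assume ne: "X \<noteq> Y"
  have "bX \<noteq> bY"
  proof
    assume "bX = bY"
    then have "Y \<subseteq> span X" using bY(4) span_mono[OF bX(1)] by auto
    then have "Y \<subseteq> X" using span_minimal[OF subset_refl sub(1)] by simp
    then show False using XY(1) ne by auto
  qed
  then show "dim X < dim Y" unfolding d using psubset_card_mono[OF fin] bY(1) by auto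
qed

section \<open>Eigenvectors modulo an invariant subspace\<close>

context complex_vs
begin

definition pev :: "'v endo \<Rightarrow> complex poly \<Rightarrow> 'v endo" where
  "pev T p = fold_coeffs (\<lambda>a y. sc a + T * y) p 0"

lemma pev_0 [simp]: "pev T 0 = 0"
  by (simp add: pev_def)

lemma pev_pCons [simp]: "pev T (pCons a p) = sc a + T * pev T p"
  by (cases "p = 0 \<and> a = 0") (auto simp: pev_def)

lemma pev_add: "pev T (p + p') = pev T p + pev T p'"
proof (induction p p' rule: poly_induct2)
  case (pCons a p b p')
  then show ?case by (simp add: S.sc_add distrib_left)
qed simp

lemma pev_smult: assumes "T \<in> S.lin" shows "pev T (Polynomial.smult b p) = sc b * pev T p"
proof (induction p)
  case (pCons a p)
  then show ?case using S.lin_sc2[OF assms] by (simp add: S.sc_mult distrib_left)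
qed simp

lemma pev_linear_factor:
  assumes "T \<in> S.lin" shows "pev T ([:- l, 1:] * p) = (T - sc l) * pev T p"
proof -
  have "[:- l, 1:] * p = Polynomial.smult (- l) p + pCons 0 p" by simp
  then show ?thesis
    by (simp only: pev_add pev_smult[OF assms] pev_pCons) (simp add: S.sc_uminus left_diff_distrib)
qed

lemma pev_monom: assumes "T \<in> S.lin" shows "pev T (monom b n) = sc b * T ^ n"
proof (induction n)
  case (Suc n)
  then show ?case using S.lin_sc2[OF assms] by (simp add: monom_Suc)
qed (simp add: monom_0)

lemma pev_sum: "pev T (sum F I) = (\<Sum>x\<in>I. pev T (F x))"
  by (induction I rule: infinite_finite_induct) (simp_all add: pev_add)

lemma pev_invariant:
  assumes "V.subspace Z" "\<And>v. v \<in> Z \<Longrightarrow> app T v \<in> Z" "z \<in> Z" shows "app (pev T p) z \<in> Z"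
proof (induction p)
  case 0
  then show ?case using V.subspace_0[OF assms(1)] by simp
next
  case (pCons a p)
  then show ?case
    using V.subspace_add[OF assms(1) V.subspace_scale[OF assms(1,3)] assms(2)] by simp
qed

text \<open>Among the vectors T^n z with n up to card B either two coincide, or there are more than
  card B distinct ones in the span of B. Either way a nontrivial linear relation results.\<close>

lemma annihilating_poly:
  assumes T: "T \<in> S.lin" and Z: "\<And>n. app (T ^ n) z \<in> V.span B" and B: "finite B"
  obtains p where "p \<noteq> 0" "app (pev T p) z = 0"
proof (cases "inj_on (\<lambda>n. app (T ^ n) z) {..card B}")
  case False
  then obtain i j where ij: "i \<noteq> j" "app (T ^ i) z = app (T ^ j) z" unfolding inj_on_def by blast
  let ?p = "monom 1 i - monom 1 j :: complex poly"
  have "coeff ?p i \<noteq> 0" using ij(1) by simp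
  then have "?p \<noteq> 0" by (metis coeff_0)
  moreover have "?p = monom 1 i + monom (-1) j" by (simp add: minus_monom)
  then have "app (pev T ?p) z = 0" using ij(2) by (simp only: pev_add pev_monom[OF T]) (simp add: app_minus_right)
  ultimately show ?thesis by (rule that)
next
  case True
  let ?v = "\<lambda>n. app (T ^ n) z"
  let ?S = "?v ` {..card B}"
  have "card ?S = Suc (card B)" using card_image[OF True] by simp
  moreover have "?S \<subseteq> V.span B" using Z by auto
  ultimately have "V.dependent ?S" using V.independent_span_bound[OF B, of ?S] by auto
  then obtain u v where u: "v \<in> ?S" "u v \<noteq> 0" "(\<Sum>v\<in>?S. scl (u v) v) = 0"
    using V.dependent_finite[of ?S] by auto
  obtain n where n: "n \<le> card B" "v = ?v n" using u(1) by auto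
  let ?p = "\<Sum>k\<le>card B. monom (u (?v k)) k"
  have "coeff ?p n = (\<Sum>k\<le>card B. if k = n then u (?v k) else 0)"
    unfolding coeff_sum by (intro sum.cong) auto
  then have "coeff ?p n = u v" using n by simp
  then have "?p \<noteq> 0" using u(2) by (metis coeff_0)
  moreover have "app (pev T ?p) z = (\<Sum>k\<le>card B. scl (u (?v k)) (?v k))"
    by (simp add: pev_sum pev_monom[OF T] app_sum)
  then have "app (pev T ?p) z = 0" using u(3) unfolding sum.reindex[OF True] by simp
  ultimately show ?thesis by (rule that)
qed

text \<open>Induction on the degree of a nonzero p with p(T) z0 in X. Split off a root l, so that p
  = (z - l) r: either r(T) z0 lies in X and r has smaller degree, or r(T) z0 is an eigenvector
  modulo X.\<close>

lemma eigenvector_modulo: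
  assumes T: "T \<in> S.lin" and X: "V.subspace X" "\<And>v. v \<in> X \<Longrightarrow> app T v \<in> X"
    and Z: "V.subspace Z" "\<And>v. v \<in> Z \<Longrightarrow> app T v \<in> Z" "Z \<subseteq> V.span B" "finite B"
    and z0: "z0 \<in> Z" "z0 \<notin> X"
  obtains z l where "z \<in> Z" "z \<notin> X" "app T z - scl l z \<in> X"
proof -
  have "app (T ^ n) z0 \<in> Z" for n by (induction n) (simp_all add: z0 Z(2))
  then have "app (T ^ n) z0 \<in> V.span B" for n using Z(3) by auto
  then obtain p where p: "p \<noteq> 0" "app (pev T p) z0 = 0"
    by (rule annihilating_poly[OF T _ Z(4)])
  have "\<exists>z l. z \<in> Z \<and> z \<notin> X \<and> app T z - scl l z \<in> X" if "p \<noteq> 0" "app (pev T p) z0 \<in> X" for p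
    using that
  proof (induction "degree p" arbitrary: p rule: less_induct)
    case less
    show ?case
    proof (cases "degree p = 0")
      case True
      then obtain b where b: "p = [:b:]" by (rule degree_eq_zeroE)
      then have "scl b z0 \<in> X" "b \<noteq> 0" using less.prems by simp_all
      then have "scl (inverse b) (scl b z0) \<in> X" using V.subspace_scale[OF X(1)] by blast
      then show ?thesis using z0(2) \<open>b \<noteq> 0\<close> by simp
    next
      case False
      then have "\<not> constant (poly p)" by (simp add: constant_degree)
      then obtain l where "poly p l = 0" using fundamental_theorem_of_algebra by blast
      then obtain r where r: "p = [:- l, 1:] * r" unfolding poly_eq_0_iff_dvd dvd_def by blast
      then have r0: "r \<noteq> 0" using less.prems(1) by auto
      have deg: "degree r < degree p" unfolding r using r0 by (subst degree_mult_eq) auto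
      have "app (pev T p) z0 = app T (app (pev T r) z0) - scl l (app (pev T r) z0)"
        unfolding r pev_linear_factor[OF T] by simp
      moreover have "app (pev T r) z0 \<in> Z" by (rule pev_invariant[OF Z(1,2) z0(1)])
      ultimately show ?thesis using less.prems(2) less.hyps[OF deg r0] by auto
    qed
  qed
  from this[OF p(1)] p(2) V.subspace_0[OF X(1)] show ?thesis using that by auto
qed

end

text \<open>With constant term 1 a polynomial is a product of factors 1 - z / y over its roots y,
  and there are finitely many such products of bounded degree.\<close>

lemma finite_polys_with_roots:
  fixes S :: "complex set"
  assumes "finite S"
  shows "finite {p :: complex poly. degree p \<le> n \<and> coeff p 0 = 1 \<and> (\<forall>y. poly p y = 0 \<longrightarrow> y \<in> S)}"
    (is "finite (?P n)")
proof (induction n)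
  case 0
  have "?P 0 \<subseteq> {1}"
  proof
    fix p assume p: "p \<in> ?P 0"
    then obtain b where "p = [:b:]" using degree_eq_zeroE[of p] by auto
    then show "p \<in> {1}" using p by simp
  qed
  then show ?case by (rule finite_subset) simp
next
  case (Suc n)
  have "?P (Suc n) \<subseteq> ?P n \<union> (\<Union>y\<in>S. (\<lambda>r. [:1, - inverse y:] * r) ` ?P n)"
  proof
    fix p assume p: "p \<in> ?P (Suc n)"
    show "p \<in> ?P n \<union> (\<Union>y\<in>S. (\<lambda>r. [:1, - inverse y:] * r) ` ?P n)"
    proof (cases "degree p \<le> n")
      case False
      then have "\<not> constant (poly p)" by (simp add: constant_degree)
      then obtain y where y: "poly p y = 0" using fundamental_theorem_of_algebra by blast
      have "coeff p 0 = 1" using p by simp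
      then have "poly p 0 \<noteq> 0" by (simp add: poly_0_coeff_0)
      then have y0: "y \<noteq> 0" using y by auto
      obtain r where r: "p = [:- y, 1:] * r" using y unfolding poly_eq_0_iff_dvd dvd_def by blast
      define r' where "r' = Polynomial.smult (- y) r"
      have f: "[:- y, 1:] = Polynomial.smult (- y) [:1, - inverse y:]" using y0 by simp
      have pr: "p = [:1, - inverse y:] * r'" unfolding r r'_def f by (simp only: mult_smult_left mult_smult_right)
      have "r' \<noteq> 0" using p pr by auto
      moreover have "degree [:1, - inverse y:] = 1" using y0 by simp
      ultimately have "degree p = 1 + degree r'" unfolding pr by (subst degree_mult_eq) auto
      then have "degree r' \<le> n" using p by simp
      moreover have "coeff r' 0 = 1" using p unfolding pr by (simp add: coeff_mult)
      moreover have "\<forall>y. poly r' y = 0 \<longrightarrow> y \<in> S" using p unfolding pr by auto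
      ultimately show ?thesis using p y pr by blast
    qed (use p in auto)
  qed
  then show ?case by (rule finite_subset) (use Suc assms in auto)
qed

locale tpoly_fin = tpoly c d q m scl \<rho> a \<Lambda> f
  for c :: "'i::{finite,linorder} \<Rightarrow> 'i \<Rightarrow> int" and d q m
    and scl :: "complex \<Rightarrow> 'v::ab_group_add \<Rightarrow> 'v" and \<rho> a \<Lambda> f +
  assumes W_finite: "\<exists>B. finite B \<and> W \<beta> \<subseteq> M.V.span B"
begin

abbreviation "submod \<equiv> submodule U scl \<rho>"

lemma submodD: assumes "submod Y" shows "M.V.subspace Y" "u \<in> carrier U \<Longrightarrow> v \<in> Y \<Longrightarrow> app (R u) v \<in> Y"
  using assms by (auto simp: submodule_def M.app_R)

lemma submod_X: "submod Y \<Longrightarrow> v \<in> Y \<Longrightarrow> app (X \<delta> j l) v \<in> Y"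
  unfolding X_def by (rule submodD(2)) auto

lemma submod_Phi: "submod Y \<Longrightarrow> v \<in> Y \<Longrightarrow> app (Phi \<delta> j l) v \<in> Y"
  unfolding Phi_def by (rule submodD(2)) auto

lemma submod_differ:
  assumes Y1: "submod Y1" and Y2: "submod Y2" and Y12: "Y1 \<subset> Y2"
  shows "\<exists>\<beta>. \<exists>u\<in>W \<beta>. u \<in> Y2 \<and> u \<notin> Y1"
proof -
  obtain y where y: "y \<in> Y2" "y \<notin> Y1" using Y12 by blast
  obtain B g where B: "finite B" "\<And>\<beta>. \<beta> \<in> B \<Longrightarrow> g \<beta> \<in> W \<beta>" "y = (\<Sum>\<beta>\<in>B. g \<beta>)"
    by (rule W_decompose) blast
  have gY: "g \<beta> \<in> Y2" if "\<beta> \<in> B" for \<beta>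
    by (rule graded_subspace[OF submodD(1)[OF Y2] submod_Phi[OF Y2] B(1,2) _ that]) (use y(1) B(3) in auto)
  have "\<exists>\<beta>\<in>B. g \<beta> \<notin> Y1" using y(2) B(3) M.V.subspace_sum[OF submodD(1)[OF Y1], of B g] by auto
  then show ?thesis using B(2) gY by blast
qed

text \<open>
  For \<open>\<beta>\<close> of minimal height the quotient of the weight spaces is annihilated by the \<open>x\<^sub>j\<^sup>+\<close>, and \<open>y\<close>
  represents a joint eigenvector in it.
\<close>

lemma highest_eigenvector:
  assumes Y1: "submod Y1" and Y2: "submod Y2" and Y12: "Y1 \<subset> Y2"
  obtains \<beta> y where "y \<in> W \<beta>" "y \<in> Y2" "y \<notin> Y1"
    "\<And>u j l. u \<in> W \<beta> \<Longrightarrow> u \<in> Y2 \<Longrightarrow> app (X Pos j l) u \<in> Y1"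
    "\<And>x. x \<in> K \<Longrightarrow> (\<And>v. v \<in> Y1 \<Longrightarrow> app x v \<in> Y1) \<Longrightarrow> (\<And>v. v \<in> Y2 \<Longrightarrow> app x v \<in> Y2) \<Longrightarrow>
        \<exists>l. app x y - scl l y \<in> Y1"
proof -
  define ht where "ht \<beta> = (\<Sum>i\<in>UNIV. \<beta> i)" for \<beta> :: "'i \<Rightarrow> nat"
  define D where "D \<beta> \<longleftrightarrow> (\<exists>u\<in>W \<beta>. u \<in> Y2 \<and> u \<notin> Y1)" for \<beta>
  have "\<exists>\<beta>. D \<beta>" using submod_differ[OF assms] by (simp add: D_def)
  then obtain \<beta> where \<beta>: "D \<beta>" "\<And>\<gamma>. D \<gamma> \<Longrightarrow> ht \<beta> \<le> ht \<gamma>"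
    using ex_has_least_nat[of D _ ht] by blast
  have sub: "M.V.subspace Y1" "M.V.subspace Y2" by (rule submodD(1)[OF Y1], rule submodD(1)[OF Y2])
  have hw: "app (X Pos j l) u \<in> Y1" if u: "u \<in> W \<beta>" "u \<in> Y2" for u j l
  proof (cases "app (X Pos j l) u = 0")
    case True
    then show ?thesis using M.V.subspace_0[OF sub(1)] by simp
  next
    case False
    then obtain \<gamma> where \<gamma>: "app (X Pos j l) u \<in> W \<gamma>" "\<And>k. int (\<gamma> k) = int (\<beta> k) - (if k = j then sgi Pos else 0)"
      using X_shift[OF u(1)] by metis
    have "int (ht \<gamma>) = int (ht \<beta>) - 1"
      unfolding ht_def of_nat_sum \<gamma>(2) by (simp add: sum_subtractf)
    then have "\<not> D \<gamma>" using \<beta>(2)[of \<gamma>] by auto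
    then show ?thesis using \<gamma>(1) submod_X[OF Y2 u(2)] unfolding D_def by blast
  qed
  define A where "A = {x \<in> K. (\<forall>v\<in>Y1. app x v \<in> Y1) \<and> (\<forall>v\<in>Y2. app x v \<in> Y2)}"
  \<comment> \<open>Z of least dimension is taken among these subspaces. For x in A the vectors of Z
    satisfying a suitable eigenvalue equation modulo Y1 form another such subspace, as A is
    commutative, so they fill Z and every vector of Z is an eigenvector modulo Y1.\<close>
  define Cand where "Cand Z \<longleftrightarrow> M.V.subspace Z \<and> Z \<subseteq> W \<beta> \<inter> Y2 \<and> Y1 \<inter> W \<beta> \<subseteq> Z \<and> (\<exists>z\<in>Z. z \<notin> Y1) \<and>
      (\<forall>x\<in>A. \<forall>v\<in>Z. app x v \<in> Z)" for Z
  have "Cand (W \<beta> \<inter> Y2)"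
    unfolding Cand_def using M.V.subspace_inter[OF W_subspace sub(2)] Y12 \<beta>(1) W_K
    by (auto simp: D_def A_def)
  then obtain Z where Z: "Cand Z" "\<And>Z'. Cand Z' \<Longrightarrow> M.V.dim Z \<le> M.V.dim Z'"
    using ex_has_least_nat[of Cand _ M.V.dim] by blast
  obtain y where y: "y \<in> Z" "y \<notin> Y1" using Z(1) by (auto simp: Cand_def)
  obtain B where B: "finite B" "W \<beta> \<subseteq> M.V.span B" using W_finite by blast
  have ZB: "Z \<subseteq> M.V.span B" using Z(1) B(2) by (auto simp: Cand_def)
  have Zs: "M.V.subspace Z" and ZA: "\<And>x v. x \<in> A \<Longrightarrow> v \<in> Z \<Longrightarrow> app x v \<in> Z" using Z(1) by (auto simp: Cand_def)
  have eig: "\<exists>l. app x y - scl l y \<in> Y1" if x: "x \<in> A" for x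
  proof -
    have xK: "x \<in> K" and x1: "\<And>v. v \<in> Y1 \<Longrightarrow> app x v \<in> Y1" using x by (auto simp: A_def)
    have xl: "x \<in> M.S.lin" by (rule C.K_lin[OF xK])
    obtain z l where z: "z \<in> Z" "z \<notin> Y1" "app x z - scl l z \<in> Y1"
      by (rule M.eigenvector_modulo[OF xl sub(1) x1 Zs ZA[OF x] ZB B(1) y])
    define Z' where "Z' = {v \<in> Z. app x v - scl l v \<in> Y1}"
    have lin: "app x (v + w) - scl l (v + w) = (app x v - scl l v) + (app x w - scl l w)"
      "app x (scl b v) - scl l (scl b v) = scl b (app x v - scl l v)" for v w b
      by (simp_all add: app_add_right M.V.scale_right_distrib app_scl[OF xl] M.V.scale_right_diff_distrib mult.commute)
    have "M.V.subspace Z'"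
      unfolding M.V.subspace_def
    proof (intro conjI ballI allI)
      show "0 \<in> Z'" using M.V.subspace_0[OF Zs] M.V.subspace_0[OF sub(1)] by (simp add: Z'_def)
      show "v + w \<in> Z'" if "v \<in> Z'" "w \<in> Z'" for v w
        using that M.V.subspace_add[OF Zs, of v w] M.V.subspace_add[OF sub(1), of "app x v - scl l v" "app x w - scl l w"]
        unfolding Z'_def mem_Collect_eq lin by blast
      show "scl b v \<in> Z'" if "v \<in> Z'" for b v
        using that M.V.subspace_scale[OF Zs, of v b] M.V.subspace_scale[OF sub(1), of "app x v - scl l v" b]
        unfolding Z'_def mem_Collect_eq lin by blast
    qed
    moreover have "app x' v \<in> Z'" if x': "x' \<in> A" and v: "v \<in> Z'" for x' v
    proof -
      have x'K: "x' \<in> K" and x'1: "\<And>v. v \<in> Y1 \<Longrightarrow> app x' v \<in> Y1" using x' by (auto simp: A_def)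
      have "app (x * x') v = app (x' * x) v" by (simp only: C.K_comm[OF xK x'K])
      then have "app x (app x' v) - scl l (app x' v) = app x' (app x v - scl l v)"
        by (simp add: app_minus_right app_scl[OF C.K_lin[OF x'K]])
      also have "\<dots> \<in> Y1" by (rule x'1) (use v in \<open>simp add: Z'_def\<close>)
      finally show ?thesis using ZA[OF x'] v by (simp add: Z'_def)
    qed
    moreover have "Y1 \<inter> W \<beta> \<subseteq> Z'"
      using Z(1) x1 M.V.subspace_diff[OF sub(1)] M.V.subspace_scale[OF sub(1)] unfolding Z'_def Cand_def by blast
    ultimately have "Cand Z'" using Z(1) z unfolding Cand_def Z'_def by blast
    then have "M.V.dim Z \<le> M.V.dim Z'" by (rule Z(2))
    moreover have "Z' \<subseteq> Z" by (auto simp: Z'_def)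
    ultimately have "Z' = Z"
      using M.V.dim_subspaces(2)[of Z' Z B] ZB B(1) Zs \<open>M.V.subspace Z'\<close> by (meson not_le)
    then show ?thesis using y(1) unfolding Z'_def by blast
  qed
  show ?thesis
  proof (rule that[of y \<beta>])
    show "y \<in> W \<beta>" "y \<in> Y2" using y(1) Z(1) by (auto simp: Cand_def)
    show "\<exists>l. app x y - scl l y \<in> Y1"
      if "x \<in> K" "\<And>v. v \<in> Y1 \<Longrightarrow> app x v \<in> Y1" "\<And>v. v \<in> Y2 \<Longrightarrow> app x v \<in> Y2" for x
      by (rule eig) (use that in \<open>simp add: A_def\<close>)
  qed (rule y(2), rule hw)
qed

text \<open>Since x_i^+ maps the weight space of y in Y2 into Y1, one of the two terms of the
  commutator drops out, and already the single factor A_i annihilates \<phi>_i^+ - \<phi>_i^- on y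
  modulo Y1. Hence the eigenvalue G of A_i times the normalized \<phi>_i^+ is a polynomial, and the
  product formula makes G(z) P_i(q_i^2 z) a multiple of a_i.\<close>

lemma eigenvalue_polynomials:
  assumes Y1: "submod Y1" and Y2: "submod Y2" and Y12: "Y1 \<subset> Y2"
  obtains \<beta> P where "\<exists>u\<in>W \<beta>. u \<in> Y2 \<and> u \<notin> Y1" "\<And>i. degree (P i) \<le> t i" "\<And>i. coeff (P i) 0 = 1"
    "\<And>i. coeff (P i) (t i) = ls \<beta> i"
    "\<And>i x. poly (P i) x = 0 \<Longrightarrow> poly (a i) (x * bb i) = 0 \<or>
        (\<exists>jp\<in>set (factors i). poly (P (fst jp)) (x * bb i * fac_exp Pos i jp) = 0)"
proof -
  obtain \<beta> y where y: "y \<in> W \<beta>" "y \<in> Y2" "y \<notin> Y1"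
    and hw: "\<And>u j l. u \<in> W \<beta> \<Longrightarrow> u \<in> Y2 \<Longrightarrow> app (X Pos j l) u \<in> Y1"
    and ev: "\<And>x. x \<in> K \<Longrightarrow> (\<And>v. v \<in> Y1 \<Longrightarrow> app x v \<in> Y1) \<Longrightarrow> (\<And>v. v \<in> Y2 \<Longrightarrow> app x v \<in> Y2) \<Longrightarrow>
        \<exists>l. app x y - scl l y \<in> Y1"
    by (rule highest_eigenvector[OF assms]) blast
  have sub: "M.V.subspace Y1" "M.V.subspace Y2" by (rule submodD(1)[OF Y1], rule submodD(1)[OF Y2])
  define A where "A = {x \<in> K. (\<forall>v\<in>Y1. app x v \<in> Y1) \<and> (\<forall>v\<in>Y2. app x v \<in> Y2)}"
  have A_add: "x + x' \<in> A" and A_mult: "x * x' \<in> A" if "x \<in> A" "x' \<in> A" for x x'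
    using that M.V.subspace_add[OF sub(1)] M.V.subspace_add[OF sub(2)] by (auto simp: A_def)
  have A_sc: "sc b \<in> A" for b
    using M.V.subspace_scale[OF sub(1)] M.V.subspace_scale[OF sub(2)] by (auto simp: A_def)
  have A_0: "0 \<in> A" "1 \<in> A" using A_sc[of 0] A_sc[of 1] by simp_all
  have A_sum: "(\<And>x. x \<in> I \<Longrightarrow> F x \<in> A) \<Longrightarrow> sum F I \<in> A" for F and I :: "nat set"
    by (induction I rule: infinite_finite_induct) (auto intro: A_add A_0)
  have A_R: "R u \<in> A" if "u \<in> carrier U" "R u \<in> K" for u
    using that submodD(2)[OF Y1] submodD(2)[OF Y2] by (auto simp: A_def)
  have A_Phi: "Phi \<epsilon> i k \<in> A" for \<epsilon> i k
    using A_R[of "ph \<epsilon> i k"] Phi_K by (simp add: Phi_def)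
  have A_SA: "SA \<epsilon> i $ k \<in> A" for \<epsilon> i k
    using A_R[of "scA \<epsilon> i k"] C.fK_D[OF SA_K, of \<epsilon> i k] by (simp add: SA_def)
  have A_phib: "phib \<epsilon> i $ k \<in> A" for \<epsilon> i k
    using A_R[of "phi_bar c d q m \<epsilon> i k"] C.fK_D[OF phib_K, of \<epsilon> i k] by (simp add: phib_def)
  \<comment> \<open>The character of the commutative algebra A through which it acts on y modulo
    Y1.\<close>
  define chi where "chi x = (SOME l. app x y - scl l y \<in> Y1)" for x
  have chi: "app x y - scl (chi x) y \<in> Y1" if "x \<in> A" for x
    unfolding chi_def by (rule someI_ex, rule ev) (use that in \<open>auto simp: A_def\<close>)
  have chi_eq: "chi x = l" if x: "x \<in> A" "app x y - scl l y \<in> Y1" for x l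
  proof (rule ccontr)
    assume ne: "chi x \<noteq> l"
    have "scl (chi x - l) y = (app x y - scl l y) - (app x y - scl (chi x) y)"
      by (simp add: M.V.scale_left_diff_distrib)
    also have "\<dots> \<in> Y1" by (rule M.V.subspace_diff[OF sub(1) x(2) chi[OF x(1)]])
    finally have "scl (inverse (chi x - l)) (scl (chi x - l) y) \<in> Y1" by (rule M.V.subspace_scale[OF sub(1)])
    then show False using ne y(3) by simp
  qed
  have chi_add: "chi (x + x') = chi x + chi x'" if "x \<in> A" "x' \<in> A" for x x'
  proof (rule chi_eq[OF A_add[OF that]])
    have "app (x + x') y - scl (chi x + chi x') y = (app x y - scl (chi x) y) + (app x' y - scl (chi x') y)"
      by (simp add: M.V.scale_left_distrib)
    also have "\<dots> \<in> Y1" by (rule M.V.subspace_add[OF sub(1) chi[OF that(1)] chi[OF that(2)]])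
    finally show "app (x + x') y - scl (chi x + chi x') y \<in> Y1" .
  qed
  have chi_mult: "chi (x * x') = chi x * chi x'" if "x \<in> A" "x' \<in> A" for x x'
  proof (rule chi_eq[OF A_mult[OF that]])
    have xl: "x \<in> M.S.lin" using that(1) by (simp add: A_def C.K_lin)
    have "app (x * x') y - scl (chi x * chi x') y =
        app x (app x' y - scl (chi x') y) + scl (chi x') (app x y - scl (chi x) y)"
      by (simp add: app_minus_right app_scl[OF xl] M.V.scale_right_diff_distrib mult.commute)
    also have "\<dots> \<in> Y1"
      using that(1) chi[OF that(2)] M.V.subspace_scale[OF sub(1) chi[OF that(1)]]
      by (intro M.V.subspace_add[OF sub(1)]) (auto simp: A_def)
    finally show "app (x * x') y - scl (chi x * chi x') y \<in> Y1" .
  qed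
  have chi_W: "chi x = l" if "x \<in> A" "app x y = scl l y" for x l
    by (rule chi_eq[OF that(1)]) (use that(2) M.V.subspace_0[OF sub(1)] in simp)
  have chi_sc: "chi (sc b) = b" for b by (rule chi_W[OF A_sc]) simp
  have chi_0: "chi 0 = 0" "chi 1 = 1" using chi_sc[of 0] chi_sc[of 1] by simp_all
  have chi_sum: "chi (sum F I) = (\<Sum>x\<in>I. chi (F x))" if "\<And>x. x \<in> I \<Longrightarrow> F x \<in> A" for F and I :: "nat set"
    using that
  proof (induction I rule: infinite_finite_induct)
    case (insert x I)
    then show ?case using A_sum[of I F] by (simp add: chi_add)
  qed (simp_all add: chi_0)
  define cF where "cF F = Abs_fps (\<lambda>k. chi (F $ k))" for F
  define AA where "AA F \<longleftrightarrow> (\<forall>k. F $ k \<in> A)" for F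
  have AA_mult: "AA (F * G)" and cF_mult: "cF (F * G) = cF F * cF G" if "AA F" "AA G" for F G
  proof -
    have p: "F $ i * G $ k \<in> A" for i k using that by (auto simp: AA_def A_mult)
    show "AA (F * G)" unfolding AA_def fps_mult_nth by (intro allI A_sum p)
    show "cF (F * G) = cF F * cF G"
    proof (intro fps_ext)
      fix n
      have "chi ((F * G) $ n) = (\<Sum>i = 0..n. chi (F $ i * G $ (n - i)))"
        unfolding fps_mult_nth by (rule chi_sum[OF p])
      also have "\<dots> = (\<Sum>i = 0..n. chi (F $ i) * chi (G $ (n - i)))"
        using that by (simp add: AA_def chi_mult)
      finally show "cF (F * G) $ n = (cF F * cF G) $ n" by (simp add: cF_def fps_mult_nth)
    qed
  qed
  have AA_zs: "AA (M.S.zs e F)" and cF_zs: "cF (M.S.zs e F) = Abs_fps (\<lambda>k. e ^ k * cF F $ k)" if "AA F" for e F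
    using that by (auto simp: AA_def cF_def A_mult A_sc chi_mult chi_sc fps_eq_iff)
  have AA_scf: "AA (M.S.scf g)" and cF_scf: "cF (M.S.scf g) = g" for g
    by (auto simp: AA_def cF_def A_sc chi_sc fps_eq_iff)
  have AA_prod: "AA (prod_list (map G xs)) \<and> cF (prod_list (map G xs)) = prod_list (map (\<lambda>x. cF (G x)) xs)"
    if "\<And>x. AA (G x)" for G and xs :: "('i \<times> nat) list"
  proof (induction xs)
    case Nil
    have "AA (M.S.scf 1)" "cF (M.S.scf 1) = 1" by (rule AA_scf, rule cF_scf)
    moreover have "M.S.scf 1 = 1" by (intro fps_ext) simp
    ultimately show ?case by simp
  qed (simp add: AA_mult cF_mult that)
  have AA_SA: "AA (SA \<epsilon> i)" "AA (phib \<epsilon> i)" for \<epsilon> i by (auto simp: AA_def A_SA A_phib)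
  define P where "P i = (\<Sum>k\<le>t i. monom (chi (SA Pos i $ k)) k)" for i
  have P_coeff: "coeff (P i) k = chi (SA Pos i $ k)" for i k
  proof -
    have "coeff (P i) k = (\<Sum>l\<le>t i. if l = k then chi (SA Pos i $ l) else 0)"
      unfolding P_def coeff_sum by (intro sum.cong) auto
    then show ?thesis by (simp add: SA_zero chi_0)
  qed
  have P_deg: "degree (P i) \<le> t i" for i
    by (rule degree_le) (simp add: P_coeff SA_zero chi_0)
  have P_fps: "cF (SA Pos i) = fps_of_poly (P i)" for i
    by (intro fps_ext) (simp add: cF_def P_coeff)
  have zs_fps: "Abs_fps (\<lambda>k. e ^ k * fps_of_poly p $ k) = fps_of_poly (pcompose p [:0, e:])" for e and p :: "complex poly"
    by (intro fps_ext) (simp add: coeff_pcompose_linear)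
  define w where "w i = lower_wt c d q \<Lambda> \<beta> i" for i
  have w: "chi (P0 i) = w i" "w i \<noteq> 0" for i
  proof -
    show "chi (P0 i) = w i" by (rule chi_W[OF A_Phi]) (use y(1) in \<open>simp add: W_iff w_def\<close>)
    show "w i \<noteq> 0" using L_nz[of i] q_nz by (simp add: w_def lower_wt_powi)
  qed
  \<comment> \<open>x_i^+ is applied from the left to \<open>X_SA\<close>. After commuting it past
    x_i^-, the terms in which it acts first on a vector of weight \<beta> in Y2 send y into
    Y1.\<close>
  have rel: "(\<Sum>r\<le>t i. chi (SA Pos i $ r) * (chi (Phi Pos i (N - int r)) - chi (Phi Neg i (N - int r)))) = 0" for i N
  proof -
    let ?c = "1 / (qi d q i - inverse (qi d q i))"
    have c: "?c \<noteq> 0"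
      using powi_diff[of "d i"] d_pos[of i] by (simp add: qi_def power_int_minus)
    let ?D = "\<lambda>M. Phi Pos i M - Phi Neg i M"
    have AD: "?D M \<in> A" for M
    proof -
      have e: "?D M = Phi Pos i M + sc (-1) * Phi Neg i M" by (simp add: M.S.sc_uminus)
      show ?thesis unfolding e by (intro A_add A_mult A_sc A_Phi)
    qed
    have chiD: "chi (?D M) = chi (Phi Pos i M) - chi (Phi Neg i M)" for M
    proof -
      have "chi (?D M + Phi Neg i M) = chi (?D M) + chi (Phi Neg i M)" by (rule chi_add[OF AD A_Phi])
      then show ?thesis by simp
    qed
    let ?E = "\<Sum>r\<le>t i. SA Pos i $ r * (sc ?c * ?D (N - int r))"
    let ?G = "\<lambda>r. X Neg i (N - int r) * (X Pos i 0 * SA Pos i $ r)"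
    have EA: "SA Pos i $ r * (sc ?c * ?D (N - int r)) \<in> A" for r by (intro A_mult A_sc AD A_SA)
    have XX: "X Pos i 0 * X Neg i M = X Neg i M * X Pos i 0 + sc ?c * ?D M" for M
      using X_X[of i 0 i M] by (simp add: algebra_simps)
    have "0 = X Pos i 0 * (\<Sum>r\<le>t i. X Neg i (N - int r) * SA Pos i $ r)" by (simp add: X_SA)
    also have "\<dots> = (\<Sum>r\<le>t i. (X Pos i 0 * X Neg i (N - int r)) * SA Pos i $ r)"
      by (simp only: sum_distrib_left mult.assoc)
    also have "\<dots> = (\<Sum>r\<le>t i. ?G r + SA Pos i $ r * (sc ?c * ?D (N - int r)))"
    proof (rule sum.cong[OF refl])
      fix r
      have "sc ?c * ?D (N - int r) * SA Pos i $ r = SA Pos i $ r * (sc ?c * ?D (N - int r))"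
        by (rule C.K_comm) (use A_SA AD A_mult A_sc in \<open>auto simp: A_def\<close>)
      then show "(X Pos i 0 * X Neg i (N - int r)) * SA Pos i $ r = ?G r + SA Pos i $ r * (sc ?c * ?D (N - int r))"
        unfolding XX distrib_right by (simp only: mult.assoc)
    qed
    finally have "?E = - (\<Sum>r\<le>t i. ?G r)" unfolding sum.distrib by (simp add: eq_neg_iff_add_eq_0 add.commute)
    then have "app ?E y = - (\<Sum>r\<le>t i. app (?G r) y)" by (simp add: app_sum)
    moreover have "app (?G r) y \<in> Y1" for r
    proof -
      have "app (SA Pos i $ r) y \<in> W \<beta>" by (rule W_K[OF C.fK_D[OF SA_K] y(1)])
      moreover have "app (SA Pos i $ r) y \<in> Y2" using A_SA[of Pos i r] y(2) by (simp add: A_def)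
      ultimately show ?thesis using submod_X[OF Y1 hw] by simp
    qed
    then have "(\<Sum>r\<le>t i. app (?G r) y) \<in> Y1" by (intro M.V.subspace_sum[OF sub(1)])
    ultimately have "app ?E y \<in> Y1" using M.V.subspace_neg[OF sub(1)] by simp
    then have "chi ?E = 0" by (intro chi_eq A_sum EA) simp
    then have "(\<Sum>r\<le>t i. chi (SA Pos i $ r) * (?c * chi (?D (N - int r)))) = 0"
      using chi_sum[of "{..t i}", OF EA] by (simp add: chi_mult A_SA A_mult A_sc AD chi_sc)
    then have "?c * (\<Sum>r\<le>t i. chi (SA Pos i $ r) * chi (?D (N - int r))) = 0"
      by (simp only: sum_distrib_left mult.left_commute)
    then show ?thesis using c by (simp add: chiD)
  qed
  \<comment> \<open>In degrees above m_i + t_i all modes of \<phi>_i^- in \<open>rel\<close> vanish,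
    which bounds the degree of the product.\<close>
  have G0: "(cF (phib Pos i) * cF (SA Pos i)) $ n = 0" if n: "int n > m i + int (t i)" for i n
  proof -
    have "0 = (\<Sum>r\<le>t i. chi (SA Pos i $ r) * chi (Phi Pos i (int n - int r)))"
    proof -
      have "chi (Phi Neg i (int n - int r)) = 0" if "r \<le> t i" for r
        using n that by (simp add: Phi_zero chi_0)
      then show ?thesis using rel[of i "int n"] by (simp add: right_diff_distrib)
    qed
    also have "\<dots> = (\<Sum>r\<in>{r. r \<le> t i \<and> r \<le> n}. chi (SA Pos i $ r) * chi (Phi Pos i (int n - int r)))"
    proof (intro sum.mono_neutral_right ballI)
      fix r assume "r \<in> {..t i} - {r. r \<le> t i \<and> r \<le> n}"
      then have "int n - int r < 0" by auto
      then show "chi (SA Pos i $ r) * chi (Phi Pos i (int n - int r)) = 0" by (simp add: Phi_zero chi_0)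
    qed auto
    also have "\<dots> = (\<Sum>r\<in>{r. r \<le> t i \<and> r \<le> n}. w i * (chi (SA Pos i $ r) * chi (phib Pos i $ (n - r))))"
    proof (rule sum.cong[OF refl])
      fix r assume "r \<in> {r. r \<le> t i \<and> r \<le> n}"
      then have "int n - int r = int (n - r)" by (simp add: of_nat_diff)
      then have "chi (Phi Pos i (int n - int r)) = w i * chi (phib Pos i $ (n - r))"
        by (simp only: Phi_Pos_phib chi_mult[OF A_Phi A_phib] w(1))
      then show "chi (SA Pos i $ r) * chi (Phi Pos i (int n - int r)) = w i * (chi (SA Pos i $ r) * chi (phib Pos i $ (n - r)))"
        by simp
    qed
    also have "\<dots> = (\<Sum>r = 0..n. w i * (chi (SA Pos i $ r) * chi (phib Pos i $ (n - r))))"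
    proof (intro sum.mono_neutral_left ballI)
      fix r assume "r \<in> {0..n} - {r. r \<le> t i \<and> r \<le> n}"
      then have "r > t i" by auto
      then show "w i * (chi (SA Pos i $ r) * chi (phib Pos i $ (n - r))) = 0" by (simp add: SA_zero chi_0)
    qed auto
    also have "\<dots> = w i * (cF (SA Pos i) * cF (phib Pos i)) $ n"
      by (simp add: fps_mult_nth cF_def sum_distrib_left)
    finally show ?thesis using w(2)[of i] by (simp add: mult.commute)
  qed
  have root: "poly (a i) (x * bb i) = 0 \<or> (\<exists>jp\<in>set (factors i). poly (P (fst jp)) (x * bb i * fac_exp Pos i jp) = 0)"
    if x: "poly (P i) x = 0" for i x
  proof -
    let ?q2 = "qi d q i ^ 2" and ?b = "inverse (coeff (a i) 0)"
    let ?Q = "\<lambda>jp. pcompose (P (fst jp)) [:0, fac_exp Pos i jp:]"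
    define Gp where "Gp = (\<Sum>n\<le>nat (m i + int (t i)). monom ((cF (phib Pos i) * cF (SA Pos i)) $ n) n)"
    have Gp: "cF (phib Pos i) * cF (SA Pos i) = fps_of_poly Gp"
    proof (intro fps_ext)
      fix n
      have "coeff Gp n = (\<Sum>l\<le>nat (m i + int (t i)). if l = n then (cF (phib Pos i) * cF (SA Pos i)) $ l else 0)"
        unfolding Gp_def coeff_sum by (intro sum.cong) auto
      then have "coeff Gp n = (if n \<le> nat (m i + int (t i)) then (cF (phib Pos i) * cF (SA Pos i)) $ n else 0)"
        by simp
      moreover have "(cF (phib Pos i) * cF (SA Pos i)) $ n = 0" if "\<not> n \<le> nat (m i + int (t i))"
        by (rule G0) (use that in linarith)
      ultimately show "(cF (phib Pos i) * cF (SA Pos i)) $ n = fps_of_poly Gp $ n" by auto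
    qed
    have "cF (phib Pos i * DD i) = cF (RR i)" by (simp only: phib_DD)
    moreover have "cF (phib Pos i * DD i) = (cF (phib Pos i) * cF (SA Pos i)) * fps_of_poly (pcompose (P i) [:0, ?q2:])"
      unfolding DD_def cF_mult[OF AA_SA(2) AA_mult[OF AA_SA(1) AA_zs[OF AA_SA(1)]]] cF_mult[OF AA_SA(1) AA_zs[OF AA_SA(1)]]
        cF_zs[OF AA_SA(1)] P_fps zs_fps by (simp only: mult.assoc)
    moreover have "cF (RR i) = lwn Pos (a i) * prod_list (map (\<lambda>jp. fps_of_poly (?Q jp)) (factors i))"
    proof -
      have "AA (M.S.zs (fac_exp Pos i jp) (SA Pos (fst jp)))" for jp by (rule AA_zs[OF AA_SA(1)])
      note p = AA_prod[of "\<lambda>jp. M.S.zs (fac_exp Pos i jp) (SA Pos (fst jp))" "factors i", OF this]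
      show ?thesis unfolding RR_def cF_mult[OF AA_scf conjunct1[OF p]] cF_scf conjunct2[OF p]
        unfolding cF_zs[OF AA_SA(1)] P_fps zs_fps ..
    qed
    moreover have "prod_list (map (\<lambda>jp. fps_of_poly (?Q jp)) js) = fps_of_poly (prod_list (map ?Q js))" for js
      by (induction js) (simp_all add: fps_of_poly_mult)
    ultimately have "fps_of_poly (Gp * pcompose (P i) [:0, ?q2:]) =
       fps_of_poly (Polynomial.smult ?b (a i) * prod_list (map ?Q (factors i)))"
      by (simp add: Gp fps_of_poly_mult)
    then have "Gp * pcompose (P i) [:0, ?q2:] = Polynomial.smult ?b (a i) * prod_list (map ?Q (factors i))"
      by (simp only: fps_of_poly_eq_iff)
    \<comment> \<open>At x q_i^(-2) the factor P_i(q_i^2 z) takes the value of P_i at its root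
      x.\<close>
    then have "poly (Gp * pcompose (P i) [:0, ?q2:]) (x * bb i) = poly (Polynomial.smult ?b (a i) * prod_list (map ?Q (factors i))) (x * bb i)"
      by simp
    moreover have "x * bb i * ?q2 = x" unfolding bb(3)[symmetric] using bb(2)[of i] by simp
    ultimately have "?b * poly (a i) (x * bb i) * poly (prod_list (map ?Q (factors i))) (x * bb i) = 0"
      using x by (simp add: poly_pcompose)
    moreover have "poly (prod_list (map ?Q js)) y = 0 \<Longrightarrow> \<exists>jp\<in>set js. poly (P (fst jp)) (y * fac_exp Pos i jp) = 0" for js y
      by (induction js) (auto simp: poly_pcompose)
    ultimately show ?thesis using a_nz(2)[of i] by auto
  qed
  show ?thesis
  proof (rule that[of \<beta> P])
    show "\<exists>u\<in>W \<beta>. u \<in> Y2 \<and> u \<notin> Y1" using y by blast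
    show "coeff (P i) 0 = 1" for i by (simp add: P_coeff SA_0 chi_0)
    show "coeff (P i) (t i) = ls \<beta> i" for i
      unfolding P_coeff by (rule chi_W[OF A_SA]) (rule St_W[OF y(1)])
  qed (rule P_deg, rule root)
qed

end

section \<open>Finiteness of the set of possible roots\<close>

context tpoly_fin
begin

definition root_closed :: "('i \<Rightarrow> complex poly) \<Rightarrow> bool" where
  "root_closed P \<longleftrightarrow> (\<forall>i. degree (P i) \<le> t i \<and> coeff (P i) 0 = 1 \<and>
     (\<forall>x. poly (P i) x = 0 \<longrightarrow> poly (a i) (x * bb i) = 0 \<or>
        (\<exists>jp\<in>set (factors i). poly (P (fst jp)) (x * bb i * fac_exp Pos i jp) = 0)))"

definition dsum :: int where "dsum = (\<Sum>i\<in>UNIV. d i)"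

lemma dsum: "d i \<le> dsum" "0 \<le> dsum"
proof -
  show "d i \<le> dsum" unfolding dsum_def by (rule member_le_sum) (use d_pos in \<open>auto intro: less_imp_le\<close>)
  then show "0 \<le> dsum" using d_pos[of i] by simp
qed

lemma factor_step:
  assumes "(j, e) \<in> set (factors i)"
  obtains k where "0 < k" "k \<le> 3 * dsum"
    "x * bb i * fac_exp Pos i (j, e) * q powi (- d j) * q powi k = x * q powi (- d i)"
proof -
  have jp: "j \<noteq> i" "e < nat (- c j i)" using assms by (simp_all add: factors_iff)
  then have neg: "c j i < 0" by simp
  \<comment> \<open>The exponent by which x q^(- d i) drops when passing to the root of P_j. It is
    positive because d j * c j i = - max (d j) (d i) and both lengths are positive.\<close>
  define k where "k = d i + d j + d j * c j i + 2 * (d j * int e)"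
  have m: "d j * c j i = - max (d j) (d i)" by (rule adjacent_b(1)[OF neg])
  have "d j * int e \<le> d j * (- c j i)" using jp(2) d_pos[of j] by (intro mult_left_mono) auto
  then have p1: "d j * int e \<le> max (d j) (d i)" using m by simp
  have p0: "0 \<le> d j * int e" using d_pos[of j] by simp
  have mx: "max (d j) (d i) < d i + d j" "max (d j) (d i) \<le> dsum"
    using d_pos[of i] d_pos[of j] dsum(1)[of i] dsum(1)[of j] by (simp_all add: max_def)
  have "0 < k" unfolding k_def m using p0 mx by linarith
  moreover have "k \<le> 3 * dsum"
    unfolding k_def m using p1 mx dsum(1)[of i] dsum(1)[of j] by linarith
  moreover have "x * bb i * fac_exp Pos i (j, e) * q powi (- d j) * q powi k = x * q powi (- d i)"
  proof -
    have "bb i * fac_exp Pos i (j, e) * q powi (- d j) * q powi k =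
        q powi (d i * (- 2)) * q powi (d j * (- c j i - 2 * int e)) * q powi (- d j) * q powi k"
      by (simp only: fac_exp_def qi_powi fst_conv snd_conv sgi.simps mult_1_left)
    also have "\<dots> = q powi (d i * (- 2) + d j * (- c j i - 2 * int e) + - d j + k)"
      using q_nz by (simp only: power_int_add simp_thms)
    also have "d i * (- 2) + d j * (- c j i - 2 * int e) + - d j + k = - d i"
      by (simp add: k_def algebra_simps)
    finally show ?thesis by (simp only: mult.assoc)
  qed
  ultimately show ?thesis by (rule that)
qed

text \<open>
  Each root of some \<open>P\<^sub>i\<close> leads to a root of some \<open>a\<^sub>j\<close> through a chain of roots along which
  \<open>x q\<^sup>-\<^sup>d\<^sub>i\<close> is divided by positive powers of \<open>q\<close>; the chain has no repetition, so its length is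
  bounded by the number of roots.
\<close>

lemma roots_finite: "\<exists>S. finite S \<and> (\<forall>P. root_closed P \<longrightarrow> (\<forall>i x. poly (P i) x = 0 \<longrightarrow> x \<in> S))"
proof -
  define S0 where "S0 = (\<Union>i. {x. poly (a i) x = 0})"
  define \<tau> where "\<tau> = (\<Sum>i\<in>UNIV. t i)"
  \<comment> \<open>At most \<tau> steps of size at most 3 dsum, a final step of size at most dsum
    to a root of some a_j, and at most dsum for passing from x q^(- d i) back to x.\<close>
  let ?S = "(\<lambda>(s, n). s * q powi n) ` (S0 \<times> {0..2 * dsum + 3 * dsum * int \<tau>})"
  have "finite S0" unfolding S0_def using a_nz(4) by (auto intro: poly_roots_finite)
  then have fin: "finite ?S" by simp
  have "x \<in> ?S" if P: "root_closed P" and x: "poly (P i) x = 0" for P i x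
  proof -
    have P0: "coeff (P i) 0 = 1" and Pd: "degree (P i) \<le> t i" for i using P by (auto simp: root_closed_def)
    have Pn: "P i \<noteq> 0" for i using P0[of i] by auto
    define Rt where "Rt = Sigma UNIV (\<lambda>i. {x. poly (P i) x = 0})"
    have Rf: "finite Rt" unfolding Rt_def by (intro finite_SigmaI poly_roots_finite Pn) simp
    have "card Rt = (\<Sum>i\<in>UNIV. card {x. poly (P i) x = 0})"
      unfolding Rt_def by (intro card_SigmaI ballI poly_roots_finite Pn) simp
    also have "\<dots> \<le> \<tau>" unfolding \<tau>_def
      by (intro sum_mono order_trans[OF card_poly_roots_bound[OF Pn] Pd])
    finally have Rc: "card Rt \<le> \<tau>" .
    have x0: "x \<noteq> 0" if "(i, x) \<in> Rt" for i x
    proof -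
      have "poly (P i) 0 = 1" by (simp add: poly_0_coeff_0 P0)
      then show ?thesis using that by (auto simp: Rt_def)
    qed
    define pot where "pot r = snd r * q powi (- d (fst r))" for r :: "'i \<times> complex"
    \<comment> \<open>The roots that may still occur further along a chain from r. This set shrinks
      strictly at each step since q is not a root of unity, so its size drives the induction and the
      bound.\<close>
    define Bel where "Bel r = {r' \<in> Rt. \<exists>k>0. pot r' * q powi k = pot r}" for r
    have Bf: "finite (Bel r)" "card (Bel r) \<le> \<tau>" for r
    proof -
      have "Bel r \<subseteq> Rt" by (auto simp: Bel_def)
      then show "finite (Bel r)" "card (Bel r) \<le> \<tau>"
        using Rf Rc card_mono[OF Rf, of "Bel r"] by (auto intro: finite_subset)
    qed
    have chain: "\<exists>s\<in>S0. \<exists>n. 0 \<le> n \<and> n \<le> dsum + 3 * dsum * int (card (Bel r)) \<and> pot r = s * q powi n" if "r \<in> Rt" for r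
      using that
    proof (induction "card (Bel r)" arbitrary: r rule: less_induct)
      case less
      obtain i x where r: "r = (i, x)" by (cases r)
      have "poly (P i) x = 0" using less.prems by (simp add: r Rt_def)
      then consider "poly (a i) (x * bb i) = 0"
        | j e where "(j, e) \<in> set (factors i)" "poly (P j) (x * bb i * fac_exp Pos i (j, e)) = 0"
        using P unfolding root_closed_def by fastforce
      then show ?case
      proof cases
        case 1
        have "bb i * q powi (d i) = q powi (- d i)"
        proof -
          have "bb i * q powi (d i) = q powi (d i * (- 2) + d i)" using q_nz by (simp only: qi_powi power_int_add simp_thms)
          then show ?thesis by simp
        qed
        then have "pot r = x * bb i * q powi (d i)" by (simp add: pot_def r mult.assoc)
        moreover have "x * bb i \<in> S0" using 1 by (auto simp: S0_def)
        moreover have "0 \<le> d i" "d i \<le> dsum + 3 * dsum * int (card (Bel r))"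
          using d_pos[of i] dsum(1)[of i] dsum(2) by (auto intro: order_trans[of _ dsum])
        ultimately show ?thesis by blast
      next
        case 2
        let ?r = "(j, x * bb i * fac_exp Pos i (j, e))"
        obtain k where k: "0 < k" "k \<le> 3 * dsum" "pot ?r * q powi k = pot r"
          using factor_step[OF 2(1), of x] by (auto simp: pot_def r)
        have rR: "?r \<in> Rt" using 2(2) by (simp add: Rt_def)
        have pn: "pot ?r \<noteq> 0" using x0[OF rR] q_nz by (simp add: pot_def)
        have "?r \<in> Bel r" using rR k by (auto simp: Bel_def)
        moreover have "?r \<notin> Bel ?r"
        proof
          assume "?r \<in> Bel ?r"
          then obtain l where "l > 0" "pot ?r * q powi l = pot ?r" by (auto simp: Bel_def)
          then have "q powi l = 1" using pn by simp
          then show False using powi_neq_1[of l] \<open>l > 0\<close> by simp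
        qed
        moreover have "Bel ?r \<subseteq> Bel r"
        proof
          fix r' assume "r' \<in> Bel ?r"
          then obtain l where l: "r' \<in> Rt" "l > 0" "pot r' * q powi l = pot ?r" by (auto simp: Bel_def)
          have "pot r' * q powi (l + k) = pot r"
            using l(3) k(3) q_nz by (simp add: power_int_add mult.assoc[symmetric])
          moreover have "l + k > 0" using l(2) k(1) by simp
          ultimately show "r' \<in> Bel r" using l(1) by (auto simp: Bel_def)
        qed
        ultimately have cd: "card (Bel ?r) < card (Bel r)" by (intro psubset_card_mono Bf) blast
        from less.hyps[OF cd rR] obtain s n where s: "s \<in> S0" "0 \<le> n"
          "n \<le> dsum + 3 * dsum * int (card (Bel ?r))" "pot ?r = s * q powi n" by blast
        have "pot r = s * q powi (n + k)"
          using k(3) s(4) q_nz by (simp add: power_int_add mult.assoc)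
        moreover have "3 * dsum * int (card (Bel ?r)) + 3 * dsum \<le> 3 * dsum * int (card (Bel r))"
        proof -
          have "3 * dsum * (int (card (Bel ?r)) + 1) \<le> 3 * dsum * int (card (Bel r))"
            using cd dsum(2) by (intro mult_left_mono) auto
          then show ?thesis by (simp add: algebra_simps)
        qed
        then have "n + k \<le> dsum + 3 * dsum * int (card (Bel r))" using s(3) k(2) by linarith
        ultimately show ?thesis using s(1,2) k(1) by (intro bexI[of _ s] exI[of _ "n + k"]) auto
      qed
    qed
    have "(i, x) \<in> Rt" using x by (simp add: Rt_def)
    from chain[OF this] obtain s n where s: "s \<in> S0" "0 \<le> n" "n \<le> dsum + 3 * dsum * int (card (Bel (i, x)))"
      "pot (i, x) = s * q powi n" by blast
    have "x = pot (i, x) * q powi (d i)"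
      using q_nz by (simp add: pot_def power_int_minus)
    then have "x = s * q powi (n + d i)" using s(4) q_nz by (simp add: power_int_add mult.assoc)
    have B1: "3 * dsum * int (card (Bel (i, x))) \<le> 3 * dsum * int \<tau>"
      using Bf(2)[of "(i, x)"] dsum(2) by (intro mult_left_mono) auto
    have "n + d i \<in> {0..2 * dsum + 3 * dsum * int \<tau>}"
      unfolding atLeastAtMost_iff using B1 s(2,3) d_pos[of i] dsum(1)[of i] by linarith
    then show ?thesis using s(1) \<open>x = s * q powi (n + d i)\<close> by (intro image_eqI[of _ _ "(s, n + d i)"]) auto
  qed
  then show ?thesis using fin by (intro exI[of _ ?S]) blast
qed

text \<open>The vector found for Y1 \<subset> Y2 has a weight \<beta> for which lam_i q_i^(-2
  \<beta>_i) is the coefficient of degree t_i of one of finitely many polynomials. As q is not a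
  root of unity, this number determines \<beta>_i.\<close>

lemma distinguishing_weights:
  obtains F where "finite F"
    "\<And>Y1 Y2. submod Y1 \<Longrightarrow> submod Y2 \<Longrightarrow> Y1 \<subset> Y2 \<Longrightarrow> \<exists>\<beta>\<in>F. Y1 \<inter> W \<beta> \<noteq> Y2 \<inter> W \<beta>"
proof -
  obtain S where S: "finite S" "\<And>P i x. root_closed P \<Longrightarrow> poly (P i) x = 0 \<Longrightarrow> x \<in> S"
    using roots_finite by blast
  define Q where "Q n = {r :: complex poly. degree r \<le> n \<and> coeff r 0 = 1 \<and> (\<forall>y. poly r y = 0 \<longrightarrow> y \<in> S)}" for n
  have Qf: "finite (Q n)" for n unfolding Q_def by (rule finite_polys_with_roots[OF S(1)])
  define N where "N i = {n. \<exists>r\<in>Q (t i). lam i * bb i ^ n = coeff r (t i)}" for i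
  have Nf: "finite (N i)" for i
  proof (rule inj_on_finite)
    show "inj_on (\<lambda>n. lam i * bb i ^ n) (N i)"
    proof (rule inj_onI)
      fix k l assume "lam i * bb i ^ k = lam i * bb i ^ l"
      then have "q powi (d i * (- 2 * int k)) = q powi (d i * (- 2 * int l))"
      proof -
        have "q powi (d i * (- 2 * int n)) = bb i ^ n" for n
          unfolding qi_powi[symmetric] by (simp only: power_int_mult power_int_of_nat)
        moreover have "bb i ^ k = bb i ^ l" using \<open>lam i * bb i ^ k = lam i * bb i ^ l\<close> p_t(1)[of i] by simp
        ultimately show ?thesis by simp
      qed
      then show "k = l" unfolding powi_inject using d_pos[of i] by simp
    qed
    show "(\<lambda>n. lam i * bb i ^ n) ` N i \<subseteq> (\<lambda>r. coeff r (t i)) ` Q (t i)" by (auto simp: N_def)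
    show "finite ((\<lambda>r. coeff r (t i)) ` Q (t i))" by (rule finite_imageI[OF Qf])
  qed
  let ?F = "PiE UNIV N"
  show ?thesis
  proof (rule that)
    show "finite ?F" by (rule finite_PiE) (use Nf in auto)
    fix Y1 Y2 assume Y: "submod Y1" "submod Y2" "Y1 \<subset> Y2"
    obtain \<beta> P where \<beta>: "\<exists>u\<in>W \<beta>. u \<in> Y2 \<and> u \<notin> Y1" "\<And>i. degree (P i) \<le> t i" "\<And>i. coeff (P i) 0 = 1"
      "\<And>i. coeff (P i) (t i) = ls \<beta> i"
      "\<And>i x. poly (P i) x = 0 \<Longrightarrow> poly (a i) (x * bb i) = 0 \<or>
        (\<exists>jp\<in>set (factors i). poly (P (fst jp)) (x * bb i * fac_exp Pos i jp) = 0)"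
      by (rule eigenvalue_polynomials[OF Y]) blast
    have "root_closed P" unfolding root_closed_def using \<beta>(2,3,5) by blast
    then have "P i \<in> Q (t i)" for i using S(2) \<beta>(2,3) by (auto simp: Q_def)
    then have "\<beta> i \<in> N i" for i unfolding N_def using \<beta>(4)[of i] by (intro CollectI bexI[of _ "P i"]) auto
    then have "\<beta> \<in> ?F" by auto
    moreover have "Y1 \<inter> W \<beta> \<noteq> Y2 \<inter> W \<beta>" using \<beta>(1) by blast
    ultimately show "\<exists>\<beta>\<in>?F. Y1 \<inter> W \<beta> \<noteq> Y2 \<inter> W \<beta>" by blast
  qed
qed

theorem finite_length: "finite_length U scl \<rho>"
proof -
  obtain F where F: "finite F"
    "\<And>Y1 Y2. submod Y1 \<Longrightarrow> submod Y2 \<Longrightarrow> Y1 \<subset> Y2 \<Longrightarrow> \<exists>\<beta>\<in>F. Y1 \<inter> W \<beta> \<noteq> Y2 \<inter> W \<beta>"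
    by (rule distinguishing_weights) blast
  \<comment> \<open>By the choice of F, \<open>len\<close> increases strictly along strict
    inclusions of submodules.\<close>
  define len where "len Y = (\<Sum>\<beta>\<in>F. M.V.dim (Y \<inter> W \<beta>))" for Y
  have len: "len Y1 < len Y2" if Y: "submod Y1" "submod Y2" "Y1 \<subset> Y2" for Y1 Y2
  proof -
    have d: "M.V.dim (Y1 \<inter> W \<beta>) \<le> M.V.dim (Y2 \<inter> W \<beta>)"
      "Y1 \<inter> W \<beta> \<noteq> Y2 \<inter> W \<beta> \<Longrightarrow> M.V.dim (Y1 \<inter> W \<beta>) < M.V.dim (Y2 \<inter> W \<beta>)" for \<beta>
    proof -
      obtain B where B: "finite B" "W \<beta> \<subseteq> M.V.span B" using W_finite by blast
      have s: "Y1 \<inter> W \<beta> \<subseteq> Y2 \<inter> W \<beta>" "Y2 \<inter> W \<beta> \<subseteq> M.V.span B" using Y(3) B(2) by auto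
      have sub: "M.V.subspace (Y1 \<inter> W \<beta>)" "M.V.subspace (Y2 \<inter> W \<beta>)"
        using M.V.subspace_inter[OF submodD(1) W_subspace] Y(1,2) by auto
      show "M.V.dim (Y1 \<inter> W \<beta>) \<le> M.V.dim (Y2 \<inter> W \<beta>)"
        "Y1 \<inter> W \<beta> \<noteq> Y2 \<inter> W \<beta> \<Longrightarrow> M.V.dim (Y1 \<inter> W \<beta>) < M.V.dim (Y2 \<inter> W \<beta>)"
        by (rule M.V.dim_subspaces[OF s B(1) sub], assumption?)+
    qed
    show ?thesis unfolding len_def
      by (rule sum_strict_mono_ex1[OF F(1)]) (use d F(2)[OF Y] in blast)+
  qed
  define series where "series Y \<longleftrightarrow> (\<exists>n (Z :: nat \<Rightarrow> 'v set). Z 0 = {0} \<and> Z n = Y \<and> (\<forall>k\<le>n. submod (Z k)) \<and>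
        (\<forall>k<n. Z k \<subset> Z (Suc k) \<and> (\<forall>X. submod X \<and> Z k \<subseteq> X \<and> X \<subseteq> Z (Suc k) \<longrightarrow> X = Z k \<or> X = Z (Suc k))))" for Y
  have zero: "submod {0}"
    by (simp add: submodule_def M.V.subspace_def flip: M.app_R)
  have "series Y" if "submod Y" for Y
    using that
  proof (induction "len Y" arbitrary: Y rule: less_induct)
    case less
    have 0: "0 \<in> Y" using M.V.subspace_0[OF submodD(1)[OF less.prems]] .
    show ?case
    proof (cases "Y = {0}")
      case True
      then show ?thesis unfolding series_def using zero by (intro exI[of _ 0] exI[of _ "\<lambda>_. {0}"]) auto
    next
      case False
      define C where "C X \<longleftrightarrow> submod X \<and> X \<subset> Y" for X
      have C0: "C {0}" using zero 0 False by (auto simp: C_def)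
      have "len X \<le> len Y" if "C X" for X using len[of X Y] that less.prems by (simp add: C_def)
      \<comment> \<open>A proper submodule of greatest \<open>len\<close> is maximal, so the
        composition series of X extends by one step to Y.\<close>
      then obtain X where X: "C X" "\<And>X'. C X' \<Longrightarrow> len X' \<le> len X"
        using ex_has_greatest_nat[of C "{0}" len "Suc (len Y)"] C0 by (meson le_imp_less_Suc)
      have "len X < len Y" using X(1) len less.prems by (simp add: C_def)
      then have "series X" using X(1) by (intro less.hyps) (auto simp: C_def)
      then obtain n Z where Z: "Z 0 = {0}" "Z n = X" "\<forall>k\<le>n. submod (Z k)"
        "\<forall>k<n. Z k \<subset> Z (Suc k) \<and> (\<forall>X. submod X \<and> Z k \<subseteq> X \<and> X \<subseteq> Z (Suc k) \<longrightarrow> X = Z k \<or> X = Z (Suc k))"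
        unfolding series_def by blast
      have max: "X' = X \<or> X' = Y" if "submod X'" "X \<subseteq> X'" "X' \<subseteq> Y" for X'
      proof (rule ccontr)
        assume ne: "\<not> (X' = X \<or> X' = Y)"
        then have "C X'" "X \<subset> X'" using that by (auto simp: C_def)
        then have "len X' \<le> len X" "len X < len X'" using X len that(1) by (auto simp: C_def)
        then show False by simp
      qed
      let ?Z = "Z(Suc n := Y)"
      have *: "?Z 0 = {0} \<and> ?Z (Suc n) = Y \<and> (\<forall>k\<le>Suc n. submod (?Z k)) \<and>
        (\<forall>k<Suc n. ?Z k \<subset> ?Z (Suc k) \<and> (\<forall>X. submod X \<and> ?Z k \<subseteq> X \<and> X \<subseteq> ?Z (Suc k) \<longrightarrow> X = ?Z k \<or> X = ?Z (Suc k)))"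
      proof (intro conjI allI impI)
        show "submod (?Z k)" if "k \<le> Suc n" for k using that Z(3) less.prems by (cases "k = Suc n") auto
        fix k assume k: "k < Suc n"
        show "?Z k \<subset> ?Z (Suc k)" using k Z(2,4) X(1) by (cases "k = n") (auto simp: C_def)
        fix X' assume "submod X' \<and> ?Z k \<subseteq> X' \<and> X' \<subseteq> ?Z (Suc k)"
        then show "X' = ?Z k \<or> X' = ?Z (Suc k)" using k Z(2,4) max[of X'] by (cases "k = n") auto
      qed (simp_all add: Z(1))
      show ?thesis unfolding series_def by (rule exI[of _ "Suc n"], rule exI[of _ ?Z], rule *)
    qed
  qed
  moreover have "submod UNIV" by (simp add: submodule_def M.V.subspace_UNIV)
  ultimately have "series UNIV" by blast
  then show ?thesis unfolding finite_length_def series_def .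
qed

end

theorem proposition5p3:
  fixes c :: "'i::{finite,linorder} \<Rightarrow> 'i \<Rightarrow> int"
    and d :: "'i \<Rightarrow> int"
    and q :: complex
    and m :: "'i \<Rightarrow> int"
    and a :: "'i \<Rightarrow> complex poly"
    and z :: "'i \<Rightarrow> complex"
    and scl :: "complex \<Rightarrow> 'v::ab_group_add \<Rightarrow> 'v"
    and \<rho> :: "'i gen falg set \<Rightarrow> 'v \<Rightarrow> 'v"
  assumes cartan: "simple_cartan_datum c d"
    and q_nonzero: "q \<noteq> 0"
    and q_not_root_of_unity: "\<forall>n>0. q ^ n \<noteq> 1"
    and a_lweight: "poly_lweight a"
    and z_nonzero: "\<forall>i. z i \<noteq> 0"
    and z_eq: "\<forall>i. (\<Prod>j\<in>UNIV. z j powi c j i) = inverse (coeff (a i) 0) * lead_coeff (a i)"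
    and V_O: "category_O c d q m scl \<rho>"
    and V_T: "T_polynomial c d q m scl \<rho>"
    and stab: "\<forall>i. stabilizes_polynomials (\<lambda>k. \<rho> (scrA c d q m a Pos i k))"
  shows "(truncatable c m a \<and>
       (\<exists>\<rho>'. alg_module (trunc_alg c d q m a) scl \<rho>' \<and>
          is_pullback (U_alg c d q m) (to_trunc c d q m a) \<rho>' \<rho>)) \<and>
     (\<exists>\<Lambda>. (\<forall>i. \<Lambda> i \<noteq> 0) \<and>
       (\<exists>\<rho>'. alg_module (trunc_alg c d q m a) scl \<rho>' \<and>
          is_pullback (U_alg c d q m) (to_trunc c d q m a) \<rho>' (L0_tensor c d q m \<Lambda> \<rho>) \<and>
          (\<exists>\<rho>''. alg_module (ad_trunc_alg c d q m a z) scl \<rho>'' \<and>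
             is_pullback (trunc_alg c d q m a) (trunc_to_ad_trunc c d q m a z) \<rho>'' \<rho>'))) \<and>
     finite_length (U_alg c d q m) scl \<rho>"
proof -
  have mod: "alg_module (U_alg c d q m) scl \<rho>"
    using V_T[unfolded T_polynomial_def] by (rule conjunct1)
  obtain \<Lambda> f where \<Lambda>f: "top_graded c d q m scl \<rho> \<Lambda> \<and>
        (\<forall>i k. \<forall>v\<in>wt_space c d q m scl \<rho> \<Lambda>. \<rho> (T_ser c d q m Pos i k) v = scl (fps_nth (f i) k) v) \<and>
        (\<forall>i \<beta>. let W = wt_space c d q m scl \<rho> (lower_wt c d q \<Lambda> \<beta>); T = normalized_T c d q m scl \<rho> f i in
           (\<forall>k > \<beta> i. \<forall>v\<in>W. T k v = 0) \<and> bij_betw (T (\<beta> i)) W W)"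
    using conjunct2[OF V_T[unfolded T_polynomial_def]] by (elim exE) (rule that)
  note top = conjunct1[OF \<Lambda>f] and eig = conjunct1[OF conjunct2[OF \<Lambda>f]]
    and T = conjunct2[OF conjunct2[OF \<Lambda>f]]
  have T1: "normalized_T c d q m scl \<rho> f i k v = 0"
    if "k > \<beta> i" "v \<in> wt_space c d q m scl \<rho> (lower_wt c d q \<Lambda> \<beta>)" for i k \<beta> v
    using spec[OF spec[OF T, of i], of \<beta>, unfolded Let_def, THEN conjunct1] that by simp
  have T2: "bij_betw (normalized_T c d q m scl \<rho> f i (\<beta> i))
      (wt_space c d q m scl \<rho> (lower_wt c d q \<Lambda> \<beta>)) (wt_space c d q m scl \<rho> (lower_wt c d q \<Lambda> \<beta>))" for i \<beta>
    by (rule spec[OF spec[OF T, of i], of \<beta>, unfolded Let_def, THEN conjunct2])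
  interpret S: shifted c d q m
    by unfold_locales (use cartan q_nonzero q_not_root_of_unity in auto)
  interpret vector_space scl using mod by (simp add: alg_module_def)
  interpret R: alg_rep "U_alg c d q m" scl \<rho>
    by unfold_locales (rule mod)
  interpret tpoly c d q m scl \<rho> a \<Lambda> f
  proof unfold_locales
    show "top_graded c d q m scl \<rho> \<Lambda>" by (rule top)
    show "\<rho> (T_ser c d q m Pos i k) v = scl (fps_nth (f i) k) v"
      if "v \<in> wt_space c d q m scl \<rho> \<Lambda>" for i k v
      by (rule bspec[OF spec[OF spec[OF eig]] that])
    show "normalized_T c d q m scl \<rho> f i k v = 0"
      if "k > \<beta> i" "v \<in> wt_space c d q m scl \<rho> (lower_wt c d q \<Lambda> \<beta>)" for i k \<beta> v
      by (rule T1[OF that])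
    show "bij_betw (normalized_T c d q m scl \<rho> f i (\<beta> i))
      (wt_space c d q m scl \<rho> (lower_wt c d q \<Lambda> \<beta>)) (wt_space c d q m scl \<rho> (lower_wt c d q \<Lambda> \<beta>))" for i \<beta>
      by (rule T2)
    show "stabilizes_polynomials (\<lambda>k. \<rho> (scrA c d q m a Pos i k))" for i using stab by blast
    show "poly_lweight a" by (rule a_lweight)
  qed
  interpret tpoly_adjoint c d q m scl \<rho> a \<Lambda> f z
  proof unfold_locales
    show "z i \<noteq> 0" for i using z_nonzero by blast
    show "(\<Prod>j\<in>UNIV. z j powi c j i) = inverse (coeff (a i) 0) * lead_coeff (a i)" for i
      using z_eq by blast
  qed (rule a_lweight)
  \<comment> \<open>The finite-dimensional weight spaces come from category O, whose condition
    ranges over weights with nonzero components; lowered weights have this property.\<close>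
  interpret tpoly_fin c d q m scl \<rho> a \<Lambda> f
  proof unfold_locales
    fix \<beta>
    have "lower_wt c d q \<Lambda> \<beta> \<in> t_dual"
      unfolding t_dual_def using L_nz q_nonzero by (simp add: lower_wt_powi)
    then show "\<exists>B. finite B \<and> W \<beta> \<subseteq> Modules.module.span scl B"
      unfolding W_def by (rule bspec[OF conjunct1[OF conjunct2[OF conjunct2[OF V_O[unfolded category_O_def]]]]])
  qed
  show ?thesis
    by (intro conjI truncatable factors_through_truncation extends_to_adjoint_truncation finite_length)
qed

end
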